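(* Let $\mathscr{J}$ be a system of arities in a symmetric monoidal closed category $\mathscr{V}$ such that $\mathscr{V}_0$ has pullbacks, let $\mathscr{C}$ be a $\mathscr{J}$-admissible $\mathscr{V}$-category, and let $\mathscr{T}$ and $\mathscr{U}$ be $\mathscr{J}$-theories. There is an equivalence of $\mathscr{V}$-categories $$(\mathscr{T},\mathscr{U})\text{-}\mathrm{Alg}(\mathscr{C})\;\simeq\;(\mathscr{T},\mathscr{U})\text{-}\mathrm{CPair}(\mathscr{C})$$ that sends each $(\mathscr{T},\mathscr{U})$-algebra $D$ to the commuting $\mathscr{T}$-$\mathscr{U}$-algebra pair $(D_\ell,D_r)$. In particular, $(\mathscr{T},\mathscr{U})\text{-}\mathrm{Alg}(\mathscr{C})$ necessarily exists as a $\mathscr{V}$-category. For each object $C$ of $\mathscr{C}$, this equivalence restricts to an equivalence $$(\mathscr{T},\mathscr{U})\text{-}\mathrm{Alg}(C)\;\simeq\;(\mathscr{T},\mathscr{U})\text{-}\mathrm{CPair}(C).$$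
   Context: Base setting. $\mathscr{V}$ is a symmetric monoidal closed category with unit object $I$ and underlying ordinary category $\mathscr{V}_0$. By universe enlargement, $\mathscr{V}$ is a full subcategory of a symmetric monoidal closed category $\mathscr{V}'$ that is complete and cocomplete relative to a universe in which everything considered is small, with $\mathscr{V}\hookrightarrow\mathscr{V}'$ preserving all limits that exist in $\mathscr{V}$; $\mathscr{V}$-functor categories exist as $\mathscr{V}'$-categories. A system of arities is a fully faithful symmetric strong monoidal $\mathscr{V}$-functor $\mathscr{J}\to\mathscr{V}$, written as the inclusion of a full sub-$\mathscr{V}$-category containing $I$ and closed under $\otimes$ ($\mathscr{J}$ need not be small). A $\mathscr{J}$-cotensor in a $\mathscr{V}$-category is a cotensor $[J,C]$ with $J\in\mathrm{ob}\,\mathscr{J}$; $\mathscr{V}$-categories with $\mathscr{J}$-cotensors are equipped with designated ones, with $[I,C]=C$ (and identity counit). A $\mathscr{J}$-theory is a $\mathscr{V}$-category $\mathscr{T}$ equipped with an identity-on-objects $\mathscr{V}$-functor $\tau:\mathscr{J}^{\mathrm{op}}\to\mathscr{T}$ that preserves $\mathscr{J}$-cotensors; equivalently, $\mathrm{ob}\,\mathscr{T}=\mathrm{ob}\,\mathscr{J}$ and each object $J$ is equipped with a morphism $J\to\mathscr{T}(J,I)$ exhibiting $J$ as a cotensor $[J,I]$ in $\mathscr{T}$, which for $J=I$ is the identity on $I$. A morphism of $\mathscr{J}$-theories is a $\mathscr{V}$-functor commuting with the structure $\mathscr{V}$-functors $\tau$. For a $\mathscr{V}$-category $\mathscr{C}$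 with $\mathscr{J}$-cotensors, a $\mathscr{T}$-algebra in $\mathscr{C}$ is a $\mathscr{V}$-functor $A:\mathscr{T}\to\mathscr{C}$ preserving $\mathscr{J}$-cotensors; its carrier is $|A|=A(I)$. $\mathscr{T}\text{-}\mathrm{Alg}(\mathscr{C})$ is the full sub-$\mathscr{V}'$-category of $[\mathscr{T},\mathscr{C}]$ on the $\mathscr{T}$-algebras; for a morphism $f$ in it, $|f|=f_I$. $\mathscr{C}$ is $\mathscr{J}$-admissible if it has $\mathscr{J}$-cotensors and for every $\mathscr{J}$-theory $\mathscr{T}$ the ends defining the hom-objects of $\mathscr{T}\text{-}\mathrm{Alg}(\mathscr{C})$ exist in $\mathscr{V}$ (so it is a $\mathscr{V}$-category). $\mathscr{J}$-cotensors in $\mathscr{T}\text{-}\mathrm{Alg}(\mathscr{C})$ are pointwise, with designated ones chosen so that evaluation at $I$ sends them to the designated ones in $\mathscr{C}$. Commutation. An algebra in $\mathscr{C}$ is a pair $(\mathscr{T},A)$ (also written $A$) with $\mathscr{T}$ a $\mathscr{J}$-theory and $A$ a $\mathscr{T}$-algebra. For an object $C$ of $\mathscr{C}$, $\mathrm{Alg}(C)$ is the category of algebras with carrier $C$, where a morphism $(M,f):(\mathscr{T},A)\to(\mathscr{U},B)$ consists of a morphism of $\mathscr{J}$-theories $M:\mathscr{T}\to\mathscr{U}$ and an isomorphism $f:A\to BM$ of $\mathscr{T}$-algebras with $|f|=1_C$. The commutant of $(\mathscr{T},A)$ is the algebra $A^\perp=(\mathscr{T}^\perp_A,A^\perp)$,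 where $\mathscr{T}^\perp_A$ is the $\mathscr{J}$-theory with $\mathscr{T}^\perp_A(J,K)=\mathscr{T}\text{-}\mathrm{Alg}(\mathscr{C})([J,A],[K,A])$ ($J,K\in\mathrm{ob}\,\mathscr{J}$), with composition and identities as in $\mathscr{T}\text{-}\mathrm{Alg}(\mathscr{C})$ and structure morphisms $J\to\mathscr{T}\text{-}\mathrm{Alg}(\mathscr{C})([J,A],A)$ the cotensor counits, and $A^\perp:\mathscr{T}^\perp_A\to\mathscr{C}$ is the algebra on $|A|$ given by $J\mapsto[J,|A|]$ and on homs by evaluation at $I$. Given algebras $A$ and $B$ on $C$, $A$ commutes with $B$ if there is a (necessarily unique) morphism $B\to A^\perp$ in $\mathrm{Alg}(C)$; this relation is symmetric. Pairs. $(\mathscr{T},\mathscr{U})\text{-}\mathrm{Pair}(\mathscr{C})$ is the pullback $\mathscr{T}\text{-}\mathrm{Alg}(\mathscr{C})\times_{\mathscr{C}}\mathscr{U}\text{-}\mathrm{Alg}(\mathscr{C})$ of $\mathscr{V}$-categories along the $\mathscr{V}$-functors $|-|$ (evaluation at $I$); its objects are pairs $(A,B)$ of a $\mathscr{T}$-algebra and a $\mathscr{U}$-algebra with $|A|=|B|$. $(\mathscr{T},\mathscr{U})\text{-}\mathrm{CPair}(\mathscr{C})$ is its full sub-$\mathscr{V}$-category on the commuting $\mathscr{T}$-$\mathscr{U}$-algebra pairs, i.e. the $(A,B)$ such that $A$ commutes with $B$. For an object $C$, $(\mathscr{T},\mathscr{U})\text{-}\mathrm{CPair}(C)$ is the fibre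 over $C$ of the carrier functor $(\mathscr{T},\mathscr{U})\text{-}\mathrm{CPair}(\mathscr{C})_0\to\mathscr{C}_0$ (objects with carrier $C$, morphisms with underlying morphism $1_C$). Bifold algebras. A $(\mathscr{T},\mathscr{U})$-algebra in $\mathscr{C}$ is a $\mathscr{V}$-functor $D:\mathscr{T}\otimes\mathscr{U}\to\mathscr{C}$ preserving $\mathscr{J}$-cotensors in each variable separately. $(\mathscr{T},\mathscr{U})\text{-}\mathrm{Alg}(\mathscr{C})$ is the full sub-$\mathscr{V}'$-category of $[\mathscr{T}\otimes\mathscr{U},\mathscr{C}]$ on the $(\mathscr{T},\mathscr{U})$-algebras; that it exists as a $\mathscr{V}$-category means that its hom-objects lie in $\mathscr{V}$. $(\mathscr{T},\mathscr{U})\text{-}\mathrm{Alg}(C)$ is the fibre over $C$ of the carrier functor $D\mapsto|D|=D(I,I)$. $D_\ell=D(-,I)$ is the left face (a $\mathscr{T}$-algebra) and $D_r=D(I,-)$ the right face (a $\mathscr{U}$-algebra), both on $|D|$. *)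

theory Defs
  imports Main "HOL-Library.FuncSet"
begin

section \<open>Ordinary categories\<close>

record ('o, 'm) cat =
  Ob :: "'o set"
  Ar :: "'m set"
  Dom :: "'m \<Rightarrow> 'o"
  Cod :: "'m \<Rightarrow> 'o"
  Idn :: "'o \<Rightarrow> 'm"
  Cmp :: "'m \<Rightarrow> 'm \<Rightarrow> 'm" (infixr "\<cdot>\<index>" 55)

locale category =
  fixes C :: "('o, 'm, 'z) cat_scheme" (structure)
  assumes Dom_Ob: "f \<in> Ar C \<Longrightarrow> Dom C f \<in> Ob C"
    and Cod_Ob: "f \<in> Ar C \<Longrightarrow> Cod C f \<in> Ob C"
    and Idn_Ar: "a \<in> Ob C \<Longrightarrow> Idn C a \<in> Ar C"
    and Dom_Idn: "a \<in> Ob C \<Longrightarrow> Dom C (Idn C a) = a"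
    and Cod_Idn: "a \<in> Ob C \<Longrightarrow> Cod C (Idn C a) = a"
    and Cmp_Ar: "\<lbrakk>f \<in> Ar C; g \<in> Ar C; Dom C g = Cod C f\<rbrakk> \<Longrightarrow> g \<cdot> f \<in> Ar C"
    and Dom_Cmp: "\<lbrakk>f \<in> Ar C; g \<in> Ar C; Dom C g = Cod C f\<rbrakk> \<Longrightarrow> Dom C (g \<cdot> f) = Dom C f"
    and Cod_Cmp: "\<lbrakk>f \<in> Ar C; g \<in> Ar C; Dom C g = Cod C f\<rbrakk> \<Longrightarrow> Cod C (g \<cdot> f) = Cod C g"
    and Idn_left: "f \<in> Ar C \<Longrightarrow> Idn C (Cod C f) \<cdot> f = f"
    and Idn_right: "f \<in> Ar C \<Longrightarrow> f \<cdot> Idn C (Dom C f) = f"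
    and Cmp_assoc: "\<lbrakk>f \<in> Ar C; g \<in> Ar C; h \<in> Ar C; Dom C g = Cod C f; Dom C h = Cod C g\<rbrakk>
      \<Longrightarrow> (h \<cdot> g) \<cdot> f = h \<cdot> (g \<cdot> f)"

definition in_hom :: "('o, 'm, 'z) cat_scheme \<Rightarrow> 'm \<Rightarrow> 'o \<Rightarrow> 'o \<Rightarrow> bool"
    ("\<guillemotleft>_ :\<index> _ \<rightarrow> _\<guillemotright>") where
  "\<guillemotleft>f :\<^bsub>C\<^esub> a \<rightarrow> b\<guillemotright> \<longleftrightarrow> f \<in> Ar C \<and> Dom C f = a \<and> Cod C f = b"

definition inverse_arrows :: "('o, 'm, 'z) cat_scheme \<Rightarrow> 'm \<Rightarrow> 'm \<Rightarrow> bool" where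
  "inverse_arrows C f g \<longleftrightarrow> f \<in> Ar C \<and> \<guillemotleft>g :\<^bsub>C\<^esub> Cod C f \<rightarrow> Dom C f\<guillemotright>
     \<and> g \<cdot>\<^bsub>C\<^esub> f = Idn C (Dom C f) \<and> f \<cdot>\<^bsub>C\<^esub> g = Idn C (Cod C f)"

definition is_iso :: "('o, 'm, 'z) cat_scheme \<Rightarrow> 'm \<Rightarrow> bool" where
  "is_iso C f \<longleftrightarrow> (\<exists>g. inverse_arrows C f g)"

definition inv_arr :: "('o, 'm, 'z) cat_scheme \<Rightarrow> 'm \<Rightarrow> 'm" where
  "inv_arr C f = (THE g. inverse_arrows C f g)"

definition is_pullback ::
  "('o, 'm, 'z) cat_scheme \<Rightarrow> 'm \<Rightarrow> 'm \<Rightarrow> 'o \<Rightarrow> 'm \<Rightarrow> 'm \<Rightarrow> bool" where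
  "is_pullback C f g P p q \<longleftrightarrow>
     \<guillemotleft>p :\<^bsub>C\<^esub> P \<rightarrow> Dom C f\<guillemotright> \<and> \<guillemotleft>q :\<^bsub>C\<^esub> P \<rightarrow> Dom C g\<guillemotright> \<and>
     f \<cdot>\<^bsub>C\<^esub> p = g \<cdot>\<^bsub>C\<^esub> q \<and>
     (\<forall>X r s. \<guillemotleft>r :\<^bsub>C\<^esub> X \<rightarrow> Dom C f\<guillemotright> \<and> \<guillemotleft>s :\<^bsub>C\<^esub> X \<rightarrow> Dom C g\<guillemotright> \<and>
          f \<cdot>\<^bsub>C\<^esub> r = g \<cdot>\<^bsub>C\<^esub> s \<longrightarrow>
        (\<exists>!h. \<guillemotleft>h :\<^bsub>C\<^esub> X \<rightarrow> P\<guillemotright> \<and> p \<cdot>\<^bsub>C\<^esub> h = r \<and> q \<cdot>\<^bsub>C\<^esub> h = s))"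

definition has_pullbacks :: "('o, 'm, 'z) cat_scheme \<Rightarrow> bool" where
  "has_pullbacks C \<longleftrightarrow>
     (\<forall>f\<in>Ar C. \<forall>g\<in>Ar C. Cod C f = Cod C g \<longrightarrow> (\<exists>P p q. is_pullback C f g P p q))"

definition pb :: "('o, 'm, 'z) cat_scheme \<Rightarrow> 'm \<Rightarrow> 'm \<Rightarrow> 'o \<times> 'm \<times> 'm" where
  "pb C f g = (SOME (P, p, q). is_pullback C f g P p q)"

definition pb_ob :: "('o, 'm, 'z) cat_scheme \<Rightarrow> 'm \<Rightarrow> 'm \<Rightarrow> 'o" where
  "pb_ob C f g = fst (pb C f g)"

definition pb_fst :: "('o, 'm, 'z) cat_scheme \<Rightarrow> 'm \<Rightarrow> 'm \<Rightarrow> 'm" where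
  "pb_fst C f g = fst (snd (pb C f g))"

definition pb_snd :: "('o, 'm, 'z) cat_scheme \<Rightarrow> 'm \<Rightarrow> 'm \<Rightarrow> 'm" where
  "pb_snd C f g = snd (snd (pb C f g))"

definition pb_pair ::
  "('o, 'm, 'z) cat_scheme \<Rightarrow> 'm \<Rightarrow> 'm \<Rightarrow> 'o \<Rightarrow> 'm \<Rightarrow> 'm \<Rightarrow> 'm" where
  "pb_pair C f g X r s = (THE h. \<guillemotleft>h :\<^bsub>C\<^esub> X \<rightarrow> pb_ob C f g\<guillemotright> \<and>
     pb_fst C f g \<cdot>\<^bsub>C\<^esub> h = r \<and> pb_snd C f g \<cdot>\<^bsub>C\<^esub> h = s)"

record ('a, 'b, 'm, 'n) ofun =
  OOb :: "'a \<Rightarrow> 'b"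
  OAr :: "'m \<Rightarrow> 'n"

definition is_functor ::
  "('a, 'm, 'y) cat_scheme \<Rightarrow> ('b, 'n, 'z) cat_scheme \<Rightarrow> ('a, 'b, 'm, 'n) ofun \<Rightarrow> bool" where
  "is_functor A B F \<longleftrightarrow> category A \<and> category B \<and>
     (\<forall>a\<in>Ob A. OOb F a \<in> Ob B) \<and>
     (\<forall>f\<in>Ar A. \<guillemotleft>OAr F f :\<^bsub>B\<^esub> OOb F (Dom A f) \<rightarrow> OOb F (Cod A f)\<guillemotright>) \<and>
     (\<forall>a\<in>Ob A. OAr F (Idn A a) = Idn B (OOb F a)) \<and>
     (\<forall>f\<in>Ar A. \<forall>g\<in>Ar A. Dom A g = Cod A f \<longrightarrow>
        OAr F (g \<cdot>\<^bsub>A\<^esub> f) = OAr F g \<cdot>\<^bsub>B\<^esub> OAr F f)"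

definition functor_id :: "('a, 'a, 'm, 'm) ofun" where
  "functor_id = \<lparr>OOb = (\<lambda>a. a), OAr = (\<lambda>f. f)\<rparr>"

definition functor_comp ::
  "('b, 'c, 'n, 'p) ofun \<Rightarrow> ('a, 'b, 'm, 'n) ofun \<Rightarrow> ('a, 'c, 'm, 'p) ofun" where
  "functor_comp G F = \<lparr>OOb = OOb G \<circ> OOb F, OAr = OAr G \<circ> OAr F\<rparr>"

definition natural_iso ::
  "('a, 'm, 'y) cat_scheme \<Rightarrow> ('b, 'n, 'z) cat_scheme \<Rightarrow>
   ('a, 'b, 'm, 'n) ofun \<Rightarrow> ('a, 'b, 'm, 'n) ofun \<Rightarrow> ('a \<Rightarrow> 'n) \<Rightarrow> bool" where
  "natural_iso A B F G \<alpha> \<longleftrightarrow>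
     (\<forall>a\<in>Ob A. \<guillemotleft>\<alpha> a :\<^bsub>B\<^esub> OOb F a \<rightarrow> OOb G a\<guillemotright> \<and> is_iso B (\<alpha> a)) \<and>
     (\<forall>f\<in>Ar A. \<alpha> (Cod A f) \<cdot>\<^bsub>B\<^esub> OAr F f = OAr G f \<cdot>\<^bsub>B\<^esub> \<alpha> (Dom A f))"

definition is_equivalence ::
  "('a, 'm, 'y) cat_scheme \<Rightarrow> ('b, 'n, 'z) cat_scheme \<Rightarrow> ('a, 'b, 'm, 'n) ofun \<Rightarrow> bool" where
  "is_equivalence A B F \<longleftrightarrow> is_functor A B F \<and>
     (\<exists>G \<eta> \<epsilon>. is_functor B A G \<and>
        natural_iso A A functor_id (functor_comp G F) \<eta> \<and>
        natural_iso B B (functor_comp F G) functor_id \<epsilon>)"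

section \<open>Symmetric monoidal closed categories\<close>

record ('o, 'm) smc = "('o, 'm) cat" +
  Ten :: "'o \<Rightarrow> 'o \<Rightarrow> 'o" (infixr "\<otimes>\<index>" 65)
  TenA :: "'m \<Rightarrow> 'm \<Rightarrow> 'm" (infixr "\<odot>\<index>" 65)
  Unt :: "'o" ("\<I>\<index>")
  Asc :: "'o \<Rightarrow> 'o \<Rightarrow> 'o \<Rightarrow> 'm"
  Lun :: "'o \<Rightarrow> 'm"
  Run :: "'o \<Rightarrow> 'm"
  Sym :: "'o \<Rightarrow> 'o \<Rightarrow> 'm"
  IHom :: "'o \<Rightarrow> 'o \<Rightarrow> 'o"
  Ev :: "'o \<Rightarrow> 'o \<Rightarrow> 'm"

locale smcc = category V for V :: "('o, 'm) smc" (structure) +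
  assumes Unt_Ob: "\<I> \<in> Ob V"
    and Ten_Ob: "\<lbrakk>a \<in> Ob V; b \<in> Ob V\<rbrakk> \<Longrightarrow> a \<otimes> b \<in> Ob V"
    and TenA_hom: "\<lbrakk>\<guillemotleft>f : a \<rightarrow> b\<guillemotright>; \<guillemotleft>g : c \<rightarrow> d\<guillemotright>\<rbrakk> \<Longrightarrow> \<guillemotleft>f \<odot> g : a \<otimes> c \<rightarrow> b \<otimes> d\<guillemotright>"
    and TenA_Idn: "\<lbrakk>a \<in> Ob V; b \<in> Ob V\<rbrakk> \<Longrightarrow> Idn V a \<odot> Idn V b = Idn V (a \<otimes> b)"
    and TenA_Cmp: "\<lbrakk>\<guillemotleft>f : a \<rightarrow> b\<guillemotright>; \<guillemotleft>g : b \<rightarrow> c\<guillemotright>; \<guillemotleft>f' : a' \<rightarrow> b'\<guillemotright>; \<guillemotleft>g' : b' \<rightarrow> c'\<guillemotright>\<rbrakk>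
      \<Longrightarrow> (g \<cdot> f) \<odot> (g' \<cdot> f') = (g \<odot> g') \<cdot> (f \<odot> f')"
    and Asc_hom: "\<lbrakk>a \<in> Ob V; b \<in> Ob V; c \<in> Ob V\<rbrakk>
      \<Longrightarrow> \<guillemotleft>Asc V a b c : (a \<otimes> b) \<otimes> c \<rightarrow> a \<otimes> (b \<otimes> c)\<guillemotright>"
    and Asc_iso: "\<lbrakk>a \<in> Ob V; b \<in> Ob V; c \<in> Ob V\<rbrakk> \<Longrightarrow> is_iso V (Asc V a b c)"
    and Asc_natural: "\<lbrakk>\<guillemotleft>f : a \<rightarrow> a'\<guillemotright>; \<guillemotleft>g : b \<rightarrow> b'\<guillemotright>; \<guillemotleft>h : c \<rightarrow> c'\<guillemotright>\<rbrakk>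
      \<Longrightarrow> Asc V a' b' c' \<cdot> ((f \<odot> g) \<odot> h) = (f \<odot> (g \<odot> h)) \<cdot> Asc V a b c"
    and Lun_hom: "a \<in> Ob V \<Longrightarrow> \<guillemotleft>Lun V a : \<I> \<otimes> a \<rightarrow> a\<guillemotright>"
    and Lun_iso: "a \<in> Ob V \<Longrightarrow> is_iso V (Lun V a)"
    and Lun_natural: "\<guillemotleft>f : a \<rightarrow> b\<guillemotright> \<Longrightarrow> Lun V b \<cdot> (Idn V \<I> \<odot> f) = f \<cdot> Lun V a"
    and Run_hom: "a \<in> Ob V \<Longrightarrow> \<guillemotleft>Run V a : a \<otimes> \<I> \<rightarrow> a\<guillemotright>"
    and Run_iso: "a \<in> Ob V \<Longrightarrow> is_iso V (Run V a)"
    and Run_natural: "\<guillemotleft>f : a \<rightarrow> b\<guillemotright> \<Longrightarrow> Run V b \<cdot> (f \<odot> Idn V \<I>) = f \<cdot> Run V a"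
    and pentagon: "\<lbrakk>a \<in> Ob V; b \<in> Ob V; c \<in> Ob V; d \<in> Ob V\<rbrakk>
      \<Longrightarrow> (Idn V a \<odot> Asc V b c d) \<cdot> Asc V a (b \<otimes> c) d \<cdot> (Asc V a b c \<odot> Idn V d)
        = Asc V a b (c \<otimes> d) \<cdot> Asc V (a \<otimes> b) c d"
    and triangle: "\<lbrakk>a \<in> Ob V; b \<in> Ob V\<rbrakk>
      \<Longrightarrow> (Idn V a \<odot> Lun V b) \<cdot> Asc V a \<I> b = Run V a \<odot> Idn V b"
    and Sym_hom: "\<lbrakk>a \<in> Ob V; b \<in> Ob V\<rbrakk> \<Longrightarrow> \<guillemotleft>Sym V a b : a \<otimes> b \<rightarrow> b \<otimes> a\<guillemotright>"
    and Sym_natural: "\<lbrakk>\<guillemotleft>f : a \<rightarrow> a'\<guillemotright>; \<guillemotleft>g : b \<rightarrow> b'\<guillemotright>\<rbrakk>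
      \<Longrightarrow> Sym V a' b' \<cdot> (f \<odot> g) = (g \<odot> f) \<cdot> Sym V a b"
    and Sym_Sym: "\<lbrakk>a \<in> Ob V; b \<in> Ob V\<rbrakk> \<Longrightarrow> Sym V b a \<cdot> Sym V a b = Idn V (a \<otimes> b)"
    and hexagon: "\<lbrakk>a \<in> Ob V; b \<in> Ob V; c \<in> Ob V\<rbrakk>
      \<Longrightarrow> Asc V b c a \<cdot> Sym V a (b \<otimes> c) \<cdot> Asc V a b c
        = (Idn V b \<odot> Sym V a c) \<cdot> Asc V b a c \<cdot> (Sym V a b \<odot> Idn V c)"
    and IHom_Ob: "\<lbrakk>a \<in> Ob V; b \<in> Ob V\<rbrakk> \<Longrightarrow> IHom V a b \<in> Ob V"
    and Ev_hom: "\<lbrakk>a \<in> Ob V; b \<in> Ob V\<rbrakk> \<Longrightarrow> \<guillemotleft>Ev V a b : IHom V a b \<otimes> a \<rightarrow> b\<guillemotright>"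
    and Ev_universal: "\<lbrakk>x \<in> Ob V; a \<in> Ob V; b \<in> Ob V; \<guillemotleft>f : x \<otimes> a \<rightarrow> b\<guillemotright>\<rbrakk>
      \<Longrightarrow> \<exists>!g. \<guillemotleft>g : x \<rightarrow> IHom V a b\<guillemotright> \<and> Ev V a b \<cdot> (g \<odot> Idn V a) = f"

section \<open>Enriched categories and functors\<close>

text \<open>\<open>VComp C a b c\<close> goes from \<open>C(b,c) \<otimes> C(a,b)\<close> to \<open>C(a,c)\<close>.\<close>

record ('c, 'o, 'm) vcat =
  VOb :: "'c set"
  VHom :: "'c \<Rightarrow> 'c \<Rightarrow> 'o"
  VId :: "'c \<Rightarrow> 'm"
  VComp :: "'c \<Rightarrow> 'c \<Rightarrow> 'c \<Rightarrow> 'm"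

record ('a, 'b, 'm) vfun =
  FOb :: "'a \<Rightarrow> 'b"
  FHom :: "'a \<Rightarrow> 'a \<Rightarrow> 'm"

text \<open>Enriched functors are kept undefined off the objects of their domain, so that
  HOL equality of such records is equality of functors.\<close>

definition mk_vfun :: "'a set \<Rightarrow> ('a \<Rightarrow> 'b) \<Rightarrow> ('a \<Rightarrow> 'a \<Rightarrow> 'm) \<Rightarrow> ('a, 'b, 'm) vfun" where
  "mk_vfun S F H = \<lparr>FOb = restrict F S, FHom = (\<lambda>a b. if a \<in> S \<and> b \<in> S then H a b else undefined)\<rparr>"

definition vfull :: "('c, 'o, 'm) vcat \<Rightarrow> 'c set \<Rightarrow> ('c, 'o, 'm) vcat" where
  "vfull C S = C\<lparr>VOb := VOb C \<inter> S\<rparr>"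

text \<open>An enriched category with designated cotensors \<open>Cot C j x = [j,x]\<close> and their counits
  \<open>Counit C j x : j \<rightarrow> C([j,x],x)\<close>.\<close>

record ('c, 'o, 'm) cvcat = "('c, 'o, 'm) vcat" +
  Cot :: "'o \<Rightarrow> 'c \<Rightarrow> 'c"
  Counit :: "'o \<Rightarrow> 'c \<Rightarrow> 'm"

text \<open>A theory has the arities themselves as objects; \<open>Str T j k : [k,j] \<rightarrow> T(j,k)\<close> is the action on
  homs of the identity-on-objects functor \<open>\<tau>\<close> from the opposite of the category of arities.\<close>

record ('o, 'm) jtheory = "('o, 'o, 'm) vcat" +
  Str :: "'o \<Rightarrow> 'o \<Rightarrow> 'm"

context smcc
begin

definition curry_arr :: "'o \<Rightarrow> 'o \<Rightarrow> 'o \<Rightarrow> 'm \<Rightarrow> 'm" where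
  "curry_arr x a b f = (THE g. \<guillemotleft>g : x \<rightarrow> IHom V a b\<guillemotright> \<and> Ev V a b \<cdot> (g \<odot> Idn V a) = f)"

definition vcategory :: "('c, 'o, 'm, 'z) vcat_scheme \<Rightarrow> bool" where
  "vcategory C \<longleftrightarrow>
     (\<forall>a\<in>VOb C. \<forall>b\<in>VOb C. VHom C a b \<in> Ob V) \<and>
     (\<forall>a\<in>VOb C. \<guillemotleft>VId C a : \<I> \<rightarrow> VHom C a a\<guillemotright>) \<and>
     (\<forall>a\<in>VOb C. \<forall>b\<in>VOb C. \<forall>c\<in>VOb C.
        \<guillemotleft>VComp C a b c : VHom C b c \<otimes> VHom C a b \<rightarrow> VHom C a c\<guillemotright>) \<and>
     (\<forall>a\<in>VOb C. \<forall>b\<in>VOb C. \<forall>c\<in>VOb C. \<forall>d\<in>VOb C.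
        VComp C a b d \<cdot> (VComp C b c d \<odot> Idn V (VHom C a b))
        = VComp C a c d \<cdot> (Idn V (VHom C c d) \<odot> VComp C a b c)
            \<cdot> Asc V (VHom C c d) (VHom C b c) (VHom C a b)) \<and>
     (\<forall>a\<in>VOb C. \<forall>b\<in>VOb C.
        VComp C a b b \<cdot> (VId C b \<odot> Idn V (VHom C a b)) = Lun V (VHom C a b) \<and>
        VComp C a a b \<cdot> (Idn V (VHom C a b) \<odot> VId C a) = Run V (VHom C a b))"

definition vfunctor ::
  "('a, 'o, 'm, 'y) vcat_scheme \<Rightarrow> ('b, 'o, 'm, 'z) vcat_scheme \<Rightarrow> ('a, 'b, 'm) vfun \<Rightarrow> bool" where
  "vfunctor A B F \<longleftrightarrow> vcategory A \<and> vcategory B \<and>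
     F = mk_vfun (VOb A) (FOb F) (FHom F) \<and>
     (\<forall>a\<in>VOb A. FOb F a \<in> VOb B) \<and>
     (\<forall>a\<in>VOb A. \<forall>b\<in>VOb A. \<guillemotleft>FHom F a b : VHom A a b \<rightarrow> VHom B (FOb F a) (FOb F b)\<guillemotright>) \<and>
     (\<forall>a\<in>VOb A. FHom F a a \<cdot> VId A a = VId B (FOb F a)) \<and>
     (\<forall>a\<in>VOb A. \<forall>b\<in>VOb A. \<forall>c\<in>VOb A.
        FHom F a c \<cdot> VComp A a b c
        = VComp B (FOb F a) (FOb F b) (FOb F c) \<cdot> (FHom F b c \<odot> FHom F a b))"

definition vid :: "('a, 'o, 'm, 'z) vcat_scheme \<Rightarrow> ('a, 'a, 'm) vfun" where
  "vid A = mk_vfun (VOb A) (\<lambda>a. a) (\<lambda>a b. Idn V (VHom A a b))"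

definition vcomp ::
  "('a, 'o, 'm, 'z) vcat_scheme \<Rightarrow> ('b, 'c, 'm) vfun \<Rightarrow> ('a, 'b, 'm) vfun \<Rightarrow> ('a, 'c, 'm) vfun" where
  "vcomp A G F = mk_vfun (VOb A) (\<lambda>a. FOb G (FOb F a))
     (\<lambda>a b. FHom G (FOb F a) (FOb F b) \<cdot> FHom F a b)"

text \<open>Composition and isomorphisms in the underlying ordinary category, whose arrows from \<open>a\<close> to \<open>b\<close>
  are the arrows from \<open>\<I>\<close> to \<open>C(a,b)\<close>.\<close>

definition ucomp :: "('c, 'o, 'm, 'z) vcat_scheme \<Rightarrow> 'c \<Rightarrow> 'c \<Rightarrow> 'c \<Rightarrow> 'm \<Rightarrow> 'm \<Rightarrow> 'm" where
  "ucomp C a b c g f = VComp C a b c \<cdot> (g \<odot> f) \<cdot> inv_arr V (Lun V \<I>)"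

definition uiso :: "('c, 'o, 'm, 'z) vcat_scheme \<Rightarrow> 'c \<Rightarrow> 'c \<Rightarrow> 'm \<Rightarrow> bool" where
  "uiso C a b f \<longleftrightarrow> \<guillemotleft>f : \<I> \<rightarrow> VHom C a b\<guillemotright> \<and>
     (\<exists>g. \<guillemotleft>g : \<I> \<rightarrow> VHom C b a\<guillemotright> \<and> ucomp C a b a g f = VId C a \<and> ucomp C b a b f g = VId C b)"

definition vnatural ::
  "('a, 'o, 'm, 'y) vcat_scheme \<Rightarrow> ('b, 'o, 'm, 'z) vcat_scheme \<Rightarrow>
   ('a, 'b, 'm) vfun \<Rightarrow> ('a, 'b, 'm) vfun \<Rightarrow> ('a \<Rightarrow> 'm) \<Rightarrow> bool" where
  "vnatural A B F G \<alpha> \<longleftrightarrow>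
     (\<forall>a\<in>VOb A. \<guillemotleft>\<alpha> a : \<I> \<rightarrow> VHom B (FOb F a) (FOb G a)\<guillemotright>) \<and>
     (\<forall>a\<in>VOb A. \<forall>b\<in>VOb A.
        VComp B (FOb F a) (FOb F b) (FOb G b) \<cdot> (\<alpha> b \<odot> FHom F a b) \<cdot> inv_arr V (Lun V (VHom A a b))
        = VComp B (FOb F a) (FOb G a) (FOb G b) \<cdot> (FHom G a b \<odot> \<alpha> a) \<cdot> inv_arr V (Run V (VHom A a b)))"

definition vnatural_iso ::
  "('a, 'o, 'm, 'y) vcat_scheme \<Rightarrow> ('b, 'o, 'm, 'z) vcat_scheme \<Rightarrow>
   ('a, 'b, 'm) vfun \<Rightarrow> ('a, 'b, 'm) vfun \<Rightarrow> ('a \<Rightarrow> 'm) \<Rightarrow> bool" where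
  "vnatural_iso A B F G \<alpha> \<longleftrightarrow> vnatural A B F G \<alpha> \<and> (\<forall>a\<in>VOb A. uiso B (FOb F a) (FOb G a) (\<alpha> a))"

definition vequivalence ::
  "('a, 'o, 'm, 'y) vcat_scheme \<Rightarrow> ('b, 'o, 'm, 'z) vcat_scheme \<Rightarrow> ('a, 'b, 'm) vfun \<Rightarrow> bool" where
  "vequivalence A B F \<longleftrightarrow> vfunctor A B F \<and>
     (\<exists>G \<eta> \<epsilon>. vfunctor B A G \<and>
        vnatural_iso A A (vid A) (vcomp A G F) \<eta> \<and>
        vnatural_iso B B (vcomp B F G) (vid B) \<epsilon>)"

definition vop :: "('c, 'o, 'm) vcat \<Rightarrow> ('c, 'o, 'm) vcat" where
  "vop C = \<lparr>VOb = VOb C, VHom = (\<lambda>a b. VHom C b a), VId = VId C,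
     VComp = (\<lambda>a b c. VComp C c b a \<cdot> Sym V (VHom C c b) (VHom C b a))\<rparr>"

text \<open>The full sub-enriched-category of \<open>V\<close>, enriched in itself by its internal hom, on the objects in \<open>S\<close>.\<close>

definition vself :: "'o set \<Rightarrow> ('o, 'o, 'm) vcat" where
  "vself S = \<lparr>VOb = S, VHom = IHom V,
     VId = (\<lambda>a. curry_arr \<I> a a (Lun V a)),
     VComp = (\<lambda>a b c. curry_arr (IHom V b c \<otimes> IHom V a b) a c
       (Ev V b c \<cdot> (Idn V (IHom V b c) \<odot> Ev V a b) \<cdot> Asc V (IHom V b c) (IHom V a b) a))\<rparr>"

definition mid4 :: "'o \<Rightarrow> 'o \<Rightarrow> 'o \<Rightarrow> 'o \<Rightarrow> 'm" where
  \<comment> \<open>the middle-four interchange \<open>(a \<otimes> b) \<otimes> (c \<otimes> d) \<rightarrow> (a \<otimes> c) \<otimes> (b \<otimes> d)\<close>\<close>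
  "mid4 a b c d = inv_arr V (Asc V a c (b \<otimes> d))
     \<cdot> (Idn V a \<odot> (Asc V c b d \<cdot> (Sym V b c \<odot> Idn V d) \<cdot> inv_arr V (Asc V b c d)))
     \<cdot> Asc V a b (c \<otimes> d)"

definition vtensor ::
  "('a, 'o, 'm, 'y) vcat_scheme \<Rightarrow> ('b, 'o, 'm, 'z) vcat_scheme \<Rightarrow> ('a \<times> 'b, 'o, 'm) vcat" where
  "vtensor A B = \<lparr>VOb = VOb A \<times> VOb B,
     VHom = (\<lambda>x y. VHom A (fst x) (fst y) \<otimes> VHom B (snd x) (snd y)),
     VId = (\<lambda>x. (VId A (fst x) \<odot> VId B (snd x)) \<cdot> inv_arr V (Lun V \<I>)),
     VComp = (\<lambda>x y z. (VComp A (fst x) (fst y) (fst z) \<odot> VComp B (snd x) (snd y) (snd z))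
       \<cdot> mid4 (VHom A (fst y) (fst z)) (VHom B (snd y) (snd z))
              (VHom A (fst x) (fst y)) (VHom B (snd x) (snd y)))\<rparr>"

text \<open>The partial functors \<open>D(-,u)\<close> and \<open>D(t,-)\<close>.\<close>

definition fix_right ::
  "('a, 'o, 'm, 'y) vcat_scheme \<Rightarrow> ('b, 'o, 'm, 'z) vcat_scheme \<Rightarrow> ('a \<times> 'b, 'c, 'm) vfun \<Rightarrow> 'b
   \<Rightarrow> ('a, 'c, 'm) vfun" where
  "fix_right A B D u = mk_vfun (VOb A) (\<lambda>t. FOb D (t, u))
     (\<lambda>t t'. FHom D (t, u) (t', u) \<cdot> (Idn V (VHom A t t') \<odot> VId B u) \<cdot> inv_arr V (Run V (VHom A t t')))"

definition fix_left ::
  "('a, 'o, 'm, 'y) vcat_scheme \<Rightarrow> ('b, 'o, 'm, 'z) vcat_scheme \<Rightarrow> ('a \<times> 'b, 'c, 'm) vfun \<Rightarrow> 'a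
   \<Rightarrow> ('b, 'c, 'm) vfun" where
  "fix_left A B D t = mk_vfun (VOb B) (\<lambda>u. FOb D (t, u))
     (\<lambda>u u'. FHom D (t, u) (t, u') \<cdot> (VId A t \<odot> Idn V (VHom B u u')) \<cdot> inv_arr V (Lun V (VHom B u u')))"

text \<open>The pullback of enriched functors \<open>F\<close> and \<open>G\<close> with common codomain; its hom-objects are
  pullbacks in \<open>V\<close>.\<close>

definition vpullback ::
  "('a, 'o, 'm) vcat \<Rightarrow> ('b, 'o, 'm) vcat \<Rightarrow> ('a, 'c, 'm) vfun \<Rightarrow> ('b, 'c, 'm) vfun
   \<Rightarrow> ('a \<times> 'b, 'o, 'm) vcat" where
  "vpullback A B F G =
     (let f = (\<lambda>x y. FHom F (fst x) (fst y)); g = (\<lambda>x y. FHom G (snd x) (snd y));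
          P = (\<lambda>x y. pb_ob V (f x y) (g x y));
          p = (\<lambda>x y. pb_fst V (f x y) (g x y)); q = (\<lambda>x y. pb_snd V (f x y) (g x y))
      in \<lparr>VOb = {x \<in> VOb A \<times> VOb B. FOb F (fst x) = FOb G (snd x)},
          VHom = P,
          VId = (\<lambda>x. pb_pair V (f x x) (g x x) \<I> (VId A (fst x)) (VId B (snd x))),
          VComp = (\<lambda>x y z. pb_pair V (f x z) (g x z) (P y z \<otimes> P x y)
             (VComp A (fst x) (fst y) (fst z) \<cdot> (p y z \<odot> p x y))
             (VComp B (snd x) (snd y) (snd z) \<cdot> (q y z \<odot> q x y)))\<rparr>)"

text \<open>The fibre over \<open>c\<close> of the ordinary functor underlying \<open>P : A \<rightarrow> C\<close>. Its arrows are triples of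
  domain, codomain and an arrow of \<open>V\<close> out of \<open>\<I>\<close>.\<close>

definition fibre ::
  "('a, 'o, 'm, 'y) vcat_scheme \<Rightarrow> ('c, 'o, 'm, 'z) vcat_scheme \<Rightarrow> ('a, 'c, 'm) vfun \<Rightarrow> 'c
   \<Rightarrow> ('a, 'a \<times> 'a \<times> 'm) cat" where
  "fibre A C P c = \<lparr>Ob = {a \<in> VOb A. FOb P a = c},
     Ar = {(a, b, f). a \<in> VOb A \<and> FOb P a = c \<and> b \<in> VOb A \<and> FOb P b = c \<and>
             \<guillemotleft>f : \<I> \<rightarrow> VHom A a b\<guillemotright> \<and> FHom P a b \<cdot> f = VId C c},
     Dom = (\<lambda>(a, b, f). a), Cod = (\<lambda>(a, b, f). b),
     Idn = (\<lambda>a. (a, a, VId A a)),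
     Cmp = (\<lambda>(b', d, g) (a, b, f). (a, d, ucomp A a b d g f))\<rparr>"

definition underlying_functor ::
  "('a, 'b, 'm) vfun \<Rightarrow> ('a, 'b, 'a \<times> 'a \<times> 'm, 'b \<times> 'b \<times> 'm) ofun" where
  "underlying_functor F = \<lparr>OOb = FOb F, OAr = (\<lambda>(a, b, f). (FOb F a, FOb F b, FHom F a b \<cdot> f))\<rparr>"

section \<open>Ends and functor categories\<close>

text \<open>\<open>wedge A B F G X \<mu>\<close>: the family \<open>\<mu> a : X \<rightarrow> B(F a, G a)\<close> is (extra)natural in \<open>a\<close>, the two
  composites being compared in the form \<open>A(a,b) \<otimes> X \<rightarrow> B(F a, G b)\<close> rather than in the transposed form
  \<open>X \<rightarrow> [A(a,b), B(F a, G b)]\<close>. An end of \<open>B(F -, G -)\<close> is a universal such family.\<close>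

definition wedge ::
  "('a, 'o, 'm, 'y) vcat_scheme \<Rightarrow> ('b, 'o, 'm, 'z) vcat_scheme \<Rightarrow>
   ('a, 'b, 'm) vfun \<Rightarrow> ('a, 'b, 'm) vfun \<Rightarrow> 'o \<Rightarrow> ('a \<Rightarrow> 'm) \<Rightarrow> bool" where
  "wedge A B F G X \<mu> \<longleftrightarrow> X \<in> Ob V \<and>
     (\<forall>a\<in>VOb A. \<guillemotleft>\<mu> a : X \<rightarrow> VHom B (FOb F a) (FOb G a)\<guillemotright>) \<and>
     (\<forall>a\<in>VOb A. \<forall>b\<in>VOb A.
        VComp B (FOb F a) (FOb G a) (FOb G b) \<cdot> (FHom G a b \<odot> \<mu> a)
        = VComp B (FOb F a) (FOb F b) (FOb G b) \<cdot> (\<mu> b \<odot> FHom F a b) \<cdot> Sym V (VHom A a b) X)"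

definition is_end ::
  "('a, 'o, 'm, 'y) vcat_scheme \<Rightarrow> ('b, 'o, 'm, 'z) vcat_scheme \<Rightarrow>
   ('a, 'b, 'm) vfun \<Rightarrow> ('a, 'b, 'm) vfun \<Rightarrow> 'o \<Rightarrow> ('a \<Rightarrow> 'm) \<Rightarrow> bool" where
  "is_end A B F G E \<pi> \<longleftrightarrow> wedge A B F G E \<pi> \<and>
     (\<forall>X \<mu>. wedge A B F G X \<mu> \<longrightarrow> (\<exists>!h. \<guillemotleft>h : X \<rightarrow> E\<guillemotright> \<and> (\<forall>a\<in>VOb A. \<pi> a \<cdot> h = \<mu> a)))"

definition has_end ::
  "('a, 'o, 'm, 'y) vcat_scheme \<Rightarrow> ('b, 'o, 'm, 'z) vcat_scheme \<Rightarrow>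
   ('a, 'b, 'm) vfun \<Rightarrow> ('a, 'b, 'm) vfun \<Rightarrow> bool" where
  "has_end A B F G \<longleftrightarrow> (\<exists>E \<pi>. is_end A B F G E \<pi>)"

definition chosen_end ::
  "('a, 'o, 'm, 'y) vcat_scheme \<Rightarrow> ('b, 'o, 'm, 'z) vcat_scheme \<Rightarrow>
   ('a, 'b, 'm) vfun \<Rightarrow> ('a, 'b, 'm) vfun \<Rightarrow> 'o \<times> ('a \<Rightarrow> 'm)" where
  "chosen_end A B F G = (SOME (E, \<pi>). is_end A B F G E \<pi>)"

definition nat_ob ::
  "('a, 'o, 'm, 'y) vcat_scheme \<Rightarrow> ('b, 'o, 'm, 'z) vcat_scheme \<Rightarrow>
   ('a, 'b, 'm) vfun \<Rightarrow> ('a, 'b, 'm) vfun \<Rightarrow> 'o" where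
  "nat_ob A B F G = fst (chosen_end A B F G)"

definition nat_pr ::
  "('a, 'o, 'm, 'y) vcat_scheme \<Rightarrow> ('b, 'o, 'm, 'z) vcat_scheme \<Rightarrow>
   ('a, 'b, 'm) vfun \<Rightarrow> ('a, 'b, 'm) vfun \<Rightarrow> 'a \<Rightarrow> 'm" where
  "nat_pr A B F G = snd (chosen_end A B F G)"

definition nat_lift ::
  "('a, 'o, 'm, 'y) vcat_scheme \<Rightarrow> ('b, 'o, 'm, 'z) vcat_scheme \<Rightarrow>
   ('a, 'b, 'm) vfun \<Rightarrow> ('a, 'b, 'm) vfun \<Rightarrow> 'o \<Rightarrow> ('a \<Rightarrow> 'm) \<Rightarrow> 'm" where
  "nat_lift A B F G X \<mu> =
     (THE h. \<guillemotleft>h : X \<rightarrow> nat_ob A B F G\<guillemotright> \<and> (\<forall>a\<in>VOb A. nat_pr A B F G a \<cdot> h = \<mu> a))"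

text \<open>The full subcategory of \<open>[A,B]\<close> on the functors in \<open>S\<close>; it is an enriched category
  when \<open>fun_cat_exists A B S\<close>.\<close>

definition fun_cat_exists ::
  "('a, 'o, 'm, 'y) vcat_scheme \<Rightarrow> ('b, 'o, 'm, 'z) vcat_scheme \<Rightarrow> ('a, 'b, 'm) vfun set \<Rightarrow> bool" where
  "fun_cat_exists A B S \<longleftrightarrow> (\<forall>F\<in>S. \<forall>G\<in>S. has_end A B F G)"

definition fun_cat ::
  "('a, 'o, 'm, 'y) vcat_scheme \<Rightarrow> ('b, 'o, 'm, 'z) vcat_scheme \<Rightarrow> ('a, 'b, 'm) vfun set
   \<Rightarrow> (('a, 'b, 'm) vfun, 'o, 'm) vcat" where
  "fun_cat A B S = \<lparr>VOb = S, VHom = nat_ob A B,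
     VId = (\<lambda>F. nat_lift A B F F \<I> (\<lambda>a. VId B (FOb F a))),
     VComp = (\<lambda>F G H. nat_lift A B F H (nat_ob A B G H \<otimes> nat_ob A B F G)
       (\<lambda>a. VComp B (FOb F a) (FOb G a) (FOb H a) \<cdot> (nat_pr A B G H a \<odot> nat_pr A B F G a)))\<rparr>"

definition evaluation ::
  "('a, 'o, 'm, 'y) vcat_scheme \<Rightarrow> ('b, 'o, 'm, 'z) vcat_scheme \<Rightarrow> ('a, 'b, 'm) vfun set \<Rightarrow> 'a
   \<Rightarrow> (('a, 'b, 'm) vfun, 'b, 'm) vfun" where
  "evaluation A B S a = mk_vfun S (\<lambda>F. FOb F a) (\<lambda>F G. nat_pr A B F G a)"

section \<open>Cotensors and theories\<close>

text \<open>The arrow \<open>\<gamma> : j \<rightarrow> C(e,x)\<close> exhibits \<open>e\<close> as a cotensor \<open>[j,x]\<close> when the induced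
  \<open>C(z,e) \<rightarrow> [j, C(z,x)]\<close> is invertible for all \<open>z\<close>.\<close>

definition is_cotensor :: "('c, 'o, 'm, 'z) vcat_scheme \<Rightarrow> 'o \<Rightarrow> 'c \<Rightarrow> 'c \<Rightarrow> 'm \<Rightarrow> bool" where
  "is_cotensor C j x e \<gamma> \<longleftrightarrow> x \<in> VOb C \<and> e \<in> VOb C \<and> \<guillemotleft>\<gamma> : j \<rightarrow> VHom C e x\<guillemotright> \<and>
     (\<forall>z\<in>VOb C. is_iso V (curry_arr (VHom C z e) j (VHom C z x)
        (VComp C z e x \<cdot> (\<gamma> \<odot> Idn V (VHom C z e)) \<cdot> Sym V (VHom C z e) j)))"

text \<open>The arrow \<open>X \<rightarrow> C(z,e)\<close> corresponding to \<open>\<phi> : X \<otimes> j \<rightarrow> C(z,x)\<close> under the cotensor \<open>(e,\<gamma>)\<close>.\<close>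

definition cot_lift ::
  "('c, 'o, 'm, 'z) vcat_scheme \<Rightarrow> 'o \<Rightarrow> 'c \<Rightarrow> 'c \<Rightarrow> 'm \<Rightarrow> 'c \<Rightarrow> 'o \<Rightarrow> 'm \<Rightarrow> 'm" where
  "cot_lift C j x e \<gamma> z X \<phi> =
     (THE h. \<guillemotleft>h : X \<rightarrow> VHom C z e\<guillemotright> \<and> VComp C z e x \<cdot> (\<gamma> \<odot> h) \<cdot> Sym V X j = \<phi>)"

definition preserves_cotensors ::
  "'o set \<Rightarrow> ('a, 'o, 'm, 'y) vcat_scheme \<Rightarrow> ('b, 'o, 'm, 'z) vcat_scheme \<Rightarrow> ('a, 'b, 'm) vfun \<Rightarrow> bool" where
  "preserves_cotensors J A B F \<longleftrightarrow>
     (\<forall>j\<in>J. \<forall>x e \<gamma>. is_cotensor A j x e \<gamma> \<longrightarrow>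
        is_cotensor B j (FOb F x) (FOb F e) (FHom F e x \<cdot> \<gamma>))"

definition has_cotensors :: "'o set \<Rightarrow> ('c, 'o, 'm) cvcat \<Rightarrow> bool" where
  "has_cotensors J C \<longleftrightarrow>
     (\<forall>j\<in>J. \<forall>x\<in>VOb C. is_cotensor C j x (Cot C j x) (Counit C j x)) \<and>
     (\<forall>x\<in>VOb C. Cot C \<I> x = x \<and> Counit C \<I> x = VId C x)"

definition system_of_arities :: "'o set \<Rightarrow> bool" where
  "system_of_arities J \<longleftrightarrow> J \<subseteq> Ob V \<and> \<I> \<in> J \<and> (\<forall>j\<in>J. \<forall>k\<in>J. j \<otimes> k \<in> J)"

definition structure_functor :: "'o set \<Rightarrow> ('o, 'm) jtheory \<Rightarrow> ('o, 'o, 'm) vfun" where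
  "structure_functor J T = mk_vfun J (\<lambda>j. j) (Str T)"

definition is_theory :: "'o set \<Rightarrow> ('o, 'm) jtheory \<Rightarrow> bool" where
  "is_theory J T \<longleftrightarrow> vcategory T \<and> VOb T = J \<and>
     vfunctor (vop (vself J)) T (structure_functor J T) \<and>
     preserves_cotensors J (vop (vself J)) T (structure_functor J T)"

definition theory_morphism ::
  "'o set \<Rightarrow> ('o, 'm) jtheory \<Rightarrow> ('o, 'm) jtheory \<Rightarrow> ('o, 'o, 'm) vfun \<Rightarrow> bool" where
  "theory_morphism J T U M \<longleftrightarrow> vfunctor T U M \<and>
     vcomp (vop (vself J)) M (structure_functor J T) = structure_functor J U"

definition algebras :: "'o set \<Rightarrow> ('o, 'm) jtheory \<Rightarrow> ('c, 'o, 'm) cvcat \<Rightarrow> ('o, 'c, 'm) vfun set" where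
  "algebras J T C = {A. vfunctor T C A \<and> preserves_cotensors J T C A}"

definition Alg ::
  "'o set \<Rightarrow> ('o, 'm) jtheory \<Rightarrow> ('c, 'o, 'm) cvcat \<Rightarrow> (('o, 'c, 'm) vfun, 'o, 'm) vcat" where
  "Alg J T C = fun_cat T C (algebras J T C)"

definition alg_carrier ::
  "'o set \<Rightarrow> ('o, 'm) jtheory \<Rightarrow> ('c, 'o, 'm) cvcat \<Rightarrow> (('o, 'c, 'm) vfun, 'c, 'm) vfun" where
  "alg_carrier J T C = evaluation T C (algebras J T C) \<I>"

definition admissible :: "'o set \<Rightarrow> ('c, 'o, 'm) cvcat \<Rightarrow> bool" where
  "admissible J C \<longleftrightarrow> vcategory C \<and> has_cotensors J C \<and>
     (\<forall>T. is_theory J T \<longrightarrow> fun_cat_exists T C (algebras J T C))"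

section \<open>Commutation\<close>

text \<open>The functor \<open>[j,-] : C \<rightarrow> C\<close>, acting on homs in the unique way making the designated counits natural.\<close>

definition cot_functor :: "('c, 'o, 'm) cvcat \<Rightarrow> 'o \<Rightarrow> ('c, 'c, 'm) vfun" where
  "cot_functor C j = mk_vfun (VOb C) (Cot C j)
     (\<lambda>x y. cot_lift C j y (Cot C j y) (Counit C j y) (Cot C j x) (VHom C x y)
        (VComp C (Cot C j x) x y \<cdot> (Idn V (VHom C x y) \<odot> Counit C j x)))"

text \<open>The designated (pointwise) cotensor \<open>[j,A]\<close> in the category of \<open>T\<close>-algebras, and its counit.\<close>

definition alg_cot ::
  "('o, 'm) jtheory \<Rightarrow> ('c, 'o, 'm) cvcat \<Rightarrow> 'o \<Rightarrow> ('o, 'c, 'm) vfun \<Rightarrow> ('o, 'c, 'm) vfun" where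
  "alg_cot T C j A = vcomp T (cot_functor C j) A"

definition alg_counit ::
  "('o, 'm) jtheory \<Rightarrow> ('c, 'o, 'm) cvcat \<Rightarrow> 'o \<Rightarrow> ('o, 'c, 'm) vfun \<Rightarrow> 'm" where
  "alg_counit T C j A = nat_lift T C (alg_cot T C j A) A j (\<lambda>k. Counit C j (FOb A k))"

text \<open>In \<open>commutant_theory\<close>, \<open>Str\<close> is the structure determined by the counits
  \<open>j \<rightarrow> Alg([j,A],A)\<close>: its component \<open>[k,j] \<rightarrow> Alg([j,A],[k,A])\<close> corresponds, under the cotensor
  \<open>[k,A]\<close>, to evaluation \<open>[k,j] \<otimes> k \<rightarrow> j\<close> followed by the counit at \<open>j\<close>.\<close>

definition commutant_theory ::
  "'o set \<Rightarrow> ('o, 'm) jtheory \<Rightarrow> ('c, 'o, 'm) cvcat \<Rightarrow> ('o, 'c, 'm) vfun \<Rightarrow> ('o, 'm) jtheory" where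
  "commutant_theory J T C A =
     (let c = (\<lambda>j. alg_cot T C j A) in
      \<lparr>VOb = J, VHom = (\<lambda>j k. VHom (Alg J T C) (c j) (c k)),
       VId = (\<lambda>j. VId (Alg J T C) (c j)),
       VComp = (\<lambda>j k l. VComp (Alg J T C) (c j) (c k) (c l)),
       Str = (\<lambda>j k. cot_lift (Alg J T C) k A (c k) (alg_counit T C k A) (c j) (IHom V k j)
         (alg_counit T C j A \<cdot> Ev V k j))\<rparr>)"

definition commutant_algebra ::
  "'o set \<Rightarrow> ('o, 'm) jtheory \<Rightarrow> ('c, 'o, 'm) cvcat \<Rightarrow> ('o, 'c, 'm) vfun \<Rightarrow> ('o, 'c, 'm) vfun" where
  "commutant_algebra J T C A = mk_vfun J (\<lambda>j. Cot C j (FOb A \<I>))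
     (\<lambda>j k. FHom (alg_carrier J T C) (alg_cot T C j A) (alg_cot T C k A))"

text \<open>\<open>(M,f)\<close> is a morphism from \<open>(T,A)\<close> to \<open>(U,B)\<close> in the category of algebras with
  carrier \<open>x\<close>.\<close>

definition algebra_morphism ::
  "'o set \<Rightarrow> ('c, 'o, 'm) cvcat \<Rightarrow> 'c \<Rightarrow> ('o, 'm) jtheory \<Rightarrow> ('o, 'c, 'm) vfun \<Rightarrow>
   ('o, 'm) jtheory \<Rightarrow> ('o, 'c, 'm) vfun \<Rightarrow> ('o, 'o, 'm) vfun \<Rightarrow> ('o \<Rightarrow> 'm) \<Rightarrow> bool" where
  "algebra_morphism J C x T A U B M f \<longleftrightarrow>
     A \<in> algebras J T C \<and> FOb A \<I> = x \<and> B \<in> algebras J U C \<and> FOb B \<I> = x \<and>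
     theory_morphism J T U M \<and> vnatural_iso T C A (vcomp T B M) f \<and> f \<I> = VId C x"

definition commutes_with ::
  "'o set \<Rightarrow> ('c, 'o, 'm) cvcat \<Rightarrow> 'c \<Rightarrow> ('o, 'm) jtheory \<Rightarrow> ('o, 'c, 'm) vfun \<Rightarrow>
   ('o, 'm) jtheory \<Rightarrow> ('o, 'c, 'm) vfun \<Rightarrow> bool" where
  "commutes_with J C x T A U B \<longleftrightarrow>
     (\<exists>M f. algebra_morphism J C x U B (commutant_theory J T C A) (commutant_algebra J T C A) M f)"

section \<open>Commuting pairs and bifold algebras\<close>

definition Pair ::
  "'o set \<Rightarrow> ('o, 'm) jtheory \<Rightarrow> ('o, 'm) jtheory \<Rightarrow> ('c, 'o, 'm) cvcat
   \<Rightarrow> (('o, 'c, 'm) vfun \<times> ('o, 'c, 'm) vfun, 'o, 'm) vcat" where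
  "Pair J T U C = vpullback (Alg J T C) (Alg J U C) (alg_carrier J T C) (alg_carrier J U C)"

definition CPair ::
  "'o set \<Rightarrow> ('o, 'm) jtheory \<Rightarrow> ('o, 'm) jtheory \<Rightarrow> ('c, 'o, 'm) cvcat
   \<Rightarrow> (('o, 'c, 'm) vfun \<times> ('o, 'c, 'm) vfun, 'o, 'm) vcat" where
  "CPair J T U C = vfull (Pair J T U C) {(A, B). commutes_with J C (FOb A \<I>) T A U B}"

definition cpair_carrier ::
  "'o set \<Rightarrow> ('o, 'm) jtheory \<Rightarrow> ('o, 'm) jtheory \<Rightarrow> ('c, 'o, 'm) cvcat
   \<Rightarrow> (('o, 'c, 'm) vfun \<times> ('o, 'c, 'm) vfun, 'c, 'm) vfun" where
  "cpair_carrier J T U C = mk_vfun (VOb (CPair J T U C)) (\<lambda>(A, B). FOb A \<I>)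
     (\<lambda>(A, B) (A', B'). FHom (alg_carrier J T C) A A'
        \<cdot> pb_fst V (FHom (alg_carrier J T C) A A') (FHom (alg_carrier J U C) B B'))"

definition bifold_algebras ::
  "'o set \<Rightarrow> ('o, 'm) jtheory \<Rightarrow> ('o, 'm) jtheory \<Rightarrow> ('c, 'o, 'm) cvcat
   \<Rightarrow> ('o \<times> 'o, 'c, 'm) vfun set" where
  "bifold_algebras J T U C = {D. vfunctor (vtensor T U) C D \<and>
     (\<forall>u\<in>VOb U. preserves_cotensors J T C (fix_right T U D u)) \<and>
     (\<forall>t\<in>VOb T. preserves_cotensors J U C (fix_left T U D t))}"

definition BiAlg ::
  "'o set \<Rightarrow> ('o, 'm) jtheory \<Rightarrow> ('o, 'm) jtheory \<Rightarrow> ('c, 'o, 'm) cvcat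
   \<Rightarrow> (('o \<times> 'o, 'c, 'm) vfun, 'o, 'm) vcat" where
  "BiAlg J T U C = fun_cat (vtensor T U) C (bifold_algebras J T U C)"

definition bialg_carrier ::
  "'o set \<Rightarrow> ('o, 'm) jtheory \<Rightarrow> ('o, 'm) jtheory \<Rightarrow> ('c, 'o, 'm) cvcat
   \<Rightarrow> (('o \<times> 'o, 'c, 'm) vfun, 'c, 'm) vfun" where
  "bialg_carrier J T U C = evaluation (vtensor T U) C (bifold_algebras J T U C) (\<I>, \<I>)"

definition left_face ::
  "('o, 'm) jtheory \<Rightarrow> ('o, 'm) jtheory \<Rightarrow> ('o \<times> 'o, 'c, 'm) vfun \<Rightarrow> ('o, 'c, 'm) vfun" where
  "left_face T U D = fix_right T U D \<I>"

definition right_face ::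
  "('o, 'm) jtheory \<Rightarrow> ('o, 'm) jtheory \<Rightarrow> ('o \<times> 'o, 'c, 'm) vfun \<Rightarrow> ('o, 'c, 'm) vfun" where
  "right_face T U D = fix_left T U D \<I>"

end

end

(* By the exponential law, a bifold algebra D is a V-functor u |-> D(-,u) from U to T-Alg(C). It preserves
   cotensors, so D(-,u) is canonically isomorphic to [u, D_l]; transporting along these isomorphisms gives a
   morphism from U to the commutant theory of D_l, and this is the commutation of the two faces. Conversely, if
   M : U -> T_A^perp witnesses that A commutes with B, then (t,u) |-> [M u, A](t) is a bifold algebra with left
   face A and with right face isomorphic to B over the identity of the carrier.

   Since D'(t,u) is at the same time the cotensor [u, D'(t,I)] and [t, D'(I,u)], a transformation D -> D' is
   determined by its components at (t,I) and (I,u), and any pair of algebra morphisms between the faces that agree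
   at (I,I) extends to one. So the pullback of the hom-objects of the faces is an end for D and D', which gives
   both existence and full faithfulness; essential surjectivity holds by isomorphisms over the identity of the
   carrier, hence also in each fibre.

   The coherence isomorphisms of V are dealt with once and for all by a calculus of generalised elements, in which
   elements depend on disjoint finite contexts and composition in an enriched category is strictly associative. *)

theory Submission
  imports Defs
begin

text \<open>Two features of the definitions shape the argument. First,
  \<open>preserves_cotensors\<close> speaks of every cotensor existing in the domain, not of chosen
  ones. The way out is that an object \<open>u\<close> of a theory is itself a cotensor of
  \<open>\<I>\<close> by \<open>u\<close>, so any cotensor of \<open>x\<close> by \<open>j\<close>
  is isomorphic to \<open>j \<otimes> x\<close>; this is where closure of the arities under tensor
  products enters. Hence only the arrows from \<open>u\<close> to the hom-object of \<open>u\<close>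
  and \<open>\<I>\<close> have to be tested, and the commutant is presented by such arrows too.
  Second, the members of a pair must have equal carriers, and faces are compared by equality of
  functors. The normalisation of cotensors by \<open>\<I>\<close> makes the cotensor of an algebra
  by \<open>\<I>\<close> that algebra itself, which gives a strict left face, and every remaining
  isomorphism is kept over the identity of the carrier. Hom-objects of functor categories are ends
  picked by choice, so transformations are handled through their components, and the comparison of
  bifold algebras with pairs is pinned down on homs by components as well.\<close>

context category begin

lemmas typing_simps [simp] = Dom_Ob Cod_Ob Idn_Ar Dom_Idn Cod_Idn Cmp_Ar Dom_Cmp Cod_Cmp

lemma Idn_l [simp]: "\<lbrakk>f \<in> Ar C; Cod C f = b\<rbrakk> \<Longrightarrow> Idn C b \<cdot> f = f"
  using Idn_left by auto

lemma Idn_r [simp]: "\<lbrakk>f \<in> Ar C; Dom C f = b\<rbrakk> \<Longrightarrow> f \<cdot> Idn C b = f"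
  using Idn_right by auto

lemma inverse_unique: "\<lbrakk>inverse_arrows C f g; inverse_arrows C f h\<rbrakk> \<Longrightarrow> g = h"
proof -
  assume a: "inverse_arrows C f g" "inverse_arrows C f h"
  then have "g = g \<cdot> (f \<cdot> h)" by (auto simp: inverse_arrows_def in_hom_def)
  also have "\<dots> = (g \<cdot> f) \<cdot> h" using a by (subst Cmp_assoc) (auto simp: inverse_arrows_def in_hom_def)
  also have "\<dots> = h" using a by (auto simp: inverse_arrows_def in_hom_def)
  finally show ?thesis .
qed

lemma inv_arr: "is_iso C f \<Longrightarrow> inverse_arrows C f (inv_arr C f)"
  unfolding is_iso_def inv_arr_def by (metis inverse_unique theI)

lemma inv_arr_eq: "inverse_arrows C f g \<Longrightarrow> inv_arr C f = g"
  using inv_arr inverse_unique is_iso_def by metis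

lemma iso_Ar: "is_iso C f \<Longrightarrow> f \<in> Ar C"
  by (auto simp: is_iso_def inverse_arrows_def)

lemma inv_typ [simp]:
  assumes "is_iso C f"
  shows "inv_arr C f \<in> Ar C" "Dom C (inv_arr C f) = Cod C f" "Cod C (inv_arr C f) = Dom C f"
    "inv_arr C f \<cdot> f = Idn C (Dom C f)" "f \<cdot> inv_arr C f = Idn C (Cod C f)"
  using inv_arr[OF assms] by (auto simp: inverse_arrows_def in_hom_def)

lemma is_isoI: "\<lbrakk>f \<in> Ar C; g \<in> Ar C; Dom C g = Cod C f; Cod C g = Dom C f;
    g \<cdot> f = Idn C (Dom C f); f \<cdot> g = Idn C (Cod C f)\<rbrakk> \<Longrightarrow> is_iso C f"
  unfolding is_iso_def inverse_arrows_def in_hom_def by blast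

lemma inv_iso [simp]: "is_iso C f \<Longrightarrow> is_iso C (inv_arr C f)"
  by (rule is_isoI[of _ f]) (auto simp: iso_Ar)

lemma Idn_iso [simp]: "a \<in> Ob C \<Longrightarrow> is_iso C (Idn C a)"
  by (rule is_isoI[of _ "Idn C a"]) auto

lemma inv_cancel_l [simp]:
  "\<lbrakk>is_iso C f; g \<in> Ar C; Cod C g = Dom C f\<rbrakk> \<Longrightarrow> inv_arr C f \<cdot> (f \<cdot> g) = g"
  by (subst Cmp_assoc[symmetric]) (auto simp: iso_Ar)

lemma inv_cancel_l' [simp]:
  "\<lbrakk>is_iso C f; g \<in> Ar C; Cod C g = Cod C f\<rbrakk> \<Longrightarrow> f \<cdot> (inv_arr C f \<cdot> g) = g"
  by (subst Cmp_assoc[symmetric]) (auto simp: iso_Ar)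

lemma Cmp_iso [simp]: assumes "is_iso C f" "is_iso C g" "Dom C g = Cod C f"
  shows "is_iso C (g \<cdot> f)"
  by (rule is_isoI[of _ "inv_arr C f \<cdot> inv_arr C g"])
     (use assms in \<open>auto simp: iso_Ar Cmp_assoc\<close>)

lemma iso_epi: "\<lbrakk>is_iso C e; f \<in> Ar C; g \<in> Ar C; Dom C f = Cod C e; Dom C g = Cod C e; f \<cdot> e = g \<cdot> e\<rbrakk> \<Longrightarrow> f = g"
  by (metis Cmp_assoc Idn_right inv_typ(1,3,5) iso_Ar inv_typ(2))

lemma iso_mono: "\<lbrakk>is_iso C e; f \<in> Ar C; g \<in> Ar C; Cod C f = Dom C e; Cod C g = Dom C e; e \<cdot> f = e \<cdot> g\<rbrakk> \<Longrightarrow> f = g"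
  by (metis inv_cancel_l)

lemma inv_Cmp: "\<lbrakk>is_iso C f; is_iso C g; Dom C g = Cod C f\<rbrakk> \<Longrightarrow> inv_arr C (g \<cdot> f) = inv_arr C f \<cdot> inv_arr C g"
  by (rule inv_arr_eq) (auto simp: inverse_arrows_def in_hom_def iso_Ar Cmp_assoc)

lemma inv_solve: "\<lbrakk>e \<cdot> f = g; is_iso C e; f \<in> Ar C; Cod C f = Dom C e\<rbrakk> \<Longrightarrow> f = inv_arr C e \<cdot> g"
  by auto

end

section \<open>Contexts and generalised elements\<close>

text \<open>A name carries its type, so a fresh name of any prescribed type always exists. Sets
  rather than lists make the union of contexts strictly associative and commutative. An element
  records its context besides its arrow because different contexts may have the same
  denotation.\<close>

type_synonym 'o ctx = "(nat \<times> 'o) set"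
type_synonym ('o, 'm) el = "'o ctx \<times> 'm"
type_synonym ('c, 'o, 'm) gr = "'c \<times> 'c \<times> ('o, 'm) el"

context smcc begin

section \<open>Coherence of unit, associativity and symmetry\<close>

lemma Ten_typ [simp]:
  "\<lbrakk>f \<in> Ar V; g \<in> Ar V\<rbrakk> \<Longrightarrow> f \<odot> g \<in> Ar V"
  "\<lbrakk>f \<in> Ar V; g \<in> Ar V\<rbrakk> \<Longrightarrow> Dom V (f \<odot> g) = Dom V f \<otimes> Dom V g"
  "\<lbrakk>f \<in> Ar V; g \<in> Ar V\<rbrakk> \<Longrightarrow> Cod V (f \<odot> g) = Cod V f \<otimes> Cod V g"
  using TenA_hom[of f "Dom V f" "Cod V f" g "Dom V g" "Cod V g"] by (auto simp: in_hom_def)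

lemmas Obs [simp] = Unt_Ob Ten_Ob IHom_Ob

lemma str_typ [simp]:
  "\<lbrakk>a \<in> Ob V; b \<in> Ob V; c \<in> Ob V\<rbrakk> \<Longrightarrow> Asc V a b c \<in> Ar V"
  "\<lbrakk>a \<in> Ob V; b \<in> Ob V; c \<in> Ob V\<rbrakk> \<Longrightarrow> Dom V (Asc V a b c) = (a \<otimes> b) \<otimes> c"
  "\<lbrakk>a \<in> Ob V; b \<in> Ob V; c \<in> Ob V\<rbrakk> \<Longrightarrow> Cod V (Asc V a b c) = a \<otimes> (b \<otimes> c)"
  "\<lbrakk>a \<in> Ob V; b \<in> Ob V; c \<in> Ob V\<rbrakk> \<Longrightarrow> is_iso V (Asc V a b c)"
  "a \<in> Ob V \<Longrightarrow> Lun V a \<in> Ar V" "a \<in> Ob V \<Longrightarrow> Dom V (Lun V a) = \<I> \<otimes> a"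
  "a \<in> Ob V \<Longrightarrow> Cod V (Lun V a) = a" "a \<in> Ob V \<Longrightarrow> is_iso V (Lun V a)"
  "a \<in> Ob V \<Longrightarrow> Run V a \<in> Ar V" "a \<in> Ob V \<Longrightarrow> Dom V (Run V a) = a \<otimes> \<I>"
  "a \<in> Ob V \<Longrightarrow> Cod V (Run V a) = a" "a \<in> Ob V \<Longrightarrow> is_iso V (Run V a)"
  "\<lbrakk>a \<in> Ob V; b \<in> Ob V\<rbrakk> \<Longrightarrow> Sym V a b \<in> Ar V"
  "\<lbrakk>a \<in> Ob V; b \<in> Ob V\<rbrakk> \<Longrightarrow> Dom V (Sym V a b) = a \<otimes> b"
  "\<lbrakk>a \<in> Ob V; b \<in> Ob V\<rbrakk> \<Longrightarrow> Cod V (Sym V a b) = b \<otimes> a"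
  "\<lbrakk>a \<in> Ob V; b \<in> Ob V\<rbrakk> \<Longrightarrow> Ev V a b \<in> Ar V"
  "\<lbrakk>a \<in> Ob V; b \<in> Ob V\<rbrakk> \<Longrightarrow> Dom V (Ev V a b) = IHom V a b \<otimes> a"
  "\<lbrakk>a \<in> Ob V; b \<in> Ob V\<rbrakk> \<Longrightarrow> Cod V (Ev V a b) = b"
  using Asc_hom Asc_iso Lun_hom Lun_iso Run_hom Run_iso Sym_hom Ev_hom by (auto simp: in_hom_def)

lemma Sym_inv: "\<lbrakk>a \<in> Ob V; b \<in> Ob V\<rbrakk> \<Longrightarrow> inverse_arrows V (Sym V a b) (Sym V b a)"
  by (simp add: inverse_arrows_def in_hom_def Sym_Sym)

lemma Sym_iso [simp]: "\<lbrakk>a \<in> Ob V; b \<in> Ob V\<rbrakk> \<Longrightarrow> is_iso V (Sym V a b)"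
  and inv_Sym [simp]: "\<lbrakk>a \<in> Ob V; b \<in> Ob V\<rbrakk> \<Longrightarrow> inv_arr V (Sym V a b) = Sym V b a"
  using Sym_inv is_iso_def inv_arr_eq by metis+

lemma Ten_Cmp:
  "\<lbrakk>f \<in> Ar V; g \<in> Ar V; f' \<in> Ar V; g' \<in> Ar V; Dom V g = Cod V f; Dom V g' = Cod V f'\<rbrakk>
   \<Longrightarrow> (g \<odot> g') \<cdot> (f \<odot> f') = (g \<cdot> f) \<odot> (g' \<cdot> f')"
  by (rule TenA_Cmp[symmetric]) (auto simp: in_hom_def)

lemma Ten_Cmp_assoc:
  "\<lbrakk>f \<in> Ar V; g \<in> Ar V; f' \<in> Ar V; g' \<in> Ar V; h \<in> Ar V; Dom V g = Cod V f; Dom V g' = Cod V f';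
    Cod V h = Dom V f \<otimes> Dom V f'\<rbrakk>
   \<Longrightarrow> (g \<odot> g') \<cdot> ((f \<odot> f') \<cdot> h) = ((g \<cdot> f) \<odot> (g' \<cdot> f')) \<cdot> h"
  by (subst Cmp_assoc[symmetric]) (auto simp: Ten_Cmp)

lemmas TenA_Idn' [simp] = TenA_Idn

lemma Ten_inv: "\<lbrakk>is_iso V f; is_iso V g\<rbrakk> \<Longrightarrow> inverse_arrows V (f \<odot> g) (inv_arr V f \<odot> inv_arr V g)"
  by (auto simp: inverse_arrows_def in_hom_def iso_Ar Ten_Cmp)

lemma Ten_iso [simp]: "\<lbrakk>is_iso V f; is_iso V g\<rbrakk> \<Longrightarrow> is_iso V (f \<odot> g)"
  using Ten_inv is_iso_def by metis

lemma Sym_nat: "\<lbrakk>f \<in> Ar V; g \<in> Ar V; Dom V f = a; Dom V g = b; Cod V f = c; Cod V g = d\<rbrakk>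
   \<Longrightarrow> Sym V c d \<cdot> (f \<odot> g) = (g \<odot> f) \<cdot> Sym V a b"
  by (rule Sym_natural) (auto simp: in_hom_def)

lemma Asc_nat: "\<lbrakk>f \<in> Ar V; g \<in> Ar V; h \<in> Ar V; Dom V f = a; Dom V g = b; Dom V h = c;
    Cod V f = a'; Cod V g = b'; Cod V h = c'\<rbrakk>
   \<Longrightarrow> Asc V a' b' c' \<cdot> ((f \<odot> g) \<odot> h) = (f \<odot> (g \<odot> h)) \<cdot> Asc V a b c"
  by (rule Asc_natural) (auto simp: in_hom_def)

lemma Asc_inv_nat: assumes "f \<in> Ar V" "g \<in> Ar V" "h \<in> Ar V" "Dom V f = a" "Dom V g = b" "Dom V h = c"
    "Cod V f = a'" "Cod V g = b'" "Cod V h = c'"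
  shows "inv_arr V (Asc V a' b' c') \<cdot> (f \<odot> (g \<odot> h)) = ((f \<odot> g) \<odot> h) \<cdot> inv_arr V (Asc V a b c)"
proof -
  have [simp]: "a \<in> Ob V" "b \<in> Ob V" "c \<in> Ob V" "a' \<in> Ob V" "b' \<in> Ob V" "c' \<in> Ob V"
    using assms by auto
  have "Asc V a' b' c' \<cdot> (((f \<odot> g) \<odot> h) \<cdot> inv_arr V (Asc V a b c)) = f \<odot> (g \<odot> h)"
    using assms by (subst Cmp_assoc[symmetric]) (simp_all add: Asc_nat Cmp_assoc)
  from this[symmetric] show ?thesis using assms by simp
qed

lemma Run_nat: "\<lbrakk>f \<in> Ar V; Dom V f = a; Cod V f = b\<rbrakk> \<Longrightarrow> Run V b \<cdot> (f \<odot> Idn V \<I>) = f \<cdot> Run V a"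
  by (rule Run_natural) (auto simp: in_hom_def)

lemma Lun_nat: "\<lbrakk>f \<in> Ar V; Dom V f = a; Cod V f = b\<rbrakk> \<Longrightarrow> Lun V b \<cdot> (Idn V \<I> \<odot> f) = f \<cdot> Lun V a"
  by (rule Lun_natural) (auto simp: in_hom_def)

text \<open>The unitors are natural and invertible, so tensoring with \<open>\<I>\<close> is
  faithful. The classical unit identities below are therefore proved after tensoring with
  \<open>\<I>\<close>.\<close>

lemma Ten_I_faithful:
  assumes "f \<in> Ar V" "g \<in> Ar V" "Dom V f = Dom V g" "Cod V f = Cod V g"
  shows "f \<odot> Idn V \<I> = g \<odot> Idn V \<I> \<Longrightarrow> f = g" "Idn V \<I> \<odot> f = Idn V \<I> \<odot> g \<Longrightarrow> f = g"
proof -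
  show "f = g" if "f \<odot> Idn V \<I> = g \<odot> Idn V \<I>"
    by (rule iso_epi[of "Run V (Dom V f)"]) (use assms that in \<open>auto simp: Run_nat[symmetric]\<close>)
  show "f = g" if "Idn V \<I> \<odot> f = Idn V \<I> \<odot> g"
    by (rule iso_epi[of "Lun V (Dom V f)"]) (use assms that in \<open>auto simp: Lun_nat[symmetric]\<close>)
qed

text \<open>A classical consequence of pentagon and triangle: after tensoring with
  \<open>\<I>\<close> both sides become comparable through the pentagon at \<open>a\<close>,
  \<open>b\<close>, \<open>\<I>\<close>, \<open>\<I>\<close>.\<close>

lemma Run_Ten: assumes [simp]: "a \<in> Ob V" "b \<in> Ob V"
  shows "(Idn V a \<odot> Run V b) \<cdot> Asc V a b \<I> = Run V (a \<otimes> b)"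
proof (rule Ten_I_faithful(1))
  let ?i = "Idn V \<I>"
  have "Asc V a b \<I> \<cdot> (((Idn V a \<odot> Run V b) \<cdot> Asc V a b \<I>) \<odot> ?i)
    = Asc V a b \<I> \<cdot> (((Idn V a \<odot> Run V b) \<odot> ?i) \<cdot> (Asc V a b \<I> \<odot> ?i))"
    by (simp add: Ten_Cmp)
  also have "\<dots> = ((Idn V a \<odot> (Run V b \<odot> ?i)) \<cdot> Asc V a (b \<otimes> \<I>) \<I>) \<cdot> (Asc V a b \<I> \<odot> ?i)"
    by (subst Cmp_assoc[symmetric]) (auto simp: Asc_nat)
  also have "\<dots> = (Idn V a \<odot> ((Idn V b \<odot> Lun V \<I>) \<cdot> Asc V b \<I> \<I>)) \<cdot> Asc V a (b \<otimes> \<I>) \<I> \<cdot> (Asc V a b \<I> \<odot> ?i)"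
    by (simp add: triangle Cmp_assoc)
  also have "\<dots> = (Idn V a \<odot> (Idn V b \<odot> Lun V \<I>)) \<cdot> (Idn V a \<odot> Asc V b \<I> \<I>) \<cdot> Asc V a (b \<otimes> \<I>) \<I> \<cdot> (Asc V a b \<I> \<odot> ?i)"
    by (simp add: Ten_Cmp_assoc)
  also have "\<dots> = (Idn V a \<odot> (Idn V b \<odot> Lun V \<I>)) \<cdot> Asc V a b (\<I> \<otimes> \<I>) \<cdot> Asc V (a \<otimes> b) \<I> \<I>"
    by (simp add: pentagon)
  also have "\<dots> = Asc V a b \<I> \<cdot> (Idn V (a \<otimes> b) \<odot> Lun V \<I>) \<cdot> Asc V (a \<otimes> b) \<I> \<I>"
    by (subst Cmp_assoc[symmetric], simp_all add: Asc_nat[symmetric]) (simp add: Cmp_assoc)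
  also have "\<dots> = Asc V a b \<I> \<cdot> (Run V (a \<otimes> b) \<odot> ?i)" by (simp add: triangle)
  finally show "((Idn V a \<odot> Run V b) \<cdot> Asc V a b \<I>) \<odot> ?i = Run V (a \<otimes> b) \<odot> ?i"
    by (rule iso_mono[rotated -1]) auto
qed auto

text \<open>The hexagon with two unit objects, followed by the left unitor, collapses by the
  triangle and \<open>Run_Ten\<close>; cancelling the invertible \<open>?X\<close> leaves the claim
  tensored with \<open>\<I>\<close>.\<close>

lemma Lun_Sym: assumes [simp]: "a \<in> Ob V" shows "Lun V a \<cdot> Sym V a \<I> = Run V a"
proof (rule Ten_I_faithful(2))
  let ?i = "Idn V \<I>" and ?X = "Asc V \<I> a \<I> \<cdot> (Sym V a \<I> \<odot> Idn V \<I>)"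
  have "(?i \<odot> (Lun V a \<cdot> Sym V a \<I>)) \<cdot> ?X = (?i \<odot> Lun V a) \<cdot> ((?i \<odot> Sym V a \<I>) \<cdot> ?X)"
    by (simp add: Ten_Cmp_assoc)
  also have "\<dots> = ((?i \<odot> Lun V a) \<cdot> Asc V \<I> \<I> a) \<cdot> Sym V a (\<I> \<otimes> \<I>) \<cdot> Asc V a \<I> \<I>"
    using hexagon[of a \<I> \<I>] by (simp add: Cmp_assoc)
  also have "\<dots> = (Run V \<I> \<odot> Idn V a) \<cdot> Sym V a (\<I> \<otimes> \<I>) \<cdot> Asc V a \<I> \<I>"
    by (simp add: triangle)
  also have "\<dots> = Sym V a \<I> \<cdot> (Idn V a \<odot> Run V \<I>) \<cdot> Asc V a \<I> \<I>"
    by (subst (1 2) Cmp_assoc[symmetric]) (simp_all add: Sym_nat)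
  also have "\<dots> = Run V (\<I> \<otimes> a) \<cdot> (Sym V a \<I> \<odot> ?i)"
    by (simp add: Run_Ten Run_nat)
  also have "\<dots> = (?i \<odot> Run V a) \<cdot> ?X"
    by (simp add: Run_Ten[symmetric] Cmp_assoc)
  finally show "?i \<odot> (Lun V a \<cdot> Sym V a \<I>) = ?i \<odot> Run V a"
    by (rule iso_epi[rotated -1]) auto
qed auto

text \<open>Naturality of \<open>Run\<close> at \<open>Run V \<I>\<close> itself computes
  \<open>Run V (\<I> \<otimes> \<I>)\<close>; the triangle and \<open>Run_Ten\<close> then express
  the result with either unitor in the second factor.\<close>

lemma Lun_Run: "Lun V \<I> = Run V \<I>"
proof (rule Ten_I_faithful(2))
  have "Run V (\<I> \<otimes> \<I>) = Run V \<I> \<odot> Idn V \<I>"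
    by (rule iso_mono[of "Run V \<I>"]) (auto simp: Run_nat)
  then have "(Idn V \<I> \<odot> Lun V \<I>) \<cdot> Asc V \<I> \<I> \<I> = (Idn V \<I> \<odot> Run V \<I>) \<cdot> Asc V \<I> \<I> \<I>"
    by (simp add: triangle Run_Ten)
  then show "Idn V \<I> \<odot> Lun V \<I> = Idn V \<I> \<odot> Run V \<I>"
    by (rule iso_epi[rotated -1]) auto
qed auto

lemma Sym_I: "Sym V \<I> \<I> = Idn V (\<I> \<otimes> \<I>)"
proof (rule iso_mono[of "Lun V \<I>"])
  show "Lun V \<I> \<cdot> Sym V \<I> \<I> = Lun V \<I> \<cdot> Idn V (\<I> \<otimes> \<I>)"
    by (simp add: Lun_Sym) (simp add: Lun_Run)
qed auto

text \<open>The hexagon solved for the exchange of the first two factors of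
  \<open>a \<otimes> (b \<otimes> c)\<close>. Associativity of shuffles uses it when the least name
  lies in the middle context.\<close>

lemma middle_swap:
  assumes [simp]: "a \<in> Ob V" "b \<in> Ob V" "c \<in> Ob V"
  shows "Asc V b a c \<cdot> (Sym V a b \<odot> Idn V c) \<cdot> inv_arr V (Asc V a b c)
    = Sym V (a \<otimes> c) b \<cdot> inv_arr V (Asc V a c b) \<cdot> (Idn V a \<odot> Sym V b c)"
proof -
  let ?L = "Asc V b a c \<cdot> (Sym V a b \<odot> Idn V c) \<cdot> inv_arr V (Asc V a b c)"
  have "Asc V a c b \<cdot> Sym V b (a \<otimes> c) \<cdot> ?L
    = (Asc V a c b \<cdot> Sym V b (a \<otimes> c) \<cdot> Asc V b a c) \<cdot> (Sym V a b \<odot> Idn V c) \<cdot> inv_arr V (Asc V a b c)"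
    by (simp add: Cmp_assoc)
  also have "\<dots> = Idn V a \<odot> Sym V b c"
    by (simp add: hexagon Cmp_assoc Ten_Cmp_assoc Sym_Sym)
  finally have *: "Asc V a c b \<cdot> Sym V b (a \<otimes> c) \<cdot> ?L = Idn V a \<odot> Sym V b c" .
  have "Sym V (a \<otimes> c) b \<cdot> (Sym V b (a \<otimes> c) \<cdot> ?L) = ?L"
    by (subst Cmp_assoc[symmetric]) (simp_all add: Sym_Sym)
  then show ?thesis by (simp flip: *)
qed

text \<open>Two ways of reversing three factors, exchanging an inner pair on either side of the
  associator, agree by the hexagon and \<open>middle_swap\<close>. This serves for a least name in
  the last context.\<close>

lemma reverse_coherence:
  assumes [simp]: "a \<in> Ob V" "b \<in> Ob V" "c \<in> Ob V"
  shows "Asc V a b c \<cdot> Sym V c (a \<otimes> b) \<cdot> (Idn V c \<odot> Sym V b a) \<cdot> Asc V c b a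
    = Sym V (b \<otimes> c) a \<cdot> (Sym V c b \<odot> Idn V a)"
proof -
  have "Asc V a b c \<cdot> Sym V c (a \<otimes> b)
    = (Asc V a b c \<cdot> Sym V c (a \<otimes> b) \<cdot> Asc V c a b) \<cdot> inv_arr V (Asc V c a b)"
    by (simp add: Cmp_assoc)
  also have "\<dots> = (Idn V a \<odot> Sym V c b) \<cdot> Asc V a c b \<cdot> (Sym V c a \<odot> Idn V b) \<cdot> inv_arr V (Asc V c a b)"
    by (simp add: hexagon Cmp_assoc)
  also have "\<dots> = (Idn V a \<odot> Sym V c b) \<cdot> Sym V (c \<otimes> b) a \<cdot> inv_arr V (Asc V c b a) \<cdot> (Idn V c \<odot> Sym V a b)"
    by (simp add: middle_swap)
  finally have "Asc V a b c \<cdot> Sym V c (a \<otimes> b) \<cdot> (Idn V c \<odot> Sym V b a) \<cdot> Asc V c b a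
    = ((Idn V a \<odot> Sym V c b) \<cdot> Sym V (c \<otimes> b) a \<cdot> inv_arr V (Asc V c b a) \<cdot> (Idn V c \<odot> Sym V a b))
       \<cdot> (Idn V c \<odot> Sym V b a) \<cdot> Asc V c b a"
    by (simp flip: Cmp_assoc)
  also have "\<dots> = (Idn V a \<odot> Sym V c b) \<cdot> Sym V (c \<otimes> b) a"
    by (simp add: Cmp_assoc Ten_Cmp_assoc Sym_Sym)
  finally show ?thesis by (simp add: Sym_nat)
qed

section \<open>Ordered contexts, their denotations and shuffles\<close>

text \<open>The objects form an unstructured type, so an order on names is taken from the
  well-ordering theorem. Its only task is to single out one bracketed product for each finite
  context.\<close>

definition name_order :: "(nat \<times> 'o) rel" where
  "name_order = (SOME r. well_order_on UNIV r)"

lemma name_order: "well_order_on UNIV (name_order :: (nat \<times> 'o) rel)"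
  unfolding name_order_def using someI_ex[OF well_order_on] .

definition below :: "nat \<times> 'o \<Rightarrow> 'o ctx \<Rightarrow> bool" where
  "below x S \<longleftrightarrow> x \<notin> S \<and> (\<forall>y\<in>S. (x, y) \<in> name_order)"

definition least :: "'o ctx \<Rightarrow> nat \<times> 'o" where
  "least S = (THE x. x \<in> S \<and> below x (S - {x}))"

lemma ex_least:
  assumes "S \<noteq> {}" shows "\<exists>x. x \<in> S \<and> below x (S - {x})"
proof -
  have "wf (name_order - Id :: (nat \<times> 'o) rel)" "total (name_order :: (nat \<times> 'o) rel)"
    using name_order by (auto simp: well_order_on_def linear_order_on_def)
  then obtain x where x: "x \<in> S" "\<And>y. (y, x) \<in> name_order - Id \<Longrightarrow> y \<notin> S"
    using assms wfE_min' by metis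
  then have "\<forall>y\<in>S - {x}. (x, y) \<in> name_order"
    using \<open>total name_order\<close> unfolding total_on_def by blast
  with x show ?thesis unfolding below_def by blast
qed

lemma below_unique:
  assumes "x \<in> S" "below x (S - {x})" "y \<in> S" "below y (S - {y})" shows "x = y"
proof -
  have "antisym (name_order :: (nat \<times> 'o) rel)"
    using name_order by (auto simp: well_order_on_def linear_order_on_def partial_order_on_def)
  moreover have "x \<noteq> y \<Longrightarrow> (x, y) \<in> name_order \<and> (y, x) \<in> name_order"
    using assms unfolding below_def by blast
  ultimately show ?thesis by (meson antisymD)
qed

lemma least: assumes "S \<noteq> {}" shows "least S \<in> S" "below (least S) (S - {least S})"
proof -
  have "\<exists>!x. x \<in> S \<and> below x (S - {x})" using ex_least[OF assms] below_unique by blast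
  from theI'[OF this] show "least S \<in> S" "below (least S) (S - {least S})"
    unfolding least_def by simp_all
qed

lemma least_insert: assumes "below x S" shows "least (insert x S) = x"
proof (rule below_unique)
  show "below x (insert x S - {x})" using assms by (simp add: below_def)
qed (use least[of "insert x S"] in simp_all)

text \<open>The inserted name lies below all those already present, so that \<open>den\<close> and
  \<open>mrg\<close> unfold at their head.\<close>

lemma ctx_induct [consumes 1, case_names empty insert]:
  assumes "finite S" "P {}" "\<And>x S. \<lbrakk>finite S; below x S; P S\<rbrakk> \<Longrightarrow> P (insert x S)"
  shows "P S"
  using assms(1)
proof (induction S rule: finite_remove_induct)
  case (remove A)
  have "P (insert (least A) (A - {least A}))"
    by (rule assms(3)) (use remove least in \<open>blast+\<close>)
  then show ?case using least(1)[of A] remove(2) by (simp add: insert_absorb)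
qed (rule assms(2))

text \<open>Contexts are finite sets of typed names; \<open>den\<close> is their tensor product, taken in the order of
  an arbitrary well-ordering, and \<open>mrg\<close> is the canonical (shuffle) isomorphism.\<close>

primrec den_rec :: "nat \<Rightarrow> 'o ctx \<Rightarrow> 'o" where
  "den_rec 0 S = \<I>"
| "den_rec (Suc n) S = snd (least S) \<otimes> den_rec n (S - {least S})"

definition den :: "'o ctx \<Rightarrow> 'o" where
  "den S = den_rec (card S) S"

primrec mrg_rec :: "nat \<Rightarrow> 'o ctx \<Rightarrow> 'o ctx \<Rightarrow> 'm" where
  "mrg_rec 0 S R = inv_arr V (Lun V \<I>)"
| "mrg_rec (Suc n) S R = (let x = least (S \<union> R) in
     if x \<in> S then inv_arr V (Asc V (snd x) (den (S - {x})) (den R)) \<cdot> (Idn V (snd x) \<odot> mrg_rec n (S - {x}) R)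
     else Sym V (den R) (den S) \<cdot> inv_arr V (Asc V (snd x) (den (R - {x})) (den S))
        \<cdot> (Idn V (snd x) \<odot> mrg_rec n (R - {x}) S))"

definition mrg :: "'o ctx \<Rightarrow> 'o ctx \<Rightarrow> 'm" where
  "mrg S R = mrg_rec (card S + card R) S R"

lemma den_empty [simp]: "den {} = \<I>"
  by (simp add: den_def)

lemma den_insert: assumes "finite S" "below x S" shows "den (insert x S) = snd x \<otimes> den S"
proof -
  have "x \<notin> S" using assms by (simp add: below_def)
  with assms show ?thesis by (simp add: den_def least_insert)
qed

lemma mrg_empty: "mrg {} {} = inv_arr V (Lun V \<I>)"
  by (simp add: mrg_def)

lemma mrg_left: "\<lbrakk>finite (S \<union> R); below x (S \<union> R)\<rbrakk> \<Longrightarrow> mrg (insert x S) R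
   = inv_arr V (Asc V (snd x) (den S) (den R)) \<cdot> (Idn V (snd x) \<odot> mrg S R)"
proof -
  assume *: "finite (S \<union> R)" "below x (S \<union> R)"
  then have 1: "card (insert x S) + card R = Suc (card S + card R)" "least (insert x S \<union> R) = x"
    "insert x S - {x} = S"
    by (simp_all add: below_def card_insert_if least_insert)
  show ?thesis unfolding mrg_def 1 mrg_rec.simps Let_def by (simp add: 1)
qed

text \<open>A least name on the right is handled in \<open>mrg_rec\<close> by exchanging the
  contexts and swapping back, so this recursion equation is an instance of the symmetry proved
  below.\<close>

lemma mrg_right: "\<lbrakk>finite (S \<union> R); below x (S \<union> R)\<rbrakk> \<Longrightarrow> mrg S (insert x R)
   = Sym V (den (insert x R)) (den S) \<cdot> mrg (insert x R) S"
proof -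
  assume *: "finite (S \<union> R)" "below x (S \<union> R)"
  then have 1: "card S + card (insert x R) = Suc (card R + card S)" "least (S \<union> insert x R) = x"
    "insert x R - {x} = R" "x \<notin> S"
    by (simp_all add: below_def card_insert_if least_insert)
  have 2: "mrg (insert x R) S = inv_arr V (Asc V (snd x) (den R) (den S)) \<cdot> (Idn V (snd x) \<odot> mrg R S)"
    using * by (intro mrg_left) (simp_all add: Un_commute)
  show ?thesis unfolding 2 unfolding mrg_def 1 mrg_rec.simps Let_def by (simp add: 1)
qed

definition okctx :: "'o ctx \<Rightarrow> bool" where
  "okctx S \<longleftrightarrow> finite S \<and> snd ` S \<subseteq> Ob V"

lemma okctx_simps [simp]: "okctx {}" "okctx (insert x S) \<longleftrightarrow> snd x \<in> Ob V \<and> okctx S"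
  "okctx (S \<union> R) \<longleftrightarrow> okctx S \<and> okctx R"
  by (auto simp: okctx_def)

lemma okctx_finite: "okctx S \<Longrightarrow> finite S"
  by (simp add: okctx_def)

lemma okctx_induct [consumes 1, case_names empty insert]:
  assumes "okctx S" "P {}" "\<And>x S. \<lbrakk>snd x \<in> Ob V; okctx S; below x S; P S\<rbrakk> \<Longrightarrow> P (insert x S)"
  shows "P S"
  using okctx_finite[OF assms(1)] assms(1)
  by (induction rule: ctx_induct) (auto intro!: assms)

lemma den_Ob [simp]: "okctx S \<Longrightarrow> den S \<in> Ob V"
  by (induction rule: okctx_induct) (auto simp: den_insert okctx_finite)

lemma below_Un: "below x (S \<union> R) \<longleftrightarrow> below x S \<and> below x R"
  by (auto simp: below_def)

lemma below_notin: "below x S \<Longrightarrow> x \<notin> S"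
  by (auto simp: below_def)

lemma insert_split:
  assumes "S \<union> R = insert x U" "x \<notin> U" "S \<inter> R = {}"
  obtains S' where "S = insert x S'" "x \<notin> S'" "S' \<union> R = U" "S' \<inter> R = {}"
  | R' where "R = insert x R'" "x \<notin> R'" "S \<union> R' = U" "S \<inter> R' = {}"
proof (cases "x \<in> S")
  case True
  then have "x \<notin> R" using assms(3) by blast
  then have "S - {x} \<union> R = (S \<union> R) - {x}" by auto
  also have "\<dots> = U" using assms(1,2) by simp
  finally show thesis using that(1)[of "S - {x}"] assms(3) True by (simp add: insert_absorb Diff_Int_distrib2)
next
  case False
  then have "x \<in> R" using assms(1) by blast
  from False have "S \<union> (R - {x}) = (S \<union> R) - {x}" by auto
  also have "\<dots> = U" using assms(1,2) by simp
  finally show thesis using that(2)[of "R - {x}"] assms(3) \<open>x \<in> R\<close> by (simp add: insert_absorb Diff_Int_distrib)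
qed

text \<open>The induction runs over the union \<open>U\<close> with its splitting left arbitrary,
  because \<open>mrg_right\<close> reduces a least name in \<open>R\<close> to one on the left and
  thereby swaps the two contexts.\<close>

lemma mrg_typing_aux:
  assumes "okctx U" "S \<union> R = U" "S \<inter> R = {}"
  shows "mrg S R \<in> Ar V \<and> Dom V (mrg S R) = den U \<and> Cod V (mrg S R) = den S \<otimes> den R \<and> is_iso V (mrg S R)"
  using assms
proof (induction U arbitrary: S R rule: okctx_induct)
  case empty
  then show ?case by (simp add: mrg_empty)
next
  case (insert x U)
  have fin: "finite U" using insert.hyps okctx_finite by blast
  have left: "mrg (insert x A) B \<in> Ar V \<and> Dom V (mrg (insert x A) B) = den (insert x U)
      \<and> Cod V (mrg (insert x A) B) = den (insert x A) \<otimes> den B \<and> is_iso V (mrg (insert x A) B)"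
    if *: "A \<union> B = U" "A \<inter> B = {}" for A B
  proof -
    have **: "mrg A B \<in> Ar V \<and> Dom V (mrg A B) = den U \<and> Cod V (mrg A B) = den A \<otimes> den B \<and> is_iso V (mrg A B)"
      using insert.IH[OF *] .
    have "okctx (A \<union> B)" "below x (A \<union> B)" using insert.hyps(2,3) *(1) by simp_all
    then have ok: "okctx A" "okctx B" "below x (A \<union> B)" "below x A" "finite A" "finite B"
      using okctx_finite by (auto simp: below_Un)
    show ?thesis unfolding mrg_left[OF finite_UnI[OF ok(5,6)] ok(3)]
      using ** insert.hyps(1,2,3) fin ok(1,2,4,5) by (simp add: den_insert)
  qed
  have "x \<notin> U" using insert.hyps below_notin by blast
  from insert.prems(1) this insert.prems(2) show ?case
  proof (cases rule: insert_split)
    case (1 S')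
    then show ?thesis using left by simp
  next
    case (2 R')
    have **: "R' \<union> S = U" "R' \<inter> S = {}" using 2(3,4) by (simp_all add: Un_commute Int_commute)
    have "okctx (S \<union> R')" and b: "below x (S \<union> R')" using insert.hyps(2,3) 2(3) by simp_all
    then have ok: "okctx S" "okctx R'" "finite (S \<union> R')"
      using okctx_finite by simp_all
    then have r: "mrg S R = Sym V (den R) (den S) \<cdot> mrg R S"
      using mrg_right[OF ok(3) b] 2(1) by simp
    have "den R \<in> Ob V" "den S \<in> Ob V" using ok 2(1) insert.hyps(1) by auto
    then show ?thesis using left[OF **] 2(1) unfolding r by simp
  qed
qed

lemma mrg_typing [simp]:
  assumes "okctx S" "okctx R" "S \<inter> R = {}"
  shows "mrg S R \<in> Ar V" "Dom V (mrg S R) = den (S \<union> R)" "Cod V (mrg S R) = den S \<otimes> den R"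
    "is_iso V (mrg S R)"
  using mrg_typing_aux[of "S \<union> R" S R] assms by auto

text \<open>If the least name lies in \<open>S\<close>, the claim is the recursion equation for
  \<open>mrg R S\<close>; otherwise it is the one for \<open>mrg S R\<close>, composed with the
  other symmetry. Two empty contexts leave \<open>Sym_I\<close>.\<close>

lemma mrg_sym:
  assumes "okctx S" "okctx R" "S \<inter> R = {}"
  shows "Sym V (den S) (den R) \<cdot> mrg S R = mrg R S"
proof (cases "S \<union> R = {}")
  case True
  then show ?thesis by (simp add: mrg_empty Sym_I)
next
  case False
  let ?x = "least (S \<union> R)" let ?U = "S \<union> R - {?x}"
  have x: "?x \<in> S \<union> R" "below ?x ?U" using least[OF False] by auto
  have "S \<union> R = insert ?x ?U" "?x \<notin> ?U" using x(1) by blast+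
  from this assms(3) show ?thesis
  proof (cases rule: insert_split)
    case (1 S')
    have "mrg R (insert ?x S') = Sym V (den (insert ?x S')) (den R) \<cdot> mrg (insert ?x S') R"
    proof (rule mrg_right)
      show "below ?x (R \<union> S')" using x(2) 1(3) by (simp add: Un_commute)
      have "finite S" "finite R" using assms okctx_finite by auto
      then show "finite (R \<union> S')" using 1(1) finite_subset[of S' S] by blast
    qed
    then show ?thesis using 1(1) by metis
  next
    case (2 R')
    have "mrg S (insert ?x R') = Sym V (den (insert ?x R')) (den S) \<cdot> mrg (insert ?x R') S"
    proof (rule mrg_right)
      show "below ?x (S \<union> R')" using x(2) 2(3) by simp
      have "finite S" "finite R" using assms okctx_finite by auto
      then show "finite (S \<union> R')" using 2(1) finite_subset[of R' R] by blast
    qed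
    then have "mrg S R = Sym V (den R) (den S) \<cdot> mrg R S" using 2(1) by metis
    moreover have "R \<inter> S = {}" using assms by blast
    ultimately show ?thesis using assms
      by (simp flip: Cmp_assoc add: Sym_Sym Un_commute)
  qed
qed

text \<open>\<open>Run_Ten\<close>, inverted, is the recursion that \<open>mrg\<close> satisfies
  when its right context is empty; the base case uses that the two unitors agree at
  \<open>\<I>\<close>.\<close>

lemma mrg_empty_right: "okctx S \<Longrightarrow> mrg S {} = inv_arr V (Run V (den S))"
proof (induction S rule: okctx_induct)
  case empty
  then show ?case by (simp add: mrg_empty Lun_Run)
next
  case (insert x S)
  let ?a = "snd x" and ?b = "den S"
  have fin: "finite S" using insert.hyps okctx_finite by blast
  have "(Idn V ?a \<odot> Run V ?b) \<cdot> Asc V ?a ?b \<I> = Run V (?a \<otimes> ?b)"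
    using insert.hyps by (simp add: Run_Ten)
  then have "inv_arr V (Run V (?a \<otimes> ?b)) = inv_arr V (Asc V ?a ?b \<I>) \<cdot> (Idn V ?a \<odot> inv_arr V (Run V ?b))"
    using insert.hyps inv_arr_eq[OF Ten_inv[of "Idn V ?a" "Run V ?b"]]
      inv_arr_eq[of "Idn V ?a" "Idn V ?a"]
    by (subst (asm) eq_commute) (simp add: inv_Cmp inverse_arrows_def in_hom_def)
  then show ?case using insert fin by (simp add: mrg_left den_insert)
qed

text \<open>The equation is named so that each position of the least name can be treated by its own
  lemma, relating different orders of the same three contexts.\<close>

definition mrg_assoc_at where
  "mrg_assoc_at S R Q \<longleftrightarrow> Asc V (den S) (den R) (den Q) \<cdot> (mrg S R \<odot> Idn V (den Q)) \<cdot> mrg (S \<union> R) Q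
    = (Idn V (den S) \<odot> mrg R Q) \<cdot> mrg S (R \<union> Q)"

text \<open>Naturality of the associator together with the pentagon, solved for the inverse
  associators that \<open>mrg_left\<close> introduces (\<open>pent\<close>), pulls the least name
  \<open>x\<close> out of both sides.\<close>

lemma mrg_assoc_left:
  assumes "okctx S" "okctx R" "okctx Q" "S \<inter> R = {}" "S \<inter> Q = {}" "R \<inter> Q = {}" "snd x \<in> Ob V"
    "below x (S \<union> R \<union> Q)" "mrg_assoc_at S R Q"
  shows "mrg_assoc_at (insert x S) R Q"
proof -
  let ?a = "snd x" and ?s = "den S" and ?r = "den R" and ?q = "den Q"
  have ob [simp]: "?a \<in> Ob V" "?s \<in> Ob V" "?r \<in> Ob V" "?q \<in> Ob V" using assms by auto
  have fin: "finite S" "finite R" "finite Q" using assms okctx_finite by auto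
  have d: "(S \<union> R) \<inter> Q = {}" "S \<inter> (R \<union> Q) = {}" using assms by auto
  have pent: "Asc V (?a \<otimes> ?s) ?r ?q \<cdot> (inv_arr V (Asc V ?a ?s ?r) \<odot> Idn V ?q) \<cdot> inv_arr V (Asc V ?a (?s \<otimes> ?r) ?q)
     = inv_arr V (Asc V ?a ?s (?r \<otimes> ?q)) \<cdot> (Idn V ?a \<odot> Asc V ?s ?r ?q)"
  proof -
    have "Asc V ?a ?s (?r \<otimes> ?q) \<cdot> (Asc V (?a \<otimes> ?s) ?r ?q \<cdot> (inv_arr V (Asc V ?a ?s ?r) \<odot> Idn V ?q) \<cdot> inv_arr V (Asc V ?a (?s \<otimes> ?r) ?q))
      = (Asc V ?a ?s (?r \<otimes> ?q) \<cdot> Asc V (?a \<otimes> ?s) ?r ?q) \<cdot> (inv_arr V (Asc V ?a ?s ?r) \<odot> Idn V ?q) \<cdot> inv_arr V (Asc V ?a (?s \<otimes> ?r) ?q)"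
      by (simp add: Cmp_assoc)
    also have "\<dots> = Idn V ?a \<odot> Asc V ?s ?r ?q"
      by (simp flip: pentagon add: Cmp_assoc Ten_Cmp_assoc)
    finally show ?thesis by (rule inv_solve) (simp_all add: iso_Ar)
  qed
  have "Asc V (?a \<otimes> ?s) ?r ?q \<cdot> ((inv_arr V (Asc V ?a ?s ?r) \<cdot> (Idn V ?a \<odot> mrg S R)) \<odot> Idn V ?q)
      \<cdot> inv_arr V (Asc V ?a (den (S \<union> R)) ?q) \<cdot> (Idn V ?a \<odot> mrg (S \<union> R) Q)
    = Asc V (?a \<otimes> ?s) ?r ?q \<cdot> (inv_arr V (Asc V ?a ?s ?r) \<odot> Idn V ?q)
      \<cdot> (((Idn V ?a \<odot> mrg S R) \<odot> Idn V ?q) \<cdot> inv_arr V (Asc V ?a (den (S \<union> R)) ?q)) \<cdot> (Idn V ?a \<odot> mrg (S \<union> R) Q)"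
    using assms d by (simp add: Cmp_assoc Ten_Cmp_assoc)
  also have "\<dots> = (Asc V (?a \<otimes> ?s) ?r ?q \<cdot> (inv_arr V (Asc V ?a ?s ?r) \<odot> Idn V ?q) \<cdot> inv_arr V (Asc V ?a (?s \<otimes> ?r) ?q))
      \<cdot> (Idn V ?a \<odot> (mrg S R \<odot> Idn V ?q)) \<cdot> (Idn V ?a \<odot> mrg (S \<union> R) Q)"
    using assms d by (simp add: Cmp_assoc flip: Asc_inv_nat)
  also have "\<dots> = inv_arr V (Asc V ?a ?s (?r \<otimes> ?q)) \<cdot> (Idn V ?a \<odot> (Asc V ?s ?r ?q \<cdot> (mrg S R \<odot> Idn V ?q) \<cdot> mrg (S \<union> R) Q))"
    using assms d by (simp add: pent Cmp_assoc Ten_Cmp_assoc Ten_Cmp)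
  also have "\<dots> = inv_arr V (Asc V ?a ?s (?r \<otimes> ?q)) \<cdot> (Idn V ?a \<odot> ((Idn V ?s \<odot> mrg R Q) \<cdot> mrg S (R \<union> Q)))"
    using assms(9) by (simp add: mrg_assoc_at_def)
  also have "\<dots> = (Idn V (?a \<otimes> ?s) \<odot> mrg R Q) \<cdot> inv_arr V (Asc V ?a ?s (den (R \<union> Q))) \<cdot> (Idn V ?a \<odot> mrg S (R \<union> Q))"
  proof -
    have e: "inv_arr V (Asc V ?a ?s (?r \<otimes> ?q)) \<cdot> (Idn V ?a \<odot> (Idn V ?s \<odot> mrg R Q))
      = ((Idn V ?a \<odot> Idn V ?s) \<odot> mrg R Q) \<cdot> inv_arr V (Asc V ?a ?s (den (R \<union> Q)))"
      by (rule Asc_inv_nat) (use assms d in auto)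
    have "inv_arr V (Asc V ?a ?s (?r \<otimes> ?q)) \<cdot> (Idn V ?a \<odot> ((Idn V ?s \<odot> mrg R Q) \<cdot> mrg S (R \<union> Q)))
      = (inv_arr V (Asc V ?a ?s (?r \<otimes> ?q)) \<cdot> (Idn V ?a \<odot> (Idn V ?s \<odot> mrg R Q))) \<cdot> (Idn V ?a \<odot> mrg S (R \<union> Q))"
      using assms d by (simp add: Cmp_assoc Ten_Cmp)
    also have "\<dots> = (((Idn V ?a \<odot> Idn V ?s) \<odot> mrg R Q) \<cdot> inv_arr V (Asc V ?a ?s (den (R \<union> Q)))) \<cdot> (Idn V ?a \<odot> mrg S (R \<union> Q))"
      by (simp only: e)
    finally show ?thesis using assms d by (simp add: Cmp_assoc)
  qed
  finally show ?thesis using assms fin d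
    by (simp add: mrg_assoc_at_def mrg_left below_Un den_insert Un_assoc)
qed

lemma Sym_nat_assoc: "\<lbrakk>f \<in> Ar V; g \<in> Ar V; h \<in> Ar V; Dom V f = a; Dom V g = b; Cod V f = c; Cod V g = d; Cod V h = a \<otimes> b\<rbrakk>
   \<Longrightarrow> Sym V c d \<cdot> ((f \<odot> g) \<cdot> h) = (g \<odot> f) \<cdot> (Sym V a b \<cdot> h)"
proof -
  assume *: "f \<in> Ar V" "g \<in> Ar V" "h \<in> Ar V" "Dom V f = a" "Dom V g = b" "Cod V f = c" "Cod V g = d" "Cod V h = a \<otimes> b"
  then have ob: "a \<in> Ob V" "b \<in> Ob V" "c \<in> Ob V" "d \<in> Ob V" by auto
  have "Sym V c d \<cdot> ((f \<odot> g) \<cdot> h) = (Sym V c d \<cdot> (f \<odot> g)) \<cdot> h" using * ob by (simp add: Cmp_assoc)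
  also have "\<dots> = ((g \<odot> f) \<cdot> Sym V a b) \<cdot> h" using * by (simp add: Sym_nat)
  finally show ?thesis using * ob by (simp add: Cmp_assoc)
qed

text \<open>Moving \<open>R\<close> to the front on both sides leaves associativity for
  \<open>R\<close>, \<open>S\<close>, \<open>Q\<close> and for \<open>R\<close>, \<open>Q\<close>,
  \<open>S\<close>; \<open>middle_swap\<close> converts one into the other.\<close>

lemma mrg_assoc_middle:
  assumes [simp]: "okctx S" "okctx R" "okctx Q" and d: "S \<inter> R = {}" "S \<inter> Q = {}" "R \<inter> Q = {}"
    and "mrg_assoc_at R S Q" "mrg_assoc_at R Q S"
  shows "mrg_assoc_at S R Q"
proof -
  let ?s = "den S" and ?r = "den R" and ?q = "den Q"
  have [simp]: "S \<inter> R = {}" "S \<inter> Q = {}" "R \<inter> Q = {}" "R \<inter> S = {}" "Q \<inter> S = {}" "Q \<inter> R = {}"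
    "(R \<union> S) \<inter> Q = {}" "R \<inter> (S \<union> Q) = {}" "(R \<union> Q) \<inter> S = {}" "S \<inter> (R \<union> Q) = {}"  "R \<inter> (Q \<union> S) = {}"
    using d by auto
  have 1: "(mrg R S \<odot> Idn V ?q) \<cdot> mrg (R \<union> S) Q = inv_arr V (Asc V ?r ?s ?q) \<cdot> (Idn V ?r \<odot> mrg S Q) \<cdot> mrg R (S \<union> Q)"
    by (rule inv_solve) (use assms(7) in \<open>simp_all add: mrg_assoc_at_def\<close>)
  have 2: "(mrg R Q \<odot> Idn V ?s) \<cdot> mrg (R \<union> Q) S = inv_arr V (Asc V ?r ?q ?s) \<cdot> (Idn V ?r \<odot> mrg Q S) \<cdot> mrg R (Q \<union> S)"
    by (rule inv_solve) (use assms(8) in \<open>simp_all add: mrg_assoc_at_def\<close>)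
  have "Asc V ?s ?r ?q \<cdot> (mrg S R \<odot> Idn V ?q) \<cdot> mrg (S \<union> R) Q
    = Asc V ?s ?r ?q \<cdot> (Sym V ?r ?s \<odot> Idn V ?q) \<cdot> ((mrg R S \<odot> Idn V ?q) \<cdot> mrg (R \<union> S) Q)"
    by (simp add: Ten_Cmp_assoc mrg_sym Un_commute)
  also have "\<dots> = (Asc V ?s ?r ?q \<cdot> (Sym V ?r ?s \<odot> Idn V ?q) \<cdot> inv_arr V (Asc V ?r ?s ?q)) \<cdot> (Idn V ?r \<odot> mrg S Q) \<cdot> mrg R (S \<union> Q)"
    unfolding 1 by (simp add: Cmp_assoc)
  also have "\<dots> = Sym V (?r \<otimes> ?q) ?s \<cdot> (inv_arr V (Asc V ?r ?q ?s) \<cdot> (Idn V ?r \<odot> mrg Q S) \<cdot> mrg R (Q \<union> S))"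
    by (simp add: middle_swap Cmp_assoc Ten_Cmp_assoc mrg_sym Un_commute)
  also have "\<dots> = (Idn V ?s \<odot> mrg R Q) \<cdot> mrg S (R \<union> Q)"
    unfolding 2[symmetric] by (simp add: Sym_nat_assoc mrg_sym)
  finally show ?thesis by (simp add: mrg_assoc_at_def)
qed

text \<open>Reversing the whole triple turns the claim into associativity for \<open>Q\<close>,
  \<open>R\<close>, \<open>S\<close>, by \<open>reverse_coherence\<close>.\<close>

lemma mrg_assoc_reverse:
  assumes [simp]: "okctx S" "okctx R" "okctx Q" and d: "S \<inter> R = {}" "S \<inter> Q = {}" "R \<inter> Q = {}"
    and "mrg_assoc_at Q R S"
  shows "mrg_assoc_at S R Q"
proof -
  let ?s = "den S" and ?r = "den R" and ?q = "den Q"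
  have [simp]: "S \<inter> R = {}" "S \<inter> Q = {}" "R \<inter> Q = {}" "R \<inter> S = {}" "Q \<inter> S = {}" "Q \<inter> R = {}"
    "(R \<union> S) \<inter> Q = {}" "R \<inter> (S \<union> Q) = {}" "(R \<union> Q) \<inter> S = {}" "S \<inter> (R \<union> Q) = {}"  "R \<inter> (Q \<union> S) = {}"
    "(Q \<union> R) \<inter> S = {}" "Q \<inter> (R \<union> S) = {}"
    using d by auto
  have "Asc V ?s ?r ?q \<cdot> (mrg S R \<odot> Idn V ?q) \<cdot> mrg (S \<union> R) Q
    = Asc V ?s ?r ?q \<cdot> Sym V ?q (?s \<otimes> ?r) \<cdot> (Idn V ?q \<odot> Sym V ?r ?s) \<cdot> ((Idn V ?q \<odot> mrg R S) \<cdot> mrg Q (R \<union> S))"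
    by (simp add: Ten_Cmp_assoc mrg_sym Sym_nat_assoc Un_commute)
  also have "\<dots> = (Asc V ?s ?r ?q \<cdot> Sym V ?q (?s \<otimes> ?r) \<cdot> (Idn V ?q \<odot> Sym V ?r ?s) \<cdot> Asc V ?q ?r ?s) \<cdot> (mrg Q R \<odot> Idn V ?s) \<cdot> mrg (Q \<union> R) S"
    unfolding assms(7)[unfolded mrg_assoc_at_def, symmetric] by (simp add: Cmp_assoc)
  also have "\<dots> = Sym V (?r \<otimes> ?q) ?s \<cdot> (mrg R Q \<odot> Idn V ?s) \<cdot> mrg (R \<union> Q) S"
    by (simp add: reverse_coherence Cmp_assoc Ten_Cmp_assoc mrg_sym Un_commute)
  also have "\<dots> = (Idn V ?s \<odot> mrg R Q) \<cdot> mrg S (R \<union> Q)"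
    by (simp add: Sym_nat_assoc mrg_sym)
  finally show ?thesis by (simp add: mrg_assoc_at_def)
qed

text \<open>Induction on the union of the three contexts. Whichever context holds the least name is
  brought to the front by a rearrangement, and there \<open>mrg_assoc_left\<close> applies.\<close>

lemma mrg_assoc_at:
  assumes "okctx U" "S \<union> R \<union> Q = U" "S \<inter> R = {}" "S \<inter> Q = {}" "R \<inter> Q = {}"
  shows "mrg_assoc_at S R Q"
  using assms
proof (induction U arbitrary: S R Q rule: okctx_induct)
  case empty
  \<comment> \<open>With all contexts empty the claim is the triangle at \<open>\<I>\<close>, where
    the two unitors coincide.\<close>
  have "Asc V \<I> \<I> \<I> \<cdot> (inv_arr V (Lun V \<I>) \<odot> Idn V \<I>) = inv_arr V (Idn V \<I> \<odot> Lun V \<I>) \<cdot> Idn V (\<I> \<otimes> \<I>)"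
  proof (rule inv_solve)
    have "(Idn V \<I> \<odot> Lun V \<I>) \<cdot> Asc V \<I> \<I> \<I> \<cdot> (inv_arr V (Lun V \<I>) \<odot> Idn V \<I>)
      = ((Idn V \<I> \<odot> Lun V \<I>) \<cdot> Asc V \<I> \<I> \<I>) \<cdot> (inv_arr V (Lun V \<I>) \<odot> Idn V \<I>)"
      by (simp add: Cmp_assoc)
    then show "(Idn V \<I> \<odot> Lun V \<I>) \<cdot> Asc V \<I> \<I> \<I> \<cdot> (inv_arr V (Lun V \<I>) \<odot> Idn V \<I>) = Idn V (\<I> \<otimes> \<I>)"
      unfolding triangle[OF Unt_Ob Unt_Ob] by (simp add: Ten_Cmp Lun_Run)
  qed simp_all
  also have "\<dots> = Idn V \<I> \<odot> inv_arr V (Lun V \<I>)"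
    using inv_arr_eq[OF Ten_inv[of "Idn V \<I>" "Lun V \<I>"]] inv_arr_eq[of "Idn V \<I>" "Idn V \<I>"]
    by (simp add: inverse_arrows_def in_hom_def)
  finally have "Asc V \<I> \<I> \<I> \<cdot> (inv_arr V (Lun V \<I>) \<odot> Idn V \<I>) = Idn V \<I> \<odot> inv_arr V (Lun V \<I>)" .
  then show ?case using empty by (simp add: mrg_assoc_at_def mrg_empty flip: Cmp_assoc)
next
  case (insert x U)
  have x: "x \<notin> U" using insert.hyps below_notin by blast
  have left: "mrg_assoc_at (insert x A) B C" if "A \<union> B \<union> C = U" "A \<inter> B = {}" "A \<inter> C = {}" "B \<inter> C = {}" for A B C
  proof -
    have "okctx (A \<union> B \<union> C)" "below x (A \<union> B \<union> C)" using insert.hyps that(1) by simp_all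
    moreover have "okctx A" "okctx B" "okctx C" using calculation(1) by simp_all
    ultimately show ?thesis using mrg_assoc_left[of A B C x] insert.IH[OF that] that insert.hyps(1) by simp
  qed
  have ok: "okctx S" "okctx R" "okctx Q"
  proof -
    have "okctx (S \<union> R \<union> Q)" using insert.prems(1) insert.hyps(1,2) by simp
    then show "okctx S" "okctx R" "okctx Q" by simp_all
  qed
  have "(S \<union> R) \<inter> Q = {}" using insert.prems by (simp add: Int_Un_distrib2)
  from insert.prems(1) x this show ?case
  proof (cases rule: insert_split)
    case (1 P)
    from 1(1) 1(2) insert.prems(2) show ?thesis
    proof (cases rule: insert_split)
      case (1 S')
      then show ?thesis using left[of S' R Q] insert.prems(2-4) \<open>P \<union> Q = U\<close> by simp
    next
      case (2 R')
      \<comment> \<open>The induction hypothesis is taken for two orders of the contexts, both with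
        \<open>R'\<close> in front, as \<open>mrg_assoc_middle\<close> requires.\<close>
      have "R' \<union> S \<union> Q = U" "R' \<union> Q \<union> S = U" "R' \<inter> S = {}" "R' \<inter> Q = {}" "S \<inter> Q = {}" "Q \<inter> S = {}"
        using 2 insert.prems(2-4) \<open>P \<union> Q = U\<close> by (simp_all add: Un_ac Int_commute)
      then have "mrg_assoc_at R S Q" "mrg_assoc_at R Q S" using left[of R' S Q] left[of R' Q S] 2(1) by simp_all
      then show ?thesis using mrg_assoc_middle ok insert.prems(2-4) by simp
    qed
  next
    case (2 Q')
    have "Q' \<union> R \<union> S = U" "Q' \<inter> R = {}" "Q' \<inter> S = {}" "R \<inter> S = {}"
      using 2 insert.prems by (simp_all add: Un_ac Int_commute)
    then have "mrg_assoc_at Q R S" using left[of Q' R S] 2(1) by simp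
    then show ?thesis using mrg_assoc_reverse ok insert.prems(2-4) by simp
  qed
qed

lemma mrg_assoc:
  assumes "okctx S" "okctx R" "okctx Q" "S \<inter> R = {}" "S \<inter> Q = {}" "R \<inter> Q = {}"
  shows "Asc V (den S) (den R) (den Q) \<cdot> (mrg S R \<odot> Idn V (den Q)) \<cdot> mrg (S \<union> R) Q
    = (Idn V (den S) \<odot> mrg R Q) \<cdot> mrg S (R \<union> Q)"
  using mrg_assoc_at[of "S \<union> R \<union> Q" S R Q] assms by (simp add: mrg_assoc_at_def)

text \<open>An element of \<open>a\<close> in context \<open>S\<close> is an arrow \<open>den S \<rightarrow> a\<close>; it is generic when it is invertible. Two arrows
  out of a tensor product agree as soon as they agree on a tensor of generic elements with disjoint contexts,
  and on such tensors the structural isomorphisms act as plain rebracketings and permutations.\<close>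

definition ct :: "('o, 'm) el \<Rightarrow> 'o ctx" where "ct x = fst x"

definition ty :: "('o, 'm) el \<Rightarrow> 'o" where "ty x = Cod V (snd x)"

definition okel :: "('o, 'm) el \<Rightarrow> bool" where
  "okel x \<longleftrightarrow> okctx (fst x) \<and> snd x \<in> Ar V \<and> Dom V (snd x) = den (fst x)"

definition isoel :: "('o, 'm) el \<Rightarrow> bool" where
  "isoel x \<longleftrightarrow> okel x \<and> is_iso V (snd x)"

definition app :: "'m \<Rightarrow> ('o, 'm) el \<Rightarrow> ('o, 'm) el" (infixr "\<triangleright>" 60) where
  "g \<triangleright> x = (fst x, g \<cdot> snd x)"

text \<open>Used for disjoint contexts: \<open>mrg\<close> then splits the union into its two parts,
  and no variable occurs twice.\<close>

definition ten :: "('o, 'm) el \<Rightarrow> ('o, 'm) el \<Rightarrow> ('o, 'm) el" (infixr "\<bowtie>" 65) where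
  "x \<bowtie> y = (fst x \<union> fst y, (snd x \<odot> snd y) \<cdot> mrg (fst x) (fst y))"

definition un :: "('o, 'm) el" where "un = ({}, Idn V \<I>)"

text \<open>A one-name context denotes \<open>a \<otimes> \<I>\<close>, so the variable of type
  \<open>a\<close> is the right unitor and not an identity.\<close>

definition gen :: "nat \<Rightarrow> 'o \<Rightarrow> ('o, 'm) el" where "gen n a = ({(n, a)}, Run V a)"

text \<open>The universal element of a context: every element over \<open>S\<close> arises from it
  by applying its own arrow, see \<open>el_idc\<close>.\<close>

definition idc :: "'o ctx \<Rightarrow> ('o, 'm) el" where "idc S = (S, Idn V (den S))"

lemma den_single [simp]: "den {x} = snd x \<otimes> \<I>"
  using den_insert[of "{}" x] by (simp add: below_def)

lemma ct_simps [simp]: "ct (g \<triangleright> x) = ct x" "ct (x \<bowtie> y) = ct x \<union> ct y" "ct un = {}" "ct (gen n a) = {(n, a)}"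
  "ct (idc S) = S"
  by (simp_all add: ct_def app_def ten_def un_def gen_def idc_def)

lemma ty_app [simp]: "\<lbrakk>g \<in> Ar V; okel x; Dom V g = ty x\<rbrakk> \<Longrightarrow> ty (g \<triangleright> x) = Cod V g"
  by (simp add: ty_def app_def okel_def)

lemma ty_ten [simp]: "\<lbrakk>okel x; okel y; ct x \<inter> ct y = {}\<rbrakk> \<Longrightarrow> ty (x \<bowtie> y) = ty x \<otimes> ty y"
  by (simp add: ty_def ten_def okel_def ct_def)

lemma ty_simps [simp]: "ty un = \<I>" "a \<in> Ob V \<Longrightarrow> ty (gen n a) = a" "okctx S \<Longrightarrow> ty (idc S) = den S"
  by (simp_all add: ty_def un_def gen_def idc_def)

lemma okel_simps [simp]:
  "okel un" "a \<in> Ob V \<Longrightarrow> okel (gen n a)" "okctx S \<Longrightarrow> okel (idc S)"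
  by (simp_all add: okel_def un_def gen_def idc_def)

lemma okel_app [simp]: "\<lbrakk>g \<in> Ar V; okel x; Dom V g = ty x\<rbrakk> \<Longrightarrow> okel (g \<triangleright> x)"
  by (simp add: ty_def app_def okel_def)

lemma okel_ten [simp]: "\<lbrakk>okel x; okel y; ct x \<inter> ct y = {}\<rbrakk> \<Longrightarrow> okel (x \<bowtie> y)"
  by (simp add: ten_def okel_def ct_def)

lemma okel_ct [simp]: "okel x \<Longrightarrow> okctx (ct x)"
  by (simp add: okel_def ct_def)

lemma ty_Ob [simp]: "okel x \<Longrightarrow> ty x \<in> Ob V"
  by (simp add: ty_def okel_def)

lemma app_Cmp [simp]: "\<lbrakk>f \<in> Ar V; g \<in> Ar V; okel x; Dom V g = Cod V f; Dom V f = ty x\<rbrakk> \<Longrightarrow> (g \<cdot> f) \<triangleright> x = g \<triangleright> f \<triangleright> x"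
  by (simp add: app_def okel_def ty_def Cmp_assoc)

lemma app_Idn [simp]: "\<lbrakk>okel x; ty x = a\<rbrakk> \<Longrightarrow> Idn V a \<triangleright> x = x"
  by (simp add: app_def okel_def ty_def)

lemma app_TenA [simp]: "\<lbrakk>f \<in> Ar V; g \<in> Ar V; okel x; okel y; ct x \<inter> ct y = {}; Dom V f = ty x; Dom V g = ty y\<rbrakk>
  \<Longrightarrow> (f \<odot> g) \<triangleright> (x \<bowtie> y) = (f \<triangleright> x) \<bowtie> (g \<triangleright> y)"
  by (simp add: app_def ten_def okel_def ty_def ct_def Ten_Cmp_assoc)

text \<open>\<open>mrg_sym\<close> as a rewrite rule. It can be an equality of elements because the
  context of a tensor is a union and hence the same in both orders.\<close>

lemma app_Sym [simp]: "\<lbrakk>okel x; okel y; ct x \<inter> ct y = {}; ty x = a; ty y = b\<rbrakk> \<Longrightarrow> Sym V a b \<triangleright> (x \<bowtie> y) = y \<bowtie> x"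
  by (auto simp: app_def ten_def okel_def ty_def ct_def Un_commute mrg_sym
     Sym_nat_assoc[of "snd x" "snd y" _ "den (fst x)" "den (fst y)"])

lemma app_inv [simp]:
  "\<lbrakk>is_iso V f; okel x; Dom V f = ty x\<rbrakk> \<Longrightarrow> inv_arr V f \<triangleright> f \<triangleright> x = x"
  "\<lbrakk>is_iso V f; okel x; Cod V f = ty x\<rbrakk> \<Longrightarrow> f \<triangleright> inv_arr V f \<triangleright> x = x"
  by (simp_all add: app_def okel_def ty_def)

lemma Asc_nat_assoc: "\<lbrakk>f \<in> Ar V; g \<in> Ar V; h \<in> Ar V; k \<in> Ar V; Dom V f = a; Dom V g = b; Dom V h = c;
    Cod V f = a'; Cod V g = b'; Cod V h = c'; Cod V k = (a \<otimes> b) \<otimes> c\<rbrakk>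
   \<Longrightarrow> Asc V a' b' c' \<cdot> (((f \<odot> g) \<odot> h) \<cdot> k) = (f \<odot> (g \<odot> h)) \<cdot> (Asc V a b c \<cdot> k)"
  (is "\<lbrakk>_; _; _; _; _; _; _; _; _; _; _\<rbrakk> \<Longrightarrow> ?l = ?r")
proof -
  assume *: "f \<in> Ar V" "g \<in> Ar V" "h \<in> Ar V" "k \<in> Ar V" "Dom V f = a" "Dom V g = b" "Dom V h = c"
    "Cod V f = a'" "Cod V g = b'" "Cod V h = c'" "Cod V k = (a \<otimes> b) \<otimes> c"
  then have ob: "a \<in> Ob V" "b \<in> Ob V" "c \<in> Ob V" "a' \<in> Ob V" "b' \<in> Ob V" "c' \<in> Ob V" by auto
  have "?l = (Asc V a' b' c' \<cdot> ((f \<odot> g) \<odot> h)) \<cdot> k" using * ob by (simp add: Cmp_assoc)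
  also have "\<dots> = ((f \<odot> (g \<odot> h)) \<cdot> Asc V a b c) \<cdot> k" using * by (simp add: Asc_nat)
  finally show ?thesis using * ob by (simp add: Cmp_assoc)
qed

text \<open>\<open>mrg_assoc\<close> as a rewrite rule. With the rules for units and symmetry it
  lets simplification remove the structural isomorphisms from equations between elements.\<close>

lemma app_Asc [simp]:
  assumes "okel x" "okel y" "okel z" "ct x \<inter> ct y = {}" "ct x \<inter> ct z = {}" "ct y \<inter> ct z = {}" "ty x = a" "ty y = b" "ty z = c"
  shows "Asc V a b c \<triangleright> ((x \<bowtie> y) \<bowtie> z) = x \<bowtie> (y \<bowtie> z)"
proof -
  obtain S f where x: "x = (S, f)" by force
  obtain R g where y: "y = (R, g)" by force
  obtain Q h where z: "z = (Q, h)" by force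
  note * = assms[unfolded x y z okel_def ty_def ct_def, simplified]
  have d: "(S \<union> R) \<inter> Q = {}" "S \<inter> (R \<union> Q) = {}" using * by (simp_all add: Int_Un_distrib Int_Un_distrib2)
  have "Asc V a b c \<cdot> ((((f \<odot> g) \<cdot> mrg S R) \<odot> h) \<cdot> mrg (S \<union> R) Q)
    = Asc V a b c \<cdot> (((f \<odot> g) \<odot> h) \<cdot> ((mrg S R \<odot> Idn V (den Q)) \<cdot> mrg (S \<union> R) Q))"
    using * d by (simp add: Ten_Cmp_assoc)
  also have "\<dots> = (f \<odot> (g \<odot> h)) \<cdot> (Asc V (den S) (den R) (den Q) \<cdot> ((mrg S R \<odot> Idn V (den Q)) \<cdot> mrg (S \<union> R) Q))"
    using * d by (intro Asc_nat_assoc) auto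
  also have "\<dots> = (f \<odot> ((g \<odot> h) \<cdot> mrg R Q)) \<cdot> mrg S (R \<union> Q)"
    using * d by (simp add: mrg_assoc Ten_Cmp_assoc)
  finally show ?thesis by (simp add: x y z app_def ten_def Un_assoc)
qed

lemma app_inv_eq: "\<lbrakk>f \<triangleright> x = y; is_iso V f; okel x; Dom V f = ty x\<rbrakk> \<Longrightarrow> inv_arr V f \<triangleright> y = x"
  by auto

lemma app_inv_Asc [simp]:
  assumes "okel x" "okel y" "okel z" "ct x \<inter> ct y = {}" "ct x \<inter> ct z = {}" "ct y \<inter> ct z = {}" "ty x = a" "ty y = b" "ty z = c"
  shows "inv_arr V (Asc V a b c) \<triangleright> (x \<bowtie> (y \<bowtie> z)) = (x \<bowtie> y) \<bowtie> z"
  by (rule app_inv_eq) (use assms in \<open>auto simp: Int_Un_distrib Int_Un_distrib2\<close>)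

text \<open>The unit element has empty context, and by \<open>mrg_empty_right\<close> a shuffle with
  the empty context is an inverse right unitor.\<close>

lemma app_inv_Run [simp]: "\<lbrakk>okel x; ty x = a\<rbrakk> \<Longrightarrow> inv_arr V (Run V a) \<triangleright> x = x \<bowtie> un"
proof -
  assume *: "okel x" "ty x = a"
  obtain S f where x: "x = (S, f)" by force
  note ** = *[unfolded x okel_def ty_def ct_def, simplified]
  have "inv_arr V (Run V a) \<cdot> f = (f \<odot> Idn V \<I>) \<cdot> inv_arr V (Run V (den S))"
    using ** by (intro inv_solve[symmetric]) (auto simp: Run_nat Cmp_assoc[symmetric], simp add: Cmp_assoc)
  then show ?thesis using ** by (simp add: x app_def ten_def un_def mrg_empty_right)
qed

lemma app_Run [simp]: "\<lbrakk>okel x; ty x = a\<rbrakk> \<Longrightarrow> Run V a \<triangleright> (x \<bowtie> un) = x"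
  using app_inv(2)[of "Run V a" x] ty_Ob[of x] by auto

text \<open>Reduced to the right unitor by \<open>Lun_Sym\<close>, so that only one of the unitors
  has to be matched against \<open>mrg\<close>.\<close>

lemma app_Lun [simp]: "\<lbrakk>okel x; ty x = a\<rbrakk> \<Longrightarrow> Lun V a \<triangleright> (un \<bowtie> x) = x"
proof -
  assume *: "okel x" "ty x = a"
  then have "Lun V a \<triangleright> (un \<bowtie> x) = Lun V a \<triangleright> (Sym V a \<I> \<triangleright> (x \<bowtie> un))" by simp
  also have "\<dots> = (Lun V a \<cdot> Sym V a \<I>) \<triangleright> (x \<bowtie> un)" using * by (auto simp del: app_Sym)
  also have "\<dots> = x" using * by (auto simp: Lun_Sym simp del: app_Cmp)
  finally show ?thesis .
qed

lemma app_inv_Lun [simp]: "\<lbrakk>okel x; ty x = a\<rbrakk> \<Longrightarrow> inv_arr V (Lun V a) \<triangleright> x = un \<bowtie> x"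
  by (rule app_inv_eq) auto

lemma app_mid4 [simp]:
  assumes "okel x" "okel y" "okel z" "okel w" "ct x \<inter> ct y = {}" "ct x \<inter> ct z = {}" "ct x \<inter> ct w = {}" "ct y \<inter> ct z = {}"
    "ct y \<inter> ct w = {}" "ct z \<inter> ct w = {}" "ty x = a" "ty y = b" "ty z = c" "ty w = d"
  shows "mid4 a b c d \<triangleright> ((x \<bowtie> y) \<bowtie> (z \<bowtie> w)) = (x \<bowtie> z) \<bowtie> (y \<bowtie> w)"
  using assms ty_Ob[of x] ty_Ob[of y] ty_Ob[of z] ty_Ob[of w]
  by (simp add: mid4_def Int_Un_distrib Int_Un_distrib2 Int_commute)

lemma isoel_okel [simp]: "isoel x \<Longrightarrow> okel x"
  by (simp add: isoel_def)

lemma isoel_simps [simp]: "isoel un" "a \<in> Ob V \<Longrightarrow> isoel (gen n a)" "okctx S \<Longrightarrow> isoel (idc S)"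
  by (simp_all add: isoel_def) (simp_all add: un_def gen_def idc_def)

lemma isoel_ten [simp]: "\<lbrakk>isoel x; isoel y; ct x \<inter> ct y = {}\<rbrakk> \<Longrightarrow> isoel (x \<bowtie> y)"
  by (simp add: isoel_def) (simp add: ten_def okel_def ct_def iso_Ar)

text \<open>A generic element is invertible, hence epic: a single test element decides an equation
  of arrows.\<close>

lemma arr_ext: "\<lbrakk>f \<triangleright> x = g \<triangleright> x; isoel x; f \<in> Ar V; g \<in> Ar V; Dom V f = ty x; Dom V g = ty x\<rbrakk> \<Longrightarrow> f = g"
  by (auto simp: isoel_def app_def ty_def okel_def intro: iso_epi)

text \<open>Since \<open>x\<close> is invertible, every element over the same context factors
  through it. In this way arrows of \<open>V\<close> are extracted from constructions carried out on
  elements.\<close>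

lemma el_arr: assumes "isoel x" "okel y" "ct y = ct x"
  obtains f where "f \<in> Ar V" "Dom V f = ty x" "Cod V f = ty y" "f \<triangleright> x = y"
proof
  let ?f = "snd y \<cdot> inv_arr V (snd x)"
  show "?f \<in> Ar V" "Dom V ?f = ty x" "Cod V ?f = ty y" "?f \<triangleright> x = y"
    using assms by (auto simp: isoel_def okel_def ct_def ty_def app_def Cmp_assoc prod_eq_iff)
qed

lemma el_eqI: "\<lbrakk>ct x = ct y; snd x = snd y\<rbrakk> \<Longrightarrow> x = y"
  by (simp add: ct_def prod_eq_iff)

lemma el_idc: "okel x \<Longrightarrow> snd x \<triangleright> idc (ct x) = x"
  by (simp add: app_def idc_def okel_def ct_def)

lemma el_snd [simp]: "okel x \<Longrightarrow> snd x \<in> Ar V" "okel x \<Longrightarrow> Dom V (snd x) = den (ct x)" "Cod V (snd x) = ty x"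
  by (simp_all add: okel_def ct_def ty_def)

lemma ex_fresh: "finite S \<Longrightarrow> \<exists>n. (n, a) \<notin> (S :: 'o ctx)"
proof (rule ccontr)
  assume "finite S" "\<not> (\<exists>n. (n, a) \<notin> S)"
  then have "(\<lambda>n. (n, a)) ` UNIV \<subseteq> S" by auto
  with \<open>finite S\<close> have "finite ((\<lambda>n::nat. (n, a)) ` UNIV)" by (rule finite_subset[rotated])
  then show False by (subst (asm) finite_image_iff) (auto simp: inj_on_def)
qed

lemma fresh_gen: assumes "okctx S" "a \<in> Ob V"
  obtains q where "isoel q" "ty q = a" "ct q \<inter> S = {}"
proof -
  obtain n where "(n, a) \<notin> S" using ex_fresh[OF okctx_finite[OF assms(1)]] by blast
  then show thesis using that[of "gen n a"] assms by simp
qed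

section \<open>Enriched categories through graded arrows\<close>

text \<open>A graded arrow is an element of a hom-object, with \<open>gc\<close> its context.\<close>

definition sr :: "('c, 'o, 'm) gr \<Rightarrow> 'c" where "sr e = fst e"
definition tg :: "('c, 'o, 'm) gr \<Rightarrow> 'c" where "tg e = fst (snd e)"
definition ge :: "('c, 'o, 'm) gr \<Rightarrow> ('o, 'm) el" where "ge e = snd (snd e)"
definition gc :: "('c, 'o, 'm) gr \<Rightarrow> 'o ctx" where "gc e = ct (ge e)"

lemma gr_simps [simp]: "sr (a, b, x) = a" "tg (a, b, x) = b" "ge (a, b, x) = x" "gc (a, b, x) = ct x"
  by (simp_all add: sr_def tg_def ge_def gc_def)

lemma ct_ge [simp]: "ct (ge e) = gc e"
  by (simp add: gc_def)

lemma gr_eqI: "\<lbrakk>sr e = sr d; tg e = tg d; ge e = ge d\<rbrakk> \<Longrightarrow> e = d"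
  by (simp add: sr_def tg_def ge_def prod_eq_iff)

lemma gr_eta: "(sr e, tg e, ge e) = e"
  by (simp add: sr_def tg_def ge_def)

definition gok :: "('c, 'o, 'm, 'z) vcat_scheme \<Rightarrow> ('c, 'o, 'm) gr \<Rightarrow> bool" where
  "gok C e \<longleftrightarrow> sr e \<in> VOb C \<and> tg e \<in> VOb C \<and> okel (ge e) \<and> ty (ge e) = VHom C (sr e) (tg e)"

definition gcmp :: "('c, 'o, 'm, 'z) vcat_scheme \<Rightarrow> ('c, 'o, 'm) gr \<Rightarrow> ('c, 'o, 'm) gr
    \<Rightarrow> ('c, 'o, 'm) gr" where
  "gcmp C g f = (sr f, tg g, VComp C (sr f) (tg f) (tg g) \<triangleright> (ge g \<bowtie> ge f))"

notation gcmp ("(_ \<bullet>\<index> _)" [56, 55] 55)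

definition gid :: "('c, 'o, 'm, 'z) vcat_scheme \<Rightarrow> 'c \<Rightarrow> ('c, 'o, 'm) gr" where
  "gid C a = (a, a, VId C a \<triangleright> un)"

definition gmp :: "('a, 'b, 'm) vfun \<Rightarrow> ('a, 'o, 'm) gr \<Rightarrow> ('b, 'o, 'm) gr" (infixr "\<star>" 70) where
  "F \<star> e = (FOb F (sr e), FOb F (tg e), FHom F (sr e) (tg e) \<triangleright> ge e)"

lemma gr_cmp [simp]: "sr (g \<bullet>\<^bsub>C\<^esub> f) = sr f" "tg (g \<bullet>\<^bsub>C\<^esub> f) = tg g" "gc (g \<bullet>\<^bsub>C\<^esub> f) = gc g \<union> gc f"
  by (simp_all add: gcmp_def)

lemma gr_id [simp]: "sr (gid C a) = a" "tg (gid C a) = a" "gc (gid C a) = {}"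
  by (simp_all add: gid_def)

lemma gr_mp [simp]: "sr (F \<star> e) = FOb F (sr e)" "tg (F \<star> e) = FOb F (tg e)" "gc (F \<star> e) = gc e"
  by (simp_all add: gmp_def)

lemma gok_D: "gok C e \<Longrightarrow> sr e \<in> VOb C" "gok C e \<Longrightarrow> tg e \<in> VOb C" "gok C e \<Longrightarrow> okel (ge e)"
  "gok C e \<Longrightarrow> ty (ge e) = VHom C (sr e) (tg e)" "gok C e \<Longrightarrow> okctx (gc e)"
  using okel_ct[of "ge e"] by (auto simp: gok_def)

lemma vcat_typ [simp]:
  "\<lbrakk>vcategory C; a \<in> VOb C; b \<in> VOb C\<rbrakk> \<Longrightarrow> VHom C a b \<in> Ob V"
  "\<lbrakk>vcategory C; a \<in> VOb C\<rbrakk> \<Longrightarrow> VId C a \<in> Ar V"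
  "\<lbrakk>vcategory C; a \<in> VOb C\<rbrakk> \<Longrightarrow> Dom V (VId C a) = \<I>"
  "\<lbrakk>vcategory C; a \<in> VOb C\<rbrakk> \<Longrightarrow> Cod V (VId C a) = VHom C a a"
  "\<lbrakk>vcategory C; a \<in> VOb C; b \<in> VOb C; c \<in> VOb C\<rbrakk> \<Longrightarrow> VComp C a b c \<in> Ar V"
  "\<lbrakk>vcategory C; a \<in> VOb C; b \<in> VOb C; c \<in> VOb C\<rbrakk> \<Longrightarrow> Dom V (VComp C a b c) = VHom C b c \<otimes> VHom C a b"
  "\<lbrakk>vcategory C; a \<in> VOb C; b \<in> VOb C; c \<in> VOb C\<rbrakk> \<Longrightarrow> Cod V (VComp C a b c) = VHom C a c"
  by (auto simp: vcategory_def in_hom_def)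

lemma gok_cmp [simp]: "\<lbrakk>vcategory C; gok C g; gok C f; sr g = tg f; gc g \<inter> gc f = {}\<rbrakk> \<Longrightarrow> gok C (g \<bullet>\<^bsub>C\<^esub> f)"
  by (simp add: gcmp_def gok_def)

lemma gok_id [simp]: "\<lbrakk>vcategory C; a \<in> VOb C\<rbrakk> \<Longrightarrow> gok C (gid C a)"
  by (simp add: gid_def gok_def)

text \<open>The associator in the axiom acts on a tensor of three elements with disjoint contexts as
  plain rebracketing, so it vanishes from the law.\<close>

lemma gcmp_assoc:
  assumes "vcategory C" "gok C h" "gok C g" "gok C f" "sr h = tg g" "sr g = tg f"
    "gc h \<inter> gc g = {}" "gc h \<inter> gc f = {}" "gc g \<inter> gc f = {}"
  shows "(h \<bullet>\<^bsub>C\<^esub> g) \<bullet>\<^bsub>C\<^esub> f = h \<bullet>\<^bsub>C\<^esub> (g \<bullet>\<^bsub>C\<^esub> f)"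
proof -
  let ?a = "sr f" and ?b = "tg f" and ?c = "tg g" and ?d = "tg h"
  have ob: "?a \<in> VOb C" "?b \<in> VOb C" "?c \<in> VOb C" "?d \<in> VOb C" using assms by (auto simp: gok_def)
  have "(VComp C ?a ?b ?d \<cdot> (VComp C ?b ?c ?d \<odot> Idn V (VHom C ?a ?b))) \<triangleright> ((ge h \<bowtie> ge g) \<bowtie> ge f)
    = (VComp C ?a ?c ?d \<cdot> (Idn V (VHom C ?c ?d) \<odot> VComp C ?a ?b ?c)
            \<cdot> Asc V (VHom C ?c ?d) (VHom C ?b ?c) (VHom C ?a ?b)) \<triangleright> ((ge h \<bowtie> ge g) \<bowtie> ge f)"
    using assms(1) ob unfolding vcategory_def by metis
  then show ?thesis using assms ob
    by (simp add: gcmp_def gok_def Int_Un_distrib Int_Un_distrib2)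
qed

lemma gid_left [simp]: assumes "vcategory C" "gok C f" "tg f = a" shows "gid C a \<bullet>\<^bsub>C\<^esub> f = f"
proof -
  have "(VComp C (sr f) a a \<cdot> (VId C a \<odot> Idn V (VHom C (sr f) a))) \<triangleright> (un \<bowtie> ge f) = Lun V (VHom C (sr f) a) \<triangleright> (un \<bowtie> ge f)"
    using assms unfolding vcategory_def by (metis gok_D(1,2))
  then show ?thesis using assms gr_eta[of f] by (auto simp: gcmp_def gid_def gok_def)
qed

lemma gid_right [simp]: assumes "vcategory C" "gok C f" "sr f = a" shows "f \<bullet>\<^bsub>C\<^esub> gid C a = f"
proof -
  have "(VComp C a a (tg f) \<cdot> (Idn V (VHom C a (tg f)) \<odot> VId C a)) \<triangleright> (ge f \<bowtie> un) = Run V (VHom C a (tg f)) \<triangleright> (ge f \<bowtie> un)"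
    using assms unfolding vcategory_def by (metis gok_D(1,2))
  then show ?thesis using assms gr_eta[of f] by (auto simp: gcmp_def gid_def gok_def)
qed

lemma vcategoryI:
  assumes hom: "\<And>a b. \<lbrakk>a \<in> VOb C; b \<in> VOb C\<rbrakk> \<Longrightarrow> VHom C a b \<in> Ob V"
    and ide: "\<And>a. a \<in> VOb C \<Longrightarrow> \<guillemotleft>VId C a : \<I> \<rightarrow> VHom C a a\<guillemotright>"
    and cmp: "\<And>a b c. \<lbrakk>a \<in> VOb C; b \<in> VOb C; c \<in> VOb C\<rbrakk>
      \<Longrightarrow> \<guillemotleft>VComp C a b c : VHom C b c \<otimes> VHom C a b \<rightarrow> VHom C a c\<guillemotright>"
    and assoc: "\<And>f g h. \<lbrakk>gok C h; gok C g; gok C f; sr h = tg g; sr g = tg f;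
        gc h \<inter> gc g = {}; gc h \<inter> gc f = {}; gc g \<inter> gc f = {}\<rbrakk>
      \<Longrightarrow> (h \<bullet>\<^bsub>C\<^esub> g) \<bullet>\<^bsub>C\<^esub> f = h \<bullet>\<^bsub>C\<^esub> (g \<bullet>\<^bsub>C\<^esub> f)"
    and idl: "\<And>f. gok C f \<Longrightarrow> gid C (tg f) \<bullet>\<^bsub>C\<^esub> f = f"
    and idr: "\<And>f. gok C f \<Longrightarrow> f \<bullet>\<^bsub>C\<^esub> gid C (sr f) = f"
  shows "vcategory C"
proof -
  have [simp]: "VId C a \<in> Ar V" "Dom V (VId C a) = \<I>" "Cod V (VId C a) = VHom C a a" if "a \<in> VOb C" for a
    using ide[OF that] by (auto simp: in_hom_def)
  have [simp]: "VComp C a b c \<in> Ar V" "Dom V (VComp C a b c) = VHom C b c \<otimes> VHom C a b"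
     "Cod V (VComp C a b c) = VHom C a c" if "a \<in> VOb C" "b \<in> VOb C" "c \<in> VOb C" for a b c
    using cmp[OF that] by (auto simp: in_hom_def)
  note [simp] = hom
  have 1: "VComp C a b d \<cdot> (VComp C b c d \<odot> Idn V (VHom C a b))
        = VComp C a c d \<cdot> (Idn V (VHom C c d) \<odot> VComp C a b c)
            \<cdot> Asc V (VHom C c d) (VHom C b c) (VHom C a b)"
    if "a \<in> VOb C" "b \<in> VOb C" "c \<in> VOb C" "d \<in> VOb C" for a b c d
  proof -
    \<comment> \<open>Different numbers keep the contexts disjoint even when some of the hom-objects
      coincide.\<close>
    let ?h = "gen 0 (VHom C c d)" and ?g = "gen 1 (VHom C b c)" and ?f = "gen 2 (VHom C a b)"
    show ?thesis
      by (rule arr_ext[of _ "(?h \<bowtie> ?g) \<bowtie> ?f"])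
        (use assoc[of "(c, d, ?h)" "(b, c, ?g)" "(a, b, ?f)"] that in \<open>auto simp: gcmp_def gok_def\<close>)
  qed
  have 2: "VComp C a b b \<cdot> (VId C b \<odot> Idn V (VHom C a b)) = Lun V (VHom C a b)"
     "VComp C a a b \<cdot> (Idn V (VHom C a b) \<odot> VId C a) = Run V (VHom C a b)" if "a \<in> VOb C" "b \<in> VOb C" for a b
  proof -
    let ?f = "gen 0 (VHom C a b)"
    show "VComp C a b b \<cdot> (VId C b \<odot> Idn V (VHom C a b)) = Lun V (VHom C a b)"
      by (rule arr_ext[of _ "un \<bowtie> ?f"])
        (use idl[of "(a, b, ?f)"] that in \<open>auto simp: gcmp_def gok_def gid_def\<close>)
    show "VComp C a a b \<cdot> (Idn V (VHom C a b) \<odot> VId C a) = Run V (VHom C a b)"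
      by (rule arr_ext[of _ "?f \<bowtie> un"])
        (use idr[of "(a, b, ?f)"] that in \<open>auto simp: gcmp_def gok_def gid_def\<close>)
  qed
  show ?thesis unfolding vcategory_def in_hom_def by (simp add: 1 2)
qed

section \<open>Enriched functors acting on graded arrows\<close>

lemma vfun_cat: "vfunctor A B F \<Longrightarrow> vcategory A" "vfunctor A B F \<Longrightarrow> vcategory B"
  by (simp_all add: vfunctor_def)

lemma vfun_typ [simp]:
  "\<lbrakk>vfunctor A B F; a \<in> VOb A\<rbrakk> \<Longrightarrow> FOb F a \<in> VOb B"
  "\<lbrakk>vfunctor A B F; a \<in> VOb A; b \<in> VOb A\<rbrakk> \<Longrightarrow> FHom F a b \<in> Ar V"
  "\<lbrakk>vfunctor A B F; a \<in> VOb A; b \<in> VOb A\<rbrakk> \<Longrightarrow> Dom V (FHom F a b) = VHom A a b"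
  "\<lbrakk>vfunctor A B F; a \<in> VOb A; b \<in> VOb A\<rbrakk> \<Longrightarrow> Cod V (FHom F a b) = VHom B (FOb F a) (FOb F b)"
  by (auto simp: vfunctor_def in_hom_def)

lemma gok_mp [simp]: "\<lbrakk>vfunctor A B F; gok A e\<rbrakk> \<Longrightarrow> gok B (F \<star> e)"
  by (simp add: gmp_def gok_def)

lemma gmp_id [simp]: "\<lbrakk>vfunctor A B F; a \<in> VOb A\<rbrakk> \<Longrightarrow> F \<star> gid A a = gid B (FOb F a)"
proof -
  assume *: "vfunctor A B F" "a \<in> VOb A"
  note [simp] = vfun_cat[OF *(1)]
  have "(FHom F a a \<cdot> VId A a) \<triangleright> un = VId B (FOb F a) \<triangleright> un" using * by (simp add: vfunctor_def)
  then show ?thesis using * by (simp add: gmp_def gid_def)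
qed

lemma gmp_cmp:
  assumes "vfunctor A B F" "gok A g" "gok A f" "sr g = tg f" "gc g \<inter> gc f = {}"
  shows "F \<star> (g \<bullet>\<^bsub>A\<^esub> f) = (F \<star> g) \<bullet>\<^bsub>B\<^esub> (F \<star> f)"
proof -
  note [simp] = vfun_cat[OF assms(1)]
  let ?a = "sr f" and ?b = "tg f" and ?c = "tg g"
  have ob: "?a \<in> VOb A" "?b \<in> VOb A" "?c \<in> VOb A" using assms by (auto simp: gok_def)
  have "(FHom F ?a ?c \<cdot> VComp A ?a ?b ?c) \<triangleright> (ge g \<bowtie> ge f)
    = (VComp B (FOb F ?a) (FOb F ?b) (FOb F ?c) \<cdot> (FHom F ?b ?c \<odot> FHom F ?a ?b)) \<triangleright> (ge g \<bowtie> ge f)"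
    using assms(1) ob by (simp add: vfunctor_def del: app_Cmp)
  then show ?thesis using assms ob by (simp add: gmp_def gcmp_def gok_def)
qed

text \<open>The laws are assumed for all graded arrows, where they can be calculated with
  \<open>\<star>\<close>; instances at generic variables give back the required equations of arrows
  in \<open>V\<close>.\<close>

lemma vfunctorI:
  assumes cat [simp]: "vcategory A" "vcategory B" and F: "F = mk_vfun (VOb A) X H"
    and ob: "\<And>a. a \<in> VOb A \<Longrightarrow> X a \<in> VOb B"
    and hom: "\<And>a b. \<lbrakk>a \<in> VOb A; b \<in> VOb A\<rbrakk> \<Longrightarrow> H a b \<in> Ar V \<and> Dom V (H a b) = VHom A a b \<and> Cod V (H a b) = VHom B (X a) (X b)"
    and ide: "\<And>a. a \<in> VOb A \<Longrightarrow> F \<star> gid A a = gid B (FOb F a)"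
    and cmp: "\<And>g f. \<lbrakk>gok A g; gok A f; sr g = tg f; gc g \<inter> gc f = {}\<rbrakk> \<Longrightarrow> F \<star> (g \<bullet>\<^bsub>A\<^esub> f) = (F \<star> g) \<bullet>\<^bsub>B\<^esub> (F \<star> f)"
  shows "vfunctor A B F"
proof -
  have [simp]: "FOb F a = X a" if "a \<in> VOb A" for a using that by (simp add: F mk_vfun_def)
  have [simp]: "FHom F a b = H a b" if "a \<in> VOb A" "b \<in> VOb A" for a b using that by (simp add: F mk_vfun_def)
  have 0: "F = mk_vfun (VOb A) (FOb F) (FHom F)" unfolding F by (auto simp: mk_vfun_def fun_eq_iff)
  have 1: "FHom F a a \<cdot> VId A a = VId B (FOb F a)" if "a \<in> VOb A" for a
    by (rule arr_ext[of _ un]) (use ide[OF that] that ob hom in \<open>auto simp: gmp_def gid_def\<close>)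
  have 2: "FHom F a c \<cdot> VComp A a b c
        = VComp B (FOb F a) (FOb F b) (FOb F c) \<cdot> (FHom F b c \<odot> FHom F a b)"
    if "a \<in> VOb A" "b \<in> VOb A" "c \<in> VOb A" for a b c
    by (rule arr_ext[of _ "gen 0 (VHom A b c) \<bowtie> gen 1 (VHom A a b)"])
      (use cmp[of "(b, c, gen 0 (VHom A b c))" "(a, b, gen 1 (VHom A a b))"] that ob hom in \<open>auto simp: gmp_def gcmp_def gok_def\<close>)
  show ?thesis unfolding vfunctor_def in_hom_def using cat 0 1 2 ob hom by simp
qed

lemma mk_vfun_simps [simp]: "a \<in> S \<Longrightarrow> FOb (mk_vfun S X H) a = X a"
  "\<lbrakk>a \<in> S; b \<in> S\<rbrakk> \<Longrightarrow> FHom (mk_vfun S X H) a b = H a b"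
  by (simp_all add: mk_vfun_def)

lemma vfun_eta: "vfunctor A B F \<Longrightarrow> mk_vfun (VOb A) (FOb F) (FHom F) = F"
  by (simp add: vfunctor_def)

lemma mk_vfun_cong: "\<lbrakk>\<And>a. a \<in> S \<Longrightarrow> X a = Y a; \<And>a b. \<lbrakk>a \<in> S; b \<in> S\<rbrakk> \<Longrightarrow> H a b = K a b\<rbrakk> \<Longrightarrow> mk_vfun S X H = mk_vfun S Y K"
  by (auto simp: mk_vfun_def fun_eq_iff)

text \<open>Functors are stored in the normal form of \<open>mk_vfun\<close>, so agreement on
  objects and graded arrows is equality of records. This is what later allows faces to be compared
  by equality.\<close>

lemma vfun_eqI:
  assumes "vfunctor A B F" "vfunctor A B G" "\<And>a. a \<in> VOb A \<Longrightarrow> FOb F a = FOb G a"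
    "\<And>e. gok A e \<Longrightarrow> F \<star> e = G \<star> e"
  shows "F = G"
proof -
  have "FHom F a b = FHom G a b" if "a \<in> VOb A" "b \<in> VOb A" for a b
    by (rule arr_ext[of _ "gen 0 (VHom A a b)"])
      (use assms(4)[of "(a, b, gen 0 (VHom A a b))"] assms(1-3) vfun_cat(1)[OF assms(1)] that in \<open>auto simp: gmp_def gok_def\<close>)
  then have "mk_vfun (VOb A) (FOb F) (FHom F) = mk_vfun (VOb A) (FOb G) (FHom G)"
    using assms(3) by (intro mk_vfun_cong)
  then show ?thesis using vfun_eta[OF assms(1)] vfun_eta[OF assms(2)] by simp
qed

lemma vcomp_functor:
  assumes "vfunctor A B F" "vfunctor B C G"
  shows "vfunctor A C (vcomp A G F)"
proof -
  note c = vfun_cat[OF assms(1)] vfun_cat[OF assms(2)]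
  have mp: "vcomp A G F \<star> e = G \<star> (F \<star> e)" if "gok A e" for e
    using that assms c by (simp add: vcomp_def gmp_def gok_def)
  show ?thesis
  proof (rule vfunctorI[OF c(1) c(4) vcomp_def])
    fix g f assume "gok A g" "gok A f" "sr g = tg f" "gc g \<inter> gc f = {}"
    then show "vcomp A G F \<star> (g \<bullet>\<^bsub>A\<^esub> f) = (vcomp A G F \<star> g) \<bullet>\<^bsub>C\<^esub> (vcomp A G F \<star> f)"
      using assms c by (simp add: mp gmp_cmp)
  next
    fix a assume "a \<in> VOb A"
    then show "vcomp A G F \<star> gid A a = gid C (FOb (vcomp A G F) a)" using assms c by (simp add: mp) (simp add: vcomp_def)
  qed (use assms c in auto)
qed

lemma vcomp_mp: "\<lbrakk>vfunctor A B F; vfunctor B C G; gok A e\<rbrakk> \<Longrightarrow> vcomp A G F \<star> e = G \<star> (F \<star> e)"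
  using vfun_cat(1)[of A B F] by (simp add: vcomp_def gmp_def gok_def)

lemma vcomp_FOb [simp]: "a \<in> VOb A \<Longrightarrow> FOb (vcomp A G F) a = FOb G (FOb F a)"
  by (simp add: vcomp_def)

section \<open>Isomorphisms and natural transformations\<close>

definition ginv :: "('c, 'o, 'm, 'z) vcat_scheme \<Rightarrow> ('c, 'o, 'm) gr \<Rightarrow> ('c, 'o, 'm) gr \<Rightarrow> bool" where
  "ginv C f g \<longleftrightarrow> gok C f \<and> gok C g \<and> gc f = {} \<and> gc g = {} \<and> sr g = tg f \<and> tg g = sr f \<and>
     g \<bullet>\<^bsub>C\<^esub> f = gid C (sr f) \<and> f \<bullet>\<^bsub>C\<^esub> g = gid C (tg f)"

lemma ginvD:
  assumes "ginv C f g"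
  shows "gok C f" "gok C g" "gc f = {}" "gc g = {}" "sr g = tg f" "tg g = sr f"
    "g \<bullet>\<^bsub>C\<^esub> f = gid C (sr f)" "f \<bullet>\<^bsub>C\<^esub> g = gid C (tg f)"
  using assms by (auto simp: ginv_def)

lemma ginv_sym: "ginv C f g \<Longrightarrow> ginv C g f"
  by (auto simp: ginv_def)

lemma ginv_cancel:
  assumes "vcategory C" "ginv C f g" "gok C h" "tg h = sr f"
  shows "g \<bullet>\<^bsub>C\<^esub> (f \<bullet>\<^bsub>C\<^esub> h) = h"
  using assms by (subst gcmp_assoc[symmetric]) (auto simp: ginv_def)

lemma ginv_cancel':
  assumes "vcategory C" "ginv C f g" "gok C h" "tg h = tg f"
  shows "f \<bullet>\<^bsub>C\<^esub> (g \<bullet>\<^bsub>C\<^esub> h) = h"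
  using ginv_cancel[OF assms(1) ginv_sym[OF assms(2)] assms(3)] assms by (simp add: ginv_def)

lemma ginv_mp: "\<lbrakk>vfunctor A B F; ginv A f g\<rbrakk> \<Longrightarrow> ginv B (F \<star> f) (F \<star> g)"
  by (auto simp: ginv_def gmp_cmp[symmetric] gok_D(1,2))

text \<open>The arrows of the underlying ordinary category are the graded arrows of empty context.\<close>

lemma gok_empty: "gok C (a, b, ({}, f)) \<longleftrightarrow> a \<in> VOb C \<and> b \<in> VOb C \<and> \<guillemotleft>f : \<I> \<rightarrow> VHom C a b\<guillemotright>"
  by (auto simp: gok_def okel_def ty_def in_hom_def)

lemma gr_empty_eta: "gc e = {} \<Longrightarrow> (sr e, tg e, ({}, snd (ge e))) = e"
  by (simp add: sr_def tg_def ge_def gc_def ct_def prod_eq_iff)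

lemma ucomp_gcmp: "(a, b, f) = (a, b, f) \<Longrightarrow> (b, d, ({}, g)) \<bullet>\<^bsub>C\<^esub> (a, b, ({}, f)) = (a, d, ({}, ucomp C a b d g f))"
  by (simp add: gcmp_def ucomp_def app_def ten_def mrg_empty)

lemma gid_VId: "\<lbrakk>vcategory C; a \<in> VOb C\<rbrakk> \<Longrightarrow> gid C a = (a, a, ({}, VId C a))"
  by (simp add: gid_def app_def un_def)

lemma uiso_ginv: assumes "vcategory C" "a \<in> VOb C" "b \<in> VOb C"
  shows "uiso C a b f \<longleftrightarrow> (\<exists>g. ginv C (a, b, ({}, f)) (b, a, ({}, g)))"
  using assms
  by (auto simp: uiso_def ginv_def gok_empty ucomp_gcmp gid_VId ct_def in_hom_def)

lemma ginv_uiso: assumes "vcategory C" "ginv C f g" shows "uiso C (sr f) (tg f) (snd (ge f))"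
proof -
  note g = ginvD[OF assms(2)]
  have "(sr f, tg f, ({}, snd (ge f))) = f" "(tg f, sr f, ({}, snd (ge g))) = g"
    using gr_empty_eta[OF g(3)] gr_empty_eta[OF g(4)] g(5,6) by simp_all
  then have "ginv C (sr f, tg f, ({}, snd (ge f))) (tg f, sr f, ({}, snd (ge g)))" using assms(2) by simp
  then show ?thesis using assms(1) g(1) uiso_ginv[of C "sr f" "tg f"] gok_D(1,2)[of C f] by blast
qed

text \<open>An arrow out of \<open>\<I>\<close> is a graded arrow of empty context. The inverse
  unitors in the naturality square only introduce the unit element, so they disappear in this
  formulation.\<close>

lemma vnatural_gr:
  assumes "vfunctor A B F" "vfunctor A B G"
  shows "vnatural A B F G \<alpha> \<longleftrightarrow> (\<forall>a\<in>VOb A. \<guillemotleft>\<alpha> a : \<I> \<rightarrow> VHom B (FOb F a) (FOb G a)\<guillemotright>) \<and>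
     (\<forall>e. gok A e \<longrightarrow> (FOb F (tg e), FOb G (tg e), ({}, \<alpha> (tg e))) \<bullet>\<^bsub>B\<^esub> (F \<star> e)
        = (G \<star> e) \<bullet>\<^bsub>B\<^esub> (FOb F (sr e), FOb G (sr e), ({}, \<alpha> (sr e))))" (is "_ \<longleftrightarrow> ?t \<and> ?n")
proof (cases ?t)
  case True
  note [simp] = vfun_cat[OF assms(1)]
  have [simp]: "\<alpha> a \<in> Ar V" "Dom V (\<alpha> a) = \<I>" "Cod V (\<alpha> a) = VHom B (FOb F a) (FOb G a)" if "a \<in> VOb A" for a
    using True that by (auto simp: in_hom_def)
  have e: "({}, \<alpha> a) = \<alpha> a \<triangleright> un" if "a \<in> VOb A" for a using that by (simp add: app_def un_def)
  let ?l = "\<lambda>a b. VComp B (FOb F a) (FOb F b) (FOb G b) \<cdot> (\<alpha> b \<odot> FHom F a b) \<cdot> inv_arr V (Lun V (VHom A a b))"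
  let ?r = "\<lambda>a b. VComp B (FOb F a) (FOb G a) (FOb G b) \<cdot> (FHom G a b \<odot> \<alpha> a) \<cdot> inv_arr V (Run V (VHom A a b))"
  have l: "(FOb F (tg e), FOb G (tg e), ({}, \<alpha> (tg e))) \<bullet>\<^bsub>B\<^esub> (F \<star> e) = (FOb F (sr e), FOb G (tg e), ?l (sr e) (tg e) \<triangleright> ge e)"
    if "gok A e" for e using that assms by (simp add: gcmp_def gmp_def e gok_def)
  have r: "(G \<star> e) \<bullet>\<^bsub>B\<^esub> (FOb F (sr e), FOb G (sr e), ({}, \<alpha> (sr e))) = (FOb F (sr e), FOb G (tg e), ?r (sr e) (tg e) \<triangleright> ge e)"
    if "gok A e" for e using that assms by (simp add: gcmp_def gmp_def e gok_def)
  \<comment> \<open>Equality at one generic element of the hom-object gives equality of arrows, so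
    quantifying over all graded arrows is the same condition.\<close>
  have lr: "?l a b = ?r a b \<longleftrightarrow> (\<forall>e. gok A e \<longrightarrow> sr e = a \<longrightarrow> tg e = b \<longrightarrow> ?l a b \<triangleright> ge e = ?r a b \<triangleright> ge e)"
    if ab: "a \<in> VOb A" "b \<in> VOb A" for a b
  proof (intro iffI allI impI)
    assume "\<forall>e. gok A e \<longrightarrow> sr e = a \<longrightarrow> tg e = b \<longrightarrow> ?l a b \<triangleright> ge e = ?r a b \<triangleright> ge e"
    from this[rule_format, of "(a, b, gen 0 (VHom A a b))"] show "?l a b = ?r a b"
      by (rule arr_ext[OF _]) (use ab assms in \<open>auto simp: gok_def\<close>)
  qed simp
  have "(\<forall>a\<in>VOb A. \<forall>b\<in>VOb A. ?l a b = ?r a b) \<longleftrightarrow> ?n"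
  proof (intro iffI allI impI ballI)
    fix e assume *: "\<forall>a\<in>VOb A. \<forall>b\<in>VOb A. ?l a b = ?r a b" and e: "gok A e"
    have "?l (sr e) (tg e) = ?r (sr e) (tg e)" using * gok_D(1,2)[OF e] by blast
    then show "(FOb F (tg e), FOb G (tg e), ({}, \<alpha> (tg e))) \<bullet>\<^bsub>B\<^esub> (F \<star> e)
        = (G \<star> e) \<bullet>\<^bsub>B\<^esub> (FOb F (sr e), FOb G (sr e), ({}, \<alpha> (sr e)))"
      unfolding l[OF e] r[OF e] by simp
  next
    fix a b assume n: ?n and ab: "a \<in> VOb A" "b \<in> VOb A"
    show "?l a b = ?r a b"
    proof (rule lr[OF ab, THEN iffD2], intro allI impI)
      fix e assume e: "gok A e" "sr e = a" "tg e = b"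
      show "?l a b \<triangleright> ge e = ?r a b \<triangleright> ge e"
        using n[rule_format, OF e(1)] unfolding l[OF e(1)] r[OF e(1)] by (simp add: e(2,3))
    qed
  qed
  then show ?thesis unfolding vnatural_def by blast
next
  case False
  then show ?thesis unfolding vnatural_def by blast
qed

declare gok_D(1,2) [simp]

lemma gok_tuple [simp]: "gok C (a, b, x) \<longleftrightarrow> a \<in> VOb C \<and> b \<in> VOb C \<and> okel x \<and> ty x = VHom C a b"
  by (simp add: gok_def)

lemma ex1_eqD: "\<exists>!x. P x \<Longrightarrow> P a \<Longrightarrow> P b \<Longrightarrow> a = b"
  by blast

lemma app_collapse:
  "\<lbrakk>g \<cdot> f = k; f \<in> Ar V; g \<in> Ar V; okel x; Dom V g = Cod V f; Dom V f = ty x\<rbrakk> \<Longrightarrow> g \<triangleright> f \<triangleright> x = k \<triangleright> x"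
  by (metis app_Cmp)

lemma gmp_tuple: "F \<star> (a, b, x) = (FOb F a, FOb F b, FHom F a b \<triangleright> x)"
  by (simp add: gmp_def)

lemma gcmp_tuple: "(b, c, y) \<bullet>\<^bsub>C\<^esub> (a, b, x) = (a, c, VComp C a b c \<triangleright> (y \<bowtie> x))"
  by (simp add: gcmp_def)

section \<open>Functor categories\<close>

lemma wedge_typ:
  assumes "wedge A B F G X \<mu>"
  shows "X \<in> Ob V" "\<And>a. a \<in> VOb A \<Longrightarrow> \<mu> a \<in> Ar V" "\<And>a. a \<in> VOb A \<Longrightarrow> Dom V (\<mu> a) = X"
    "\<And>a. a \<in> VOb A \<Longrightarrow> Cod V (\<mu> a) = VHom B (FOb F a) (FOb G a)"
  using assms by (auto simp: wedge_def in_hom_def)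

lemma wedge_gr:
  assumes F: "vfunctor A B F" "vfunctor A B G" and w: "wedge A B F G X \<mu>"
    and e: "gok A e" and x: "okel x" "ty x = X" "gc e \<inter> ct x = {}"
  shows "(G \<star> e) \<bullet>\<^bsub>B\<^esub> (FOb F (sr e), FOb G (sr e), \<mu> (sr e) \<triangleright> x)
     = (FOb F (tg e), FOb G (tg e), \<mu> (tg e) \<triangleright> x) \<bullet>\<^bsub>B\<^esub> (F \<star> e)"
proof -
  note [simp] = wedge_typ[OF w] vfun_cat[OF F(1)]
  have ob: "sr e \<in> VOb A" "tg e \<in> VOb A" using e by auto
  have "(VComp B (FOb F (sr e)) (FOb G (sr e)) (FOb G (tg e)) \<cdot> (FHom G (sr e) (tg e) \<odot> \<mu> (sr e))) \<triangleright> (ge e \<bowtie> x)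
    = (VComp B (FOb F (sr e)) (FOb F (tg e)) (FOb G (tg e)) \<cdot> (\<mu> (tg e) \<odot> FHom F (sr e) (tg e)) \<cdot> Sym V (VHom A (sr e) (tg e)) X) \<triangleright> (ge e \<bowtie> x)"
    using w ob unfolding wedge_def by metis
  then show ?thesis using e x ob F by (simp add: gcmp_def gmp_def gok_D Int_commute)
qed

text \<open>\<open>K\<close> collects names that the test arrow \<open>e\<close> may be assumed to
  avoid, for callers whose family was built with auxiliary variables. The proof tests each
  hom-object at one fresh generic element, so excluding finitely many names is harmless.\<close>

lemma wedgeI_gr:
  assumes F: "vfunctor A B F" "vfunctor A B G"
    and x: "isoel x" "ty x = X" and K: "okctx K"
    and t0: "\<And>a. a \<in> VOb A \<Longrightarrow> \<mu> a \<in> Ar V \<and> Dom V (\<mu> a) = X \<and> Cod V (\<mu> a) = VHom B (FOb F a) (FOb G a)"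
    and nat: "\<And>e. \<lbrakk>gok A e; gc e \<inter> ct x = {}; gc e \<inter> K = {}\<rbrakk> \<Longrightarrow> (G \<star> e) \<bullet>\<^bsub>B\<^esub> (FOb F (sr e), FOb G (sr e), \<mu> (sr e) \<triangleright> x)
     = (FOb F (tg e), FOb G (tg e), \<mu> (tg e) \<triangleright> x) \<bullet>\<^bsub>B\<^esub> (F \<star> e)"
  shows "wedge A B F G X \<mu>"
proof -
  note [simp] = vfun_cat[OF F(1)]
  have X [simp]: "X \<in> Ob V" using x ty_Ob by auto
  have "VComp B (FOb F a) (FOb G a) (FOb G b) \<cdot> (FHom G a b \<odot> \<mu> a)
        = VComp B (FOb F a) (FOb F b) (FOb G b) \<cdot> (\<mu> b \<odot> FHom F a b) \<cdot> Sym V (VHom A a b) X"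
    if ab: "a \<in> VOb A" "b \<in> VOb A" for a b
  proof -
    have "okctx (ct x \<union> K)" "VHom A a b \<in> Ob V" using x K ab by simp_all
    then obtain q where q: "isoel q" "ty q = VHom A a b" "ct q \<inter> (ct x \<union> K) = {}" using fresh_gen by metis
    then have d: "ct q \<inter> ct x = {}" "ct q \<inter> K = {}" by auto
    show ?thesis
      by (rule arr_ext[of _ "q \<bowtie> x"])
        (use nat[of "(a, b, q)"] q d x ab F t0 in \<open>auto simp: gcmp_def gmp_def Int_commute\<close>)
  qed
  then show ?thesis using t0 unfolding wedge_def in_hom_def by simp
qed

definition fcat :: "('a, 'o, 'm, 'y) vcat_scheme \<Rightarrow> ('b, 'o, 'm, 'z) vcat_scheme \<Rightarrow> ('a, 'b, 'm) vfun set \<Rightarrow> bool" where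
  "fcat A B S \<longleftrightarrow> vcategory A \<and> vcategory B \<and> fun_cat_exists A B S \<and> (\<forall>F\<in>S. vfunctor A B F)"

lemma fcatD:
  assumes "fcat A B S" shows "vcategory A" "vcategory B" "F \<in> S \<Longrightarrow> vfunctor A B F"
    "\<lbrakk>F \<in> S; G \<in> S\<rbrakk> \<Longrightarrow> is_end A B F G (nat_ob A B F G) (nat_pr A B F G)"
proof -
  show "vcategory A" "vcategory B" "F \<in> S \<Longrightarrow> vfunctor A B F" using assms by (auto simp: fcat_def)
  assume "F \<in> S" "G \<in> S"
  then have "\<exists>p. case p of (E, \<pi>) \<Rightarrow> is_end A B F G E \<pi>"
    using assms by (auto simp: fcat_def fun_cat_exists_def has_end_def)
  from someI_ex[OF this] show "is_end A B F G (nat_ob A B F G) (nat_pr A B F G)"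
    by (simp add: nat_ob_def nat_pr_def chosen_end_def case_prod_unfold)
qed

lemma nat_pr_typ:
  assumes "fcat A B S" "F \<in> S" "G \<in> S"
  shows "nat_ob A B F G \<in> Ob V" "a \<in> VOb A \<Longrightarrow> nat_pr A B F G a \<in> Ar V"
    "a \<in> VOb A \<Longrightarrow> Dom V (nat_pr A B F G a) = nat_ob A B F G"
    "a \<in> VOb A \<Longrightarrow> Cod V (nat_pr A B F G a) = VHom B (FOb F a) (FOb G a)"
  using fcatD(4)[OF assms] wedge_typ[of A B F G] by (auto simp: is_end_def)

lemma nat_lift:
  assumes "fcat A B S" "F \<in> S" "G \<in> S" "wedge A B F G X \<mu>"
  shows "nat_lift A B F G X \<mu> \<in> Ar V" "Dom V (nat_lift A B F G X \<mu>) = X"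
    "Cod V (nat_lift A B F G X \<mu>) = nat_ob A B F G"
    "a \<in> VOb A \<Longrightarrow> nat_pr A B F G a \<cdot> nat_lift A B F G X \<mu> = \<mu> a"
proof -
  have "\<exists>!h. \<guillemotleft>h : X \<rightarrow> nat_ob A B F G\<guillemotright> \<and> (\<forall>a\<in>VOb A. nat_pr A B F G a \<cdot> h = \<mu> a)"
    using fcatD(4)[OF assms(1-3)] assms(4) unfolding is_end_def by blast
  from theI'[OF this] show "nat_lift A B F G X \<mu> \<in> Ar V" "Dom V (nat_lift A B F G X \<mu>) = X"
    "Cod V (nat_lift A B F G X \<mu>) = nat_ob A B F G"
    "a \<in> VOb A \<Longrightarrow> nat_pr A B F G a \<cdot> nat_lift A B F G X \<mu> = \<mu> a"
    unfolding nat_lift_def in_hom_def by auto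
qed

text \<open>A graded arrow of the functor category is a transformation depending on a context; this
  is its component at \<open>a\<close>, and it keeps that context.\<close>

definition cmpt :: "('a, 'o, 'm, 'y) vcat_scheme \<Rightarrow> ('b, 'o, 'm, 'z) vcat_scheme \<Rightarrow> 'a
  \<Rightarrow> ('a, 'b, 'm) vfun \<times> ('a, 'b, 'm) vfun \<times> ('o, 'm) el \<Rightarrow> ('b, 'o, 'm) gr" where
  "cmpt A B a p = (FOb (sr p) a, FOb (tg p) a, nat_pr A B (sr p) (tg p) a \<triangleright> ge p)"

lemma cmpt_simps [simp]: "sr (cmpt A B a p) = FOb (sr p) a" "tg (cmpt A B a p) = FOb (tg p) a" "gc (cmpt A B a p) = gc p"
  by (simp_all add: cmpt_def)

lemma fun_cat_simps [simp]: "VOb (fun_cat A B S) = S" "VHom (fun_cat A B S) = nat_ob A B"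
  by (simp_all add: fun_cat_def)

lemma gok_cmpt [simp]: assumes "fcat A B S" "gok (fun_cat A B S) p" "a \<in> VOb A" shows "gok B (cmpt A B a p)"
  using gok_D[OF assms(2)] vfun_typ(1)[OF fcatD(3)[OF assms(1)]] nat_pr_typ[OF assms(1)] assms(3)
  by (simp add: cmpt_def)

lemma cmpt_nat:
  assumes "fcat A B S" "gok (fun_cat A B S) p" "gok A e" "gc e \<inter> gc p = {}"
  shows "(tg p \<star> e) \<bullet>\<^bsub>B\<^esub> cmpt A B (sr e) p = cmpt A B (tg e) p \<bullet>\<^bsub>B\<^esub> (sr p \<star> e)"
  unfolding cmpt_def
  by (rule wedge_gr) (use gok_D[OF assms(2)] fcatD[OF assms(1)] assms in \<open>auto simp: is_end_def\<close>)

text \<open>The projections of an end are jointly monic: the components of \<open>p\<close> form a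
  wedge out of the denotation of its context, and both arrows are factorisations of that
  wedge.\<close>

lemma cmpt_ext:
  assumes "fcat A B S" "gok (fun_cat A B S) p" "gok (fun_cat A B S) p'" "sr p = sr p'" "tg p = tg p'" "gc p = gc p'"
    and c: "\<And>a. a \<in> VOb A \<Longrightarrow> cmpt A B a p = cmpt A B a p'"
  shows "p = p'"
proof -
  let ?F = "sr p" and ?G = "tg p" let ?X = "den (gc p)" let ?\<mu> = "\<lambda>a. nat_pr A B ?F ?G a \<cdot> snd (ge p)"
  note p = gok_D[OF assms(2), simplified] note p' = gok_D[OF assms(3), simplified]
  note funs = fcatD(3)[OF assms(1) p(1)] fcatD(3)[OF assms(1) p(2)]
  note t [simp] = nat_pr_typ[OF assms(1) p(1,2)]
  have id: "(nat_pr A B ?F ?G a \<cdot> snd (ge p)) \<triangleright> idc (gc p) = nat_pr A B ?F ?G a \<triangleright> ge p" if "a \<in> VOb A" for a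
    using p el_idc[of "ge p"] that by simp
  have "wedge A B ?F ?G ?X ?\<mu>"
    by (rule wedgeI_gr[OF funs, of "idc (gc p)" _ "{}"])
      (use p id cmpt_nat[OF assms(1,2)] in \<open>auto simp: cmpt_def Int_commute simp del: app_Cmp\<close>)
  then have ex1: "\<exists>!h. \<guillemotleft>h : ?X \<rightarrow> nat_ob A B ?F ?G\<guillemotright> \<and> (\<forall>a\<in>VOb A. nat_pr A B ?F ?G a \<cdot> h = ?\<mu> a)"
    using fcatD(4)[OF assms(1) p(1,2)] unfolding is_end_def by blast
  moreover have "\<guillemotleft>snd (ge p) : ?X \<rightarrow> nat_ob A B ?F ?G\<guillemotright>" "\<guillemotleft>snd (ge p') : ?X \<rightarrow> nat_ob A B ?F ?G\<guillemotright>"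
    using p p' assms(4-6) by (auto simp: in_hom_def)
  moreover have "nat_pr A B ?F ?G a \<cdot> snd (ge p') = ?\<mu> a" if "a \<in> VOb A" for a
    using c[OF that] assms(4,5) by (simp add: cmpt_def app_def)
  ultimately have "snd (ge p) = snd (ge p')" by (intro ex1_eqD[OF ex1]) simp_all
  then show ?thesis using assms(4-6) by (intro gr_eqI el_eqI) auto
qed

text \<open>The existence half of the universal property of the end, for families over a context.
  The names in \<open>K\<close> are handed on to \<open>wedgeI_gr\<close>.\<close>

lemma cmpt_ex:
  assumes "fcat A B S" "F \<in> S" "G \<in> S" "okctx Q" "okctx K"
    and m: "\<And>a. a \<in> VOb A \<Longrightarrow> gok B (m a) \<and> sr (m a) = FOb F a \<and> tg (m a) = FOb G a \<and> gc (m a) = Q"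
    and nat: "\<And>e. \<lbrakk>gok A e; gc e \<inter> Q = {}; gc e \<inter> K = {}\<rbrakk> \<Longrightarrow> (G \<star> e) \<bullet>\<^bsub>B\<^esub> m (sr e) = m (tg e) \<bullet>\<^bsub>B\<^esub> (F \<star> e)"
  obtains p where "gok (fun_cat A B S) p" "sr p = F" "tg p = G" "gc p = Q" "\<And>a. a \<in> VOb A \<Longrightarrow> cmpt A B a p = m a"
proof -
  let ?\<mu> = "\<lambda>a. snd (ge (m a))"
  have id: "(FOb F a, FOb G a, ?\<mu> a \<triangleright> idc Q) = m a" if "a \<in> VOb A" for a
    using m[OF that] el_idc[of "ge (m a)"] gok_D(3)[of B "m a"] by (intro gr_eqI) auto
  have mt: "?\<mu> a \<in> Ar V \<and> Dom V (?\<mu> a) = den Q \<and> Cod V (?\<mu> a) = VHom B (FOb F a) (FOb G a)" if "a \<in> VOb A" for a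
    using m[OF that] gok_D(3,4)[of B "m a"] by simp
  \<comment> \<open>Each \<open>m a\<close> is its underlying arrow applied to the universal element
    of \<open>Q\<close>, so the family amounts to a wedge out of \<open>den Q\<close>.\<close>
  have w: "wedge A B F G (den Q) ?\<mu>"
    by (rule wedgeI_gr[OF fcatD(3)[OF assms(1,2)] fcatD(3)[OF assms(1,3)], of "idc Q" _ K])
      (use assms(4,5) mt id nat in auto)
  note l = nat_lift[OF assms(1-3) w]
  let ?h = "nat_lift A B F G (den Q) ?\<mu>"
  show thesis
  proof (rule that[of "(F, G, ?h \<triangleright> idc Q)"])
    fix a assume a: "a \<in> VOb A"
    have "nat_pr A B F G a \<triangleright> ?h \<triangleright> idc Q = ?\<mu> a \<triangleright> idc Q"
      by (rule app_collapse[OF l(4)[OF a]]) (use l(1-3) nat_pr_typ[OF assms(1-3)] assms(4) a in auto)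
    then show "cmpt A B a (F, G, ?h \<triangleright> idc Q) = m a"
      using id[OF a] by (simp add: cmpt_def)
  qed (use l assms in auto)
qed

lemma fun_cat_VId:
  assumes S: "fcat A B S" and F: "F \<in> S"
  shows "wedge A B F F \<I> (\<lambda>a. VId B (FOb F a))"
proof -
  note f = fcatD(3)[OF S F] and c = fcatD(1,2)[OF S]
  have "(F \<star> e) \<bullet>\<^bsub>B\<^esub> gid B (FOb F (sr e)) = gid B (FOb F (tg e)) \<bullet>\<^bsub>B\<^esub> (F \<star> e)" if "gok A e" for e
    using that f c by (simp)
  then show ?thesis
    by (intro wedgeI_gr[OF f f, of un _ "{}"]) (use f c in \<open>auto simp: gid_def\<close>)
qed

text \<open>On \<open>?y \<bowtie> ?x\<close> the family is the composite of two components, and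
  naturality is the usual pasting of two naturality squares.\<close>

lemma fun_cat_VComp:
  assumes S: "fcat A B S" and F: "F \<in> S" "G \<in> S" "H \<in> S"
  shows "wedge A B F H (nat_ob A B G H \<otimes> nat_ob A B F G)
       (\<lambda>a. VComp B (FOb F a) (FOb G a) (FOb H a) \<cdot> (nat_pr A B G H a \<odot> nat_pr A B F G a))"
proof -
  note f = fcatD(3)[OF S F(1)] fcatD(3)[OF S F(2)] fcatD(3)[OF S F(3)] and c = fcatD(1,2)[OF S]
  note t = nat_pr_typ[OF S F(1,2)] nat_pr_typ[OF S F(2,3)]
  let ?y = "gen 0 (nat_ob A B G H)" and ?x = "gen 1 (nat_ob A B F G)"
  let ?q = "(G, H, ?y)" and ?p = "(F, G, ?x)"
  have ok: "gok (fun_cat A B S) ?q" "gok (fun_cat A B S) ?p" using F t by simp_all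
  have e: "(FOb F a, FOb H a, (VComp B (FOb F a) (FOb G a) (FOb H a) \<cdot> (nat_pr A B G H a \<odot> nat_pr A B F G a)) \<triangleright> (?y \<bowtie> ?x))
    = cmpt A B a ?q \<bullet>\<^bsub>B\<^esub> cmpt A B a ?p" if "a \<in> VOb A" for a
    using that f c t by (simp add: cmpt_def gcmp_def)
  have n: "(H \<star> e) \<bullet>\<^bsub>B\<^esub> (cmpt A B (sr e) ?q \<bullet>\<^bsub>B\<^esub> cmpt A B (sr e) ?p) = (cmpt A B (tg e) ?q \<bullet>\<^bsub>B\<^esub> cmpt A B (tg e) ?p) \<bullet>\<^bsub>B\<^esub> (F \<star> e)"
    if e: "gok A e" "gc e \<inter> ct (?y \<bowtie> ?x) = {}" for e
  proof -
    have d: "gc e \<inter> gc ?q = {}" "gc e \<inter> gc ?p = {}" "gc ?q \<inter> gc e = {}" "gc ?p \<inter> gc e = {}" "gc ?q \<inter> gc ?p = {}" using e(2) by auto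
    note k = gok_cmpt[OF S ok(1)] gok_cmpt[OF S ok(2)]
    have "(H \<star> e) \<bullet>\<^bsub>B\<^esub> (cmpt A B (sr e) ?q \<bullet>\<^bsub>B\<^esub> cmpt A B (sr e) ?p)
      = ((H \<star> e) \<bullet>\<^bsub>B\<^esub> cmpt A B (sr e) ?q) \<bullet>\<^bsub>B\<^esub> cmpt A B (sr e) ?p"
      using e(1) d c k f by (simp add: gcmp_assoc del: gr_simps(4))
    also have "\<dots> = (cmpt A B (tg e) ?q \<bullet>\<^bsub>B\<^esub> (G \<star> e)) \<bullet>\<^bsub>B\<^esub> cmpt A B (sr e) ?p"
      using cmpt_nat[OF S ok(1) e(1) d(1)] by simp
    also have "\<dots> = cmpt A B (tg e) ?q \<bullet>\<^bsub>B\<^esub> ((G \<star> e) \<bullet>\<^bsub>B\<^esub> cmpt A B (sr e) ?p)"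
      using e(1) d c k f by (simp add: gcmp_assoc del: gr_simps(4))
    also have "\<dots> = cmpt A B (tg e) ?q \<bullet>\<^bsub>B\<^esub> (cmpt A B (tg e) ?p \<bullet>\<^bsub>B\<^esub> (F \<star> e))"
      using cmpt_nat[OF S ok(2) e(1) d(2)] by simp
    also have "\<dots> = (cmpt A B (tg e) ?q \<bullet>\<^bsub>B\<^esub> cmpt A B (tg e) ?p) \<bullet>\<^bsub>B\<^esub> (F \<star> e)"
      using e(1) d c k f by (simp add: gcmp_assoc del: gr_simps(4))
    finally show ?thesis .
  qed
  show ?thesis
    by (rule wedgeI_gr[OF f(1) f(3), of "?y \<bowtie> ?x" _ "{}"])
      (use f c t e n in \<open>auto simp del: app_Cmp\<close>)
qed

lemma cmpt_cmp:
  assumes S: "fcat A B S" and g: "gok (fun_cat A B S) q" "gok (fun_cat A B S) p" "sr q = tg p" "gc q \<inter> gc p = {}"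
  shows "gok (fun_cat A B S) (q \<bullet>\<^bsub>fun_cat A B S\<^esub> p)"
    "a \<in> VOb A \<Longrightarrow> cmpt A B a (q \<bullet>\<^bsub>fun_cat A B S\<^esub> p) = cmpt A B a q \<bullet>\<^bsub>B\<^esub> cmpt A B a p"
proof -
  note q = gok_D[OF g(1), simplified] note p = gok_D[OF g(2), simplified]
  let ?F = "sr p" and ?G = "tg p" and ?H = "tg q"
  let ?\<mu> = "\<lambda>a. VComp B (FOb ?F a) (FOb ?G a) (FOb ?H a) \<cdot> (nat_pr A B ?G ?H a \<odot> nat_pr A B ?F ?G a)"
  let ?h = "nat_lift A B ?F ?H (nat_ob A B ?G ?H \<otimes> nat_ob A B ?F ?G) ?\<mu>"
  note l = nat_lift[OF S p(1) q(2) fun_cat_VComp[OF S p(1,2) q(2)]]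
  note f = fcatD(3)[OF S p(1)] fcatD(3)[OF S p(2)] fcatD(3)[OF S q(2)]
  note t = nat_pr_typ[OF S p(1,2)] nat_pr_typ[OF S p(2) q(2)] nat_pr_typ[OF S p(1) q(2)]
  have e: "q \<bullet>\<^bsub>fun_cat A B S\<^esub> p = (?F, ?H, ?h \<triangleright> (ge q \<bowtie> ge p))"
    by (simp add: gcmp_def fun_cat_def)
  show "gok (fun_cat A B S) (q \<bullet>\<^bsub>fun_cat A B S\<^esub> p)"
    unfolding e using l p q g(3,4) by simp
  assume a: "a \<in> VOb A"
  have "nat_pr A B ?F ?H a \<triangleright> ?h \<triangleright> (ge q \<bowtie> ge p) = ?\<mu> a \<triangleright> (ge q \<bowtie> ge p)"
    by (rule app_collapse[OF l(4)[OF a]]) (use l(1-3) p q g(3,4) t a in auto)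
  then show "cmpt A B a (q \<bullet>\<^bsub>fun_cat A B S\<^esub> p) = cmpt A B a q \<bullet>\<^bsub>B\<^esub> cmpt A B a p"
    unfolding e using p q g(3,4) t a f fcatD(2)[OF S] by (simp add: cmpt_def gcmp_def)
qed

lemma cmpt_id:
  assumes S: "fcat A B S" and F: "F \<in> S"
  shows "gok (fun_cat A B S) (gid (fun_cat A B S) F)"
    "a \<in> VOb A \<Longrightarrow> cmpt A B a (gid (fun_cat A B S) F) = gid B (FOb F a)"
proof -
  let ?h = "nat_lift A B F F \<I> (\<lambda>a. VId B (FOb F a))"
  note l = nat_lift[OF S F F fun_cat_VId[OF S F]]
  note t = nat_pr_typ[OF S F F]
  have e: "gid (fun_cat A B S) F = (F, F, ?h \<triangleright> un)" by (simp add: gid_def fun_cat_def)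
  show "gok (fun_cat A B S) (gid (fun_cat A B S) F)" unfolding e using l F by simp
  assume a: "a \<in> VOb A"
  have "nat_pr A B F F a \<triangleright> ?h \<triangleright> un = VId B (FOb F a) \<triangleright> un"
    by (rule app_collapse[OF l(4)[OF a]]) (use l(1-3) t a in auto)
  then show "cmpt A B a (gid (fun_cat A B S) F) = gid B (FOb F a)"
    unfolding e by (simp add: cmpt_def) (simp add: gid_def)
qed

text \<open>By \<open>cmpt_ext\<close> each law is compared on components, where it is the
  corresponding law of \<open>B\<close>.\<close>

lemma fun_cat_vcategory:
  assumes S: "fcat A B S"
  shows "vcategory (fun_cat A B S)"
proof (rule vcategoryI)
  let ?C = "fun_cat A B S"
  note c = fcatD(1,2)[OF S]
  fix f g h
  assume *: "gok ?C h" "gok ?C g" "gok ?C f" "sr h = tg g" "sr g = tg f" "gc h \<inter> gc g = {}" "gc h \<inter> gc f = {}" "gc g \<inter> gc f = {}"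
  then have d: "(gc h \<union> gc g) \<inter> gc f = {}" "gc h \<inter> (gc g \<union> gc f) = {}" by auto
  note hg = cmpt_cmp[OF S *(1,2,4,6)] and gf = cmpt_cmp[OF S *(2,3,5,8)]
  show "(h \<bullet>\<^bsub>?C\<^esub> g) \<bullet>\<^bsub>?C\<^esub> f = h \<bullet>\<^bsub>?C\<^esub> (g \<bullet>\<^bsub>?C\<^esub> f)"
  proof (rule cmpt_ext[OF S])
    fix a assume a: "a \<in> VOb A"
    show "cmpt A B a ((h \<bullet>\<^bsub>?C\<^esub> g) \<bullet>\<^bsub>?C\<^esub> f) = cmpt A B a (h \<bullet>\<^bsub>?C\<^esub> (g \<bullet>\<^bsub>?C\<^esub> f))"
      using cmpt_cmp(2)[OF S hg(1) *(3)] cmpt_cmp(2)[OF S *(1) gf(1)] hg(2) gf(2) a * d c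
        gok_cmpt[OF S *(1) a] gok_cmpt[OF S *(2) a] gok_cmpt[OF S *(3) a]
      by (simp add: gcmp_assoc)
  qed (use cmpt_cmp(1)[OF S hg(1) *(3)] cmpt_cmp(1)[OF S *(1) gf(1)] * d in auto)
next
  let ?C = "fun_cat A B S"
  note c = fcatD(1,2)[OF S]
  fix f assume f: "gok ?C f"
  note i = cmpt_id[OF S gok_D(1)[OF f, simplified]] cmpt_id[OF S gok_D(2)[OF f, simplified]]
  show "gid ?C (tg f) \<bullet>\<^bsub>?C\<^esub> f = f"
    by (rule cmpt_ext[OF S]) (use cmpt_cmp[OF S i(3) f] f i c gok_cmpt[OF S f] in auto)
  show "f \<bullet>\<^bsub>?C\<^esub> gid ?C (sr f) = f"
    by (rule cmpt_ext[OF S]) (use cmpt_cmp[OF S f i(1)] f i c gok_cmpt[OF S f] in auto)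
next
  fix F assume "F \<in> VOb (fun_cat A B S)"
  then show "\<guillemotleft>VId (fun_cat A B S) F : \<I> \<rightarrow> VHom (fun_cat A B S) F F\<guillemotright>"
    using nat_lift(1-3)[OF S _ _ fun_cat_VId[OF S]] by (simp add: fun_cat_def in_hom_def)
next
  fix F G H assume "F \<in> VOb (fun_cat A B S)" "G \<in> VOb (fun_cat A B S)" "H \<in> VOb (fun_cat A B S)"
  then show "\<guillemotleft>VComp (fun_cat A B S) F G H : VHom (fun_cat A B S) G H \<otimes> VHom (fun_cat A B S) F G \<rightarrow> VHom (fun_cat A B S) F H\<guillemotright>"
    using nat_lift(1-3)[OF S _ _ fun_cat_VComp[OF S]] by (simp add: fun_cat_def in_hom_def)
qed (use nat_pr_typ(1)[OF S] in simp)

lemma evaluation_mp: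
  assumes "gok (fun_cat A B S) p"
  shows "evaluation A B S a \<star> p = cmpt A B a p"
  using assms by (simp add: evaluation_def gmp_def cmpt_def gok_def)

lemma evaluation_vfunctor:
  assumes S: "fcat A B S" and a: "a \<in> VOb A"
  shows "vfunctor (fun_cat A B S) B (evaluation A B S a)"
proof (rule vfunctorI[OF fun_cat_vcategory[OF S] fcatD(2)[OF S]])
  show "evaluation A B S a = mk_vfun (VOb (fun_cat A B S)) (\<lambda>F. FOb F a) (\<lambda>F G. nat_pr A B F G a)"
    by (simp add: evaluation_def)
next
  fix F assume F: "F \<in> VOb (fun_cat A B S)"
  then show "evaluation A B S a \<star> gid (fun_cat A B S) F = gid B (FOb (evaluation A B S a) F)"
    using cmpt_id[OF S, of F] a by (simp add: evaluation_mp) (simp add: evaluation_def)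
next
  fix q p assume "gok (fun_cat A B S) q" "gok (fun_cat A B S) p" "sr q = tg p" "gc q \<inter> gc p = {}"
  then show "evaluation A B S a \<star> (q \<bullet>\<^bsub>fun_cat A B S\<^esub> p) = (evaluation A B S a \<star> q) \<bullet>\<^bsub>B\<^esub> (evaluation A B S a \<star> p)"
    using cmpt_cmp[OF S, of q p] a by (simp add: evaluation_mp)
qed (use nat_pr_typ[OF S] vfun_typ(1)[OF fcatD(3)[OF S]] a in auto)

section \<open>Cotensors\<close>

lemma curry_arr:
  assumes "x \<in> Ob V" "a \<in> Ob V" "b \<in> Ob V" "f \<in> Ar V" "Dom V f = x \<otimes> a" "Cod V f = b"
  shows "curry_arr x a b f \<in> Ar V" "Dom V (curry_arr x a b f) = x" "Cod V (curry_arr x a b f) = IHom V a b"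
    "Ev V a b \<cdot> (curry_arr x a b f \<odot> Idn V a) = f"
  using theI'[OF Ev_universal[of x a b f]] assms by (auto simp: in_hom_def curry_arr_def)

lemma app_curry:
  assumes "x \<in> Ob V" "a \<in> Ob V" "b \<in> Ob V" "f \<in> Ar V" "Dom V f = x \<otimes> a" "Cod V f = b"
    and "okel p" "okel q" "ct p \<inter> ct q = {}" "ty p = x" "ty q = a"
  shows "Ev V a b \<triangleright> ((curry_arr x a b f \<triangleright> p) \<bowtie> q) = f \<triangleright> (p \<bowtie> q)"
proof -
  note c = curry_arr[OF assms(1-6)]
  have "(Ev V a b \<cdot> (curry_arr x a b f \<odot> Idn V a)) \<triangleright> (p \<bowtie> q) = f \<triangleright> (p \<bowtie> q)" by (simp only: c(4))
  then show ?thesis using c(1-3) assms by simp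
qed

lemma Ev_unique:
  assumes "f \<in> Ar V" "g \<in> Ar V" "Dom V f = Dom V g" "Cod V f = IHom V a b" "Cod V g = IHom V a b" "a \<in> Ob V" "b \<in> Ob V"
    "Ev V a b \<cdot> (f \<odot> Idn V a) = Ev V a b \<cdot> (g \<odot> Idn V a)"
  shows "f = g"
  by (rule ex1_eqD[OF Ev_universal[of "Dom V f" a b "Ev V a b \<cdot> (g \<odot> Idn V a)"]])
    (use assms in \<open>auto simp: in_hom_def\<close>)

lemma IHom_ext:
  assumes "okel x" "okel y" "ct x = ct y" "ty x = IHom V a b" "ty y = IHom V a b" "b \<in> Ob V"
    "isoel q" "ty q = a" "ct x \<inter> ct q = {}" "Ev V a b \<triangleright> (x \<bowtie> q) = Ev V a b \<triangleright> (y \<bowtie> q)"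
  shows "x = y"
proof -
  have a: "a \<in> Ob V" using assms(7,8) ty_Ob by auto
  note s = el_idc[OF assms(1)] el_idc[OF assms(2)]
  have "snd x = snd y"
  proof (rule Ev_unique)
    show "Ev V a b \<cdot> (snd x \<odot> Idn V a) = Ev V a b \<cdot> (snd y \<odot> Idn V a)"
      by (rule arr_ext[of _ "idc (ct x) \<bowtie> q"]) (use s assms a in auto)
  qed (use assms a in auto)
  then show ?thesis using assms(3) by (rule el_eqI[rotated])
qed

text \<open>Yoneda: the transpose of \<open>\<beta>\<close> is invertible exactly when
  \<open>\<beta>\<close> has the universal property that characterises evaluation.\<close>

lemma curry_iso:
  assumes ob: "H \<in> Ob V" "j \<in> Ob V" "K \<in> Ob V" and b: "\<beta> \<in> Ar V" "Dom V \<beta> = H \<otimes> j" "Cod V \<beta> = K"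
  shows "is_iso V (curry_arr H j K \<beta>) \<longleftrightarrow>
    (\<forall>X\<in>Ob V. \<forall>\<phi>. \<phi> \<in> Ar V \<and> Dom V \<phi> = X \<otimes> j \<and> Cod V \<phi> = K \<longrightarrow>
       (\<exists>!h. h \<in> Ar V \<and> Dom V h = X \<and> Cod V h = H \<and> \<beta> \<cdot> (h \<odot> Idn V j) = \<phi>))"
proof -
  let ?k = "curry_arr H j K \<beta>"
  note k = curry_arr[OF ob b]
  have bh: "\<beta> \<cdot> (h \<odot> Idn V j) = Ev V j K \<cdot> ((?k \<cdot> h) \<odot> Idn V j)" if "h \<in> Ar V" "Cod V h = H" for h
  proof -
    have "\<beta> \<cdot> (h \<odot> Idn V j) = (Ev V j K \<cdot> (?k \<odot> Idn V j)) \<cdot> (h \<odot> Idn V j)" by (simp only: k(4))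
    also have "\<dots> = Ev V j K \<cdot> ((?k \<cdot> h) \<odot> Idn V j)" using that k(1-3) ob by (simp add: Cmp_assoc Ten_Cmp)
    finally show ?thesis .
  qed
  show ?thesis
  proof (intro iffI ballI allI impI)
    fix X \<phi> assume i: "is_iso V ?k" and X: "X \<in> Ob V" and "\<phi> \<in> Ar V \<and> Dom V \<phi> = X \<otimes> j \<and> Cod V \<phi> = K"
    then have p: "\<phi> \<in> Ar V" "Dom V \<phi> = X \<otimes> j" "Cod V \<phi> = K" by auto
    note c = curry_arr[OF X ob(2,3) p]
    show "\<exists>!h. h \<in> Ar V \<and> Dom V h = X \<and> Cod V h = H \<and> \<beta> \<cdot> (h \<odot> Idn V j) = \<phi>"
    proof (rule ex1I[of _ "inv_arr V ?k \<cdot> curry_arr X j K \<phi>"])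
      show "inv_arr V ?k \<cdot> curry_arr X j K \<phi> \<in> Ar V \<and> Dom V (inv_arr V ?k \<cdot> curry_arr X j K \<phi>) = X
        \<and> Cod V (inv_arr V ?k \<cdot> curry_arr X j K \<phi>) = H \<and> \<beta> \<cdot> ((inv_arr V ?k \<cdot> curry_arr X j K \<phi>) \<odot> Idn V j) = \<phi>"
        using i k(1-3) c by (simp add: bh)
      fix h assume h: "h \<in> Ar V \<and> Dom V h = X \<and> Cod V h = H \<and> \<beta> \<cdot> (h \<odot> Idn V j) = \<phi>"
      have "?k \<cdot> h = curry_arr X j K \<phi>"
        by (rule Ev_unique[of _ _ j K]) (use h bh[of h] k(1-3) c ob in auto)
      then show "h = inv_arr V ?k \<cdot> curry_arr X j K \<phi>"
        by (rule inv_solve) (use h i k(1-3) in auto)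
    qed
  next
    assume u: "\<forall>X\<in>Ob V. \<forall>\<phi>. \<phi> \<in> Ar V \<and> Dom V \<phi> = X \<otimes> j \<and> Cod V \<phi> = K \<longrightarrow>
       (\<exists>!h. h \<in> Ar V \<and> Dom V h = X \<and> Cod V h = H \<and> \<beta> \<cdot> (h \<odot> Idn V j) = \<phi>)"
    \<comment> \<open>Universality of \<open>\<beta>\<close>, applied to the evaluation itself,
      produces the candidate inverse.\<close>
    then obtain h where h: "h \<in> Ar V" "Dom V h = IHom V j K" "Cod V h = H" "\<beta> \<cdot> (h \<odot> Idn V j) = Ev V j K"
      using ob by (metis IHom_Ob str_typ(16,17,18))
    have 1: "?k \<cdot> h = Idn V (IHom V j K)"
      by (rule Ev_unique[of _ _ j K]) (use h bh[of h] k(1-3) ob in auto)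
    \<comment> \<open>Uniqueness for the arrow \<open>\<beta>\<close> itself will give the second
      inverse law.\<close>
    have u2: "\<exists>!h. h \<in> Ar V \<and> Dom V h = H \<and> Cod V h = H \<and> \<beta> \<cdot> (h \<odot> Idn V j) = \<beta>"
      using u[rule_format, of H \<beta>] b ob by blast
    have "?k \<cdot> (h \<cdot> ?k) = ?k"
      using 1 h k(1-3) by (simp flip: Cmp_assoc)
    then have "h \<cdot> ?k = Idn V H"
      by (intro ex1_eqD[OF u2]) (use h bh[of "h \<cdot> ?k"] k ob b in auto)
    then show "is_iso V ?k" using 1 h(1-3) k(1-3) by (intro is_isoI[of _ h]) auto
  qed
qed

section \<open>The universal property of cotensors on elements\<close>

lemma cotD:
  assumes "is_cotensor C j x e \<gamma>"
  shows "x \<in> VOb C" "e \<in> VOb C" "\<gamma> \<in> Ar V" "Dom V \<gamma> = j" "Cod V \<gamma> = VHom C e x" "j \<in> Ob V"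
  using assms by (auto simp: is_cotensor_def in_hom_def)

text \<open>This is \<open>curry_iso\<close> with the symmetry moved past \<open>h\<close>, so that
  the factorisation is phrased by the equation that also defines \<open>cot_lift\<close>.\<close>

lemma cot_iff:
  assumes C: "vcategory C" and x: "x \<in> VOb C" "e \<in> VOb C" and g: "\<gamma> \<in> Ar V" "Dom V \<gamma> = j" "Cod V \<gamma> = VHom C e x"
  shows "is_cotensor C j x e \<gamma> \<longleftrightarrow> (\<forall>z\<in>VOb C. \<forall>X\<in>Ob V. \<forall>\<phi>. \<phi> \<in> Ar V \<and> Dom V \<phi> = X \<otimes> j \<and> Cod V \<phi> = VHom C z x \<longrightarrow>
     (\<exists>!h. h \<in> Ar V \<and> Dom V h = X \<and> Cod V h = VHom C z e \<and> VComp C z e x \<cdot> (\<gamma> \<odot> h) \<cdot> Sym V X j = \<phi>))"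
proof -
  have j: "j \<in> Ob V" using g by auto
  have "is_iso V (curry_arr (VHom C z e) j (VHom C z x) (VComp C z e x \<cdot> (\<gamma> \<odot> Idn V (VHom C z e)) \<cdot> Sym V (VHom C z e) j))
    \<longleftrightarrow> (\<forall>X\<in>Ob V. \<forall>\<phi>. \<phi> \<in> Ar V \<and> Dom V \<phi> = X \<otimes> j \<and> Cod V \<phi> = VHom C z x \<longrightarrow>
     (\<exists>!h. h \<in> Ar V \<and> Dom V h = X \<and> Cod V h = VHom C z e \<and> VComp C z e x \<cdot> (\<gamma> \<odot> h) \<cdot> Sym V X j = \<phi>))"
    (is "is_iso V (curry_arr ?H j ?K ?b) \<longleftrightarrow> _") if z: "z \<in> VOb C" for z
  proof -
    have "?b \<cdot> (h \<odot> Idn V j) = VComp C z e x \<cdot> (\<gamma> \<odot> h) \<cdot> Sym V X j" if "h \<in> Ar V" "Dom V h = X" "Cod V h = ?H" for h X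
    proof -
      have "X \<in> Ob V" using that by auto
      then show ?thesis using that C x z g j by (simp add: Cmp_assoc Sym_nat[of h "Idn V j" X j] Ten_Cmp_assoc)
    qed
    then have e: "(h \<in> Ar V \<and> Dom V h = X \<and> Cod V h = ?H \<and> ?b \<cdot> (h \<odot> Idn V j) = \<phi>) \<longleftrightarrow>
      (h \<in> Ar V \<and> Dom V h = X \<and> Cod V h = VHom C z e \<and> VComp C z e x \<cdot> (\<gamma> \<odot> h) \<cdot> Sym V X j = \<phi>)" for h X \<phi>
      by metis
    show ?thesis unfolding e[symmetric]
      by (rule curry_iso) (use C x z g j in auto)
  qed
  then show ?thesis unfolding is_cotensor_def using x g by (simp add: in_hom_def)
qed

lemma cot_lift_arr:
  assumes C: "vcategory C" and c: "is_cotensor C j x e \<gamma>" and z: "z \<in> VOb C"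
    and X: "X \<in> Ob V" and p: "\<phi> \<in> Ar V" "Dom V \<phi> = X \<otimes> j" "Cod V \<phi> = VHom C z x"
  shows "cot_lift C j x e \<gamma> z X \<phi> \<in> Ar V" "Dom V (cot_lift C j x e \<gamma> z X \<phi>) = X"
    "Cod V (cot_lift C j x e \<gamma> z X \<phi>) = VHom C z e"
    "\<lbrakk>okel y; ty y = X; okel q; ty q = j; ct y \<inter> ct q = {}\<rbrakk> \<Longrightarrow>
      (e, x, \<gamma> \<triangleright> q) \<bullet>\<^bsub>C\<^esub> (z, e, cot_lift C j x e \<gamma> z X \<phi> \<triangleright> y) = (z, x, \<phi> \<triangleright> (y \<bowtie> q))"
proof -
  note g = cotD[OF c]
  let ?h = "cot_lift C j x e \<gamma> z X \<phi>"
  have "\<exists>!h. h \<in> Ar V \<and> Dom V h = X \<and> Cod V h = VHom C z e \<and> VComp C z e x \<cdot> (\<gamma> \<odot> h) \<cdot> Sym V X j = \<phi>"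
    using cot_iff[OF C g(1-5)] c z X p by blast
  then have "\<exists>!h. \<guillemotleft>h : X \<rightarrow> VHom C z e\<guillemotright> \<and> VComp C z e x \<cdot> (\<gamma> \<odot> h) \<cdot> Sym V X j = \<phi>"
    by (simp add: in_hom_def conj_assoc)
  from theI'[OF this] have h: "?h \<in> Ar V" "Dom V ?h = X" "Cod V ?h = VHom C z e" "VComp C z e x \<cdot> (\<gamma> \<odot> ?h) \<cdot> Sym V X j = \<phi>"
    unfolding cot_lift_def by (auto simp: in_hom_def)
  show "?h \<in> Ar V" "Dom V ?h = X" "Cod V ?h = VHom C z e" by (fact h)+
  assume y: "okel y" "ty y = X" "okel q" "ty q = j" "ct y \<inter> ct q = {}"
  have "(VComp C z e x \<cdot> (\<gamma> \<odot> ?h) \<cdot> Sym V X j) \<triangleright> (y \<bowtie> q) = \<phi> \<triangleright> (y \<bowtie> q)" by (simp only: h(4))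
  then show "(e, x, \<gamma> \<triangleright> q) \<bullet>\<^bsub>C\<^esub> (z, e, ?h \<triangleright> y) = (z, x, \<phi> \<triangleright> (y \<bowtie> q))"
    using h(1-3) g C X z y by (simp add: gcmp_tuple Int_commute)
qed

text \<open>Because \<open>q\<close> is generic, \<open>f\<close> is an arrow applied to
  \<open>idc S \<bowtie> q\<close>, and lifting that arrow yields a graded arrow over
  \<open>S\<close> alone. In effect the variable \<open>q\<close> is abstracted.\<close>

lemma cotensor_ex:
  assumes C: "vcategory C" and c: "is_cotensor C j x e \<gamma>" and q: "isoel q" "ty q = j" "S \<inter> ct q = {}" "okctx S"
    and f: "gok C f" "tg f = x" "gc f = S \<union> ct q"
  obtains h where "gok C h" "sr h = sr f" "tg h = e" "gc h = S" "(e, x, \<gamma> \<triangleright> q) \<bullet>\<^bsub>C\<^esub> h = f"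
proof -
  note g = cotD[OF c] note f' = gok_D[OF f(1)]
  obtain \<phi> where p: "\<phi> \<in> Ar V" "Dom V \<phi> = ty (idc S \<bowtie> q)" "Cod V \<phi> = ty (ge f)" "\<phi> \<triangleright> (idc S \<bowtie> q) = ge f"
    by (rule el_arr[of "idc S \<bowtie> q" "ge f"]) (use q f f' in auto)
  have p2: "Dom V \<phi> = den S \<otimes> j" "Cod V \<phi> = VHom C (sr f) x" using p(2,3) q f f' by simp_all
  note l = cot_lift_arr[OF C c f'(1) den_Ob[OF q(4)] p(1) p2]
  show thesis
  proof (rule that)
    show "(e, x, \<gamma> \<triangleright> q) \<bullet>\<^bsub>C\<^esub> (sr f, e, cot_lift C j x e \<gamma> (sr f) (den S) \<phi> \<triangleright> idc S) = f"
      using l(4)[of "idc S" q] q p(4) f(2) gr_eta[of f] by simp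
  qed (use l f' g q in auto)
qed

lemma cotensor_ext:
  assumes C: "vcategory C" and c: "is_cotensor C j x e \<gamma>" and q: "isoel q" "ty q = j" "gc h \<inter> ct q = {}"
    and h: "gok C h" "gok C h'" "sr h = sr h'" "tg h = e" "tg h' = e" "gc h = gc h'"
    and eq: "(e, x, \<gamma> \<triangleright> q) \<bullet>\<^bsub>C\<^esub> h = (e, x, \<gamma> \<triangleright> q) \<bullet>\<^bsub>C\<^esub> h'"
  shows "h = h'"
proof -
  note g = cotD[OF c] note d = gok_D[OF h(1)] gok_D[OF h(2)]
  let ?X = "den (gc h)" let ?f = "\<lambda>h. VComp C (sr h) e x \<cdot> (\<gamma> \<odot> snd (ge h)) \<cdot> Sym V ?X j"
  have s: "snd (ge h) \<triangleright> idc (gc h) = ge h" "snd (ge h') \<triangleright> idc (gc h) = ge h'"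
    using el_idc[OF d(3)] el_idc[OF d(8)] h(6) by simp_all
  have "?f h = ?f h'"
    by (rule arr_ext[of _ "idc (gc h) \<bowtie> q"])
      (use eq s d g q C h in \<open>auto simp: gcmp_def Int_commute\<close>)
  moreover have "\<exists>!k. k \<in> Ar V \<and> Dom V k = ?X \<and> Cod V k = VHom C (sr h) e \<and> VComp C (sr h) e x \<cdot> (\<gamma> \<odot> k) \<cdot> Sym V ?X j = ?f h"
    by (rule iffD1[OF cot_iff[OF C g(1-5)] c, rule_format, OF d(1) den_Ob[OF d(5)]]) (use d g q C h in auto)
  ultimately have "snd (ge h) = snd (ge h')"
    by (intro ex1_eqD[of "\<lambda>k. k \<in> Ar V \<and> Dom V k = ?X \<and> Cod V k = VHom C (sr h) e \<and> VComp C (sr h) e x \<cdot> (\<gamma> \<odot> k) \<cdot> Sym V ?X j = ?f h"])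
      (use d h in auto)
  then show ?thesis using h by (intro gr_eqI el_eqI) auto
qed

text \<open>Unique abstraction of a generic variable characterises cotensors. The proof uses
  \<open>gen 0 X\<close> for the parameters and \<open>gen 1 j\<close> for the abstracted
  variable.\<close>

lemma cotensorI_el:
  assumes C: "vcategory C" and x: "x \<in> VOb C" "e \<in> VOb C" and g: "\<gamma> \<in> Ar V" "Dom V \<gamma> = j" "Cod V \<gamma> = VHom C e x"
    and ex: "\<And>S q f. \<lbrakk>okctx S; isoel q; ty q = j; S \<inter> ct q = {}; gok C f; tg f = x; gc f = S \<union> ct q\<rbrakk>
      \<Longrightarrow> \<exists>h. gok C h \<and> sr h = sr f \<and> tg h = e \<and> gc h = S \<and> (e, x, \<gamma> \<triangleright> q) \<bullet>\<^bsub>C\<^esub> h = f"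
    and un: "\<And>q h h'. \<lbrakk>isoel q; ty q = j; gc h \<inter> ct q = {}; gok C h; gok C h'; sr h = sr h'; tg h = e; tg h' = e; gc h = gc h';
        (e, x, \<gamma> \<triangleright> q) \<bullet>\<^bsub>C\<^esub> h = (e, x, \<gamma> \<triangleright> q) \<bullet>\<^bsub>C\<^esub> h'\<rbrakk> \<Longrightarrow> h = h'"
  shows "is_cotensor C j x e \<gamma>"
proof (rule cot_iff[OF C x g, THEN iffD2], intro ballI allI impI)
  fix z X \<phi> assume z: "z \<in> VOb C" and X: "X \<in> Ob V" and p: "\<phi> \<in> Ar V \<and> Dom V \<phi> = X \<otimes> j \<and> Cod V \<phi> = VHom C z x"
  have j: "j \<in> Ob V" using g by auto
  let ?y = "gen 0 X" and ?q = "gen 1 j"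
  have eq: "(e, x, \<gamma> \<triangleright> ?q) \<bullet>\<^bsub>C\<^esub> (z, e, h \<triangleright> ?y) = (z, x, (VComp C z e x \<cdot> (\<gamma> \<odot> h) \<cdot> Sym V X j) \<triangleright> (?y \<bowtie> ?q))"
    if "h \<in> Ar V" "Dom V h = X" "Cod V h = VHom C z e" for h
    using that C z X p j g x by (simp add: gcmp_tuple)
  have "\<exists>h. gok C h \<and> sr h = z \<and> tg h = e \<and> gc h = ct ?y \<and> (e, x, \<gamma> \<triangleright> ?q) \<bullet>\<^bsub>C\<^esub> h = (z, x, \<phi> \<triangleright> (?y \<bowtie> ?q))"
    using ex[of "ct ?y" ?q "(z, x, \<phi> \<triangleright> (?y \<bowtie> ?q))"] X j z x p by simp
  then obtain k where k: "gok C k" "sr k = z" "tg k = e" "gc k = ct ?y" "(e, x, \<gamma> \<triangleright> ?q) \<bullet>\<^bsub>C\<^esub> k = (z, x, \<phi> \<triangleright> (?y \<bowtie> ?q))" by blast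
  note kd = gok_D[OF k(1)]
  obtain h where h: "h \<in> Ar V" "Dom V h = ty ?y" "Cod V h = ty (ge k)" "h \<triangleright> ?y = ge k"
    by (rule el_arr[of ?y "ge k"]) (use X kd k in auto)
  have h2: "Dom V h = X" "Cod V h = VHom C z e" using h X kd k by auto
  show "\<exists>!h. h \<in> Ar V \<and> Dom V h = X \<and> Cod V h = VHom C z e \<and> VComp C z e x \<cdot> (\<gamma> \<odot> h) \<cdot> Sym V X j = \<phi>"
  proof (rule ex1I[of _ h])
    have "(z, e, h \<triangleright> ?y) = k" using h(4) k(2,3) gr_eta[of k] by simp
    then have "VComp C z e x \<cdot> (\<gamma> \<odot> h) \<cdot> Sym V X j = \<phi>"
      using eq[OF h(1) h2] k(5)
      by (intro arr_ext[of _ "?y \<bowtie> ?q"]) (use h(1) h2 C z X p j g x in auto)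
    then show "h \<in> Ar V \<and> Dom V h = X \<and> Cod V h = VHom C z e \<and> VComp C z e x \<cdot> (\<gamma> \<odot> h) \<cdot> Sym V X j = \<phi>"
      using h(1) h2 by simp
    fix h' assume h': "h' \<in> Ar V \<and> Dom V h' = X \<and> Cod V h' = VHom C z e \<and> VComp C z e x \<cdot> (\<gamma> \<odot> h') \<cdot> Sym V X j = \<phi>"
    have "(z, e, h' \<triangleright> ?y) = k"
      by (rule un[of ?q]) (use h' eq[of h'] k X j z x C in auto)
    then have "h' \<triangleright> ?y = h \<triangleright> ?y" using h(4) by (metis gr_simps(3))
    then show "h' = h" by (rule arr_ext) (use h' h(1) h2 X in auto)
  qed
qed

text \<open>\<open>\<alpha>\<close> and the family \<open>\<beta>\<close> need not be generic here, so the lift is characterised at all \<open>q\<close> at once.\<close>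

lemma cotensor_lift_all:
  assumes C: "vcategory C" and c: "is_cotensor C j x e \<gamma>"
    and a: "gok C \<alpha>" "tg \<alpha> = x" and b: "\<beta> \<in> Ar V" "Dom V \<beta> = j" "Cod V \<beta> = VHom C z (sr \<alpha>)" "z \<in> VOb C"
  obtains h where "gok C h" "sr h = z" "tg h = e" "gc h = gc \<alpha>"
    "\<And>q. \<lbrakk>okel q; ty q = j; gc \<alpha> \<inter> ct q = {}\<rbrakk> \<Longrightarrow> (e, x, \<gamma> \<triangleright> q) \<bullet>\<^bsub>C\<^esub> h = \<alpha> \<bullet>\<^bsub>C\<^esub> (z, sr \<alpha>, \<beta> \<triangleright> q)"
proof -
  note g = cotD[OF c] note d = gok_D[OF a(1)]
  let ?S = "gc \<alpha>" let ?\<phi> = "VComp C z (sr \<alpha>) x \<cdot> (snd (ge \<alpha>) \<odot> \<beta>)"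
  have s: "snd (ge \<alpha>) \<triangleright> idc ?S = ge \<alpha>" using el_idc[OF d(3)] by simp
  have p: "?\<phi> \<in> Ar V" "Dom V ?\<phi> = den ?S \<otimes> j" "Cod V ?\<phi> = VHom C z x"
    using C d a b g by simp_all
  note l = cot_lift_arr[OF C c b(4) den_Ob[OF d(5)] p]
  let ?h = "(z, e, cot_lift C j x e \<gamma> z (den ?S) ?\<phi> \<triangleright> idc ?S)"
  show thesis
  proof (rule that[of ?h])
    fix q assume q: "okel q" "ty q = j" "?S \<inter> ct q = {}"
    then show "(e, x, \<gamma> \<triangleright> q) \<bullet>\<^bsub>C\<^esub> ?h = \<alpha> \<bullet>\<^bsub>C\<^esub> (z, sr \<alpha>, \<beta> \<triangleright> q)"
      using l(4)[of "idc ?S" q] d a b C s by (simp add: gcmp_def)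
  qed (use l d b g in auto)
qed

declare split_paired_All [simp del] split_paired_Ex [simp del]

lemmas disj = Int_Un_distrib Int_Un_distrib2 Int_commute

lemmas cotensor_ext' = cotensor_ext[rotated -1]

section \<open>The functors given by cotensoring with an arity\<close>

definition cu :: "('c, 'o, 'm) cvcat \<Rightarrow> 'o \<Rightarrow> 'c \<Rightarrow> ('o, 'm) el \<Rightarrow> ('c, 'o, 'm) gr" where
  "cu C j x q = (Cot C j x, x, Counit C j x \<triangleright> q)"

lemma cu_simps [simp]: "sr (cu C j x q) = Cot C j x" "tg (cu C j x q) = x" "gc (cu C j x q) = ct q"
  by (simp_all add: cu_def)

lemma has_cotD: "\<lbrakk>has_cotensors J C; j \<in> J; x \<in> VOb C\<rbrakk> \<Longrightarrow> is_cotensor C j x (Cot C j x) (Counit C j x)"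
  by (simp add: has_cotensors_def)

lemma gok_cu [simp]: assumes "has_cotensors J C" "j \<in> J" "x \<in> VOb C" "okel q" "ty q = j" shows "gok C (cu C j x q)"
  using cotD[OF has_cotD[OF assms(1-3)]] assms by (simp add: cu_def)

lemma cu_ext:
  assumes eq: "cu C j x q \<bullet>\<^bsub>C\<^esub> h = cu C j x q \<bullet>\<^bsub>C\<^esub> h'" and C: "vcategory C" "has_cotensors J C" and j: "j \<in> J" "x \<in> VOb C"
    and q: "isoel q" "ty q = j" "gc h \<inter> ct q = {}"
    and h: "gok C h" "gok C h'" "sr h = sr h'" "tg h = Cot C j x" "tg h' = Cot C j x" "gc h = gc h'"
  shows "h = h'"
  by (rule cotensor_ext[OF C(1) has_cotD[OF C(2) j] q h eq[unfolded cu_def]])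

text \<open>The last equation is naturality of the designated counits. By \<open>cu_ext\<close> it
  determines the action on homs, and later calculations with \<open>cot_functor\<close> rest on
  it.\<close>

lemma cot_functor_char:
  assumes C: "vcategory C" "has_cotensors J C" and j: "j \<in> J" and f: "gok C f"
  shows "gok C (cot_functor C j \<star> f)" "sr (cot_functor C j \<star> f) = Cot C j (sr f)" "tg (cot_functor C j \<star> f) = Cot C j (tg f)"
    "\<lbrakk>okel q; ty q = j; gc f \<inter> ct q = {}\<rbrakk> \<Longrightarrow> cu C j (tg f) q \<bullet>\<^bsub>C\<^esub> (cot_functor C j \<star> f) = f \<bullet>\<^bsub>C\<^esub> cu C j (sr f) q"
proof -
  let ?x = "sr f" and ?y = "tg f"
  note d = gok_D[OF f] note cx = cotD[OF has_cotD[OF C(2) j d(1)]] and cy = cotD[OF has_cotD[OF C(2) j d(2)]]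
  let ?\<phi> = "VComp C (Cot C j ?x) ?x ?y \<cdot> (Idn V (VHom C ?x ?y) \<odot> Counit C j ?x)"
  let ?h = "cot_lift C j ?y (Cot C j ?y) (Counit C j ?y) (Cot C j ?x) (VHom C ?x ?y) ?\<phi>"
  have e: "cot_functor C j \<star> f = (Cot C j ?x, Cot C j ?y, ?h \<triangleright> ge f)"
    using d by (simp add: cot_functor_def gmp_def)
  have X: "VHom C ?x ?y \<in> Ob V" using C d by simp
  have p: "?\<phi> \<in> Ar V" "Dom V ?\<phi> = VHom C ?x ?y \<otimes> j" "Cod V ?\<phi> = VHom C (Cot C j ?x) ?y" using C d cx cy by simp_all
  note l = cot_lift_arr[OF C(1) has_cotD[OF C(2) j d(2)] cx(2) X p]
  show "gok C (cot_functor C j \<star> f)" "sr (cot_functor C j \<star> f) = Cot C j ?x" "tg (cot_functor C j \<star> f) = Cot C j ?y"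
    using l d cx cy by (simp_all add: e)
  assume q: "okel q" "ty q = j" "gc f \<inter> ct q = {}"
  show "cu C j ?y q \<bullet>\<^bsub>C\<^esub> (cot_functor C j \<star> f) = f \<bullet>\<^bsub>C\<^esub> cu C j ?x q"
    using l(4)[of "ge f" q] q d C cx X by (simp add: e cu_def) (simp add: gcmp_def)
qed

text \<open>Both functor laws are compared after composition with the counit at one fresh variable
  \<open>q\<close>, where the naturality of counits evaluates them.\<close>

lemma cot_functor_vfunctor:
  assumes C: "vcategory C" "has_cotensors J C" and j: "j \<in> J"
  shows "vfunctor C C (cot_functor C j)"
proof (rule vfunctorI[OF C(1) C(1) cot_functor_def])
  fix x y assume xy: "x \<in> VOb C" "y \<in> VOb C"
  note cx = cotD[OF has_cotD[OF C(2) j xy(1)]] and cy = cotD[OF has_cotD[OF C(2) j xy(2)]]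
  show "Cot C j x \<in> VOb C" by (fact cx)
  let ?\<phi> = "VComp C (Cot C j x) x y \<cdot> (Idn V (VHom C x y) \<odot> Counit C j x)"
  have X: "VHom C x y \<in> Ob V" using C xy by simp
  have p: "?\<phi> \<in> Ar V" "Dom V ?\<phi> = VHom C x y \<otimes> j" "Cod V ?\<phi> = VHom C (Cot C j x) y" using C xy cx cy by simp_all
  note l = cot_lift_arr[OF C(1) has_cotD[OF C(2) j xy(2)] cx(2) X p]
  show "cot_lift C j y (Cot C j y) (Counit C j y) (Cot C j x) (VHom C x y) ?\<phi> \<in> Ar V \<and>
     Dom V (cot_lift C j y (Cot C j y) (Counit C j y) (Cot C j x) (VHom C x y) ?\<phi>) = VHom C x y \<and>
     Cod V (cot_lift C j y (Cot C j y) (Counit C j y) (Cot C j x) (VHom C x y) ?\<phi>) = VHom C (Cot C j x) (Cot C j y)"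
    using l by simp
next
  fix x assume x: "x \<in> VOb C"
  note ch = cot_functor_char[OF C j gok_id[OF C(1) x], simplified]
  note c = has_cotD[OF C(2) j x]
  have j': "j \<in> Ob V" using cotD[OF c] by simp
  let ?q = "gen 0 j"
  have k: "gok C (cu C j x ?q)" "Cot C j x \<in> VOb C" using C(2) j x j' cotD[OF c] by simp_all
  have "cu C j x ?q \<bullet>\<^bsub>C\<^esub> (cot_functor C j \<star> gid C x) = cu C j x ?q \<bullet>\<^bsub>C\<^esub> gid C (Cot C j x)"
    using ch(4)[of ?q] j' k C(1) by simp
  then have "cot_functor C j \<star> gid C x = gid C (Cot C j x)"
    by (rule cu_ext[OF _ C j x]) (use ch(1,2,3) j' k C in auto)
  then show "cot_functor C j \<star> gid C x = gid C (FOb (cot_functor C j) x)"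
    using x by (simp add: cot_functor_def)
next
  fix g f assume *: "gok C g" "gok C f" "sr g = tg f" "gc g \<inter> gc f = {}"
  let ?H = "cot_functor C j" let ?gf = "g \<bullet>\<^bsub>C\<^esub> f"
  note G = cot_functor_char[OF C j *(1)] and F = cot_functor_char[OF C j *(2)]
  have ok: "gok C ?gf" using * C by simp
  note GF = cot_functor_char[OF C j ok]
  note c = has_cotD[OF C(2) j gok_D(2)[OF *(1)]]
  have "okctx (gc g \<union> gc f)" "j \<in> Ob V" using * cotD[OF c] by (simp_all add: gok_D)
  then obtain q where q: "isoel q" "ty q = j" "ct q \<inter> (gc g \<union> gc f) = {}" using fresh_gen by metis
  then have d: "ct q \<inter> gc g = {}" "ct q \<inter> gc f = {}" by auto
  have k: "gok C (cu C j x q)" if "x \<in> VOb C" for x using C(2) j that q by simp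
  have "cu C j (tg g) q \<bullet>\<^bsub>C\<^esub> ((?H \<star> g) \<bullet>\<^bsub>C\<^esub> (?H \<star> f)) = (cu C j (tg g) q \<bullet>\<^bsub>C\<^esub> (?H \<star> g)) \<bullet>\<^bsub>C\<^esub> (?H \<star> f)"
    using C k G(1-3) F(1-3) * d by (simp add: gcmp_assoc disj)
  also have "\<dots> = g \<bullet>\<^bsub>C\<^esub> (cu C j (tg f) q \<bullet>\<^bsub>C\<^esub> (?H \<star> f))"
    using C k G F(1-3) * d q by (simp add: gcmp_assoc disj)
  also have "\<dots> = cu C j (tg g) q \<bullet>\<^bsub>C\<^esub> (?H \<star> ?gf)"
    using C k GF F * d q by (simp add: gcmp_assoc disj)
  finally show "?H \<star> ?gf = (?H \<star> g) \<bullet>\<^bsub>C\<^esub> (?H \<star> f)"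
    by (rule cu_ext[OF sym C j gok_D(2)[OF *(1)] q(1,2)]) (use GF(1-3) G(1-3) F(1-3) * d C in \<open>simp_all add: disj\<close>)
qed

lemma cot_functor_FOb [simp]: "x \<in> VOb C \<Longrightarrow> FOb (cot_functor C j) x = Cot C j x"
  by (simp add: cot_functor_def)

text \<open>Cotensors commute with cotensors. An arrow into the cotensor of \<open>x\<close> by
  \<open>j\<close> is an arrow into \<open>x\<close> with one more variable \<open>w\<close>, and
  abstracting \<open>q\<close> and \<open>w\<close> in either order comes to the same.\<close>

lemma cot_functor_preserves:
  assumes C: "vcategory C" "has_cotensors J C" and j: "j \<in> J"
  shows "preserves_cotensors J C C (cot_functor C j)"
  unfolding preserves_cotensors_def
proof (intro ballI allI impI)
  fix k x e \<gamma> assume k: "k \<in> J" and c: "is_cotensor C k x e \<gamma>"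
  let ?H = "cot_functor C j"
  note H = cot_functor_vfunctor[OF C j] and g = cotD[OF c]
  note cx = has_cotD[OF C(2) j g(1)] and ce = has_cotD[OF C(2) j g(2)]
  have jo: "j \<in> Ob V" using cotD[OF cx] by simp
  let ?g = "\<lambda>q. (e, x, \<gamma> \<triangleright> q)"
  have gq: "gok C (?g q)" "(FOb ?H e, FOb ?H x, (FHom ?H e x \<cdot> \<gamma>) \<triangleright> q) = ?H \<star> ?g q" if "okel q" "ty q = k" for q
    using that g vfun_typ[OF H] by (simp_all add: gmp_def)
  have nat: "cu C j x w \<bullet>\<^bsub>C\<^esub> (?H \<star> ?g q) = ?g q \<bullet>\<^bsub>C\<^esub> cu C j e w"
    if "okel w" "ty w = j" "okel q" "ty q = k" "ct q \<inter> ct w = {}" for q w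
    using cot_functor_char(4)[OF C j gq(1)[OF that(3,4)], of w] that by simp
  have kk: "gok C (cu C j x w)" "gok C (cu C j e w)" if "okel w" "ty w = j" for w using that C(2) j g by simp_all
  show "is_cotensor C k (FOb ?H x) (FOb ?H e) (FHom ?H e x \<cdot> \<gamma>)"
  proof (rule cotensorI_el[OF C(1)])
    show "FOb ?H x \<in> VOb C" "FOb ?H e \<in> VOb C" "FHom ?H e x \<cdot> \<gamma> \<in> Ar V" "Dom V (FHom ?H e x \<cdot> \<gamma>) = k"
      "Cod V (FHom ?H e x \<cdot> \<gamma>) = VHom C (FOb ?H e) (FOb ?H x)"
      using g vfun_typ[OF H] by simp_all
  next
    fix S q f assume S: "okctx S" "S \<inter> ct q = {}" and q: "isoel q" "ty q = k" and f: "gok C f" "tg f = FOb ?H x" "gc f = S \<union> ct q"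
    have "okctx (S \<union> ct q)" using S q by simp
    then obtain w where w: "isoel w" "ty w = j" "ct w \<inter> (S \<union> ct q) = {}" using fresh_gen jo by metis
    then have d: "ct w \<inter> S = {}" "ct w \<inter> ct q = {}" "ct q \<inter> ct w = {}" by auto
    note kw = kk[OF isoel_okel[OF w(1)] w(2)]
    have f': "tg f = Cot C j x" using f g by simp
    have d1: "(S \<union> ct w) \<inter> ct q = {}" using S d by (simp add: Int_Un_distrib2)
    have o1: "gok C (cu C j x w \<bullet>\<^bsub>C\<^esub> f)" using C kw f f' d by (simp add: disj)
    have oS: "okctx (S \<union> ct w)" using S w by simp
    have t1: "tg (cu C j x w \<bullet>\<^bsub>C\<^esub> f) = x" "gc (cu C j x w \<bullet>\<^bsub>C\<^esub> f) = (S \<union> ct w) \<union> ct q"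
      and s1: "sr (cu C j x w \<bullet>\<^bsub>C\<^esub> f) = sr f" using f by (simp_all add: Un_ac)
    have dS: "S \<inter> ct w = {}" using d by blast
    \<comment> \<open>First \<open>q\<close> is abstracted while \<open>w\<close> stays a parameter;
      the next factorisation abstracts \<open>w\<close>.\<close>
    obtain h1 where h1: "gok C h1" "sr h1 = sr f" "tg h1 = e" "gc h1 = S \<union> ct w" "?g q \<bullet>\<^bsub>C\<^esub> h1 = cu C j x w \<bullet>\<^bsub>C\<^esub> f"
      using cotensor_ex[OF C(1) c q d1 oS o1 t1] by (simp add: s1) blast
    obtain h where h: "gok C h" "sr h = sr h1" "tg h = Cot C j e" "gc h = S" "cu C j e w \<bullet>\<^bsub>C\<^esub> h = h1"
      using cotensor_ex[OF C(1) ce w(1,2) dS S(1) h1(1,3,4)] unfolding cu_def[symmetric] by blast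
    have Hq: "gok C (?H \<star> ?g q)" "sr (?H \<star> ?g q) = Cot C j e" "tg (?H \<star> ?g q) = Cot C j x"
      using cot_functor_char(1-3)[OF C j gq(1)[of q]] q by auto
    have "cu C j x w \<bullet>\<^bsub>C\<^esub> ((?H \<star> ?g q) \<bullet>\<^bsub>C\<^esub> h) = (cu C j x w \<bullet>\<^bsub>C\<^esub> (?H \<star> ?g q)) \<bullet>\<^bsub>C\<^esub> h"
      by (rule gcmp_assoc[symmetric]) (use C kw Hq h d S in \<open>auto simp: disj\<close>)
    also have "\<dots> = (?g q \<bullet>\<^bsub>C\<^esub> cu C j e w) \<bullet>\<^bsub>C\<^esub> h" using nat q w d by simp
    also have "\<dots> = ?g q \<bullet>\<^bsub>C\<^esub> h1" unfolding h(5)[symmetric]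
      by (rule gcmp_assoc) (use C kw gq(1)[of q] q h d S in \<open>auto simp: disj\<close>)
    finally have "cu C j x w \<bullet>\<^bsub>C\<^esub> ((?H \<star> ?g q) \<bullet>\<^bsub>C\<^esub> h) = cu C j x w \<bullet>\<^bsub>C\<^esub> f" using h1(5) by simp
    then have "(?H \<star> ?g q) \<bullet>\<^bsub>C\<^esub> h = f"
      by (rule cu_ext[OF _ C j g(1) w(1,2)]) (use C(1) Hq h(1-4) h1(1-4) f f' S d in \<open>auto simp: disj\<close>)
    then show "\<exists>h. gok C h \<and> sr h = sr f \<and> tg h = FOb ?H e \<and> gc h = S \<and> (FOb ?H e, FOb ?H x, (FHom ?H e x \<cdot> \<gamma>) \<triangleright> q) \<bullet>\<^bsub>C\<^esub> h = f"
      using h(1-4) h1(2) g unfolding gq(2)[OF isoel_okel[OF q(1)] q(2)] by (intro exI[of _ h]) simp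
  next
    fix q h h' assume q: "isoel q" "ty q = k" and h: "gc h \<inter> ct q = {}" "gok C h" "gok C h'" "sr h = sr h'" "tg h = FOb ?H e" "tg h' = FOb ?H e" "gc h = gc h'"
      and eq: "(FOb ?H e, FOb ?H x, (FHom ?H e x \<cdot> \<gamma>) \<triangleright> q) \<bullet>\<^bsub>C\<^esub> h = (FOb ?H e, FOb ?H x, (FHom ?H e x \<cdot> \<gamma>) \<triangleright> q) \<bullet>\<^bsub>C\<^esub> h'"
    have "okctx (gc h \<union> ct q)" using h q by (simp add: gok_D)
    then obtain w where w: "isoel w" "ty w = j" "ct w \<inter> (gc h \<union> ct q) = {}" using fresh_gen jo by metis
    then have d: "ct w \<inter> gc h' = {}" "ct w \<inter> ct q = {}" "ct q \<inter> ct w = {}" using h by auto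
    note kw = kk[OF isoel_okel[OF w(1)] w(2)]
    have Hq: "gok C (?H \<star> ?g q)" "sr (?H \<star> ?g q) = Cot C j e" "tg (?H \<star> ?g q) = Cot C j x"
      using cot_functor_char(1-3)[OF C j gq(1)[of q]] q by auto
    have *: "cu C j x w \<bullet>\<^bsub>C\<^esub> ((?H \<star> ?g q) \<bullet>\<^bsub>C\<^esub> k) = ?g q \<bullet>\<^bsub>C\<^esub> (cu C j e w \<bullet>\<^bsub>C\<^esub> k)"
      if k: "gok C k" "tg k = FOb ?H e" "gc k = gc h" for k
    proof -
      have "cu C j x w \<bullet>\<^bsub>C\<^esub> ((?H \<star> ?g q) \<bullet>\<^bsub>C\<^esub> k) = (cu C j x w \<bullet>\<^bsub>C\<^esub> (?H \<star> ?g q)) \<bullet>\<^bsub>C\<^esub> k"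
        by (rule gcmp_assoc[symmetric]) (use C kw Hq k h d g in \<open>auto simp: disj\<close>)
      also have "\<dots> = (?g q \<bullet>\<^bsub>C\<^esub> cu C j e w) \<bullet>\<^bsub>C\<^esub> k" using nat q w d by simp
      also have "\<dots> = ?g q \<bullet>\<^bsub>C\<^esub> (cu C j e w \<bullet>\<^bsub>C\<^esub> k)"
        by (rule gcmp_assoc) (use C kw gq(1)[of q] q k h d g in \<open>auto simp: disj\<close>)
      finally show ?thesis .
    qed
    have "?g q \<bullet>\<^bsub>C\<^esub> (cu C j e w \<bullet>\<^bsub>C\<^esub> h) = ?g q \<bullet>\<^bsub>C\<^esub> (cu C j e w \<bullet>\<^bsub>C\<^esub> h')"
      using *[OF h(2,5)] *[OF h(3,6) h(7)[symmetric]] eq[unfolded gq(2)[OF isoel_okel[OF q(1)] q(2)]] by simp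
    then have "cu C j e w \<bullet>\<^bsub>C\<^esub> h = cu C j e w \<bullet>\<^bsub>C\<^esub> h'"
      by (rule cotensor_ext'[OF _ C(1) c q]) (use C kw h d g in \<open>auto simp: disj\<close>)
    then show "h = h'"
      by (rule cu_ext[OF _ C j g(2) w(1,2)]) (use h d g in \<open>auto simp: disj\<close>)
  qed
qed

lemma preserves_vcomp:
  assumes "vfunctor A B F" "vfunctor B C G" "preserves_cotensors J A B F" "preserves_cotensors J B C G"
  shows "preserves_cotensors J A C (vcomp A G F)"
  unfolding preserves_cotensors_def
proof (intro ballI allI impI)
  fix j x e \<gamma> assume j: "j \<in> J" and c: "is_cotensor A j x e \<gamma>"
  note g = cotD[OF c]
  have "is_cotensor C j (FOb G (FOb F x)) (FOb G (FOb F e)) (FHom G (FOb F e) (FOb F x) \<cdot> FHom F e x \<cdot> \<gamma>)"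
    using assms(3,4) j c unfolding preserves_cotensors_def by blast
  moreover have "FHom (vcomp A G F) e x \<cdot> \<gamma> = FHom G (FOb F e) (FOb F x) \<cdot> FHom F e x \<cdot> \<gamma>"
    using g vfun_typ[OF assms(1)] vfun_typ[OF assms(2)] by (simp add: vcomp_def Cmp_assoc)
  ultimately show "is_cotensor C j (FOb (vcomp A G F) x) (FOb (vcomp A G F) e) (FHom (vcomp A G F) e x \<cdot> \<gamma>)"
    using g by simp
qed

text \<open>Each component is factored separately; uniqueness of the factorisations makes the
  resulting family natural.\<close>

lemma pointwise_cotensor:
  assumes S: "fcat A B S" and X: "X \<in> S" "E \<in> S" and g: "\<gamma> \<in> Ar V" "Dom V \<gamma> = j" "Cod V \<gamma> = nat_ob A B E X"
    and c: "\<And>a. a \<in> VOb A \<Longrightarrow> is_cotensor B j (FOb X a) (FOb E a) (nat_pr A B E X a \<cdot> \<gamma>)"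
  shows "is_cotensor (fun_cat A B S) j X E \<gamma>"
proof -
  let ?FC = "fun_cat A B S" let ?G = "\<lambda>q. (E, X, \<gamma> \<triangleright> q)"
  note FC = fun_cat_vcategory[OF S] and B = fcatD(2)[OF S] and t = nat_pr_typ[OF S X(2,1)]
  have G: "gok ?FC (?G q)" "a \<in> VOb A \<Longrightarrow> cmpt A B a (?G q) = (FOb E a, FOb X a, (nat_pr A B E X a \<cdot> \<gamma>) \<triangleright> q)"
    if "okel q" "ty q = j" for q a using that X g t by (simp_all add: cmpt_def)
  show ?thesis
  proof (rule cotensorI_el[OF FC])
    fix Q q f assume Q: "okctx Q" "Q \<inter> ct q = {}" and q: "isoel q" "ty q = j" and f: "gok ?FC f" "tg f = X" "gc f = Q \<union> ct q"
    note G = G[OF isoel_okel[OF q(1)] q(2)]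
    have fs: "sr f \<in> S" using gok_D(1)[OF f(1)] by simp
    have "\<exists>m. gok B m \<and> sr m = FOb (sr f) a \<and> tg m = FOb E a \<and> gc m = Q \<and> cmpt A B a (?G q) \<bullet>\<^bsub>B\<^esub> m = cmpt A B a f" if a: "a \<in> VOb A" for a
    proof -
      have "gok B (cmpt A B a f)" "tg (cmpt A B a f) = FOb X a" "gc (cmpt A B a f) = Q \<union> ct q"
        using S f a by simp_all
      from cotensor_ex[OF B c[OF a] q Q(2,1) this] show ?thesis unfolding G(2)[OF a] cmpt_simps by blast
    qed
    then obtain m where m: "\<And>a. a \<in> VOb A \<Longrightarrow> gok B (m a) \<and> sr (m a) = FOb (sr f) a \<and> tg (m a) = FOb E a \<and> gc (m a) = Q"
      and mc: "\<And>a. a \<in> VOb A \<Longrightarrow> cmpt A B a (?G q) \<bullet>\<^bsub>B\<^esub> m a = cmpt A B a f" by metis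
    note fE = fcatD(3)[OF S X(2)] and fX = fcatD(3)[OF S X(1)] and fF = fcatD(3)[OF S fs]
    \<comment> \<open>The factors are compared after composition with the counit component at
      \<open>q\<close>, so the test arrow must not use the names of \<open>q\<close>. That is the
      set avoided in the appeal to \<open>cmpt_ex\<close> below.\<close>
    have nat: "(E \<star> e) \<bullet>\<^bsub>B\<^esub> m (sr e) = m (tg e) \<bullet>\<^bsub>B\<^esub> (sr f \<star> e)" if e: "gok A e" "gc e \<inter> Q = {}" "gc e \<inter> ct q = {}" for e
    proof -
      have ob: "sr e \<in> VOb A" "tg e \<in> VOb A" using e by auto
      have Gc: "gok B (cmpt A B a (?G q))" "sr (cmpt A B a (?G q)) = FOb E a" "tg (cmpt A B a (?G q)) = FOb X a" "gc (cmpt A B a (?G q)) = ct q"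
        if "a \<in> VOb A" for a using gok_cmpt[OF S G(1) that] by simp_all
      have d: "gc e \<inter> gc (?G q) = {}" using e by simp
      have "cmpt A B (tg e) (?G q) \<bullet>\<^bsub>B\<^esub> ((E \<star> e) \<bullet>\<^bsub>B\<^esub> m (sr e)) = (cmpt A B (tg e) (?G q) \<bullet>\<^bsub>B\<^esub> (E \<star> e)) \<bullet>\<^bsub>B\<^esub> m (sr e)"
        by (rule gcmp_assoc[symmetric]) (use B Gc[OF ob(2)] gok_mp[OF fE e(1)] m[OF ob(1)] e Q in \<open>auto simp: disj\<close>)
      also have "\<dots> = ((X \<star> e) \<bullet>\<^bsub>B\<^esub> cmpt A B (sr e) (?G q)) \<bullet>\<^bsub>B\<^esub> m (sr e)"
        using cmpt_nat[OF S G(1) e(1) d] by simp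
      also have "\<dots> = (X \<star> e) \<bullet>\<^bsub>B\<^esub> cmpt A B (sr e) f" unfolding mc[OF ob(1), symmetric]
        by (rule gcmp_assoc) (use B Gc[OF ob(1)] gok_mp[OF fX e(1)] m[OF ob(1)] e Q in \<open>auto simp: disj\<close>)
      also have "\<dots> = cmpt A B (tg e) f \<bullet>\<^bsub>B\<^esub> (sr f \<star> e)"
        using cmpt_nat[OF S f(1) e(1)] e f by (simp add: disj)
      also have "\<dots> = cmpt A B (tg e) (?G q) \<bullet>\<^bsub>B\<^esub> (m (tg e) \<bullet>\<^bsub>B\<^esub> (sr f \<star> e))" unfolding mc[OF ob(2), symmetric]
        by (rule gcmp_assoc) (use B Gc[OF ob(2)] gok_mp[OF fF e(1)] m[OF ob(2)] e Q in \<open>auto simp: disj\<close>)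
      finally show ?thesis unfolding G(2)[OF ob(2)]
        by (rule cotensor_ext'[OF _ B c[OF ob(2)] q])
          (use B gok_mp[OF fE e(1)] gok_mp[OF fF e(1)] m[OF ob(1)] m[OF ob(2)] e Q in \<open>auto simp: disj\<close>)
    qed
    obtain p where p: "gok ?FC p" "sr p = sr f" "tg p = E" "gc p = Q" "\<And>a. a \<in> VOb A \<Longrightarrow> cmpt A B a p = m a"
      using cmpt_ex[OF S fs X(2) Q(1) okel_ct[OF isoel_okel[OF q(1)]] m nat] by blast
    have "?G q \<bullet>\<^bsub>?FC\<^esub> p = f"
    proof (rule cmpt_ext[OF S])
      fix a assume a: "a \<in> VOb A"
      show "cmpt A B a (?G q \<bullet>\<^bsub>?FC\<^esub> p) = cmpt A B a f"
        using cmpt_cmp(2)[OF S G(1) p(1) _ _ a] p mc[OF a] Q a by (simp add: disj)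
    qed (use cmpt_cmp(1)[OF S G(1) p(1)] f p Q in \<open>auto simp: disj\<close>)
    then show "\<exists>h. gok ?FC h \<and> sr h = sr f \<and> tg h = E \<and> gc h = Q \<and> ?G q \<bullet>\<^bsub>?FC\<^esub> h = f" using p by blast
  next
    fix q h h' assume q: "isoel q" "ty q = j" and h: "gc h \<inter> ct q = {}" "gok ?FC h" "gok ?FC h'" "sr h = sr h'" "tg h = E" "tg h' = E" "gc h = gc h'"
      and eq: "?G q \<bullet>\<^bsub>?FC\<^esub> h = ?G q \<bullet>\<^bsub>?FC\<^esub> h'"
    note G = G[OF isoel_okel[OF q(1)] q(2)]
    show "h = h'"
    proof (rule cmpt_ext[OF S h(2,3,4) _ h(7)])
      fix a assume a: "a \<in> VOb A"
      have "cmpt A B a (?G q) \<bullet>\<^bsub>B\<^esub> cmpt A B a h = cmpt A B a (?G q) \<bullet>\<^bsub>B\<^esub> cmpt A B a h'"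
        using cmpt_cmp(2)[OF S G(1) h(2) _ _ a] cmpt_cmp(2)[OF S G(1) h(3) _ _ a] eq h by (simp add: disj)
      then show "cmpt A B a h = cmpt A B a h'" unfolding G(2)[OF a]
        by (rule cotensor_ext'[OF _ B c[OF a] q]) (use h S a in auto)
    qed (use h in simp)
  qed (use X g t in simp_all)
qed

section \<open>Theories\<close>

definition kp :: "('o \<Rightarrow> 'm) \<Rightarrow> 'o \<Rightarrow> ('o, 'm) el \<Rightarrow> ('o, 'o, 'm) gr" where
  "kp \<kappa> u q = (u, \<I>, \<kappa> u \<triangleright> q)"

lemma kp_simps [simp]: "sr (kp \<kappa> u q) = u" "tg (kp \<kappa> u q) = \<I>" "gc (kp \<kappa> u q) = ct q"
  by (simp_all add: kp_def)

text \<open>The presentation of a theory by arrows \<open>\<kappa> u : u \<rightarrow> W(u,\<I>)\<close> that exhibit \<open>u\<close> as a cotensor \<open>[u,\<I>]\<close>.\<close>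

definition kappas :: "'o set \<Rightarrow> ('o, 'o, 'm, 'z) vcat_scheme \<Rightarrow> ('o \<Rightarrow> 'm) \<Rightarrow> bool" where
  "kappas J W \<kappa> \<longleftrightarrow> vcategory W \<and> VOb W = J \<and> (\<forall>u\<in>J. is_cotensor W u \<I> u (\<kappa> u))"

lemma kappasD: assumes "kappas J W \<kappa>" shows "vcategory W" "VOb W = J" "u \<in> J \<Longrightarrow> is_cotensor W u \<I> u (\<kappa> u)"
  using assms by (auto simp: kappas_def)

lemma gok_kp [simp]: "\<lbrakk>kappas J W \<kappa>; okel q; ty q = u; u \<in> J\<rbrakk> \<Longrightarrow> gok W (kp \<kappa> u q)"
  using cotD[OF kappasD(3)[of J W \<kappa> u]] by (simp add: kp_def)

lemma kp_ext:
  assumes eq: "kp \<kappa> u q \<bullet>\<^bsub>W\<^esub> h = kp \<kappa> u q \<bullet>\<^bsub>W\<^esub> h'" and W: "kappas J W \<kappa>" and u: "u \<in> J"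
    and q: "isoel q" "ty q = u" "gc h \<inter> ct q = {}"
    and h: "gok W h" "gok W h'" "sr h = sr h'" "tg h = u" "tg h' = u" "gc h = gc h'"
  shows "h = h'"
  by (rule cotensor_ext[OF kappasD(1,3)[OF W] q h eq[unfolded kp_def]]) (fact u)

lemma arities_ten: "\<lbrakk>system_of_arities J; j \<in> J; k \<in> J\<rbrakk> \<Longrightarrow> j \<otimes> k \<in> J"
  and arities_Ob: "\<lbrakk>system_of_arities J; j \<in> J\<rbrakk> \<Longrightarrow> j \<in> Ob V"
  and arities_I: "system_of_arities J \<Longrightarrow> \<I> \<in> J"
  by (auto simp: system_of_arities_def)

text \<open>Both objects represent arrows into \<open>\<I>\<close> with two further variables
  \<open>q\<close> and \<open>w\<close>: \<open>e\<close> abstracts them one after the other,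
  \<open>j \<otimes> x\<close> as a single variable. Closure of the arities under tensor products
  makes the latter an object of \<open>W\<close>.\<close>

lemma cotensor_iso:
  assumes J: "system_of_arities J" and W: "kappas J W \<kappa>" and j: "j \<in> J" and c: "is_cotensor W j x e \<gamma>"
    and q: "isoel q" "ty q = j" and w: "isoel w" "ty w = x" and d: "ct q \<inter> ct w = {}"
  obtains \<theta> \<theta>' where "ginv W \<theta> \<theta>'" "sr \<theta> = j \<otimes> x" "tg \<theta> = e"
    "kp \<kappa> x w \<bullet>\<^bsub>W\<^esub> ((e, x, \<gamma> \<triangleright> q) \<bullet>\<^bsub>W\<^esub> \<theta>) = kp \<kappa> (j \<otimes> x) (q \<bowtie> w)"
    "kp \<kappa> (j \<otimes> x) (q \<bowtie> w) \<bullet>\<^bsub>W\<^esub> \<theta>' = kp \<kappa> x w \<bullet>\<^bsub>W\<^esub> (e, x, \<gamma> \<triangleright> q)"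
proof -
  let ?p = "j \<otimes> x" and ?g = "(e, x, \<gamma> \<triangleright> q)"
  note Wc = kappasD(1)[OF W] and WO = kappasD(2)[OF W] and g = cotD[OF c]
  have x: "x \<in> J" and e: "e \<in> J" using g WO by auto
  note p = arities_ten[OF J j x] and jO = arities_Ob[OF J j] and xO = arities_Ob[OF J x]
  have qw: "isoel (q \<bowtie> w)" "ty (q \<bowtie> w) = ?p" "ct (q \<bowtie> w) = ct q \<union> ct w" using q w d by simp_all
  have gq: "gok W ?g" using q g by simp
  have kw: "gok W (kp \<kappa> x w)" "gok W (kp \<kappa> ?p (q \<bowtie> w))" using W w x qw p by simp_all
  have oq: "okctx (ct q)" and ow: "okctx (ct w)" using q w by simp_all
  \<comment> \<open>From the universal arrow of \<open>j \<otimes> x\<close>, the variable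
    \<open>w\<close> is abstracted first; abstracting \<open>q\<close> from the result gives
    \<open>\<theta>\<close>.\<close>
  obtain \<delta> where \<delta>: "gok W \<delta>" "sr \<delta> = ?p" "tg \<delta> = x" "gc \<delta> = ct q" "kp \<kappa> x w \<bullet>\<^bsub>W\<^esub> \<delta> = kp \<kappa> ?p (q \<bowtie> w)"
    using cotensor_ex[OF Wc kappasD(3)[OF W x] w d oq kw(2)] qw(3) unfolding kp_def[symmetric] kp_simps by blast
  have g0: "gc \<delta> = {} \<union> ct q" using \<delta>(4) by simp
  obtain \<theta> where \<theta>: "gok W \<theta>" "sr \<theta> = ?p" "tg \<theta> = e" "gc \<theta> = {}" "?g \<bullet>\<^bsub>W\<^esub> \<theta> = \<delta>"
    using cotensor_ex[OF Wc c q Int_empty_left okctx_simps(1) \<delta>(1,3) g0] unfolding \<delta>(2) by blast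
  have k2: "gok W (kp \<kappa> x w \<bullet>\<^bsub>W\<^esub> ?g)" using Wc kw gq d by (simp add: disj)
  have g1: "tg (kp \<kappa> x w \<bullet>\<^bsub>W\<^esub> ?g) = \<I>" "gc (kp \<kappa> x w \<bullet>\<^bsub>W\<^esub> ?g) = {} \<union> ct (q \<bowtie> w)"
    and s1: "sr (kp \<kappa> x w \<bullet>\<^bsub>W\<^esub> ?g) = e" using qw by auto
  obtain \<theta>' where \<theta>': "gok W \<theta>'" "sr \<theta>' = e" "tg \<theta>' = ?p" "gc \<theta>' = {}"
      "kp \<kappa> ?p (q \<bowtie> w) \<bullet>\<^bsub>W\<^esub> \<theta>' = kp \<kappa> x w \<bullet>\<^bsub>W\<^esub> ?g"
    using cotensor_ex[OF Wc kappasD(3)[OF W p] qw(1,2) Int_empty_left okctx_simps(1) k2 g1] unfolding kp_def[symmetric] s1 by blast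
  have 1: "kp \<kappa> x w \<bullet>\<^bsub>W\<^esub> (?g \<bullet>\<^bsub>W\<^esub> \<theta>) = kp \<kappa> ?p (q \<bowtie> w)" using \<delta>(5) \<theta>(5) by simp
  have "kp \<kappa> ?p (q \<bowtie> w) \<bullet>\<^bsub>W\<^esub> (\<theta>' \<bullet>\<^bsub>W\<^esub> \<theta>) = (kp \<kappa> ?p (q \<bowtie> w) \<bullet>\<^bsub>W\<^esub> \<theta>') \<bullet>\<^bsub>W\<^esub> \<theta>"
    by (rule gcmp_assoc[symmetric]) (use Wc kw \<theta>' \<theta> in auto)
  also have "\<dots> = kp \<kappa> x w \<bullet>\<^bsub>W\<^esub> (?g \<bullet>\<^bsub>W\<^esub> \<theta>)" unfolding \<theta>'(5)
    by (rule gcmp_assoc) (use Wc kw gq \<theta> d in \<open>auto simp: disj\<close>)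
  also have "\<dots> = kp \<kappa> ?p (q \<bowtie> w) \<bullet>\<^bsub>W\<^esub> gid W ?p" unfolding 1 using Wc kw by simp
  finally have i1: "\<theta>' \<bullet>\<^bsub>W\<^esub> \<theta> = gid W ?p"
    by (rule kp_ext[OF _ W p qw(1,2)]) (use Wc WO p \<theta>(1-4) \<theta>'(1-4) in auto)
  \<comment> \<open>The second inverse law takes two cancellations: of the universal arrow at
    \<open>x\<close>, and then of the given cotensor.\<close>
  have "kp \<kappa> x w \<bullet>\<^bsub>W\<^esub> (?g \<bullet>\<^bsub>W\<^esub> (\<theta> \<bullet>\<^bsub>W\<^esub> \<theta>')) = kp \<kappa> x w \<bullet>\<^bsub>W\<^esub> ((?g \<bullet>\<^bsub>W\<^esub> \<theta>) \<bullet>\<^bsub>W\<^esub> \<theta>')"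
    by (subst gcmp_assoc) (use Wc gq \<theta> \<theta>' in auto)
  also have "\<dots> = (kp \<kappa> x w \<bullet>\<^bsub>W\<^esub> (?g \<bullet>\<^bsub>W\<^esub> \<theta>)) \<bullet>\<^bsub>W\<^esub> \<theta>'"
    by (rule gcmp_assoc[symmetric]) (use Wc kw gq \<theta>(1-4) \<theta>'(1-4) d in \<open>auto simp: disj\<close>)
  also have "\<dots> = kp \<kappa> x w \<bullet>\<^bsub>W\<^esub> (?g \<bullet>\<^bsub>W\<^esub> gid W e)" unfolding 1 \<theta>'(5) using Wc gq by simp
  finally have "?g \<bullet>\<^bsub>W\<^esub> (\<theta> \<bullet>\<^bsub>W\<^esub> \<theta>') = ?g \<bullet>\<^bsub>W\<^esub> gid W e"
    by (rule kp_ext[OF _ W x w]) (use Wc WO gq g(2) \<theta>(1-4) \<theta>'(1-4) d in \<open>auto simp: disj\<close>)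
  then have i2: "\<theta> \<bullet>\<^bsub>W\<^esub> \<theta>' = gid W e"
    by (rule cotensor_ext'[OF _ Wc c q]) (use Wc g(2) \<theta>(1-4) \<theta>'(1-4) in auto)
  have "ginv W \<theta> \<theta>'" using \<theta> \<theta>' i1 i2 by (simp add: ginv_def)
  then show thesis using that \<theta> \<theta>' 1 by blast
qed

text \<open>By \<open>cotensor_iso\<close> every cotensor in \<open>W\<close> is, up to an
  isomorphism that \<open>F\<close> preserves, one of the distinguished ones. A lift against the
  image of \<open>j \<otimes> x\<close> is therefore carried along \<open>F \<star> \<theta>\<close>
  to a lift against the image of \<open>e\<close>.\<close>

lemma preserves_if_kappas:
  assumes J: "system_of_arities J" and W: "kappas J W \<kappa>" and F: "vfunctor W C F"
    and k: "\<And>u. u \<in> J \<Longrightarrow> is_cotensor C u (FOb F \<I>) (FOb F u) (FHom F u \<I> \<cdot> \<kappa> u)"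
  shows "preserves_cotensors J W C F"
  unfolding preserves_cotensors_def
proof (intro ballI allI impI)
  fix j x e \<gamma> assume j: "j \<in> J" and c: "is_cotensor W j x e \<gamma>"
  note Wc = kappasD(1)[OF W] and WO = kappasD(2)[OF W] and g = cotD[OF c] and C = vfun_cat(2)[OF F]
  have x: "x \<in> J" and e: "e \<in> J" using g WO by auto
  let ?p = "j \<otimes> x" and ?g = "\<lambda>q. (e, x, \<gamma> \<triangleright> q)"
  note p = arities_ten[OF J j x] and xO = arities_Ob[OF J x] and I = arities_I[OF J]
  have Fg: "(FOb F e, FOb F x, (FHom F e x \<cdot> \<gamma>) \<triangleright> q) = F \<star> ?g q" "gok W (?g q)" if "okel q" "ty q = j" for q
    using that g vfun_typ[OF F] by (simp_all add: gmp_def)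
  have Fk: "(FOb F u, FOb F \<I>, (FHom F u \<I> \<cdot> \<kappa> u) \<triangleright> q) = F \<star> kp \<kappa> u q" if "u \<in> J" "okel q" "ty q = u" for u q
    using that cotD[OF kappasD(3)[OF W that(1)]] vfun_typ[OF F] WO I by (simp add: gmp_def kp_def)
  show "is_cotensor C j (FOb F x) (FOb F e) (FHom F e x \<cdot> \<gamma>)"
  proof (rule cotensorI_el[OF C])
    show "FOb F x \<in> VOb C" "FOb F e \<in> VOb C" "FHom F e x \<cdot> \<gamma> \<in> Ar V" "Dom V (FHom F e x \<cdot> \<gamma>) = j"
      "Cod V (FHom F e x \<cdot> \<gamma>) = VHom C (FOb F e) (FOb F x)"
      using g vfun_typ[OF F] by simp_all
  next
    fix S q f assume S: "okctx S" "S \<inter> ct q = {}" and q: "isoel q" "ty q = j" and f: "gok C f" "tg f = FOb F x" "gc f = S \<union> ct q"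
    have "okctx (S \<union> ct q)" using S q by simp
    then obtain w where w: "isoel w" "ty w = x" "ct w \<inter> (S \<union> ct q) = {}" using fresh_gen xO by metis
    then have d: "ct w \<inter> S = {}" "ct w \<inter> ct q = {}" "ct q \<inter> ct w = {}" by auto
    obtain \<theta> \<theta>' where \<theta>: "ginv W \<theta> \<theta>'" "sr \<theta> = ?p" "tg \<theta> = e" "kp \<kappa> x w \<bullet>\<^bsub>W\<^esub> (?g q \<bullet>\<^bsub>W\<^esub> \<theta>) = kp \<kappa> ?p (q \<bowtie> w)"
      using cotensor_iso[OF J W j c q w(1,2) d(3)] by metis
    have qw: "isoel (q \<bowtie> w)" "ty (q \<bowtie> w) = ?p" "ct (q \<bowtie> w) = ct q \<union> ct w" using q w d by simp_all
    note kx = gok_mp[OF F gok_kp[OF W isoel_okel[OF w(1)] w(2) x]] and kpp = gok_mp[OF F gok_kp[OF W isoel_okel[OF qw(1)] qw(2) p]]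
    note gq = Fg[OF isoel_okel[OF q(1)] q(2)] and th = ginvD(1,3)[OF \<theta>(1)]
    let ?f1 = "(F \<star> kp \<kappa> x w) \<bullet>\<^bsub>C\<^esub> f"
    have f1: "gok C ?f1" "tg ?f1 = FOb F \<I>" "gc ?f1 = S \<union> ct (q \<bowtie> w)" using C kx f d qw by (auto simp: disj)
    have s1: "sr ?f1 = sr f" by simp
    have dS: "S \<inter> ct (q \<bowtie> w) = {}" using S d by auto
    obtain h' where h': "gok C h'" "sr h' = sr f" "tg h' = FOb F ?p" "gc h' = S" "(F \<star> kp \<kappa> ?p (q \<bowtie> w)) \<bullet>\<^bsub>C\<^esub> h' = ?f1"
      using cotensor_ex[OF C k[OF p] qw(1,2) dS S(1) f1] unfolding Fk[OF p isoel_okel[OF qw(1)] qw(2)] s1 by blast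
    let ?h = "(F \<star> \<theta>) \<bullet>\<^bsub>C\<^esub> h'"
    have h: "gok C ?h" "sr ?h = sr f" "tg ?h = FOb F e" "gc ?h = S"
      using C gok_mp[OF F th(1)] h' \<theta> th by simp_all
    have "(F \<star> kp \<kappa> x w) \<bullet>\<^bsub>C\<^esub> ((F \<star> ?g q) \<bullet>\<^bsub>C\<^esub> ?h) = (F \<star> kp \<kappa> x w) \<bullet>\<^bsub>C\<^esub> (((F \<star> ?g q) \<bullet>\<^bsub>C\<^esub> (F \<star> \<theta>)) \<bullet>\<^bsub>C\<^esub> h')"
      by (subst gcmp_assoc) (use C gok_mp[OF F gq(2)] gok_mp[OF F th(1)] h'(1-4) \<theta>(2,3) th(2) S in \<open>auto simp: disj\<close>)
    also have "(F \<star> ?g q) \<bullet>\<^bsub>C\<^esub> (F \<star> \<theta>) = F \<star> (?g q \<bullet>\<^bsub>W\<^esub> \<theta>)"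
      by (rule gmp_cmp[symmetric, OF F gq(2) th(1)]) (use \<theta>(3) th in auto)
    also have "(F \<star> kp \<kappa> x w) \<bullet>\<^bsub>C\<^esub> ((F \<star> (?g q \<bullet>\<^bsub>W\<^esub> \<theta>)) \<bullet>\<^bsub>C\<^esub> h') = ((F \<star> kp \<kappa> x w) \<bullet>\<^bsub>C\<^esub> (F \<star> (?g q \<bullet>\<^bsub>W\<^esub> \<theta>))) \<bullet>\<^bsub>C\<^esub> h'"
      by (rule gcmp_assoc[symmetric]) (use C kx gok_mp[OF F gok_cmp[OF Wc gq(2) th(1)]] h'(1-4) \<theta>(2,3) th(2) S d in \<open>auto simp: disj\<close>)
    also have "(F \<star> kp \<kappa> x w) \<bullet>\<^bsub>C\<^esub> (F \<star> (?g q \<bullet>\<^bsub>W\<^esub> \<theta>)) = F \<star> (kp \<kappa> x w \<bullet>\<^bsub>W\<^esub> (?g q \<bullet>\<^bsub>W\<^esub> \<theta>))"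
      by (rule gmp_cmp[symmetric, OF F]) (use W w x Wc gq(2) th \<theta>(3) d in \<open>auto simp: disj\<close>)
    finally have "(F \<star> kp \<kappa> x w) \<bullet>\<^bsub>C\<^esub> ((F \<star> ?g q) \<bullet>\<^bsub>C\<^esub> ?h) = ?f1" unfolding \<theta>(4) h'(5) .
    then have "(F \<star> ?g q) \<bullet>\<^bsub>C\<^esub> ?h = f" unfolding Fk[OF x isoel_okel[OF w(1)] w(2), symmetric]
      by (rule cotensor_ext'[OF _ C k[OF x] w(1,2)]) (use C gok_mp[OF F gq(2)] h f S d in \<open>auto simp: disj\<close>)
    then show "\<exists>h. gok C h \<and> sr h = sr f \<and> tg h = FOb F e \<and> gc h = S \<and> (FOb F e, FOb F x, (FHom F e x \<cdot> \<gamma>) \<triangleright> q) \<bullet>\<^bsub>C\<^esub> h = f"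
      using h unfolding gq(1) by blast
  next
    fix q h h' assume q: "isoel q" "ty q = j" and h: "gc h \<inter> ct q = {}" "gok C h" "gok C h'" "sr h = sr h'" "tg h = FOb F e" "tg h' = FOb F e" "gc h = gc h'"
      and eq: "(FOb F e, FOb F x, (FHom F e x \<cdot> \<gamma>) \<triangleright> q) \<bullet>\<^bsub>C\<^esub> h = (FOb F e, FOb F x, (FHom F e x \<cdot> \<gamma>) \<triangleright> q) \<bullet>\<^bsub>C\<^esub> h'"
    have "okctx (gc h \<union> ct q)" using h q by (simp add: gok_D)
    then obtain w where w: "isoel w" "ty w = x" "ct w \<inter> (gc h \<union> ct q) = {}" using fresh_gen xO by metis
    then have d: "ct w \<inter> gc h' = {}" "ct w \<inter> ct q = {}" "ct q \<inter> ct w = {}" "gc h' \<inter> ct q = {}" using h by auto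
    obtain \<theta> \<theta>' where \<theta>: "ginv W \<theta> \<theta>'" "sr \<theta> = ?p" "tg \<theta> = e" "kp \<kappa> ?p (q \<bowtie> w) \<bullet>\<^bsub>W\<^esub> \<theta>' = kp \<kappa> x w \<bullet>\<^bsub>W\<^esub> ?g q"
      using cotensor_iso[OF J W j c q w(1,2) d(3)] by metis
    have qw: "isoel (q \<bowtie> w)" "ty (q \<bowtie> w) = ?p" "ct (q \<bowtie> w) = ct q \<union> ct w" using q w d by simp_all
    note kx = gok_mp[OF F gok_kp[OF W isoel_okel[OF w(1)] w(2) x]] and kpp = gok_mp[OF F gok_kp[OF W isoel_okel[OF qw(1)] qw(2) p]]
    note gq = Fg[OF isoel_okel[OF q(1)] q(2)] and th = ginvD(2,4,5,6)[OF \<theta>(1)]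
    \<comment> \<open>This relation between the two universal arrows turns agreement of
      \<open>h\<close> and \<open>h'\<close> against the given cotensor into agreement against the
      distinguished one, where the assumption \<open>k\<close> applies.\<close>
    have *: "(F \<star> kp \<kappa> ?p (q \<bowtie> w)) \<bullet>\<^bsub>C\<^esub> ((F \<star> \<theta>') \<bullet>\<^bsub>C\<^esub> k) = (F \<star> kp \<kappa> x w) \<bullet>\<^bsub>C\<^esub> ((F \<star> ?g q) \<bullet>\<^bsub>C\<^esub> k)"
      if k: "gok C k" "tg k = FOb F e" "gc k = gc h'" for k
    proof -
      have "(F \<star> kp \<kappa> ?p (q \<bowtie> w)) \<bullet>\<^bsub>C\<^esub> ((F \<star> \<theta>') \<bullet>\<^bsub>C\<^esub> k) = ((F \<star> kp \<kappa> ?p (q \<bowtie> w)) \<bullet>\<^bsub>C\<^esub> (F \<star> \<theta>')) \<bullet>\<^bsub>C\<^esub> k"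
        by (rule gcmp_assoc[symmetric]) (use C kpp gok_mp[OF F th(1)] k \<theta>(2,3) th qw d in \<open>auto simp: disj\<close>)
      also have "(F \<star> kp \<kappa> ?p (q \<bowtie> w)) \<bullet>\<^bsub>C\<^esub> (F \<star> \<theta>') = F \<star> (kp \<kappa> x w \<bullet>\<^bsub>W\<^esub> ?g q)" unfolding \<theta>(4)[symmetric]
        by (rule gmp_cmp[symmetric, OF F]) (use W qw p th \<theta>(2,3) in auto)
      also have "\<dots> = (F \<star> kp \<kappa> x w) \<bullet>\<^bsub>C\<^esub> (F \<star> ?g q)"
        by (rule gmp_cmp[OF F]) (use W w x gq d in \<open>auto simp: disj\<close>)
      also have "((F \<star> kp \<kappa> x w) \<bullet>\<^bsub>C\<^esub> (F \<star> ?g q)) \<bullet>\<^bsub>C\<^esub> k = (F \<star> kp \<kappa> x w) \<bullet>\<^bsub>C\<^esub> ((F \<star> ?g q) \<bullet>\<^bsub>C\<^esub> k)"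
        by (rule gcmp_assoc) (use C kx gok_mp[OF F gq(2)] k d in \<open>auto simp: disj\<close>)
      finally show ?thesis .
    qed
    have "(F \<star> kp \<kappa> ?p (q \<bowtie> w)) \<bullet>\<^bsub>C\<^esub> ((F \<star> \<theta>') \<bullet>\<^bsub>C\<^esub> h) = (F \<star> kp \<kappa> ?p (q \<bowtie> w)) \<bullet>\<^bsub>C\<^esub> ((F \<star> \<theta>') \<bullet>\<^bsub>C\<^esub> h')"
      unfolding *[OF h(2,5,7)] *[OF h(3,6) refl] using eq unfolding gq(1) by simp
    then have "(F \<star> \<theta>') \<bullet>\<^bsub>C\<^esub> h = (F \<star> \<theta>') \<bullet>\<^bsub>C\<^esub> h'" unfolding Fk[OF p isoel_okel[OF qw(1)] qw(2), symmetric]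
      by (rule cotensor_ext'[OF _ C k[OF p] qw(1,2)]) (use C gok_mp[OF F th(1)] h \<theta>(2,3) th qw d in \<open>auto simp: disj\<close>)
    then have "(F \<star> \<theta>) \<bullet>\<^bsub>C\<^esub> ((F \<star> \<theta>') \<bullet>\<^bsub>C\<^esub> h) = (F \<star> \<theta>) \<bullet>\<^bsub>C\<^esub> ((F \<star> \<theta>') \<bullet>\<^bsub>C\<^esub> h')" by simp
    then show "h = h'" using ginv_cancel'[OF C ginv_mp[OF F \<theta>(1)]] h \<theta>(3) by simp
  qed
qed

lemma IHom_ex:
  assumes S: "okctx S" and f: "okel f" "ct f = S \<union> ct q" "ty f = b" and q: "isoel q" "ty q = a" "S \<inter> ct q = {}"
  obtains x where "okel x" "ct x = S" "ty x = IHom V a b" "Ev V a b \<triangleright> (x \<bowtie> q) = f"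
proof -
  obtain \<phi> where p: "\<phi> \<in> Ar V" "Dom V \<phi> = ty (idc S \<bowtie> q)" "Cod V \<phi> = ty f" "\<phi> \<triangleright> (idc S \<bowtie> q) = f"
    by (rule el_arr[of "idc S \<bowtie> q" f]) (use S f q in auto)
  have ob: "den S \<in> Ob V" "a \<in> Ob V" "b \<in> Ob V" using S f q ty_Ob by auto
  have p2: "Dom V \<phi> = den S \<otimes> a" "Cod V \<phi> = b" using p S q f by simp_all
  note c = curry_arr[OF ob p(1) p2]
  show thesis
    by (rule that[of "curry_arr (den S) a b \<phi> \<triangleright> idc S"])
      (use c(1-3) app_curry[OF ob p(1) p2, of "idc S" q] p(4) S q in auto)
qed

section \<open>The opposite of the arities and the universal arrows of a theory\<close>

abbreviation opJ :: "'o set \<Rightarrow> ('o, 'o, 'm) vcat" where "opJ J \<equiv> vop (vself J)"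

lemma opJ_simps [simp]: "VOb (opJ J) = J" "VHom (opJ J) a b = IHom V b a"
  by (simp_all add: vop_def vself_def)

text \<open>The symmetry in \<open>vop\<close> undoes the reversal of the factors, so evaluation
  sees ordinary composition of internal homs.\<close>

lemma opJ_cmp:
  assumes J: "system_of_arities J" and ab: "a \<in> J" "b \<in> J" "c \<in> J"
    and x: "okel x" "ty x = IHom V b a" and y: "okel y" "ty y = IHom V c b" and q: "okel q" "ty q = c"
    and d: "ct x \<inter> ct y = {}" "ct x \<inter> ct q = {}" "ct y \<inter> ct q = {}"
  shows "Ev V c a \<triangleright> (ge ((b, c, y) \<bullet>\<^bsub>opJ J\<^esub> (a, b, x)) \<bowtie> q) = Ev V b a \<triangleright> (x \<bowtie> (Ev V c b \<triangleright> (y \<bowtie> q)))"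
proof -
  have ob: "a \<in> Ob V" "b \<in> Ob V" "c \<in> Ob V" using arities_Ob[OF J] ab by auto
  let ?f = "Ev V b a \<cdot> (Idn V (IHom V b a) \<odot> Ev V c b) \<cdot> Asc V (IHom V b a) (IHom V c b) c"
  have f: "IHom V b a \<otimes> IHom V c b \<in> Ob V" "c \<in> Ob V" "a \<in> Ob V" "?f \<in> Ar V"
    "Dom V ?f = (IHom V b a \<otimes> IHom V c b) \<otimes> c" "Cod V ?f = a" using ob by simp_all
  note cu = curry_arr[OF f]
  have "ge ((b, c, y) \<bullet>\<^bsub>opJ J\<^esub> (a, b, x)) = curry_arr (IHom V b a \<otimes> IHom V c b) c a ?f \<triangleright> (x \<bowtie> y)"
    using ob x y d cu(1-3) by (simp add: gcmp_tuple vop_def vself_def Int_commute)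
  then show ?thesis using app_curry[OF f, of "x \<bowtie> y" q] x y q d ob by (simp add: disj)
qed

text \<open>The naming map from \<open>u\<close> to the internal hom of \<open>\<I>\<close> and
  \<open>u\<close>, transposed from the right unitor. In the opposite category it lands in the hom
  from \<open>u\<close> to \<open>\<I>\<close> and presents \<open>u\<close> as a cotensor of
  \<open>\<I>\<close>.\<close>

definition nm :: "'o \<Rightarrow> 'm" where "nm u = curry_arr u \<I> u (Run V u)"

lemma nm_typ [simp]: assumes "u \<in> Ob V" shows "nm u \<in> Ar V" "Dom V (nm u) = u" "Cod V (nm u) = IHom V \<I> u"
  using curry_arr[of u \<I> u "Run V u"] assms by (simp_all add: nm_def)

lemma nm_Ev [simp]: "\<lbrakk>okel p; ty p = u\<rbrakk> \<Longrightarrow> Ev V \<I> u \<triangleright> ((nm u \<triangleright> p) \<bowtie> un) = p"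
  using app_curry[of u \<I> u "Run V u" p un] ty_Ob[of p] by (auto simp: nm_def)

text \<open>Both sides are evaluated at the unit element, where a name gives back the element that
  it names.\<close>

lemma nm_cmp:
  assumes J: "system_of_arities J" and jk: "j \<in> J" "k \<in> J" and cat: "vcategory (opJ J)"
    and q: "okel q" "ty q = k" and y: "okel y" "ty y = IHom V k j" and d: "ct y \<inter> ct q = {}"
  shows "(k, \<I>, nm k \<triangleright> q) \<bullet>\<^bsub>opJ J\<^esub> (j, k, y) = (j, \<I>, nm j \<triangleright> (Ev V k j \<triangleright> (y \<bowtie> q)))"
proof -
  have ob: "j \<in> Ob V" "k \<in> Ob V" using arities_Ob[OF J] jk by auto
  note I = arities_I[OF J]
  have g: "gok (opJ J) (k, \<I>, nm k \<triangleright> q)" "gok (opJ J) (j, k, y)" using jk I q y ob by simp_all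
  have gg: "gok (opJ J) ((k, \<I>, nm k \<triangleright> q) \<bullet>\<^bsub>opJ J\<^esub> (j, k, y))" using cat g d by (simp add: disj)
  note ggD = gok_D[OF gg, simplified]
  have "ge ((k, \<I>, nm k \<triangleright> q) \<bullet>\<^bsub>opJ J\<^esub> (j, k, y)) = nm j \<triangleright> (Ev V k j \<triangleright> (y \<bowtie> q))"
  proof (rule IHom_ext[of _ _ \<I> j un])
    show "Ev V \<I> j \<triangleright> (ge ((k, \<I>, nm k \<triangleright> q) \<bullet>\<^bsub>opJ J\<^esub> (j, k, y)) \<bowtie> un) = Ev V \<I> j \<triangleright> ((nm j \<triangleright> (Ev V k j \<triangleright> (y \<bowtie> q))) \<bowtie> un)"
      using opJ_cmp[OF J jk I, of y "nm k \<triangleright> q" un] q y d ob by simp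
  qed (use ggD q y d ob in auto)
  then show ?thesis by (intro gr_eqI) simp_all
qed

text \<open>A graded arrow from \<open>z\<close> to \<open>u\<close> in the opposite is an element
  of \<open>IHom V u z\<close>. By \<open>ev\<close>, evaluating its composite with the name of
  \<open>q\<close> at the unit element is evaluating it at \<open>q\<close>, so the claim is the
  universal property of the internal hom.\<close>

lemma nm_cotensor:
  assumes J: "system_of_arities J" and u: "u \<in> J" and cat: "vcategory (opJ J)"
  shows "is_cotensor (opJ J) u \<I> u (nm u)"
proof -
  note I = arities_I[OF J] and uO = arities_Ob[OF J u]
  have ev: "Ev V \<I> z \<triangleright> (ge ((u, \<I>, nm u \<triangleright> q) \<bullet>\<^bsub>opJ J\<^esub> h) \<bowtie> un) = Ev V u z \<triangleright> (ge h \<bowtie> q)"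
    if "gok (opJ J) h" "sr h = z" "tg h = u" "okel q" "ty q = u" "gc h \<inter> ct q = {}" for h q z
    using opJ_cmp[OF J _ u I, of z "ge h" "nm u \<triangleright> q" un] gok_D[OF that(1)] that(2-) uO gr_eta[of h] by (simp add: disj)
  have ok: "gok (opJ J) ((u, \<I>, nm u \<triangleright> q) \<bullet>\<^bsub>opJ J\<^esub> h)"
    if "gok (opJ J) h" "tg h = u" "okel q" "ty q = u" "gc h \<inter> ct q = {}" for h q
    using cat that uO u I by (simp add: disj)
  show ?thesis
  proof (rule cotensorI_el[OF cat])
    fix S q f assume S: "okctx S" and q: "isoel q" "ty q = u" "S \<inter> ct q = {}" and f: "gok (opJ J) f" "tg f = \<I>" "gc f = S \<union> ct q"
    note fD = gok_D[OF f(1), simplified]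
    have zO: "sr f \<in> Ob V" using arities_Ob[OF J] fD by simp
    have e: "okel (Ev V \<I> (sr f) \<triangleright> (ge f \<bowtie> un))" "ct (Ev V \<I> (sr f) \<triangleright> (ge f \<bowtie> un)) = S \<union> ct q"
      "ty (Ev V \<I> (sr f) \<triangleright> (ge f \<bowtie> un)) = sr f" using fD f zO by simp_all
    obtain x where x: "okel x" "ct x = S" "ty x = IHom V u (sr f)" "Ev V u (sr f) \<triangleright> (x \<bowtie> q) = Ev V \<I> (sr f) \<triangleright> (ge f \<bowtie> un)"
      using IHom_ex[OF S e q] by blast
    let ?h = "(sr f, u, x)"
    have h: "gok (opJ J) ?h" using fD u x by simp
    note k = gok_D[OF ok[OF h, of q], simplified]
    have "ge ((u, \<I>, nm u \<triangleright> q) \<bullet>\<^bsub>opJ J\<^esub> ?h) = ge f"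
      by (rule IHom_ext[of _ _ \<I> "sr f" un]) (use ev[OF h, of "sr f" q] k x q f fD zO in auto)
    then have "(u, \<I>, nm u \<triangleright> q) \<bullet>\<^bsub>opJ J\<^esub> ?h = f" by (rule gr_eqI[rotated 2]) (simp_all add: f)
    then show "\<exists>h. gok (opJ J) h \<and> sr h = sr f \<and> tg h = u \<and> gc h = S \<and> (u, \<I>, nm u \<triangleright> q) \<bullet>\<^bsub>opJ J\<^esub> h = f"
      using h x by (intro exI[of _ ?h]) simp
  next
    fix q h h' assume q: "isoel q" "ty q = u" and h: "gc h \<inter> ct q = {}" "gok (opJ J) h" "gok (opJ J) h'" "sr h = sr h'" "tg h = u" "tg h' = u" "gc h = gc h'"
      and eq: "(u, \<I>, nm u \<triangleright> q) \<bullet>\<^bsub>opJ J\<^esub> h = (u, \<I>, nm u \<triangleright> q) \<bullet>\<^bsub>opJ J\<^esub> h'"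
    have "Ev V u (sr h) \<triangleright> (ge h \<bowtie> q) = Ev V u (sr h) \<triangleright> (ge h' \<bowtie> q)"
      using ev[OF h(2) refl h(5), of q] ev[OF h(3) h(4)[symmetric] h(6), of q] eq q h by simp
    then have "ge h = ge h'"
      by (rule IHom_ext[rotated -1, of u "sr h" _ q])
        (use gok_D[OF h(2), simplified] gok_D[OF h(3), simplified] h q arities_Ob[OF J] in auto)
    then show "h = h'" by (rule gr_eqI[rotated 2]) (simp_all add: h)
  qed (use I u uO in simp_all)
qed

text \<open>The structure morphism from \<open>u\<close> to the hom of \<open>u\<close> and
  \<open>\<I>\<close> in the theory, obtained as the image of \<open>nm u\<close> under the
  structure functor.\<close>

definition kap :: "('o, 'm) jtheory \<Rightarrow> 'o \<Rightarrow> 'm" where "kap T u = Str T u \<I> \<cdot> nm u"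

lemma theory_tau:
  assumes T: "is_theory J T"
  shows "vcategory T" "VOb T = J" "vcategory (opJ J)" "vfunctor (opJ J) T (structure_functor J T)"
    "x \<in> J \<Longrightarrow> FOb (structure_functor J T) x = x" "\<lbrakk>x \<in> J; y \<in> J\<rbrakk> \<Longrightarrow> FHom (structure_functor J T) x y = Str T x y"
    "\<lbrakk>x \<in> J; y \<in> J\<rbrakk> \<Longrightarrow> Str T x y \<in> Ar V" "\<lbrakk>x \<in> J; y \<in> J\<rbrakk> \<Longrightarrow> Dom V (Str T x y) = IHom V y x"
    "\<lbrakk>x \<in> J; y \<in> J\<rbrakk> \<Longrightarrow> Cod V (Str T x y) = VHom T x y"
proof -
  show t: "vcategory T" "VOb T = J" and f: "vfunctor (opJ J) T (structure_functor J T)"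
    using T by (auto simp: is_theory_def)
  show "vcategory (opJ J)" using vfun_cat[OF f] by simp
  show o: "FOb (structure_functor J T) x = x" if "x \<in> J" for x using that by (simp add: structure_functor_def)
  show h: "FHom (structure_functor J T) x y = Str T x y" if "x \<in> J" "y \<in> J" for x y using that by (simp add: structure_functor_def)
  assume xy: "x \<in> J" "y \<in> J"
  show "Str T x y \<in> Ar V" "Dom V (Str T x y) = IHom V y x" "Cod V (Str T x y) = VHom T x y"
    using vfun_typ(2-4)[OF f, simplified, OF xy] h[OF xy] o[OF xy(1)] o[OF xy(2)] by simp_all
qed

lemma theory_kappas:
  assumes J: "system_of_arities J" and T: "is_theory J T"
  shows "kappas J T (kap T)"
proof -
  note t = theory_tau[OF T]
  have "is_cotensor T u \<I> u (kap T u)" if u: "u \<in> J" for u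
  proof -
    have "is_cotensor T u (FOb (structure_functor J T) \<I>) (FOb (structure_functor J T) u) (FHom (structure_functor J T) u \<I> \<cdot> nm u)"
      using T nm_cotensor[OF J u t(3)] u unfolding is_theory_def preserves_cotensors_def by blast
    then show ?thesis using t(5,6) u arities_I[OF J] by (simp add: kap_def)
  qed
  then show ?thesis using t by (simp add: kappas_def)
qed

text \<open>By the universal property of \<open>kap T k\<close> this equation determines
  \<open>Str T j k\<close>, so the structure functor is recovered from the arrows into
  \<open>\<I>\<close>. It is the image of \<open>nm_cmp\<close> under that functor.\<close>

lemma kp_Str:
  assumes J: "system_of_arities J" and T: "is_theory J T" and jk: "j \<in> J" "k \<in> J"
    and q: "okel q" "ty q = k" and y: "okel y" "ty y = IHom V k j" and d: "ct y \<inter> ct q = {}"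
  shows "kp (kap T) k q \<bullet>\<^bsub>T\<^esub> (j, k, Str T j k \<triangleright> y) = kp (kap T) j (Ev V k j \<triangleright> (y \<bowtie> q))"
proof -
  note t = theory_tau[OF T] and I = arities_I[OF J]
  let ?\<tau> = "structure_functor J T"
  have ob: "j \<in> Ob V" "k \<in> Ob V" using arities_Ob[OF J] jk by auto
  have kq: "?\<tau> \<star> (u, \<I>, nm u \<triangleright> p) = kp (kap T) u p" if "u \<in> J" "okel p" "ty p = u" for u p
    using that t(5-8) I arities_Ob[OF J that(1)] by (simp add: gmp_tuple kp_def kap_def)
  have y': "?\<tau> \<star> (j, k, y) = (j, k, Str T j k \<triangleright> y)" using t(5,6) jk by (simp add: gmp_tuple)
  have g: "gok (opJ J) (k, \<I>, nm k \<triangleright> q)" "gok (opJ J) (j, k, y)" using jk I q y ob by simp_all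
  have "(?\<tau> \<star> (k, \<I>, nm k \<triangleright> q)) \<bullet>\<^bsub>T\<^esub> (?\<tau> \<star> (j, k, y)) = ?\<tau> \<star> (j, \<I>, nm j \<triangleright> (Ev V k j \<triangleright> (y \<bowtie> q)))"
    unfolding nm_cmp[OF J jk t(3) q y d, symmetric]
    by (rule gmp_cmp[OF t(4) g, symmetric]) (use d in \<open>auto simp: disj\<close>)
  then show ?thesis using kq[OF jk(2) q] kq[OF jk(1), of "Ev V k j \<triangleright> (y \<bowtie> q)"] y' q y d ob by simp
qed

text \<open>The name of the unit element is the identity of \<open>\<I>\<close> in the opposite
  category, because the two unitors agree at \<open>\<I>\<close>; functors preserve
  identities.\<close>

lemma kp_un:
  assumes J: "system_of_arities J" and T: "is_theory J T"
  shows "kp (kap T) \<I> un = gid T \<I>"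
proof -
  note t = theory_tau[OF T] and I = arities_I[OF J]
  have "structure_functor J T \<star> gid (opJ J) \<I> = gid T \<I>" using gmp_id[OF t(4), of \<I>] t(5) I by simp
  moreover have "gid (opJ J) \<I> = (\<I>, \<I>, nm \<I> \<triangleright> un)" by (simp add: gid_def vop_def vself_def nm_def Lun_Run)
  ultimately show ?thesis using t(5-8) I by (simp add: gmp_tuple kp_def kap_def)
qed

section \<open>Commutants\<close>

lemma algebrasD: assumes "A \<in> algebras J T C" shows "vfunctor T C A" "preserves_cotensors J T C A"
  using assms by (auto simp: algebras_def)

definition setting :: "'o set \<Rightarrow> ('o, 'm) jtheory \<Rightarrow> ('c, 'o, 'm) cvcat \<Rightarrow> bool" where
  "setting J T C \<longleftrightarrow> system_of_arities J \<and> is_theory J T \<and> vcategory C \<and> has_cotensors J C \<and> fcat T C (algebras J T C)"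

lemma settingD: assumes "setting J T C" shows "system_of_arities J" "is_theory J T" "vcategory C" "has_cotensors J C" "fcat T C (algebras J T C)"
    "VOb T = J" "vcategory T" "\<I> \<in> J"
  using assms by (auto simp: setting_def is_theory_def system_of_arities_def)

lemma settingI: "\<lbrakk>system_of_arities J; is_theory J T; admissible J C\<rbrakk> \<Longrightarrow> setting J T C"
  by (auto simp: setting_def admissible_def fcat_def algebras_def is_theory_def)

lemma alg_kappa_cotensor:
  assumes S: "setting J T C" and A: "A \<in> algebras J T C" and t: "t \<in> J"
  shows "is_cotensor C t (FOb A \<I>) (FOb A t) (FHom A t \<I> \<cdot> kap T t)"
  using algebrasD(2)[OF A] kappasD(3)[OF theory_kappas[OF settingD(1,2)[OF S]] t] t unfolding preserves_cotensors_def by blast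

lemma alg_cot_algebra:
  assumes S: "setting J T C" and A: "A \<in> algebras J T C" and j: "j \<in> J"
  shows "alg_cot T C j A \<in> algebras J T C"
  using vcomp_functor[OF algebrasD(1)[OF A] cot_functor_vfunctor[OF settingD(3,4)[OF S] j]]
    preserves_vcomp[OF algebrasD(1)[OF A] cot_functor_vfunctor[OF settingD(3,4)[OF S] j] algebrasD(2)[OF A] cot_functor_preserves[OF settingD(3,4)[OF S] j]]
  by (simp add: algebras_def alg_cot_def)

lemma alg_cot_FOb [simp]:
  assumes S: "setting J T C" and A: "A \<in> algebras J T C" and k: "k \<in> J"
  shows "FOb (alg_cot T C j A) k = Cot C j (FOb A k)"
  using vfun_typ(1)[OF algebrasD(1)[OF A]] k settingD(6)[OF S] by (simp add: alg_cot_def)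

lemma alg_cot_mp:
  assumes S: "setting J T C" and A: "A \<in> algebras J T C" and j: "j \<in> J" and e: "gok T e"
  shows "alg_cot T C j A \<star> e = cot_functor C j \<star> (A \<star> e)"
  unfolding alg_cot_def by (rule vcomp_mp[OF algebrasD(1)[OF A] cot_functor_vfunctor[OF settingD(3,4)[OF S] j] e])

lemma alg_counit_wedge:
  assumes S: "setting J T C" and A: "A \<in> algebras J T C" and j: "j \<in> J"
  shows "wedge T C (alg_cot T C j A) A j (\<lambda>k. Counit C j (FOb A k))"
proof -
  note s = settingD[OF S] and c = algebrasD(1)[OF alg_cot_algebra[OF S A j]] and a = algebrasD(1)[OF A]
  have jO: "j \<in> Ob V" using arities_Ob s j by blast
  have x: "FOb A k \<in> VOb C" if "k \<in> J" for k using vfun_typ(1)[OF a] that s by simp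
  show ?thesis
  proof (rule wedgeI_gr[OF c a, of "gen 0 j" _ "{}"])
    fix k assume "k \<in> VOb T"
    then have k: "k \<in> J" using s by simp
    show "Counit C j (FOb A k) \<in> Ar V \<and> Dom V (Counit C j (FOb A k)) = j \<and>
         Cod V (Counit C j (FOb A k)) = VHom C (FOb (alg_cot T C j A) k) (FOb A k)"
      using cotD[OF has_cotD[OF s(4) j x[OF k]]] alg_cot_FOb[OF S A k] by simp
  next
    fix e assume e: "gok T e" "gc e \<inter> ct (gen 0 j) = {}"
    have ob: "sr e \<in> J" "tg e \<in> J" using gok_D(1,2)[OF e(1)] s by simp_all
    have "(A \<star> e) \<bullet>\<^bsub>C\<^esub> cu C j (FOb A (sr e)) (gen 0 j) = cu C j (FOb A (tg e)) (gen 0 j) \<bullet>\<^bsub>C\<^esub> (alg_cot T C j A \<star> e)"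
      using cot_functor_char(4)[OF s(3,4) j gok_mp[OF a e(1)], of "gen 0 j"] jO e(2) alg_cot_mp[OF S A j e(1)] by simp
    then show "(A \<star> e) \<bullet>\<^bsub>C\<^esub> (FOb (alg_cot T C j A) (sr e), FOb A (sr e), Counit C j (FOb A (sr e)) \<triangleright> gen 0 j) =
       (FOb (alg_cot T C j A) (tg e), FOb A (tg e), Counit C j (FOb A (tg e)) \<triangleright> gen 0 j) \<bullet>\<^bsub>C\<^esub> (alg_cot T C j A \<star> e)"
      using alg_cot_FOb[OF S A ob(1)] alg_cot_FOb[OF S A ob(2)] by (simp add: cu_def)
  qed (use jO in simp_all)
qed

text \<open>The components of the counit are the designated counits of \<open>C\<close>, so the last
  claim is an instance of \<open>pointwise_cotensor\<close>.\<close>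

lemma alg_counit:
  assumes S: "setting J T C" and A: "A \<in> algebras J T C" and j: "j \<in> J"
  shows "alg_counit T C j A \<in> Ar V" "Dom V (alg_counit T C j A) = j" "Cod V (alg_counit T C j A) = nat_ob T C (alg_cot T C j A) A"
    "k \<in> J \<Longrightarrow> nat_pr T C (alg_cot T C j A) A k \<cdot> alg_counit T C j A = Counit C j (FOb A k)"
    "is_cotensor (Alg J T C) j A (alg_cot T C j A) (alg_counit T C j A)"
proof -
  note s = settingD[OF S] and c = alg_cot_algebra[OF S A j]
  note l = nat_lift[OF s(5) c A alg_counit_wedge[OF S A j], folded alg_counit_def, unfolded s(6)]
  show "alg_counit T C j A \<in> Ar V" "Dom V (alg_counit T C j A) = j" "Cod V (alg_counit T C j A) = nat_ob T C (alg_cot T C j A) A"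
    "k \<in> J \<Longrightarrow> nat_pr T C (alg_cot T C j A) A k \<cdot> alg_counit T C j A = Counit C j (FOb A k)" for k
    by (fact l)+
  show "is_cotensor (Alg J T C) j A (alg_cot T C j A) (alg_counit T C j A)" unfolding Alg_def
  proof (rule pointwise_cotensor[OF s(5) A c l(1-3)])
    fix a assume "a \<in> VOb T"
    then have a: "a \<in> J" using s by simp
    show "is_cotensor C j (FOb A a) (FOb (alg_cot T C j A) a) (nat_pr T C (alg_cot T C j A) A a \<cdot> alg_counit T C j A)"
      unfolding l(4)[OF a] alg_cot_FOb[OF S A a]
      by (rule has_cotD[OF s(4) j]) (use vfun_typ(1)[OF algebrasD(1)[OF A]] a s in simp)
  qed
qed

text \<open>At the unit element the counits on both sides of the naturality equation are identities,
  which leaves \<open>f\<close> itself.\<close>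

lemma cot_functor_I: assumes C: "vcategory C" "has_cotensors J C" and I: "\<I> \<in> J" and f: "gok C f"
  shows "cot_functor C \<I> \<star> f = f"
proof -
  have x: "Cot C \<I> x = x" "cu C \<I> x un = gid C x" if "x \<in> VOb C" for x
    using C(2) that by (simp_all add: has_cotensors_def cu_def gid_def)
  show ?thesis using cot_functor_char[OF C I f] cot_functor_char(4)[OF C I f, of un] x gok_D(1,2)[OF f] C(1) f by simp
qed

text \<open>An equality and not merely an isomorphism: it rests on the normalised cotensors by
  \<open>\<I>\<close> and on the normal form of functor records. It will make the left face of the
  constructed bifold algebra equal to \<open>A\<close>.\<close>

lemma alg_cot_I: assumes S: "setting J T C" and A: "A \<in> algebras J T C" shows "alg_cot T C \<I> A = A"
proof -
  note s = settingD[OF S] and a = algebrasD(1)[OF A]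
  show ?thesis
    by (rule vfun_eqI[OF algebrasD(1)[OF alg_cot_algebra[OF S A s(8)]] a])
      (use alg_cot_mp[OF S A s(8)] alg_cot_FOb[OF S A] s cot_functor_I[OF s(3,4,8)] gok_mp[OF a] vfun_typ(1)[OF a] in \<open>auto simp: has_cotensors_def\<close>)
qed

lemma Cot_I: "\<lbrakk>has_cotensors J C; x \<in> VOb C\<rbrakk> \<Longrightarrow> Cot C \<I> x = x" "\<lbrakk>has_cotensors J C; x \<in> VOb C\<rbrakk> \<Longrightarrow> Counit C \<I> x = VId C x"
  by (simp_all add: has_cotensors_def)

section \<open>The commutant theory and its algebra\<close>

text \<open>A hom of the commutant theory is literally a hom of algebras, only the endpoints are
  labelled by arities. Replacing the label \<open>j\<close> by \<open>alg_cot T C j A\<close> allows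
  calculations to be done in the category of algebras.\<close>

definition lft :: "('o, 'm) jtheory \<Rightarrow> ('c, 'o, 'm) cvcat \<Rightarrow> ('o, 'c, 'm) vfun \<Rightarrow> ('o, 'o, 'm) gr
   \<Rightarrow> ('o, 'c, 'm) vfun \<times> ('o, 'c, 'm) vfun \<times> ('o, 'm) el" where
  "lft T C A e = (alg_cot T C (sr e) A, alg_cot T C (tg e) A, ge e)"

lemma lft_simps [simp]: "sr (lft T C A e) = alg_cot T C (sr e) A" "tg (lft T C A e) = alg_cot T C (tg e) A"
    "gc (lft T C A e) = gc e" "ge (lft T C A e) = ge e"
  by (simp_all add: lft_def)

lemma commutant_simps [simp]: "VOb (commutant_theory J T C A) = J"
    "VHom (commutant_theory J T C A) j k = nat_ob T C (alg_cot T C j A) (alg_cot T C k A)"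
    "VId (commutant_theory J T C A) j = VId (Alg J T C) (alg_cot T C j A)"
    "VComp (commutant_theory J T C A) j k l = VComp (Alg J T C) (alg_cot T C j A) (alg_cot T C k A) (alg_cot T C l A)"
    "Str (commutant_theory J T C A) j k = cot_lift (Alg J T C) k A (alg_cot T C k A) (alg_counit T C k A) (alg_cot T C j A) (IHom V k j)
         (alg_counit T C j A \<cdot> Ev V k j)"
  by (simp_all add: commutant_theory_def Let_def Alg_def)

lemma Alg_simps [simp]: "VOb (Alg J T C) = algebras J T C" "VHom (Alg J T C) = nat_ob T C"
  by (simp_all add: Alg_def)

lemma lft_cmp: "lft T C A (g \<bullet>\<^bsub>commutant_theory J T C A\<^esub> f) = lft T C A g \<bullet>\<^bsub>Alg J T C\<^esub> lft T C A f"
  by (simp add: lft_def gcmp_def)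

lemma lft_gid: "lft T C A (gid (commutant_theory J T C A) j) = gid (Alg J T C) (alg_cot T C j A)"
  by (simp add: lft_def gid_def)

lemma gok_commutant:
  assumes S: "setting J T C" and A: "A \<in> algebras J T C"
  shows "gok (commutant_theory J T C A) e \<longleftrightarrow> sr e \<in> J \<and> tg e \<in> J \<and> gok (Alg J T C) (lft T C A e)"
  using alg_cot_algebra[OF S A] by (auto simp: gok_def)

lemma Alg_vcategory: "setting J T C \<Longrightarrow> vcategory (Alg J T C)"
  using fun_cat_vcategory[OF settingD(5)] by (simp add: Alg_def)

text \<open>The endpoints are compared separately because an arity cannot in general be recovered
  from the corresponding cotensor of \<open>A\<close>.\<close>

lemma lft_inj: "\<lbrakk>sr e = sr d; tg e = tg d; lft T C A e = lft T C A d\<rbrakk> \<Longrightarrow> e = d"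
  by (intro gr_eqI) (auto simp: lft_def)

lemma commutant_vcategory:
  assumes S: "setting J T C" and A: "A \<in> algebras J T C"
  shows "vcategory (commutant_theory J T C A)"
proof -
  have "vcategory (Alg J T C)" using Alg_vcategory[OF S] .
  then show ?thesis unfolding vcategory_def using alg_cot_algebra[OF S A] by simp
qed

text \<open>The objects of the commutant theory test against some of the algebras only, so a
  cotensor among algebras stays one here; \<open>alg_cot_I\<close> identifies the base object with
  \<open>A\<close>.\<close>

lemma commutant_kappas:
  assumes S: "setting J T C" and A: "A \<in> algebras J T C"
  shows "kappas J (commutant_theory J T C A) (\<lambda>u. alg_counit T C u A)"
proof -
  have "is_cotensor (commutant_theory J T C A) u \<I> u (alg_counit T C u A)" if u: "u \<in> J" for u
    using alg_counit(5)[OF S A u] alg_cot_algebra[OF S A] u settingD(8)[OF S]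
    unfolding is_cotensor_def by (simp add: alg_cot_I[OF S A])
  then show ?thesis using commutant_vcategory[OF S A] by (simp add: kappas_def)
qed

text \<open>The same equation as in \<open>kp_Str\<close>, here because \<open>Str\<close> is
  defined as a lift. Comparing the two will show that a functor into the commutant respects the
  structure arrows.\<close>

lemma commutant_Str:
  assumes S: "setting J T C" and A: "A \<in> algebras J T C" and jk: "j \<in> J" "k \<in> J"
  defines "W \<equiv> commutant_theory J T C A"
  shows "Str W j k \<in> Ar V" "Dom V (Str W j k) = IHom V k j" "Cod V (Str W j k) = VHom W j k"
    "\<lbrakk>okel q; ty q = k; okel y; ty y = IHom V k j; ct y \<inter> ct q = {}\<rbrakk> \<Longrightarrow>
      kp (\<lambda>u. alg_counit T C u A) k q \<bullet>\<^bsub>W\<^esub> (j, k, Str W j k \<triangleright> y) = kp (\<lambda>u. alg_counit T C u A) j (Ev V k j \<triangleright> (y \<bowtie> q))"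
proof -
  have ob: "j \<in> Ob V" "k \<in> Ob V" using arities_Ob[OF settingD(1)[OF S]] jk by auto
  note cj = alg_counit[OF S A jk(1)] and ck = alg_counit[OF S A jk(2)]
  let ?\<phi> = "alg_counit T C j A \<cdot> Ev V k j"
  have p: "?\<phi> \<in> Ar V" "Dom V ?\<phi> = IHom V k j \<otimes> k" "Cod V ?\<phi> = VHom (Alg J T C) (alg_cot T C j A) A"
    using cj ob by simp_all
  have z: "alg_cot T C j A \<in> VOb (Alg J T C)" "IHom V k j \<in> Ob V" using alg_cot_algebra[OF S A jk(1)] ob by simp_all
  note l = cot_lift_arr[OF Alg_vcategory[OF S] ck(5) z p]
  show "Str W j k \<in> Ar V" "Dom V (Str W j k) = IHom V k j" "Cod V (Str W j k) = VHom W j k"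
    using l unfolding W_def by simp_all
  assume q: "okel q" "ty q = k" "okel y" "ty y = IHom V k j" "ct y \<inter> ct q = {}"
  show "kp (\<lambda>u. alg_counit T C u A) k q \<bullet>\<^bsub>W\<^esub> (j, k, Str W j k \<triangleright> y) = kp (\<lambda>u. alg_counit T C u A) j (Ev V k j \<triangleright> (y \<bowtie> q))"
    by (rule lft_inj[of _ _ T C A])
      (use l(4)[of y q] q cj(1-3) ob in \<open>simp_all add: W_def lft_cmp\<close>, simp add: lft_def kp_def alg_cot_I[OF S A])
qed

text \<open>Component by component, the counit for \<open>\<I>\<close> is a designated counit and
  hence an identity.\<close>

lemma commutant_kp_un:
  assumes S: "setting J T C" and A: "A \<in> algebras J T C"
  shows "kp (\<lambda>u. alg_counit T C u A) \<I> un = gid (commutant_theory J T C A) \<I>"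
proof (rule lft_inj[of _ _ T C A])
  note s = settingD[OF S] and cI = alg_counit[OF S A settingD(8)[OF S]]
  have l: "lft T C A (kp (\<lambda>u. alg_counit T C u A) \<I> un) = (A, A, alg_counit T C \<I> A \<triangleright> un)"
    by (simp add: lft_def kp_def alg_cot_I[OF S A])
  have "(A, A, alg_counit T C \<I> A \<triangleright> un) = gid (fun_cat T C (algebras J T C)) A"
  proof (rule cmpt_ext[OF s(5) _ cmpt_id(1)[OF s(5) A]])
    show "gok (fun_cat T C (algebras J T C)) (A, A, alg_counit T C \<I> A \<triangleright> un)"
      using cI(1-3) A by (simp add: alg_cot_I[OF S A])
    fix a assume "a \<in> VOb T"
    then have a: "a \<in> J" "FOb A a \<in> VOb C" using s vfun_typ(1)[OF algebrasD(1)[OF A]] by simp_all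
    have "nat_pr T C A A a \<triangleright> alg_counit T C \<I> A \<triangleright> un = VId C (FOb A a) \<triangleright> un"
      by (rule app_collapse)
        (use cI(1-3) cI(4)[OF a(1)] nat_pr_typ[OF s(5) A A] a s Cot_I(2)[OF s(4) a(2)] in \<open>auto simp: alg_cot_I[OF S A]\<close>)
    then show "cmpt T C a (A, A, alg_counit T C \<I> A \<triangleright> un) = cmpt T C a (gid (fun_cat T C (algebras J T C)) A)"
      using cmpt_id(2)[OF s(5) A] a s by (simp add: cmpt_def gid_def)
  qed simp_all
  then show "lft T C A (kp (\<lambda>u. alg_counit T C u A) \<I> un) = lft T C A (gid (commutant_theory J T C A) \<I>)"
    unfolding l by (simp add: lft_gid alg_cot_I[OF S A]) (simp add: Alg_def)
qed simp_all

lemma commutant_algebra_mp: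
  assumes S: "setting J T C" and A: "A \<in> algebras J T C" and e: "gok (commutant_theory J T C A) e"
  shows "commutant_algebra J T C A \<star> e = cmpt T C \<I> (lft T C A e)"
  using gok_D(1,2)[OF e] alg_cot_algebra[OF S A] alg_cot_FOb[OF S A settingD(8)[OF S]]
  by (simp add: commutant_algebra_def gmp_def cmpt_def alg_carrier_def evaluation_def)

lemma commutant_algebra_vfunctor:
  assumes S: "setting J T C" and A: "A \<in> algebras J T C"
  shows "vfunctor (commutant_theory J T C A) C (commutant_algebra J T C A)"
proof -
  note s = settingD[OF S] and mp = commutant_algebra_mp[OF S A]
  note W = commutant_vcategory[OF S A] and al = alg_cot_algebra[OF S A]
  have IT: "\<I> \<in> VOb T" using s by simp
  have P: "commutant_algebra J T C A = mk_vfun (VOb (commutant_theory J T C A)) (\<lambda>j. Cot C j (FOb A \<I>))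
     (\<lambda>j k. FHom (alg_carrier J T C) (alg_cot T C j A) (alg_cot T C k A))" by (simp add: commutant_algebra_def)
  have x: "FOb A \<I> \<in> VOb C" using vfun_typ(1)[OF algebrasD(1)[OF A] IT] .
  show ?thesis
  proof (rule vfunctorI[OF W s(3) P])
    fix a assume "a \<in> VOb (commutant_theory J T C A)"
    then have a: "a \<in> J" by simp
    show "Cot C a (FOb A \<I>) \<in> VOb C" using cotD[OF has_cotD[OF s(4) a x]] by simp
    show "commutant_algebra J T C A \<star> gid (commutant_theory J T C A) a = gid C (FOb (commutant_algebra J T C A) a)"
      using a W cmpt_id(2)[OF s(5) al[OF a] IT] alg_cot_FOb[OF S A s(8)] by (simp add: mp lft_gid) (simp add: Alg_def commutant_algebra_def)
  next
    fix a b assume "a \<in> VOb (commutant_theory J T C A)" "b \<in> VOb (commutant_theory J T C A)"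
    then have ab: "a \<in> J" "b \<in> J" by simp_all
    show "FHom (alg_carrier J T C) (alg_cot T C a A) (alg_cot T C b A) \<in> Ar V \<and>
       Dom V (FHom (alg_carrier J T C) (alg_cot T C a A) (alg_cot T C b A)) = VHom (commutant_theory J T C A) a b \<and>
       Cod V (FHom (alg_carrier J T C) (alg_cot T C a A) (alg_cot T C b A)) = VHom C (Cot C a (FOb A \<I>)) (Cot C b (FOb A \<I>))"
      using nat_pr_typ[OF s(5) al[OF ab(1)] al[OF ab(2)]] IT al ab alg_cot_FOb[OF S A s(8)]
      by (simp add: alg_carrier_def evaluation_def)
  next
    fix g f assume *: "gok (commutant_theory J T C A) g" "gok (commutant_theory J T C A) f" "sr g = tg f" "gc g \<inter> gc f = {}"
    have l: "gok (fun_cat T C (algebras J T C)) (lft T C A g)" "gok (fun_cat T C (algebras J T C)) (lft T C A f)"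
      using *(1,2) unfolding gok_commutant[OF S A] by (simp_all add: Alg_def)
    show "commutant_algebra J T C A \<star> (g \<bullet>\<^bsub>commutant_theory J T C A\<^esub> f) =
       (commutant_algebra J T C A \<star> g) \<bullet>\<^bsub>C\<^esub> (commutant_algebra J T C A \<star> f)"
      using cmpt_cmp(2)[OF s(5) l _ _ IT] * W by (simp add: mp lft_cmp) (simp add: Alg_def)
  qed
qed

text \<open>By \<open>preserves_if_kappas\<close> only the counits have to be considered, and their
  components at \<open>\<I>\<close> are the designated counits of \<open>C\<close>.\<close>

lemma commutant_algebra_algebra:
  assumes S: "setting J T C" and A: "A \<in> algebras J T C"
  shows "commutant_algebra J T C A \<in> algebras J (commutant_theory J T C A) C"
proof -
  note s = settingD[OF S] and al = alg_cot_algebra[OF S A] and F = commutant_algebra_vfunctor[OF S A]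
  have x: "FOb A \<I> \<in> VOb C" using vfun_typ(1)[OF algebrasD(1)[OF A]] s by simp
  have "is_cotensor C u (FOb (commutant_algebra J T C A) \<I>) (FOb (commutant_algebra J T C A) u)
     (FHom (commutant_algebra J T C A) u \<I> \<cdot> alg_counit T C u A)" if u: "u \<in> J" for u
    using has_cotD[OF s(4) u x] alg_counit(4)[OF S A u s(8)] u s(8) al[OF u] A Cot_I(1)[OF s(4) x]
    by (simp add: commutant_algebra_def alg_carrier_def evaluation_def alg_cot_I[OF S A])
  from preserves_if_kappas[OF s(1) commutant_kappas[OF S A] F this] show ?thesis using F by (simp add: algebras_def)
qed

section \<open>Tensor products of enriched categories\<close>

text \<open>For tests on hom-objects that are tensor products, it is enough to use decomposable generic elements.\<close>

lemma vcategoryI_gen: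
  assumes hom: "\<And>a b. \<lbrakk>a \<in> VOb C; b \<in> VOb C\<rbrakk> \<Longrightarrow> VHom C a b \<in> Ob V"
    and ide: "\<And>a. a \<in> VOb C \<Longrightarrow> \<guillemotleft>VId C a : \<I> \<rightarrow> VHom C a a\<guillemotright>"
    and cmp: "\<And>a b c. \<lbrakk>a \<in> VOb C; b \<in> VOb C; c \<in> VOb C\<rbrakk>
      \<Longrightarrow> \<guillemotleft>VComp C a b c : VHom C b c \<otimes> VHom C a b \<rightarrow> VHom C a c\<guillemotright>"
    and assoc: "\<And>a b c d. \<lbrakk>a \<in> VOb C; b \<in> VOb C; c \<in> VOb C; d \<in> VOb C\<rbrakk> \<Longrightarrow>
      \<exists>f g h. isoel h \<and> isoel g \<and> isoel f \<and> ty h = VHom C c d \<and> ty g = VHom C b c \<and> ty f = VHom C a b \<and>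
        ct h \<inter> ct g = {} \<and> ct h \<inter> ct f = {} \<and> ct g \<inter> ct f = {} \<and>
        ((c, d, h) \<bullet>\<^bsub>C\<^esub> (b, c, g)) \<bullet>\<^bsub>C\<^esub> (a, b, f) = (c, d, h) \<bullet>\<^bsub>C\<^esub> ((b, c, g) \<bullet>\<^bsub>C\<^esub> (a, b, f))"
    and idl: "\<And>a b. \<lbrakk>a \<in> VOb C; b \<in> VOb C\<rbrakk> \<Longrightarrow> \<exists>f. isoel f \<and> ty f = VHom C a b \<and>
       gid C b \<bullet>\<^bsub>C\<^esub> (a, b, f) = (a, b, f) \<and> (a, b, f) \<bullet>\<^bsub>C\<^esub> gid C a = (a, b, f)"
  shows "vcategory C"
proof -
  have [simp]: "VId C a \<in> Ar V" "Dom V (VId C a) = \<I>" "Cod V (VId C a) = VHom C a a" if "a \<in> VOb C" for a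
    using ide[OF that] by (auto simp: in_hom_def)
  have [simp]: "VComp C a b c \<in> Ar V" "Dom V (VComp C a b c) = VHom C b c \<otimes> VHom C a b"
     "Cod V (VComp C a b c) = VHom C a c" if "a \<in> VOb C" "b \<in> VOb C" "c \<in> VOb C" for a b c
    using cmp[OF that] by (auto simp: in_hom_def)
  note [simp] = hom
  have 1: "VComp C a b d \<cdot> (VComp C b c d \<odot> Idn V (VHom C a b))
        = VComp C a c d \<cdot> (Idn V (VHom C c d) \<odot> VComp C a b c)
            \<cdot> Asc V (VHom C c d) (VHom C b c) (VHom C a b)"
    if ob: "a \<in> VOb C" "b \<in> VOb C" "c \<in> VOb C" "d \<in> VOb C" for a b c d
  proof -
    obtain f g h where *: "isoel h" "isoel g" "isoel f" "ty h = VHom C c d" "ty g = VHom C b c" "ty f = VHom C a b"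
        "ct h \<inter> ct g = {}" "ct h \<inter> ct f = {}" "ct g \<inter> ct f = {}"
        "((c, d, h) \<bullet>\<^bsub>C\<^esub> (b, c, g)) \<bullet>\<^bsub>C\<^esub> (a, b, f) = (c, d, h) \<bullet>\<^bsub>C\<^esub> ((b, c, g) \<bullet>\<^bsub>C\<^esub> (a, b, f))"
      using assoc[OF ob] by blast
    show ?thesis
      by (rule arr_ext[of _ "(h \<bowtie> g) \<bowtie> f"]) (use * ob in \<open>simp_all add: gcmp_tuple disj\<close>)
  qed
  have 2: "VComp C a b b \<cdot> (VId C b \<odot> Idn V (VHom C a b)) = Lun V (VHom C a b)"
     "VComp C a a b \<cdot> (Idn V (VHom C a b) \<odot> VId C a) = Run V (VHom C a b)" if ob: "a \<in> VOb C" "b \<in> VOb C" for a b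
  proof -
    obtain f where *: "isoel f" "ty f = VHom C a b" "gid C b \<bullet>\<^bsub>C\<^esub> (a, b, f) = (a, b, f)" "(a, b, f) \<bullet>\<^bsub>C\<^esub> gid C a = (a, b, f)"
      using idl[OF ob] by blast
    show "VComp C a b b \<cdot> (VId C b \<odot> Idn V (VHom C a b)) = Lun V (VHom C a b)"
      by (rule arr_ext[of _ "un \<bowtie> f"]) (use * ob in \<open>simp_all add: gcmp_tuple gid_def\<close>)
    show "VComp C a a b \<cdot> (Idn V (VHom C a b) \<odot> VId C a) = Run V (VHom C a b)"
      by (rule arr_ext[of _ "f \<bowtie> un"]) (use * ob in \<open>simp_all add: gcmp_tuple gid_def\<close>)
  qed
  show ?thesis unfolding vcategory_def in_hom_def by (simp add: 1 2)
qed

lemma vfunctorI_gen: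
  assumes cat [simp]: "vcategory A" "vcategory B" and F: "F = mk_vfun (VOb A) X H"
    and ob: "\<And>a. a \<in> VOb A \<Longrightarrow> X a \<in> VOb B"
    and hom: "\<And>a b. \<lbrakk>a \<in> VOb A; b \<in> VOb A\<rbrakk> \<Longrightarrow> H a b \<in> Ar V \<and> Dom V (H a b) = VHom A a b \<and> Cod V (H a b) = VHom B (X a) (X b)"
    and ide: "\<And>a. a \<in> VOb A \<Longrightarrow> F \<star> gid A a = gid B (FOb F a)"
    and cmp: "\<And>a b c. \<lbrakk>a \<in> VOb A; b \<in> VOb A; c \<in> VOb A\<rbrakk> \<Longrightarrow>
      \<exists>f g. isoel g \<and> isoel f \<and> ty g = VHom A b c \<and> ty f = VHom A a b \<and> ct g \<inter> ct f = {} \<and>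
        F \<star> ((b, c, g) \<bullet>\<^bsub>A\<^esub> (a, b, f)) = (F \<star> (b, c, g)) \<bullet>\<^bsub>B\<^esub> (F \<star> (a, b, f))"
  shows "vfunctor A B F"
proof -
  have [simp]: "FOb F a = X a" if "a \<in> VOb A" for a using that by (simp add: F)
  have [simp]: "FHom F a b = H a b" if "a \<in> VOb A" "b \<in> VOb A" for a b using that by (simp add: F)
  have 0: "F = mk_vfun (VOb A) (FOb F) (FHom F)" unfolding F by (auto simp: mk_vfun_def fun_eq_iff)
  have 1: "FHom F a a \<cdot> VId A a = VId B (FOb F a)" if "a \<in> VOb A" for a
    by (rule arr_ext[of _ un]) (use ide[OF that] that ob hom in \<open>auto simp: gmp_tuple gid_def\<close>)
  have 2: "FHom F a c \<cdot> VComp A a b c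
        = VComp B (FOb F a) (FOb F b) (FOb F c) \<cdot> (FHom F b c \<odot> FHom F a b)"
    if abc: "a \<in> VOb A" "b \<in> VOb A" "c \<in> VOb A" for a b c
  proof -
    obtain f g where *: "isoel g" "isoel f" "ty g = VHom A b c" "ty f = VHom A a b" "ct g \<inter> ct f = {}"
        "F \<star> ((b, c, g) \<bullet>\<^bsub>A\<^esub> (a, b, f)) = (F \<star> (b, c, g)) \<bullet>\<^bsub>B\<^esub> (F \<star> (a, b, f))" using cmp[OF abc] by blast
    show ?thesis
      by (rule arr_ext[of _ "g \<bowtie> f"]) (use * abc ob hom in \<open>auto simp: gmp_tuple gcmp_tuple\<close>)
  qed
  show ?thesis unfolding vfunctor_def in_hom_def using cat 0 1 2 ob hom by simp
qed

lemma wedgeI_gen: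
  assumes F: "vfunctor A B F" "vfunctor A B G"
    and x: "isoel x" "ty x = X"
    and t0: "\<And>a. a \<in> VOb A \<Longrightarrow> \<mu> a \<in> Ar V \<and> Dom V (\<mu> a) = X \<and> Cod V (\<mu> a) = VHom B (FOb F a) (FOb G a)"
    and nat: "\<And>a b. \<lbrakk>a \<in> VOb A; b \<in> VOb A\<rbrakk> \<Longrightarrow> \<exists>q. isoel q \<and> ty q = VHom A a b \<and> ct q \<inter> ct x = {} \<and>
      (G \<star> (a, b, q)) \<bullet>\<^bsub>B\<^esub> (FOb F a, FOb G a, \<mu> a \<triangleright> x) = (FOb F b, FOb G b, \<mu> b \<triangleright> x) \<bullet>\<^bsub>B\<^esub> (F \<star> (a, b, q))"
  shows "wedge A B F G X \<mu>"
proof -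
  note [simp] = vfun_cat[OF F(1)]
  have X [simp]: "X \<in> Ob V" using x ty_Ob by auto
  have "VComp B (FOb F a) (FOb G a) (FOb G b) \<cdot> (FHom G a b \<odot> \<mu> a)
        = VComp B (FOb F a) (FOb F b) (FOb G b) \<cdot> (\<mu> b \<odot> FHom F a b) \<cdot> Sym V (VHom A a b) X"
    if ab: "a \<in> VOb A" "b \<in> VOb A" for a b
  proof -
    obtain q where *: "isoel q" "ty q = VHom A a b" "ct q \<inter> ct x = {}"
      "(G \<star> (a, b, q)) \<bullet>\<^bsub>B\<^esub> (FOb F a, FOb G a, \<mu> a \<triangleright> x) = (FOb F b, FOb G b, \<mu> b \<triangleright> x) \<bullet>\<^bsub>B\<^esub> (F \<star> (a, b, q))"
      using nat[OF ab] by blast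
    show ?thesis
      by (rule arr_ext[of _ "q \<bowtie> x"])
        (use * x ab F t0 in \<open>auto simp: gcmp_tuple gmp_tuple Int_commute\<close>)
  qed
  then show ?thesis using t0 unfolding wedge_def in_hom_def by simp
qed

definition gt :: "('a, 'o, 'm) gr \<Rightarrow> ('b, 'o, 'm) gr \<Rightarrow> ('a \<times> 'b) \<times> ('a \<times> 'b) \<times> ('o, 'm) el" where
  "gt e d = ((sr e, sr d), (tg e, tg d), ge e \<bowtie> ge d)"

lemma gt_simps [simp]: "sr (gt e d) = (sr e, sr d)" "tg (gt e d) = (tg e, tg d)" "gc (gt e d) = gc e \<union> gc d"
  by (simp_all add: gt_def)

lemma vtensor_simps [simp]: "VOb (vtensor A B) = VOb A \<times> VOb B"
  "VHom (vtensor A B) (a, b) (a', b') = VHom A a a' \<otimes> VHom B b b'"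
  by (simp_all add: vtensor_def)

lemma gok_gt [simp]: "\<lbrakk>gok A e; gok B d; gc e \<inter> gc d = {}\<rbrakk> \<Longrightarrow> gok (vtensor A B) (gt e d)"
  by (simp add: gt_def gok_D)

lemma gid_gt: "\<lbrakk>vcategory A; vcategory B; a \<in> VOb A; b \<in> VOb B\<rbrakk> \<Longrightarrow> gid (vtensor A B) (a, b) = gt (gid A a) (gid B b)"
  by (simp add: gid_def gt_def) (simp add: vtensor_def)

lemma gt_cmp:
  assumes "vcategory A" "vcategory B" "gok A e'" "gok A e" "gok B d'" "gok B d" "sr e' = tg e" "sr d' = tg d"
    "gc e' \<inter> gc e = {}" "gc d' \<inter> gc d = {}" "gc e' \<inter> gc d' = {}" "gc e' \<inter> gc d = {}" "gc e \<inter> gc d' = {}" "gc e \<inter> gc d = {}"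
  shows "gt e' d' \<bullet>\<^bsub>vtensor A B\<^esub> gt e d = gt (e' \<bullet>\<^bsub>A\<^esub> e) (d' \<bullet>\<^bsub>B\<^esub> d)"
proof -
  note d = gok_D[OF assms(3)] gok_D[OF assms(4)] gok_D[OF assms(5)] gok_D[OF assms(6)]
  have m: "mid4 (VHom A (tg e) (tg e')) (VHom B (tg d) (tg d')) (VHom A (sr e) (tg e)) (VHom B (sr d) (tg d)) \<in> Ar V"
    "Dom V (mid4 (VHom A (tg e) (tg e')) (VHom B (tg d) (tg d')) (VHom A (sr e) (tg e)) (VHom B (sr d) (tg d)))
     = (VHom A (tg e) (tg e') \<otimes> VHom B (tg d) (tg d')) \<otimes> (VHom A (sr e) (tg e) \<otimes> VHom B (sr d) (tg d))"
    "Cod V (mid4 (VHom A (tg e) (tg e')) (VHom B (tg d) (tg d')) (VHom A (sr e) (tg e)) (VHom B (sr d) (tg d)))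
     = (VHom A (tg e) (tg e') \<otimes> VHom A (sr e) (tg e)) \<otimes> (VHom B (tg d) (tg d') \<otimes> VHom B (sr d) (tg d))"
    using assms(1,2) d by (simp_all add: mid4_def)
  show ?thesis using assms d m
    by (simp add: gt_def gcmp_def) (simp add: vtensor_def disj)
qed

lemma vtensor_vcategory:
  assumes A: "vcategory A" and B: "vcategory B"
  shows "vcategory (vtensor A B)"
proof (rule vcategoryI_gen)
  let ?C = "vtensor A B"
  fix p assume "p \<in> VOb ?C"
  then show "\<guillemotleft>VId ?C p : \<I> \<rightarrow> VHom ?C p p\<guillemotright>" using A B by (auto simp: vtensor_def in_hom_def)
next
  let ?C = "vtensor A B"
  fix p q r assume "p \<in> VOb ?C" "q \<in> VOb ?C" "r \<in> VOb ?C"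
  then show "\<guillemotleft>VComp ?C p q r : VHom ?C q r \<otimes> VHom ?C p q \<rightarrow> VHom ?C p r\<guillemotright>"
    using A B by (auto simp: vtensor_def in_hom_def mid4_def)
next
  let ?C = "vtensor A B"
  fix p q r s assume *: "p \<in> VOb ?C" "q \<in> VOb ?C" "r \<in> VOb ?C" "s \<in> VOb ?C"
  obtain a a' b b' c c' d d' where e: "p = (a, a')" "q = (b, b')" "r = (c, c')" "s = (d, d')" by (metis surj_pair)
  \<comment> \<open>There is one variable for each tensor factor of each of the three hom-objects,
    so the associativity law splits into those of \<open>A\<close> and \<open>B\<close>.\<close>
  let ?f = "(a, b, gen 0 (VHom A a b))" and ?g = "(b, c, gen 1 (VHom A b c))" and ?h = "(c, d, gen 2 (VHom A c d))"
  let ?f' = "(a', b', gen 3 (VHom B a' b'))" and ?g' = "(b', c', gen 4 (VHom B b' c'))" and ?h' = "(c', d', gen 5 (VHom B c' d'))"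
  have ok: "gok A ?f" "gok A ?g" "gok A ?h" "gok B ?f'" "gok B ?g'" "gok B ?h'" using * A B unfolding e by auto
  have 1: "(gt ?h ?h' \<bullet>\<^bsub>?C\<^esub> gt ?g ?g') \<bullet>\<^bsub>?C\<^esub> gt ?f ?f' = gt ((?h \<bullet>\<^bsub>A\<^esub> ?g) \<bullet>\<^bsub>A\<^esub> ?f) ((?h' \<bullet>\<^bsub>B\<^esub> ?g') \<bullet>\<^bsub>B\<^esub> ?f')"
    using ok A B by (simp add: gt_cmp disj del: gok_tuple)
  have 2: "gt ?h ?h' \<bullet>\<^bsub>?C\<^esub> (gt ?g ?g' \<bullet>\<^bsub>?C\<^esub> gt ?f ?f') = gt (?h \<bullet>\<^bsub>A\<^esub> (?g \<bullet>\<^bsub>A\<^esub> ?f)) (?h' \<bullet>\<^bsub>B\<^esub> (?g' \<bullet>\<^bsub>B\<^esub> ?f'))"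
    using ok A B by (simp add: gt_cmp disj del: gok_tuple)
  have "(gt ?h ?h' \<bullet>\<^bsub>?C\<^esub> gt ?g ?g') \<bullet>\<^bsub>?C\<^esub> gt ?f ?f' = gt ?h ?h' \<bullet>\<^bsub>?C\<^esub> (gt ?g ?g' \<bullet>\<^bsub>?C\<^esub> gt ?f ?f')"
    unfolding 1 2 using ok A B by (simp add: gcmp_assoc del: gok_tuple)
  then show "\<exists>f g h. isoel h \<and> isoel g \<and> isoel f \<and> ty h = VHom ?C r s \<and> ty g = VHom ?C q r \<and> ty f = VHom ?C p q \<and>
        ct h \<inter> ct g = {} \<and> ct h \<inter> ct f = {} \<and> ct g \<inter> ct f = {} \<and>
        ((r, s, h) \<bullet>\<^bsub>?C\<^esub> (q, r, g)) \<bullet>\<^bsub>?C\<^esub> (p, q, f) = (r, s, h) \<bullet>\<^bsub>?C\<^esub> ((q, r, g) \<bullet>\<^bsub>?C\<^esub> (p, q, f))"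
    unfolding e
    by (intro exI[of _ "ge ?f \<bowtie> ge ?f'"] exI[of _ "ge ?g \<bowtie> ge ?g'"] exI[of _ "ge ?h \<bowtie> ge ?h'"])
      (use * A B e in \<open>auto simp: gt_def\<close>)
next
  let ?C = "vtensor A B"
  fix p q assume *: "p \<in> VOb ?C" "q \<in> VOb ?C"
  obtain a a' b b' where e: "p = (a, a')" "q = (b, b')" by (metis surj_pair)
  let ?f = "(a, b, gen 0 (VHom A a b))" and ?f' = "(a', b', gen 1 (VHom B a' b'))"
  have ok: "gok A ?f" "gok B ?f'" and ob: "a \<in> VOb A" "b \<in> VOb A" "a' \<in> VOb B" "b' \<in> VOb B" using * A B unfolding e by auto
  have 1: "gid ?C q \<bullet>\<^bsub>?C\<^esub> gt ?f ?f' = gt ?f ?f'" "gt ?f ?f' \<bullet>\<^bsub>?C\<^esub> gid ?C p = gt ?f ?f'"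
    unfolding e using ok ob A B by (simp_all add: gid_gt gt_cmp del: gok_tuple)
  then show "\<exists>f. isoel f \<and> ty f = VHom ?C p q \<and> gid ?C q \<bullet>\<^bsub>?C\<^esub> (p, q, f) = (p, q, f) \<and> (p, q, f) \<bullet>\<^bsub>?C\<^esub> gid ?C p = (p, q, f)"
    by (intro exI[of _ "ge ?f \<bowtie> ge ?f'"]) (use ob A B in \<open>auto simp: gt_def e\<close>)
qed (use A B in auto)

context
  fixes A :: "('a, 'o, 'm, 'y) vcat_scheme" and B :: "('b, 'o, 'm, 'z) vcat_scheme" and C :: "('c, 'o, 'm, 'w) vcat_scheme"
    and D :: "('a \<times> 'b, 'c, 'm) vfun"
  assumes A: "vcategory A" and B: "vcategory B" and D: "vfunctor (vtensor A B) C D"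
begin

lemma fix_right_mp: "\<lbrakk>u \<in> VOb B; gok A e\<rbrakk> \<Longrightarrow> fix_right A B D u \<star> e = D \<star> gt e (gid B u)"
  using vfun_typ(1)[OF D, of "(sr e, u)"] vfun_typ(1)[OF D, of "(tg e, u)"] vfun_typ(2-4)[OF D, of "(sr e, u)" "(tg e, u)"] A B gok_D[of A e]
  by (simp add: gmp_def fix_right_def gt_def) (simp add: gid_def)

lemma fix_left_mp: "\<lbrakk>t \<in> VOb A; gok B d\<rbrakk> \<Longrightarrow> fix_left A B D t \<star> d = D \<star> gt (gid A t) d"
  using vfun_typ(1)[OF D, of "(t, sr d)"] vfun_typ(1)[OF D, of "(t, tg d)"] vfun_typ(2-4)[OF D, of "(t, sr d)" "(t, tg d)"] A B gok_D[of B d]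
  by (simp add: gmp_def fix_left_def gt_def) (simp add: gid_def)

lemma fix_right_FOb [simp]: "t \<in> VOb A \<Longrightarrow> FOb (fix_right A B D u) t = FOb D (t, u)"
  by (simp add: fix_right_def)

lemma fix_left_FOb [simp]: "u \<in> VOb B \<Longrightarrow> FOb (fix_left A B D t) u = FOb D (t, u)"
  by (simp add: fix_left_def)

lemma fix_right_vfunctor: assumes u: "u \<in> VOb B" shows "vfunctor A C (fix_right A B D u)"
proof (rule vfunctorI[OF A vfun_cat(2)[OF D] fix_right_def])
  fix t t' assume t: "t \<in> VOb A" "t' \<in> VOb A"
  let ?H = "FHom D (t, u) (t', u) \<cdot> (Idn V (VHom A t t') \<odot> VId B u) \<cdot> inv_arr V (Run V (VHom A t t'))"
  show "?H \<in> Ar V \<and> Dom V ?H = VHom A t t' \<and> Cod V ?H = VHom C (FOb D (t, u)) (FOb D (t', u))"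
    using vfun_typ(1)[OF D, of "(t, u)"] vfun_typ(1)[OF D, of "(t', u)"] vfun_typ(2-4)[OF D, of "(t, u)" "(t', u)"] A B t u by simp
next
  fix t assume t: "t \<in> VOb A"
  show "fix_right A B D u \<star> gid A t = gid C (FOb (fix_right A B D u) t)"
    using t u A B gmp_id[OF D, of "(t, u)"] by (simp add: fix_right_mp gid_gt)
next
  fix g f assume *: "gok A g" "gok A f" "sr g = tg f" "gc g \<inter> gc f = {}"
  have "D \<star> (gt g (gid B u) \<bullet>\<^bsub>vtensor A B\<^esub> gt f (gid B u)) = (D \<star> gt g (gid B u)) \<bullet>\<^bsub>C\<^esub> (D \<star> gt f (gid B u))"
    by (rule gmp_cmp[OF D]) (use * u A B in auto)
  then show "fix_right A B D u \<star> (g \<bullet>\<^bsub>A\<^esub> f) = (fix_right A B D u \<star> g) \<bullet>\<^bsub>C\<^esub> (fix_right A B D u \<star> f)"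
    using * u A B by (simp add: fix_right_mp gt_cmp)
qed (use vfun_typ(1)[OF D] u in simp)

lemma fix_left_vfunctor: assumes t: "t \<in> VOb A" shows "vfunctor B C (fix_left A B D t)"
proof (rule vfunctorI[OF B vfun_cat(2)[OF D] fix_left_def])
  fix u u' assume u: "u \<in> VOb B" "u' \<in> VOb B"
  let ?H = "FHom D (t, u) (t, u') \<cdot> (VId A t \<odot> Idn V (VHom B u u')) \<cdot> inv_arr V (Lun V (VHom B u u'))"
  show "?H \<in> Ar V \<and> Dom V ?H = VHom B u u' \<and> Cod V ?H = VHom C (FOb D (t, u)) (FOb D (t, u'))"
    using vfun_typ(1)[OF D, of "(t, u)"] vfun_typ(1)[OF D, of "(t, u')"] vfun_typ(2-4)[OF D, of "(t, u)" "(t, u')"] A B t u by simp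
next
  fix u assume u: "u \<in> VOb B"
  show "fix_left A B D t \<star> gid B u = gid C (FOb (fix_left A B D t) u)"
    using t u A B gmp_id[OF D, of "(t, u)"] by (simp add: fix_left_mp gid_gt)
next
  fix g f assume *: "gok B g" "gok B f" "sr g = tg f" "gc g \<inter> gc f = {}"
  have "D \<star> (gt (gid A t) g \<bullet>\<^bsub>vtensor A B\<^esub> gt (gid A t) f) = (D \<star> gt (gid A t) g) \<bullet>\<^bsub>C\<^esub> (D \<star> gt (gid A t) f)"
    by (rule gmp_cmp[OF D]) (use * t A B in auto)
  then show "fix_left A B D t \<star> (g \<bullet>\<^bsub>B\<^esub> f) = (fix_left A B D t \<star> g) \<bullet>\<^bsub>C\<^esub> (fix_left A B D t \<star> f)"
    using * t A B by (simp add: fix_left_mp gt_cmp)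
qed (use vfun_typ(1)[OF D] t in simp)

text \<open>The pair of \<open>e\<close> and \<open>d\<close> is \<open>e\<close> after
  \<open>d\<close>, with identities in the other variables, and equally \<open>d\<close> after
  \<open>e\<close>.\<close>

lemma partial_interchange:
  assumes e: "gok A e" and d: "gok B d" and ed: "gc e \<inter> gc d = {}"
  shows "D \<star> gt e d = (fix_right A B D (tg d) \<star> e) \<bullet>\<^bsub>C\<^esub> (fix_left A B D (sr e) \<star> d)"
    "D \<star> gt e d = (fix_left A B D (tg e) \<star> d) \<bullet>\<^bsub>C\<^esub> (fix_right A B D (sr d) \<star> e)"
proof -
  have "D \<star> (gt e (gid B (tg d)) \<bullet>\<^bsub>vtensor A B\<^esub> gt (gid A (sr e)) d) = (D \<star> gt e (gid B (tg d))) \<bullet>\<^bsub>C\<^esub> (D \<star> gt (gid A (sr e)) d)"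
    by (rule gmp_cmp[OF D]) (use e d ed A B in auto)
  then show "D \<star> gt e d = (fix_right A B D (tg d) \<star> e) \<bullet>\<^bsub>C\<^esub> (fix_left A B D (sr e) \<star> d)"
    using e d ed A B by (simp add: fix_left_mp fix_right_mp gt_cmp)
  have "D \<star> (gt (gid A (tg e)) d \<bullet>\<^bsub>vtensor A B\<^esub> gt e (gid B (sr d))) = (D \<star> gt (gid A (tg e)) d) \<bullet>\<^bsub>C\<^esub> (D \<star> gt e (gid B (sr d)))"
    by (rule gmp_cmp[OF D]) (use e d ed A B in \<open>auto simp: disj\<close>)
  then show "D \<star> gt e d = (fix_left A B D (tg e) \<star> d) \<bullet>\<^bsub>C\<^esub> (fix_right A B D (sr d) \<star> e)"
    using e d ed A B by (simp add: fix_left_mp fix_right_mp gt_cmp disj)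
qed

end

text \<open>The action on homs is forced by \<open>partial_interchange\<close>: first the second
  variable acts, then the first. The assumption \<open>nat\<close> is precisely what compatibility
  with composition requires.\<close>

lemma bifunctorI:
  assumes A: "vcategory A" and B: "vcategory B" and C: "vcategory C"
    and R: "\<And>u. u \<in> VOb B \<Longrightarrow> vfunctor A C (R u)" and L: "\<And>t. t \<in> VOb A \<Longrightarrow> vfunctor B C (L t)"
    and ob: "\<And>t u. \<lbrakk>t \<in> VOb A; u \<in> VOb B\<rbrakk> \<Longrightarrow> FOb (R u) t = FOb (L t) u"
    and nat: "\<And>e d. \<lbrakk>gok A e; gok B d; gc e \<inter> gc d = {}\<rbrakk> \<Longrightarrow> (R (tg d) \<star> e) \<bullet>\<^bsub>C\<^esub> (L (sr e) \<star> d) = (L (tg e) \<star> d) \<bullet>\<^bsub>C\<^esub> (R (sr d) \<star> e)"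
  obtains D where "vfunctor (vtensor A B) C D" "\<And>t u. \<lbrakk>t \<in> VOb A; u \<in> VOb B\<rbrakk> \<Longrightarrow> FOb D (t, u) = FOb (R u) t"
    "\<And>u. u \<in> VOb B \<Longrightarrow> fix_right A B D u = R u" "\<And>t. t \<in> VOb A \<Longrightarrow> fix_left A B D t = L t"
proof -
  let ?X = "\<lambda>p. FOb (R (snd p)) (fst p)"
  let ?H = "\<lambda>p q. VComp C (FOb (R (snd p)) (fst p)) (FOb (R (snd q)) (fst p)) (FOb (R (snd q)) (fst q)) \<cdot>
     (FHom (R (snd q)) (fst p) (fst q) \<odot> FHom (L (fst p)) (snd p) (snd q))"
  define D where "D = mk_vfun (VOb (vtensor A B)) ?X ?H"
  have H: "?H p q \<in> Ar V \<and> Dom V (?H p q) = VHom (vtensor A B) p q \<and> Cod V (?H p q) = VHom C (?X p) (?X q)"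
    if "p \<in> VOb (vtensor A B)" "q \<in> VOb (vtensor A B)" for p q
  proof -
    obtain t u t' u' where e: "p = (t, u)" "q = (t', u')" by (metis surj_pair)
    show ?thesis using that C vfun_typ[OF R] vfun_typ[OF L] ob unfolding e by simp
  qed
  have mp: "D \<star> gt e d = (R (tg d) \<star> e) \<bullet>\<^bsub>C\<^esub> (L (sr e) \<star> d)" if "gok A e" "gok B d" "gc e \<inter> gc d = {}" for e d
  proof -
    note ed = gok_D[OF that(1)] gok_D[OF that(2)]
    show ?thesis using ed that(3) C vfun_typ[OF R] vfun_typ[OF L] ob by (simp add: D_def gmp_def gt_def gcmp_def)
  qed
  have Rok: "gok C (R u \<star> e)" if "u \<in> VOb B" "gok A e" for u e using gok_mp[OF R] that by blast
  have Lok: "gok C (L t \<star> d)" if "t \<in> VOb A" "gok B d" for t d using gok_mp[OF L] that by blast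
  have D: "vfunctor (vtensor A B) C D"
  proof (rule vfunctorI_gen[OF vtensor_vcategory[OF A B] C D_def])
    show "?X p \<in> VOb C" if "p \<in> VOb (vtensor A B)" for p using that vfun_typ(1)[OF R] by auto
    show "?H p q \<in> Ar V \<and> Dom V (?H p q) = VHom (vtensor A B) p q \<and> Cod V (?H p q) = VHom C (?X p) (?X q)"
      if "p \<in> VOb (vtensor A B)" "q \<in> VOb (vtensor A B)" for p q using H[OF that] .
  next
    fix p assume "p \<in> VOb (vtensor A B)"
    then obtain t u where p: "p = (t, u)" "t \<in> VOb A" "u \<in> VOb B" by auto
    show "D \<star> gid (vtensor A B) p = gid C (FOb D p)"
      using p A B C gmp_id[OF R] gmp_id[OF L] ob vfun_typ(1)[OF R] by (simp add: gid_gt mp) (simp add: D_def)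
  next
    fix p q r assume *: "p \<in> VOb (vtensor A B)" "q \<in> VOb (vtensor A B)" "r \<in> VOb (vtensor A B)"
    then obtain a a' b b' c c' where pqr: "p = (a, a')" "q = (b, b')" "r = (c, c')" "a \<in> VOb A" "b \<in> VOb A" "c \<in> VOb A"
       "a' \<in> VOb B" "b' \<in> VOb B" "c' \<in> VOb B" by auto
    let ?f = "(a, b, gen 0 (VHom A a b))" and ?g = "(b, c, gen 1 (VHom A b c))"
    let ?f' = "(a', b', gen 2 (VHom B a' b'))" and ?g' = "(b', c', gen 3 (VHom B b' c'))"
    have ok: "gok A ?f" "gok A ?g" "gok B ?f'" "gok B ?g'" using pqr A B by auto
    have c1: "gok A (?g \<bullet>\<^bsub>A\<^esub> ?f)" "gok B (?g' \<bullet>\<^bsub>B\<^esub> ?f')" using ok A B by (simp_all del: gok_tuple)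
    have rl: "R c' \<star> (?g \<bullet>\<^bsub>A\<^esub> ?f) = (R c' \<star> ?g) \<bullet>\<^bsub>C\<^esub> (R c' \<star> ?f)" "L a \<star> (?g' \<bullet>\<^bsub>B\<^esub> ?f') = (L a \<star> ?g') \<bullet>\<^bsub>C\<^esub> (L a \<star> ?f')"
      by (rule gmp_cmp[OF R[OF pqr(9)] ok(2,1)], simp, simp) (rule gmp_cmp[OF L[OF pqr(4)] ok(4,3)], simp, simp)
    note k = Rok[OF pqr(9) ok(2)] Rok[OF pqr(9) ok(1)] Rok[OF pqr(8) ok(1)] Lok[OF pqr(4) ok(4)] Lok[OF pqr(4) ok(3)] Lok[OF pqr(5) ok(4)]
    \<comment> \<open>The two inner factors of the fourfold composite stand in the wrong order and
      are exchanged here.\<close>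
    have n: "(R c' \<star> ?f) \<bullet>\<^bsub>C\<^esub> (L a \<star> ?g') = (L b \<star> ?g') \<bullet>\<^bsub>C\<^esub> (R b' \<star> ?f)" using nat[OF ok(1,4)] by simp
    have "D \<star> (gt ?g ?g' \<bullet>\<^bsub>vtensor A B\<^esub> gt ?f ?f') = D \<star> gt (?g \<bullet>\<^bsub>A\<^esub> ?f) (?g' \<bullet>\<^bsub>B\<^esub> ?f')"
      using ok A B by (simp add: gt_cmp del: gok_tuple)
    also have "\<dots> = ((R c' \<star> ?g) \<bullet>\<^bsub>C\<^esub> (R c' \<star> ?f)) \<bullet>\<^bsub>C\<^esub> ((L a \<star> ?g') \<bullet>\<^bsub>C\<^esub> (L a \<star> ?f'))"
      using mp[OF c1] rl by simp
    also have "\<dots> = (R c' \<star> ?g) \<bullet>\<^bsub>C\<^esub> (((R c' \<star> ?f) \<bullet>\<^bsub>C\<^esub> (L a \<star> ?g')) \<bullet>\<^bsub>C\<^esub> (L a \<star> ?f'))"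
      using C k ob pqr by (simp add: gcmp_assoc del: gok_tuple)
    also have "\<dots> = ((R c' \<star> ?g) \<bullet>\<^bsub>C\<^esub> (L b \<star> ?g')) \<bullet>\<^bsub>C\<^esub> ((R b' \<star> ?f) \<bullet>\<^bsub>C\<^esub> (L a \<star> ?f'))"
      unfolding n using C k ob pqr by (simp add: gcmp_assoc del: gok_tuple)
    also have "\<dots> = (D \<star> gt ?g ?g') \<bullet>\<^bsub>C\<^esub> (D \<star> gt ?f ?f')"
      using mp[OF ok(2,4)] mp[OF ok(1,3)] by simp
    finally show "\<exists>f g. isoel g \<and> isoel f \<and> ty g = VHom (vtensor A B) q r \<and> ty f = VHom (vtensor A B) p q \<and> ct g \<inter> ct f = {} \<and>
        D \<star> ((q, r, g) \<bullet>\<^bsub>vtensor A B\<^esub> (p, q, f)) = (D \<star> (q, r, g)) \<bullet>\<^bsub>C\<^esub> (D \<star> (p, q, f))"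
      by (intro exI[of _ "ge ?f \<bowtie> ge ?f'"] exI[of _ "ge ?g \<bowtie> ge ?g'"]) (use pqr A B in \<open>auto simp: gt_def\<close>)
  qed
  have o: "FOb D (t, u) = FOb (R u) t" if "t \<in> VOb A" "u \<in> VOb B" for t u using that by (simp add: D_def)
  have r: "fix_right A B D u = R u" if u: "u \<in> VOb B" for u
  proof (rule vfun_eqI[OF fix_right_vfunctor[OF A B D u] R[OF u]])
    fix e assume e: "gok A e"
    show "fix_right A B D u \<star> e = R u \<star> e"
      using fix_right_mp[OF A B D u e] mp[OF e gok_id[OF B u]] gmp_id[OF L, of "sr e" u] ob[of "sr e" u] u e C Rok[OF u e] by simp
  qed (use o u in \<open>simp add: fix_right_def\<close>)
  have l: "fix_left A B D t = L t" if t: "t \<in> VOb A" for t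
  proof (rule vfun_eqI[OF fix_left_vfunctor[OF A B D t] L[OF t]])
    fix d assume d: "gok B d"
    show "fix_left A B D t \<star> d = L t \<star> d"
      using fix_left_mp[OF A B D t d] mp[OF gok_id[OF A t] d] gmp_id[OF R, of "tg d" t] ob[of t "tg d"] t d C Lok[OF t d] by simp
  qed (use o t ob in \<open>simp add: fix_left_def\<close>)
  show thesis using that D o r l by blast
qed

declare commutant_simps(5) [simp del]

section \<open>From commuting pairs to bifold algebras\<close>

lemma bifoldD:
  assumes "D \<in> bifold_algebras J T U C"
  shows "vfunctor (vtensor T U) C D" "\<lbrakk>u \<in> VOb U\<rbrakk> \<Longrightarrow> preserves_cotensors J T C (fix_right T U D u)"
    "\<lbrakk>t \<in> VOb T\<rbrakk> \<Longrightarrow> preserves_cotensors J U C (fix_left T U D t)"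
  using assms by (auto simp: bifold_algebras_def)

text \<open>The inclusion of the commutant theory into the category of algebras. After it, a functor
  into the commutant can be followed by evaluation at any object of \<open>T\<close>, not only at
  \<open>\<I>\<close>.\<close>

definition iota :: "'o set \<Rightarrow> ('o, 'm) jtheory \<Rightarrow> ('c, 'o, 'm) cvcat \<Rightarrow> ('o, 'c, 'm) vfun \<Rightarrow> ('o, ('o, 'c, 'm) vfun, 'm) vfun" where
  "iota J T C A = mk_vfun J (\<lambda>j. alg_cot T C j A) (\<lambda>j k. Idn V (nat_ob T C (alg_cot T C j A) (alg_cot T C k A)))"

lemma iota_FOb [simp]: "j \<in> J \<Longrightarrow> FOb (iota J T C A) j = alg_cot T C j A"
  by (simp add: iota_def)

lemma iota_mp: "gok (commutant_theory J T C A) e \<Longrightarrow> iota J T C A \<star> e = lft T C A e"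
  using gok_D[of "commutant_theory J T C A" e] by (simp add: iota_def gmp_def lft_def)

lemma iota_vfunctor:
  assumes S: "setting J T C" and A: "A \<in> algebras J T C"
  shows "vfunctor (commutant_theory J T C A) (Alg J T C) (iota J T C A)"
proof (rule vfunctorI)
  note W = commutant_vcategory[OF S A] and al = alg_cot_algebra[OF S A]
  show "vcategory (commutant_theory J T C A)" by (fact W)
  show "vcategory (Alg J T C)" by (rule Alg_vcategory[OF S])
  show "iota J T C A = mk_vfun (VOb (commutant_theory J T C A)) (\<lambda>j. alg_cot T C j A)
    (\<lambda>j k. Idn V (nat_ob T C (alg_cot T C j A) (alg_cot T C k A)))" by (simp add: iota_def)
  fix a assume "a \<in> VOb (commutant_theory J T C A)"
  then have a: "a \<in> J" by simp
  show "alg_cot T C a A \<in> VOb (Alg J T C)" using al a by simp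
  show "iota J T C A \<star> gid (commutant_theory J T C A) a = gid (Alg J T C) (FOb (iota J T C A) a)"
    using a W by (simp add: iota_mp lft_gid)
  fix b assume "b \<in> VOb (commutant_theory J T C A)"
  then have b: "b \<in> J" by simp
  show "Idn V (nat_ob T C (alg_cot T C a A) (alg_cot T C b A)) \<in> Ar V \<and>
       Dom V (Idn V (nat_ob T C (alg_cot T C a A) (alg_cot T C b A))) = VHom (commutant_theory J T C A) a b \<and>
       Cod V (Idn V (nat_ob T C (alg_cot T C a A) (alg_cot T C b A))) = VHom (Alg J T C) (alg_cot T C a A) (alg_cot T C b A)"
    using nat_pr_typ(1)[OF settingD(5)[OF S] al[OF a] al[OF b]] by simp
next
  note W = commutant_vcategory[OF S A]
  fix g f assume "gok (commutant_theory J T C A) g" "gok (commutant_theory J T C A) f" "sr g = tg f" "gc g \<inter> gc f = {}"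
  then show "iota J T C A \<star> (g \<bullet>\<^bsub>commutant_theory J T C A\<^esub> f) = (iota J T C A \<star> g) \<bullet>\<^bsub>Alg J T C\<^esub> (iota J T C A \<star> f)"
    using W by (simp add: iota_mp lft_cmp)
qed

lemma kappa_image:
  assumes F: "vfunctor W C F" and W: "kappas J W \<kappa>" and I: "\<I> \<in> J" and u: "u \<in> J" "u \<in> Ob V"
    and g: "g \<in> Ar V" "Dom V g = u" "Cod V g = VHom C (FOb F u) (FOb F \<I>)"
    and eq: "\<And>q. \<lbrakk>isoel q; ty q = u\<rbrakk> \<Longrightarrow> F \<star> kp \<kappa> u q = (FOb F u, FOb F \<I>, g \<triangleright> q)"
  shows "FHom F u \<I> \<cdot> \<kappa> u = g"
proof -
  note c = cotD[OF kappasD(3)[OF W u(1)]] and t = vfun_typ(2-4)[OF F, of u \<I>]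
  have ob: "u \<in> VOb W" "\<I> \<in> VOb W" using kappasD(2)[OF W] u I by auto
  show ?thesis
    by (rule arr_ext[of _ "gen 0 u"]) (use eq[of "gen 0 u"] c t ob u g in \<open>simp_all add: kp_def gmp_tuple\<close>)
qed

lemma theory_morphismD:
  assumes m: "theory_morphism J U W M" and U: "is_theory J U" and W: "VOb W = J"
  shows "vfunctor U W M" "u \<in> J \<Longrightarrow> FOb M u = u" "\<lbrakk>u \<in> J; v \<in> J\<rbrakk> \<Longrightarrow> FHom M u v \<cdot> Str U u v = Str W u v"
proof -
  show "vfunctor U W M" using m by (simp add: theory_morphism_def)
  have e: "vcomp (opJ J) M (structure_functor J U) = structure_functor J W" using m by (simp add: theory_morphism_def)
  show o: "FOb M u = u" if "u \<in> J" for u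
    using arg_cong[OF e, of "\<lambda>F. FOb F u"] that by (simp add: vcomp_def structure_functor_def)
  show "FHom M u v \<cdot> Str U u v = Str W u v" if "u \<in> J" "v \<in> J"
    using arg_cong[OF e, of "\<lambda>F. FHom F u v"] that by (simp add: vcomp_def structure_functor_def)
qed

text \<open>A theory morphism is known to commute with \<open>Str\<close>, and \<open>kap\<close> is
  \<open>Str\<close> after \<open>nm\<close>. The image is thus given by the structure of the
  commutant towards \<open>\<I>\<close>, where its universal arrow is an identity.\<close>

lemma commutant_morphism_kappa:
  assumes S: "setting J T C" and A: "A \<in> algebras J T C" and U: "is_theory J U"
    and m: "theory_morphism J U (commutant_theory J T C A) M" and u: "u \<in> J" and q: "okel q" "ty q = u"
  shows "M \<star> kp (kap U) u q = kp (\<lambda>u. alg_counit T C u A) u q"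
proof -
  let ?W = "commutant_theory J T C A" let ?\<kappa> = "\<lambda>u. alg_counit T C u A"
  note s = settingD[OF S] and M = theory_morphismD[OF m U commutant_simps(1)] and t = theory_tau[OF U]
  note uO = arities_Ob[OF s(1) u] and st = commutant_Str[OF S A u s(8)]
  have "M \<star> kp (kap U) u q = (u, \<I>, FHom M u \<I> \<triangleright> Str U u \<I> \<triangleright> nm u \<triangleright> q)"
    using M(2) u s(8) t q uO by (simp add: kp_def kap_def gmp_tuple)
  also have "FHom M u \<I> \<triangleright> Str U u \<I> \<triangleright> nm u \<triangleright> q = Str ?W u \<I> \<triangleright> nm u \<triangleright> q"
    by (rule app_collapse[OF M(3)[OF u s(8)]])
      (use vfun_typ(2-4)[OF M(1), of u \<I>] t u s(8) q uO in simp_all)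
  also have "(u, \<I>, Str ?W u \<I> \<triangleright> nm u \<triangleright> q) = gid ?W \<I> \<bullet>\<^bsub>?W\<^esub> (u, \<I>, Str ?W u \<I> \<triangleright> nm u \<triangleright> q)"
    by (rule gid_left[symmetric, OF commutant_vcategory[OF S A]]) (use st(1-3) u s(8) q uO in simp_all)
  \<comment> \<open>Writing the identity as a universal arrow at the unit element brings the
    composite into the form covered by \<open>commutant_Str\<close>.\<close>
  also have "\<dots> = kp ?\<kappa> \<I> un \<bullet>\<^bsub>?W\<^esub> (u, \<I>, Str ?W u \<I> \<triangleright> nm u \<triangleright> q)"
    unfolding commutant_kp_un[OF S A] ..
  also have "\<dots> = kp ?\<kappa> u q" using st(4)[of un "nm u \<triangleright> q"] q uO by simp
  finally show ?thesis .
qed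

text \<open>The right face comes out as the commutant algebra pulled back along \<open>M\<close>;
  the isomorphism \<open>f\<close> contained in the notion of commuting is what remains between it
  and \<open>B\<close>.\<close>

lemma commuting_bifold:
  assumes S: "setting J T C" and S': "setting J U C" and A: "A \<in> algebras J T C"
    and cw: "commutes_with J C x T A U B"
  obtains D f where "D \<in> bifold_algebras J T U C" "left_face T U D = A" "vnatural_iso U C B (right_face T U D) f"
    "f \<I> = VId C x" "B \<in> algebras J U C" "FOb B \<I> = x"
proof -
  let ?W = "commutant_theory J T C A" and ?P = "commutant_algebra J T C A"
  let ?c = "\<lambda>j. alg_cot T C j A" and ?FC = "fun_cat T C (algebras J T C)"
  from cw obtain M f where B: "B \<in> algebras J U C" "FOb B \<I> = x" and m: "theory_morphism J U ?W M"
    and f: "vnatural_iso U C B (vcomp U ?P M) f" "f \<I> = VId C x"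
    unfolding commutes_with_def algebra_morphism_def by blast
  note s = settingD[OF S] and s' = settingD[OF S'] and al = alg_cot_algebra[OF S A]
  note M = theory_morphismD[OF m s'(2) commutant_simps(1)]
  \<comment> \<open>The second variable acts by transformations of algebras obtained from
    \<open>M\<close>; at \<open>t\<close> their components are taken.\<close>
  let ?L = "\<lambda>t. vcomp U (evaluation T C (algebras J T C) t) (vcomp U (iota J T C A) M)"
  note io = iota_vfunctor[OF S A, unfolded Alg_def]
  have cm: "vfunctor U ?FC (vcomp U (iota J T C A) M)" by (rule vcomp_functor[OF M(1) io])
  have L: "vfunctor U C (?L t)" if "t \<in> J" for t
    by (rule vcomp_functor[OF cm evaluation_vfunctor[OF s(5)]]) (use that s in simp)
  have Lo: "FOb (?L t) u = FOb (?c u) t" if "t \<in> J" "u \<in> J" for t u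
    using that s'(6) M(2) al by (simp add: evaluation_def)
  have Mok: "gok ?W (M \<star> d)" "gok ?FC (lft T C A (M \<star> d))" if "gok U d" for d
    using gok_mp[OF M(1) that] gok_mp[OF io gok_mp[OF M(1) that]] by (simp_all add: iota_mp)
  have Lmp: "?L t \<star> d = cmpt T C t (lft T C A (M \<star> d))" if "t \<in> J" "gok U d" for t d
    using vcomp_mp[OF cm evaluation_vfunctor[OF s(5)] that(2), of t] vcomp_mp[OF M(1) io that(2)] that s
      iota_mp[OF Mok(1)[OF that(2)]] evaluation_mp[OF Mok(2)[OF that(2)]] by simp
  obtain D where D: "vfunctor (vtensor T U) C D" "\<And>u. u \<in> J \<Longrightarrow> fix_right T U D u = ?c u"
    "\<And>t. t \<in> J \<Longrightarrow> fix_left T U D t = ?L t"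
  proof (rule bifunctorI[OF s(7) s'(7) s(3), of ?c ?L, unfolded s(6) s'(6)])
    show "vfunctor T C (?c u)" if "u \<in> J" for u using algebrasD(1)[OF al[OF that]] .
    show "vfunctor U C (?L t)" if "t \<in> J" for t using L[OF that] .
    show "FOb (?c u) t = FOb (?L t) u" if "t \<in> J" "u \<in> J" for t u using Lo[OF that] ..
    fix e d assume e: "gok T e" and d: "gok U d" and ed: "gc e \<inter> gc d = {}"
    have ob: "sr e \<in> J" "tg e \<in> J" "sr d \<in> J" "tg d \<in> J" using gok_D(1,2)[OF e] gok_D(1,2)[OF d] s s' by simp_all
    \<comment> \<open>The interchange is naturality of the algebra transformation
      \<open>M \<star> d\<close> with respect to \<open>e\<close>.\<close>
    show "(?c (tg d) \<star> e) \<bullet>\<^bsub>C\<^esub> (?L (sr e) \<star> d) = (?L (tg e) \<star> d) \<bullet>\<^bsub>C\<^esub> (?c (sr d) \<star> e)"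
      using cmpt_nat[OF s(5) Mok(2)[OF d] e] ed ob M(2) by (simp add: Lmp d)
  qed blast
  have pl: "preserves_cotensors J U C (?L t)" if t: "t \<in> J" for t
  proof (rule preserves_if_kappas[OF s(1) theory_kappas[OF s(1) s'(2)] L[OF t]])
    fix u assume u: "u \<in> J"
    have At: "FOb A t \<in> VOb C" using vfun_typ(1)[OF algebrasD(1)[OF A]] t s by simp
    have o: "FOb (?L t) \<I> = FOb A t" "FOb (?L t) u = Cot C u (FOb A t)"
      using Lo[OF t s(8)] Lo[OF t u] alg_cot_I[OF S A] alg_cot_FOb[OF S A t] by simp_all
    note hc = has_cotD[OF s(4) u At] and cn = alg_counit[OF S A u]
    \<comment> \<open>Preservation is tested on the universal arrows of \<open>U\<close>. The
      morphism \<open>M\<close> sends them to counits of algebras, whose components at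
      \<open>t\<close> are designated counits of \<open>C\<close>.\<close>
    have "FHom (?L t) u \<I> \<cdot> kap U u = Counit C u (FOb A t)"
    proof (rule kappa_image[OF L[OF t] theory_kappas[OF s(1) s'(2)] s(8) u arities_Ob[OF s(1) u]])
      show "Counit C u (FOb A t) \<in> Ar V" "Dom V (Counit C u (FOb A t)) = u"
        "Cod V (Counit C u (FOb A t)) = VHom C (FOb (?L t) u) (FOb (?L t) \<I>)"
        using cotD[OF hc] unfolding o by simp_all
      fix q assume q: "isoel q" "ty q = u"
      have "?L t \<star> kp (kap U) u q = cmpt T C t (lft T C A (kp (\<lambda>u. alg_counit T C u A) u q))"
        using Lmp[OF t gok_kp[OF theory_kappas[OF s(1) s'(2)] _ q(2) u]] commutant_morphism_kappa[OF S A s'(2) m u _ q(2)] q by simp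
      also have "\<dots> = (Cot C u (FOb A t), FOb A t, nat_pr T C (?c u) A t \<triangleright> alg_counit T C u A \<triangleright> q)"
        using alg_cot_FOb[OF S A t] by (simp add: cmpt_def lft_def kp_def alg_cot_I[OF S A])
      also have "nat_pr T C (?c u) A t \<triangleright> alg_counit T C u A \<triangleright> q = Counit C u (FOb A t) \<triangleright> q"
        by (rule app_collapse[OF cn(4)[OF t]]) (use cn(1-3) nat_pr_typ[OF s(5) al[OF u] A] t s(6) q in simp_all)
      finally show "?L t \<star> kp (kap U) u q = (FOb (?L t) u, FOb (?L t) \<I>, Counit C u (FOb A t) \<triangleright> q)" unfolding o .
    qed
    then show "is_cotensor C u (FOb (?L t) \<I>) (FOb (?L t) u) (FHom (?L t) u \<I> \<cdot> kap U u)" using hc unfolding o by simp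
  qed
  have "D \<in> bifold_algebras J T U C"
    using D pl algebrasD(2)[OF al] s(6) s'(6) by (simp add: bifold_algebras_def)
  moreover have "left_face T U D = A" using D(2)[OF s(8)] alg_cot_I[OF S A] by (simp add: left_face_def)
  moreover have "right_face T U D = vcomp U ?P M"
    unfolding right_face_def D(3)[OF s(8)]
  proof (rule vfun_eqI[OF L[OF s(8)] vcomp_functor[OF M(1) commutant_algebra_vfunctor[OF S A]]])
    fix u assume "u \<in> VOb U"
    then have u: "u \<in> J" using s' by simp
    show "FOb (?L \<I>) u = FOb (vcomp U ?P M) u"
      using Lo[OF s(8) u] u s'(6) M(2)[OF u] alg_cot_FOb[OF S A s(8)] by (simp add: commutant_algebra_def)
  next
    fix d assume d: "gok U d"
    show "?L \<I> \<star> d = vcomp U ?P M \<star> d"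
      using Lmp[OF s(8) d] vcomp_mp[OF M(1) commutant_algebra_vfunctor[OF S A] d] commutant_algebra_mp[OF S A Mok(1)[OF d]] by simp
  qed
  ultimately show thesis using that f B by simp
qed

section \<open>The faces of a bifold algebra commute\<close>

text \<open>Lifting the identity of \<open>x\<close> against either counit gives the two comparison
  arrows, and uniqueness of lifts makes them inverse to each other.\<close>

lemma cotensor_comparison:
  assumes C: "vcategory C" and c: "is_cotensor C j x e \<gamma>" "is_cotensor C j x e' \<gamma>'"
  obtains \<psi> \<psi>' where "ginv C \<psi> \<psi>'" "sr \<psi> = e'" "tg \<psi> = e"
    "\<And>q. \<lbrakk>okel q; ty q = j\<rbrakk> \<Longrightarrow> (e, x, \<gamma> \<triangleright> q) \<bullet>\<^bsub>C\<^esub> \<psi> = (e', x, \<gamma>' \<triangleright> q)"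
proof -
  note g = cotD[OF c(1)] and g' = cotD[OF c(2)]
  have i: "gok C (gid C x)" "tg (gid C x) = x" "Cod V \<gamma>' = VHom C e' (sr (gid C x))" "Cod V \<gamma> = VHom C e (sr (gid C x))"
    using C g g' by simp_all
  obtain \<psi> where \<psi>: "gok C \<psi>" "sr \<psi> = e'" "tg \<psi> = e" "gc \<psi> = gc (gid C x)"
    "\<And>q. \<lbrakk>okel q; ty q = j; gc (gid C x) \<inter> ct q = {}\<rbrakk> \<Longrightarrow> (e, x, \<gamma> \<triangleright> q) \<bullet>\<^bsub>C\<^esub> \<psi> = gid C x \<bullet>\<^bsub>C\<^esub> (e', sr (gid C x), \<gamma>' \<triangleright> q)"
    using cotensor_lift_all[OF C c(1) i(1,2) g'(3,4) i(3) g'(2)] by blast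
  obtain \<psi>' where \<psi>': "gok C \<psi>'" "sr \<psi>' = e" "tg \<psi>' = e'" "gc \<psi>' = gc (gid C x)"
    "\<And>q. \<lbrakk>okel q; ty q = j; gc (gid C x) \<inter> ct q = {}\<rbrakk> \<Longrightarrow> (e', x, \<gamma>' \<triangleright> q) \<bullet>\<^bsub>C\<^esub> \<psi>' = gid C x \<bullet>\<^bsub>C\<^esub> (e, sr (gid C x), \<gamma> \<triangleright> q)"
    using cotensor_lift_all[OF C c(2) i(1,2) g(3,4) i(4) g(2)] by blast
  have 1: "(e, x, \<gamma> \<triangleright> q) \<bullet>\<^bsub>C\<^esub> \<psi> = (e', x, \<gamma>' \<triangleright> q)" "(e', x, \<gamma>' \<triangleright> q) \<bullet>\<^bsub>C\<^esub> \<psi>' = (e, x, \<gamma> \<triangleright> q)"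
    and ok: "gok C (e, x, \<gamma> \<triangleright> q)" "gok C (e', x, \<gamma>' \<triangleright> q)" if "okel q" "ty q = j" for q
    using \<psi>(5)[OF that] \<psi>'(5)[OF that] that C g g' by simp_all
  let ?q = "gen 0 j"
  have q: "isoel ?q" "ty ?q = j" "okel ?q" using g by simp_all
  have "(e', x, \<gamma>' \<triangleright> ?q) \<bullet>\<^bsub>C\<^esub> (\<psi>' \<bullet>\<^bsub>C\<^esub> \<psi>) = ((e', x, \<gamma>' \<triangleright> ?q) \<bullet>\<^bsub>C\<^esub> \<psi>') \<bullet>\<^bsub>C\<^esub> \<psi>"
    by (rule gcmp_assoc[symmetric]) (use C ok[OF q(3,2)] \<psi>(1-4) \<psi>'(1-4) in simp_all)
  also have "\<dots> = (e', x, \<gamma>' \<triangleright> ?q) \<bullet>\<^bsub>C\<^esub> gid C e'" using 1[OF q(3,2)] ok[OF q(3,2)] C by simp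
  finally have a: "\<psi>' \<bullet>\<^bsub>C\<^esub> \<psi> = gid C e'"
    by (rule cotensor_ext'[OF _ C c(2) q(1,2)]) (use C g g' \<psi>(1-4) \<psi>'(1-4) in simp_all)
  have "(e, x, \<gamma> \<triangleright> ?q) \<bullet>\<^bsub>C\<^esub> (\<psi> \<bullet>\<^bsub>C\<^esub> \<psi>') = ((e, x, \<gamma> \<triangleright> ?q) \<bullet>\<^bsub>C\<^esub> \<psi>) \<bullet>\<^bsub>C\<^esub> \<psi>'"
    by (rule gcmp_assoc[symmetric]) (use C ok[OF q(3,2)] \<psi>(1-4) \<psi>'(1-4) in simp_all)
  also have "\<dots> = (e, x, \<gamma> \<triangleright> ?q) \<bullet>\<^bsub>C\<^esub> gid C e" using 1[OF q(3,2)] ok[OF q(3,2)] C by simp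
  finally have b: "\<psi> \<bullet>\<^bsub>C\<^esub> \<psi>' = gid C e"
    by (rule cotensor_ext'[OF _ C c(1) q(1,2)]) (use C g g' \<psi>(1-4) \<psi>'(1-4) in simp_all)
  show thesis
    by (rule that[of \<psi> \<psi>']) (use \<psi>(1-4) \<psi>'(1-4) 1 a b in \<open>simp_all add: ginv_def\<close>)
qed

text \<open>The arrow of \<open>V\<close> behind conjugation of \<open>K\<close> by the isomorphisms
  \<open>\<psi>\<close>; the inverse unitors insert their empty contexts. The purpose is to replace
  \<open>K\<close> by an isomorphic functor with prescribed objects.\<close>

definition transport :: "('a, 'o, 'm, 'y) vcat_scheme \<Rightarrow> ('b, 'o, 'm, 'z) vcat_scheme \<Rightarrow> ('a, 'b, 'm) vfun
    \<Rightarrow> ('a \<Rightarrow> ('b, 'o, 'm) gr) \<Rightarrow> ('a \<Rightarrow> ('b, 'o, 'm) gr) \<Rightarrow> ('a, 'b, 'm) vfun" where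
  "transport A B K \<psi> \<psi>' = mk_vfun (VOb A) (\<lambda>a. tg (\<psi> a)) (\<lambda>a b.
     VComp B (tg (\<psi> a)) (FOb K b) (tg (\<psi> b))
       \<cdot> (snd (ge (\<psi> b)) \<odot> (VComp B (tg (\<psi> a)) (FOb K a) (FOb K b) \<cdot> (FHom K a b \<odot> snd (ge (\<psi>' a))) \<cdot> inv_arr V (Run V (VHom A a b))))
       \<cdot> inv_arr V (Lun V (VHom A a b)))"

text \<open>Composition is preserved because the mutually inverse arrows at the middle object cancel
  (\<open>c\<close>).\<close>

lemma transport:
  assumes K: "vfunctor A B K" and p: "\<And>a. a \<in> VOb A \<Longrightarrow> ginv B (\<psi> a) (\<psi>' a)" "\<And>a. a \<in> VOb A \<Longrightarrow> sr (\<psi> a) = FOb K a"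
  shows "vfunctor A B (transport A B K \<psi> \<psi>')" "a \<in> VOb A \<Longrightarrow> FOb (transport A B K \<psi> \<psi>') a = tg (\<psi> a)"
    "gok A e \<Longrightarrow> transport A B K \<psi> \<psi>' \<star> e = \<psi> (tg e) \<bullet>\<^bsub>B\<^esub> ((K \<star> e) \<bullet>\<^bsub>B\<^esub> \<psi>' (sr e))"
proof -
  note A = vfun_cat(1)[OF K] and B = vfun_cat(2)[OF K]
  let ?X = "\<lambda>a. tg (\<psi> a)"
  have ps: "ge (\<psi> a) = snd (ge (\<psi> a)) \<triangleright> un" "snd (ge (\<psi> a)) \<in> Ar V" "Dom V (snd (ge (\<psi> a))) = \<I>"
      "Cod V (snd (ge (\<psi> a))) = VHom B (FOb K a) (?X a)" "?X a \<in> VOb B"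
      "ge (\<psi>' a) = snd (ge (\<psi>' a)) \<triangleright> un" "snd (ge (\<psi>' a)) \<in> Ar V" "Dom V (snd (ge (\<psi>' a))) = \<I>"
      "Cod V (snd (ge (\<psi>' a))) = VHom B (?X a) (FOb K a)" if "a \<in> VOb A" for a
  proof -
    note i = ginvD[OF p(1)[OF that]] and d = gok_D[OF ginvD(1)[OF p(1)[OF that]]] and d' = gok_D[OF ginvD(2)[OF p(1)[OF that]]]
    have "un = idc {}" by (simp add: un_def idc_def)
    then show "ge (\<psi> a) = snd (ge (\<psi> a)) \<triangleright> un" "ge (\<psi>' a) = snd (ge (\<psi>' a)) \<triangleright> un"
      using el_idc[OF d(3)] el_idc[OF d'(3)] i by simp_all
    show "snd (ge (\<psi> a)) \<in> Ar V" "Dom V (snd (ge (\<psi> a))) = \<I>"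
      "Cod V (snd (ge (\<psi> a))) = VHom B (FOb K a) (?X a)" "?X a \<in> VOb B"
      "snd (ge (\<psi>' a)) \<in> Ar V" "Dom V (snd (ge (\<psi>' a))) = \<I>"
      "Cod V (snd (ge (\<psi>' a))) = VHom B (?X a) (FOb K a)" using d d' i p(2)[OF that] by simp_all
  qed
  show o: "FOb (transport A B K \<psi> \<psi>') a = ?X a" if "a \<in> VOb A" for a using that by (simp add: transport_def)
  show mp: "transport A B K \<psi> \<psi>' \<star> e = \<psi> (tg e) \<bullet>\<^bsub>B\<^esub> ((K \<star> e) \<bullet>\<^bsub>B\<^esub> \<psi>' (sr e))" if e: "gok A e" for e
  proof -
    have ob: "sr e \<in> VOb A" "tg e \<in> VOb A" using e by simp_all
    note s = ps[OF ob(1)] and t = ps[OF ob(2)] and d = gok_D[OF e]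
    have "\<psi> (tg e) \<bullet>\<^bsub>B\<^esub> ((K \<star> e) \<bullet>\<^bsub>B\<^esub> \<psi>' (sr e)) = (?X (sr e), ?X (tg e),
       VComp B (?X (sr e)) (FOb K (tg e)) (?X (tg e)) \<triangleright> ((snd (ge (\<psi> (tg e))) \<triangleright> un) \<bowtie>
         (VComp B (?X (sr e)) (FOb K (sr e)) (FOb K (tg e)) \<triangleright> ((FHom K (sr e) (tg e) \<triangleright> ge e) \<bowtie> (snd (ge (\<psi>' (sr e))) \<triangleright> un)))))"
      unfolding gcmp_def gmp_def using ginvD(6)[OF p(1)[OF ob(1)]] ginvD(5)[OF p(1)[OF ob(1)]] p(2)[OF ob(2)] s(6) t(1) p(2)[OF ob(1)]
      by simp
    then show ?thesis using A B ob s(2-5,7-9) t(2-5,7-9) d vfun_typ[OF K]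
      by (simp add: transport_def gmp_def)
  qed
  have ok: "gok B (\<psi> (tg e) \<bullet>\<^bsub>B\<^esub> ((K \<star> e) \<bullet>\<^bsub>B\<^esub> \<psi>' (sr e)))" if "gok A e" for e
    using that ginvD[OF p(1)[OF gok_D(1)[OF that]]] ginvD[OF p(1)[OF gok_D(2)[OF that]]] p(2) gok_mp[OF K that] B by simp
  show "vfunctor A B (transport A B K \<psi> \<psi>')"
  proof (rule vfunctorI[OF A B transport_def])
    fix a assume a: "a \<in> VOb A"
    show "?X a \<in> VOb B" using ps(5)[OF a] .
    show "transport A B K \<psi> \<psi>' \<star> gid A a = gid B (FOb (transport A B K \<psi> \<psi>') a)"
      using mp[OF gok_id[OF A a]] a gmp_id[OF K a] B ginvD[OF p(1)[OF a]] p(2)[OF a] o by simp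
    fix b assume b: "b \<in> VOb A"
    show "VComp B (?X a) (FOb K b) (?X b)
       \<cdot> (snd (ge (\<psi> b)) \<odot> (VComp B (?X a) (FOb K a) (FOb K b) \<cdot> (FHom K a b \<odot> snd (ge (\<psi>' a))) \<cdot> inv_arr V (Run V (VHom A a b))))
       \<cdot> inv_arr V (Lun V (VHom A a b)) \<in> Ar V \<and> Dom V (VComp B (?X a) (FOb K b) (?X b)
       \<cdot> (snd (ge (\<psi> b)) \<odot> (VComp B (?X a) (FOb K a) (FOb K b) \<cdot> (FHom K a b \<odot> snd (ge (\<psi>' a))) \<cdot> inv_arr V (Run V (VHom A a b))))
       \<cdot> inv_arr V (Lun V (VHom A a b))) = VHom A a b \<and> Cod V (VComp B (?X a) (FOb K b) (?X b)
       \<cdot> (snd (ge (\<psi> b)) \<odot> (VComp B (?X a) (FOb K a) (FOb K b) \<cdot> (FHom K a b \<odot> snd (ge (\<psi>' a))) \<cdot> inv_arr V (Run V (VHom A a b))))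
       \<cdot> inv_arr V (Lun V (VHom A a b))) = VHom B (?X a) (?X b)"
      using A B a b ps(2-5,7-9)[OF a] ps(2-5,7-9)[OF b] vfun_typ[OF K] by simp
  next
    fix g f assume *: "gok A g" "gok A f" "sr g = tg f" "gc g \<inter> gc f = {}"
    have ob: "sr f \<in> VOb A" "tg f \<in> VOb A" "tg g \<in> VOb A" using * by simp_all
    note i = ginvD[OF p(1)[OF ob(1)]] and j = ginvD[OF p(1)[OF ob(2)]] and k = ginvD[OF p(1)[OF ob(3)]]
    note kg = gok_mp[OF K *(1)] and kf = gok_mp[OF K *(2)]
    have kfs: "gok B ((K \<star> f) \<bullet>\<^bsub>B\<^esub> \<psi>' (sr f))" using B kf i p(2)[OF ob(1)] by simp
    have c: "\<psi>' (tg f) \<bullet>\<^bsub>B\<^esub> (\<psi> (tg f) \<bullet>\<^bsub>B\<^esub> ((K \<star> f) \<bullet>\<^bsub>B\<^esub> \<psi>' (sr f))) = (K \<star> f) \<bullet>\<^bsub>B\<^esub> \<psi>' (sr f)"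
      by (rule ginv_cancel[OF B p(1)[OF ob(2)] kfs]) (simp add: p(2)[OF ob(2)])
    have "(transport A B K \<psi> \<psi>' \<star> g) \<bullet>\<^bsub>B\<^esub> (transport A B K \<psi> \<psi>' \<star> f)
      = (\<psi> (tg g) \<bullet>\<^bsub>B\<^esub> ((K \<star> g) \<bullet>\<^bsub>B\<^esub> \<psi>' (tg f))) \<bullet>\<^bsub>B\<^esub> (\<psi> (tg f) \<bullet>\<^bsub>B\<^esub> ((K \<star> f) \<bullet>\<^bsub>B\<^esub> \<psi>' (sr f)))"
      using mp * by simp
    also have "\<dots> = \<psi> (tg g) \<bullet>\<^bsub>B\<^esub> ((K \<star> g) \<bullet>\<^bsub>B\<^esub> (\<psi>' (tg f) \<bullet>\<^bsub>B\<^esub> (\<psi> (tg f) \<bullet>\<^bsub>B\<^esub> ((K \<star> f) \<bullet>\<^bsub>B\<^esub> \<psi>' (sr f)))))"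
      using B kg kf i(1-6) j(1-6) k(1-6) p(2)[OF ob(1)] p(2)[OF ob(2)] p(2)[OF ob(3)] * by (simp add: gcmp_assoc)
    also have "\<dots> = \<psi> (tg g) \<bullet>\<^bsub>B\<^esub> (((K \<star> g) \<bullet>\<^bsub>B\<^esub> (K \<star> f)) \<bullet>\<^bsub>B\<^esub> \<psi>' (sr f))"
      unfolding c using B kg kf i(1-6) j(1-6) k(1-6) p(2)[OF ob(1)] p(2)[OF ob(2)] p(2)[OF ob(3)] * by (simp add: gcmp_assoc)
    also have "\<dots> = transport A B K \<psi> \<psi>' \<star> (g \<bullet>\<^bsub>A\<^esub> f)"
      using mp[of "g \<bullet>\<^bsub>A\<^esub> f"] * A gmp_cmp[OF K *] by simp
    finally show "transport A B K \<psi> \<psi>' \<star> (g \<bullet>\<^bsub>A\<^esub> f) = (transport A B K \<psi> \<psi>' \<star> g) \<bullet>\<^bsub>B\<^esub> (transport A B K \<psi> \<psi>' \<star> f)" ..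
  qed
qed

lemma bifold_faces:
  assumes S: "setting J T C" and S': "setting J U C" and D: "D \<in> bifold_algebras J T U C"
  shows "u \<in> J \<Longrightarrow> fix_right T U D u \<in> algebras J T C" "t \<in> J \<Longrightarrow> fix_left T U D t \<in> algebras J U C"
    "left_face T U D \<in> algebras J T C" "right_face T U D \<in> algebras J U C"
    "\<lbrakk>t \<in> J; u \<in> J\<rbrakk> \<Longrightarrow> FOb D (t, u) \<in> VOb C"
    "t \<in> J \<Longrightarrow> FOb (fix_right T U D u) t = FOb D (t, u)" "u \<in> J \<Longrightarrow> FOb (fix_left T U D t) u = FOb D (t, u)"
proof -
  note s = settingD[OF S] and s' = settingD[OF S'] and d = bifoldD[OF D]
  show r: "fix_right T U D u \<in> algebras J T C" if "u \<in> J" for u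
    using fix_right_vfunctor[OF s(7) s'(7) d(1), of u] d(2)[of u] that s'(6) by (simp add: algebras_def)
  show l: "fix_left T U D t \<in> algebras J U C" if "t \<in> J" for t
    using fix_left_vfunctor[OF s(7) s'(7) d(1), of t] d(3)[of t] that s(6) by (simp add: algebras_def)
  show "left_face T U D \<in> algebras J T C" "right_face T U D \<in> algebras J U C"
    using r l s(8) by (simp_all add: left_face_def right_face_def)
  show "FOb D (t, u) \<in> VOb C" if "t \<in> J" "u \<in> J" using vfun_typ(1)[OF d(1), of "(t, u)"] that s(6) s'(6) by simp
  show "FOb (fix_right T U D u) t = FOb D (t, u)" if "t \<in> J" using that s(6) by (simp add: fix_right_def)
  show "FOb (fix_left T U D t) u = FOb D (t, u)" if "u \<in> J" using that s'(6) by (simp add: fix_left_def)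
qed

lemma faces_interchange:
  assumes S: "setting J T C" and S': "setting J U C" and D: "D \<in> bifold_algebras J T U C"
    and "gok T e" "gok U d" "gc e \<inter> gc d = {}"
  shows "(fix_right T U D (tg d) \<star> e) \<bullet>\<^bsub>C\<^esub> (fix_left T U D (sr e) \<star> d) = (fix_left T U D (tg e) \<star> d) \<bullet>\<^bsub>C\<^esub> (fix_right T U D (sr d) \<star> e)"
  using partial_interchange[OF settingD(7)[OF S] settingD(7)[OF S'] bifoldD(1)[OF D] assms(4-6)] by simp

lemma gmp_kp: "F \<star> kp \<kappa> u q = (FOb F u, FOb F \<I>, FHom F u \<I> \<triangleright> \<kappa> u \<triangleright> q)"
  by (simp add: kp_def gmp_tuple)

text \<open>The arrows \<open>FHom (?L t) u v\<close> form a wedge in \<open>t\<close> by the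
  interchange of the partial functors. The functor laws hold on components, where they are the laws
  of \<open>D\<close> with its first argument fixed.\<close>

lemma bifold_curry:
  assumes S: "setting J T C" and S': "setting J U C" and D: "D \<in> bifold_algebras J T U C"
  obtains K where "vfunctor U (Alg J T C) K" "\<And>u. u \<in> J \<Longrightarrow> FOb K u = fix_right T U D u"
    "\<And>t d. \<lbrakk>t \<in> J; gok U d\<rbrakk> \<Longrightarrow> cmpt T C t (K \<star> d) = fix_left T U D t \<star> d"
    "\<And>t u v. \<lbrakk>t \<in> J; u \<in> J; v \<in> J\<rbrakk> \<Longrightarrow> nat_pr T C (fix_right T U D u) (fix_right T U D v) t \<cdot> FHom K u v = FHom (fix_left T U D t) u v"
proof -
  note s = settingD[OF S] and s' = settingD[OF S'] and d = bifoldD[OF D] and F = bifold_faces[OF S S' D]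
  let ?FC = "fun_cat T C (algebras J T C)"
  let ?R = "fix_right T U D" and ?L = "fix_left T U D"
  let ?H = "\<lambda>u v. nat_lift T C (?R u) (?R v) (VHom U u v) (\<lambda>t. FHom (?L t) u v)"
  define K where "K = mk_vfun (VOb U) ?R ?H"
  have w: "wedge T C (?R u) (?R v) (VHom U u v) (\<lambda>t. FHom (?L t) u v)" if u: "u \<in> J" "v \<in> J" for u v
  proof (rule wedgeI_gr[OF algebrasD(1)[OF F(1)[OF u(1)]] algebrasD(1)[OF F(1)[OF u(2)]], of "gen 0 (VHom U u v)" _ "{}"])
    have X: "VHom U u v \<in> Ob V" using s' u by simp
    show "isoel (gen 0 (VHom U u v))" "ty (gen 0 (VHom U u v)) = VHom U u v" "okctx {}" using X by simp_all
    fix t assume "t \<in> VOb T"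
    then have t: "t \<in> J" using s by simp
    show "FHom (?L t) u v \<in> Ar V \<and> Dom V (FHom (?L t) u v) = VHom U u v \<and> Cod V (FHom (?L t) u v) = VHom C (FOb (?R u) t) (FOb (?R v) t)"
      using vfun_typ(2-4)[OF algebrasD(1)[OF F(2)[OF t]], of u v] u s' F(6,7) t by simp
  next
    fix e assume e: "gok T e" "gc e \<inter> ct (gen 0 (VHom U u v)) = {}"
    have g: "gok U (u, v, gen 0 (VHom U u v))" using s' u by simp
    have ob: "sr e \<in> J" "tg e \<in> J" using gok_D(1,2)[OF e(1)] s by simp_all
    show "(?R v \<star> e) \<bullet>\<^bsub>C\<^esub> (FOb (?R u) (sr e), FOb (?R v) (sr e), FHom (?L (sr e)) u v \<triangleright> gen 0 (VHom U u v)) =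
         (FOb (?R u) (tg e), FOb (?R v) (tg e), FHom (?L (tg e)) u v \<triangleright> gen 0 (VHom U u v)) \<bullet>\<^bsub>C\<^esub> (?R u \<star> e)"
      using faces_interchange[OF S S' D e(1) g] e ob u F(6,7) by (simp add: gmp_tuple)
  qed
  note l = nat_lift[OF s(5) F(1) F(1) w, unfolded s(6)]
  have Ko: "FOb K u = ?R u" if "u \<in> J" for u using that s' by (simp add: K_def)
  have Kh: "FHom K u v = ?H u v" if "u \<in> J" "v \<in> J" for u v using that s' by (simp add: K_def)
  have mp: "gok ?FC (K \<star> d)" "t \<in> J \<Longrightarrow> cmpt T C t (K \<star> d) = ?L t \<star> d" if d: "gok U d" for d t
  proof -
    have ob: "sr d \<in> J" "tg d \<in> J" using gok_D(1,2)[OF d] s' by simp_all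
    note dd = gok_D[OF d]
    show "gok ?FC (K \<star> d)" using Ko[OF ob(1)] Ko[OF ob(2)] Kh[OF ob] F(1)[OF ob(1)] F(1)[OF ob(2)] l(1-3)[OF ob(1,2,1,2)] dd
      by (simp add: gmp_def)
    assume t: "t \<in> J"
    have "nat_pr T C (?R (sr d)) (?R (tg d)) t \<triangleright> ?H (sr d) (tg d) \<triangleright> ge d = FHom (?L t) (sr d) (tg d) \<triangleright> ge d"
      by (rule app_collapse[OF l(4)[OF ob(1,2,1,2) t]])
        (use l(1-3)[OF ob(1,2,1,2)] nat_pr_typ[OF s(5) F(1)[OF ob(1)] F(1)[OF ob(2)]] dd t s in simp_all)
    then show "cmpt T C t (K \<star> d) = ?L t \<star> d" using Ko Kh ob F(6,7) t by (simp add: cmpt_def gmp_def)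
  qed
  have K: "vfunctor U ?FC K"
  proof (rule vfunctorI[OF s'(7) fun_cat_vcategory[OF s(5)] K_def])
    fix u assume "u \<in> VOb U"
    then have u: "u \<in> J" using s' by simp
    show "?R u \<in> VOb ?FC" using F(1)[OF u] by simp
    note i = gok_id[OF s'(7), of u] and ci = cmpt_id[OF s(5) F(1)[OF u]]
    show "K \<star> gid U u = gid ?FC (FOb K u)" unfolding Ko[OF u]
    proof (rule cmpt_ext[OF s(5) _ ci(1)])
      show "gok ?FC (K \<star> gid U u)" using mp(1)[OF i] u s' by simp
      fix t assume "t \<in> VOb T"
      then have t: "t \<in> J" using s by simp
      show "cmpt T C t (K \<star> gid U u) = cmpt T C t (gid ?FC (?R u))"
        using mp(2)[OF i t] ci(2)[of t] gmp_id[OF algebrasD(1)[OF F(2)[OF t]], of u] u t s s' F(6,7) by simp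
    qed (use Ko[OF u] in simp_all)
    fix v assume "v \<in> VOb U"
    then have v: "v \<in> J" using s' by simp
    show "?H u v \<in> Ar V \<and> Dom V (?H u v) = VHom U u v \<and> Cod V (?H u v) = VHom ?FC (?R u) (?R v)"
      using l(1-3)[OF u v u v] by simp
  next
    fix g f assume *: "gok U g" "gok U f" "sr g = tg f" "gc g \<inter> gc f = {}"
    have gf: "gok U (g \<bullet>\<^bsub>U\<^esub> f)" using * s' by simp
    note c = cmpt_cmp[OF s(5) mp(1)[OF *(1)] mp(1)[OF *(2)]]
    show "K \<star> (g \<bullet>\<^bsub>U\<^esub> f) = (K \<star> g) \<bullet>\<^bsub>?FC\<^esub> (K \<star> f)"
    proof (rule cmpt_ext[OF s(5) mp(1)[OF gf]])
      show "gok ?FC ((K \<star> g) \<bullet>\<^bsub>?FC\<^esub> (K \<star> f))" using c(1) * by simp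
      fix t assume "t \<in> VOb T"
      then have t: "t \<in> J" using s by simp
      show "cmpt T C t (K \<star> (g \<bullet>\<^bsub>U\<^esub> f)) = cmpt T C t ((K \<star> g) \<bullet>\<^bsub>?FC\<^esub> (K \<star> f))"
        using mp(2)[OF gf t] mp(2)[OF *(1) t] mp(2)[OF *(2) t] c(2)[of t] * gmp_cmp[OF algebrasD(1)[OF F(2)[OF t]] *] t s by simp
    qed simp_all
  qed
  show thesis by (rule that[of K]) (use K Ko mp(2) l(4) Kh in \<open>simp_all add: Alg_def\<close>)
qed

lemma bifold_commutes:
  assumes S: "setting J T C" and S': "setting J U C" and D: "D \<in> bifold_algebras J T U C"
  shows "commutes_with J C (FOb (left_face T U D) \<I>) T (left_face T U D) U (right_face T U D)"
proof -
  note s = settingD[OF S] and s' = settingD[OF S'] and F = bifold_faces[OF S S' D]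
  let ?FC = "Alg J T C" and ?A = "left_face T U D" and ?B = "right_face T U D"
  let ?R = "fix_right T U D" and ?L = "fix_left T U D" and ?c = "\<lambda>u. alg_cot T C u (left_face T U D)"
  let ?W = "commutant_theory J T C ?A" and ?P = "commutant_algebra J T C ?A"
  have FC: "vcategory ?FC" and AR: "?A = ?R \<I>" and BL: "?B = ?L \<I>"
    using Alg_vcategory[OF S] by (simp_all add: left_face_def right_face_def)
  note Aa = F(3) and al = alg_cot_algebra[OF S F(3)] and W = commutant_vcategory[OF S F(3)]
  obtain K where K: "vfunctor U ?FC K" and Ko: "\<And>u. u \<in> J \<Longrightarrow> FOb K u = ?R u"
    and Kc: "\<And>t d. \<lbrakk>t \<in> J; gok U d\<rbrakk> \<Longrightarrow> cmpt T C t (K \<star> d) = ?L t \<star> d"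
    and Kp: "\<And>t u v. \<lbrakk>t \<in> J; u \<in> J; v \<in> J\<rbrakk> \<Longrightarrow> nat_pr T C (?R u) (?R v) t \<cdot> FHom K u v = FHom (?L t) u v"
    using bifold_curry[OF S S' D] by blast
  note kU = theory_kappas[OF s(1) s'(2)]
  \<comment> \<open>The images under \<open>K\<close> of the universal arrows of \<open>U\<close>.
    At each \<open>t\<close> they become those of the algebra obtained by fixing \<open>t\<close>,
    which is why \<open>?R u\<close> is a cotensor of the left face by \<open>u\<close>.\<close>
  let ?\<beta> = "\<lambda>u. FHom K u \<I> \<cdot> kap U u"
  have bt: "?\<beta> u \<in> Ar V" "Dom V (?\<beta> u) = u" "Cod V (?\<beta> u) = nat_ob T C (?R u) ?A"
    "nat_pr T C (?R u) ?A t \<cdot> ?\<beta> u = FHom (?L t) u \<I> \<cdot> kap U u" if "u \<in> J" "t \<in> J" for u t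
    using cotD[OF kappasD(3)[OF kU that(1)]] vfun_typ(2-4)[OF K, of u \<I>] that s s' Ko Kp[OF that(2,1) s(8)]
      nat_pr_typ[OF s(5) F(1)[OF that(1)] F(3)]
    by (simp_all add: AR flip: Cmp_assoc)
  have bc: "is_cotensor ?FC u ?A (?R u) (?\<beta> u)" if u: "u \<in> J" for u
    unfolding Alg_def
  proof (rule pointwise_cotensor[OF s(5) F(3) F(1)[OF u]])
    fix t assume "t \<in> VOb T"
    then have t: "t \<in> J" using s by simp
    show "is_cotensor C u (FOb ?A t) (FOb (?R u) t) (nat_pr T C (?R u) ?A t \<cdot> ?\<beta> u)"
      unfolding bt(4)[OF u t] using alg_kappa_cotensor[OF S' F(2)[OF t] u] F(6,7) t u s(8) by (simp add: AR)
  qed (use bt[OF u u] in simp_all)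
  \<comment> \<open>Pairs are quantified so that a single use of choice provides the comparison
    isomorphisms together with their inverses.\<close>
  have "\<forall>u\<in>J. \<exists>g. ginv ?FC (fst g) (snd g) \<and> sr (fst g) = ?R u \<and> tg (fst g) = ?c u \<and>
     (\<forall>q. okel q \<and> ty q = u \<longrightarrow> (?c u, ?A, alg_counit T C u ?A \<triangleright> q) \<bullet>\<^bsub>?FC\<^esub> fst g = (?R u, ?A, ?\<beta> u \<triangleright> q))"
  proof
    fix u assume u: "u \<in> J"
    obtain \<psi> \<psi>' where "ginv ?FC \<psi> \<psi>'" "sr \<psi> = ?R u" "tg \<psi> = ?c u"
      "\<And>q. \<lbrakk>okel q; ty q = u\<rbrakk> \<Longrightarrow> (?c u, ?A, alg_counit T C u ?A \<triangleright> q) \<bullet>\<^bsub>?FC\<^esub> \<psi> = (?R u, ?A, ?\<beta> u \<triangleright> q)"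
      using cotensor_comparison[OF FC alg_counit(5)[OF S F(3) u] bc[OF u]] by blast
    then show "\<exists>g. ginv ?FC (fst g) (snd g) \<and> sr (fst g) = ?R u \<and> tg (fst g) = ?c u \<and>
       (\<forall>q. okel q \<and> ty q = u \<longrightarrow> (?c u, ?A, alg_counit T C u ?A \<triangleright> q) \<bullet>\<^bsub>?FC\<^esub> fst g = (?R u, ?A, ?\<beta> u \<triangleright> q))"
      by (intro exI[of _ "(\<psi>, \<psi>')"]) simp
  qed
  from bchoice[OF this] obtain g where g: "\<forall>u\<in>J. ginv ?FC (fst (g u)) (snd (g u)) \<and> sr (fst (g u)) = ?R u \<and> tg (fst (g u)) = ?c u \<and>
     (\<forall>q. okel q \<and> ty q = u \<longrightarrow> (?c u, ?A, alg_counit T C u ?A \<triangleright> q) \<bullet>\<^bsub>?FC\<^esub> fst (g u) = (?R u, ?A, ?\<beta> u \<triangleright> q))" ..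
  define \<psi> where "\<psi> u = fst (g u)" for u
  define \<psi>' where "\<psi>' u = snd (g u)" for u
  have p: "\<And>u. u \<in> J \<Longrightarrow> ginv ?FC (\<psi> u) (\<psi>' u)" "\<And>u. u \<in> J \<Longrightarrow> sr (\<psi> u) = ?R u" "\<And>u. u \<in> J \<Longrightarrow> tg (\<psi> u) = ?c u"
    and pq: "\<And>u q. \<lbrakk>u \<in> J; okel q; ty q = u\<rbrakk> \<Longrightarrow> (?c u, ?A, alg_counit T C u ?A \<triangleright> q) \<bullet>\<^bsub>?FC\<^esub> \<psi> u = (?R u, ?A, ?\<beta> u \<triangleright> q)"
    using g unfolding \<psi>_def \<psi>'_def by blast+
  \<comment> \<open>After conjugation the value at \<open>u\<close> is exactly the cotensor
    \<open>?c u\<close> occurring in the commutant theory, so the action on homs can be reused for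
    \<open>M\<close>.\<close>
  let ?N = "transport U ?FC K \<psi> \<psi>'"
  have pK: "\<And>u. u \<in> VOb U \<Longrightarrow> ginv ?FC (\<psi> u) (\<psi>' u)" "\<And>u. u \<in> VOb U \<Longrightarrow> sr (\<psi> u) = FOb K u" using p Ko s' by simp_all
  have N: "vfunctor U ?FC ?N" "\<And>a. a \<in> VOb U \<Longrightarrow> FOb ?N a = tg (\<psi> a)"
    "\<And>e. gok U e \<Longrightarrow> ?N \<star> e = \<psi> (tg e) \<bullet>\<^bsub>?FC\<^esub> ((K \<star> e) \<bullet>\<^bsub>?FC\<^esub> \<psi>' (sr e))"
    by (rule transport(1)[OF K], simp_all add: pK, rule transport(2)[OF K], simp_all add: pK,
        rule transport(3)[OF K], simp_all add: pK)
  have No: "FOb ?N u = ?c u" if "u \<in> J" for u using N(2)[of u] p(3)[OF that] that s' by simp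
  define M where "M = mk_vfun (VOb U) (\<lambda>u. u) (FHom ?N)"
  have Mo: "FOb M u = u" "\<And>v. v \<in> J \<Longrightarrow> FHom M u v = FHom ?N u v" if "u \<in> J" for u using that s' by (simp_all add: M_def)
  have Ml: "lft T C ?A (M \<star> d) = ?N \<star> d" if "gok U d" for d
    using gok_D[OF that] Mo No s' by (simp add: lft_def gmp_def)
  have M: "vfunctor U ?W M"
  proof (rule vfunctorI[OF s'(7) W M_def])
    fix u assume "u \<in> VOb U"
    then have u: "u \<in> J" using s' by simp
    show "u \<in> VOb ?W" using u by simp
    show "M \<star> gid U u = gid ?W (FOb M u)"
      by (rule lft_inj[of _ _ T C ?A]) (use u Mo gmp_id[OF N(1), of u] No s' Ml[OF gok_id[OF s'(7), of u]] in \<open>simp_all add: lft_gid\<close>)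
    fix v assume "v \<in> VOb U"
    then have v: "v \<in> J" using s' by simp
    show "FHom ?N u v \<in> Ar V \<and> Dom V (FHom ?N u v) = VHom U u v \<and> Cod V (FHom ?N u v) = VHom ?W u v"
      using vfun_typ(2-4)[OF N(1), of u v] u v s' No by simp
  next
    fix g f assume *: "gok U g" "gok U f" "sr g = tg f" "gc g \<inter> gc f = {}"
    have ob: "sr f \<in> J" "tg f \<in> J" "tg g \<in> J" using gok_D(1,2)[OF *(2)] gok_D(2)[OF *(1)] s' by simp_all
    show "M \<star> (g \<bullet>\<^bsub>U\<^esub> f) = (M \<star> g) \<bullet>\<^bsub>?W\<^esub> (M \<star> f)"
      by (rule lft_inj[of _ _ T C ?A])
        (use ob Mo gmp_cmp[OF N(1) *] Ml[OF *(1)] Ml[OF *(2)] Ml[of "g \<bullet>\<^bsub>U\<^esub> f"] * s' in \<open>simp_all add: lft_cmp\<close>)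
  qed
  have Kkp: "K \<star> kp (kap U) u q = (?R u, ?A, ?\<beta> u \<triangleright> q)" "gok U (kp (kap U) u q)" if "u \<in> J" "okel q" "ty q = u" for u q
    using that cotD[OF kappasD(3)[OF kU that(1)]] vfun_typ(2-4)[OF K, of u \<I>] s s' Ko
    by (simp_all add: gmp_kp AR gok_kp[OF kU])
  have ct: "gok ?FC (?c u, ?A, alg_counit T C u ?A \<triangleright> q)" if "u \<in> J" "okel q" "ty q = u" for u q
    using alg_counit(1-3)[OF S F(3) that(1)] al[OF that(1)] F(3) that by simp
  \<comment> \<open>Compatibility with the structure arrows is tested by composing with the
    universal arrow at \<open>k\<close>: the conjugating isomorphisms cancel, and
    \<open>kp_Str\<close> on one side meets \<open>commutant_Str\<close> on the other.\<close>
  have str: "FHom M j k \<cdot> Str U j k = Str ?W j k" if jk: "j \<in> J" "k \<in> J" for j k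
  proof -
    have ob: "j \<in> Ob V" "k \<in> Ob V" using arities_Ob[OF s(1)] jk by simp_all
    note stU = theory_tau(7-9)[OF s'(2) jk] and stW = commutant_Str[OF S F(3) jk]
    let ?y = "gen 0 (IHom V k j)" and ?q = "gen 1 k"
    let ?d = "(j, k, Str U j k \<triangleright> ?y)" and ?r = "Ev V k j \<triangleright> (?y \<bowtie> ?q)"
    have d: "gok U ?d" using stU jk s' ob by simp
    have r: "okel ?r" "ty ?r = j" "ct ?r \<inter> {} = {}" using ob by simp_all
    note kd = gok_mp[OF K d] and pk = ginvD[OF p(1)[OF jk(2)]] and pj = ginvD[OF p(1)[OF jk(1)]]
    have Md: "M \<star> ?d = (j, k, FHom ?N j k \<triangleright> Str U j k \<triangleright> ?y)" using Mo jk by (simp add: gmp_tuple)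
    let ?k = "(?c k, ?A, alg_counit T C k ?A \<triangleright> ?q)"
    have kk: "gok ?FC ?k" "gok ?FC (K \<star> kp (kap U) k ?q)" using ct[OF jk(2), of ?q] gok_mp[OF K Kkp(2)[OF jk(2), of ?q]] ob by simp_all
    have "?k \<bullet>\<^bsub>?FC\<^esub> (?N \<star> ?d) = (?k \<bullet>\<^bsub>?FC\<^esub> \<psi> k) \<bullet>\<^bsub>?FC\<^esub> ((K \<star> ?d) \<bullet>\<^bsub>?FC\<^esub> \<psi>' j)"
      unfolding N(3)[OF d] using FC kk kd pk pj p(2,3)[OF jk(1)] p(2,3)[OF jk(2)] Ko[OF jk(1)] Ko[OF jk(2)]
      by (subst gcmp_assoc) (simp_all del: gok_tuple)
    also have "\<dots> = ((K \<star> kp (kap U) k ?q) \<bullet>\<^bsub>?FC\<^esub> (K \<star> ?d)) \<bullet>\<^bsub>?FC\<^esub> \<psi>' j"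
      unfolding pq[OF jk(2) okel_simps(2)[OF ob(2)] ty_simps(2)[OF ob(2)]] Kkp(1)[OF jk(2) okel_simps(2)[OF ob(2)] ty_simps(2)[OF ob(2)], symmetric]
      using FC kk kd pj p(2,3)[OF jk(1)] Ko[OF jk(1)] by (subst gcmp_assoc) (simp_all del: gok_tuple)
    also have "(K \<star> kp (kap U) k ?q) \<bullet>\<^bsub>?FC\<^esub> (K \<star> ?d) = K \<star> kp (kap U) j ?r"
      using kp_Str[OF s(1) s'(2) jk, of ?q ?y] gmp_cmp[OF K Kkp(2)[OF jk(2), of ?q] d] ob by simp
    also have "\<dots> = (?c j, ?A, alg_counit T C j ?A \<triangleright> ?r) \<bullet>\<^bsub>?FC\<^esub> \<psi> j"
      unfolding Kkp(1)[OF jk(1) r(1,2)] pq[OF jk(1) r(1,2)] ..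
    also have "((?c j, ?A, alg_counit T C j ?A \<triangleright> ?r) \<bullet>\<^bsub>?FC\<^esub> \<psi> j) \<bullet>\<^bsub>?FC\<^esub> \<psi>' j = (?c j, ?A, alg_counit T C j ?A \<triangleright> ?r)"
      using FC ct[OF jk(1) r(1,2)] pj p(3)[OF jk(1)] by (subst gcmp_assoc) (simp_all del: gok_tuple)
    finally have 1: "?k \<bullet>\<^bsub>?FC\<^esub> lft T C ?A (M \<star> ?d) = (?c j, ?A, alg_counit T C j ?A \<triangleright> ?r)" unfolding Ml[OF d] .
    have "kp (\<lambda>u. alg_counit T C u ?A) k ?q \<bullet>\<^bsub>?W\<^esub> (M \<star> ?d) = kp (\<lambda>u. alg_counit T C u ?A) j ?r"
      by (rule lft_inj[of _ _ T C ?A]) (use 1 Mo jk in \<open>simp_all add: lft_cmp\<close>, simp add: lft_def kp_def alg_cot_I[OF S F(3)])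
    also have "\<dots> = kp (\<lambda>u. alg_counit T C u ?A) k ?q \<bullet>\<^bsub>?W\<^esub> (j, k, Str ?W j k \<triangleright> ?y)"
      using stW(4)[of ?q ?y] ob by simp
    finally have "M \<star> ?d = (j, k, Str ?W j k \<triangleright> ?y)"
      by (rule kp_ext[OF _ commutant_kappas[OF S F(3)] jk(2)])
        (use gok_mp[OF M d] stW(1-3) jk ob Mo in \<open>simp_all\<close>)
    then have "FHom ?N j k \<triangleright> Str U j k \<triangleright> ?y = Str ?W j k \<triangleright> ?y" unfolding Md by simp
    then show ?thesis
      by (intro arr_ext[of _ ?y]) (use Mo jk ob stU stW(1-3) vfun_typ(2-4)[OF N(1), of j k] s' No in simp_all)
  qed
  have tm: "theory_morphism J U ?W M"
    unfolding theory_morphism_def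
  proof
    show "vcomp (opJ J) M (structure_functor J U) = structure_functor J ?W"
      unfolding vcomp_def structure_functor_def opJ_simps
      by (rule mk_vfun_cong) (use Mo str in simp_all)
  qed (rule M)
  \<comment> \<open>The comparison isomorphisms, evaluated at \<open>\<I>\<close>, relate the right
    face to the commutant algebra pulled back along \<open>M\<close>.\<close>
  define f where "f u = snd (ge (cmpt T C \<I> (\<psi> u)))" for u
  let ?E = "evaluation T C (algebras J T C) \<I>"
  have ev: "vfunctor ?FC C ?E" unfolding Alg_def by (rule evaluation_vfunctor[OF s(5)]) (use s in simp)
  have evp: "?E \<star> p = cmpt T C \<I> p" if "gok ?FC p" for p using that evaluation_mp[of T C "algebras J T C" p] by (simp add: Alg_def)
  have Po: "FOb ?P u = FOb (?c u) \<I>" if "u \<in> J" for u using that alg_cot_FOb[OF S F(3) s(8)] by (simp add: commutant_algebra_def)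
  have Bo: "FOb ?B u = FOb (?R u) \<I>" if "u \<in> J" for u using that F(6,7) s(8) by (simp add: BL)
  have fe: "(FOb ?B u, FOb (vcomp U ?P M) u, ({}, f u)) = cmpt T C \<I> (\<psi> u)" if u: "u \<in> J" for u
    using gr_empty_eta[of "cmpt T C \<I> (\<psi> u)"] ginvD[OF p(1)[OF u]] p(2,3)[OF u] Po[OF u] Bo[OF u] u s' Mo
    by (simp add: f_def)
  note P = commutant_algebra_vfunctor[OF S F(3)]
  have PM: "vfunctor U C (vcomp U ?P M)" by (rule vcomp_functor[OF M P])
  have gi: "ginv C (cmpt T C \<I> (\<psi> u)) (cmpt T C \<I> (\<psi>' u))" if "u \<in> J" for u
    using ginv_mp[OF ev p(1)[OF that]] evp ginvD(1,2)[OF p(1)[OF that]] by simp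
  have fn: "vnatural_iso U C ?B (vcomp U ?P M) f"
    unfolding vnatural_iso_def vnatural_gr[OF algebrasD(1)[OF F(4)] PM]
  proof (intro conjI ballI allI impI)
    fix u assume "u \<in> VOb U"
    then have u: "u \<in> J" using s' by simp
    note g = ginvD(1)[OF gi[OF u]]
    show "\<guillemotleft>f u : \<I> \<rightarrow> VHom C (FOb ?B u) (FOb (vcomp U ?P M) u)\<guillemotright>"
      using g unfolding fe[OF u, symmetric] gok_empty by simp
    show "uiso C (FOb ?B u) (FOb (vcomp U ?P M) u) (f u)"
      using ginv_uiso[OF s(3) gi[OF u]] unfolding fe[OF u, symmetric] by simp
  next
    fix d assume d: "gok U d"
    have ob: "sr d \<in> J" "tg d \<in> J" using gok_D(1,2)[OF d] s' by simp_all
    note Kd = gok_mp[OF K d] and a = ginvD[OF p(1)[OF ob(1)]] and b = ginvD[OF p(1)[OF ob(2)]]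
    have Md: "gok ?W (M \<star> d)" using gok_mp[OF M d] .
    have Kpsi: "gok ?FC ((K \<star> d) \<bullet>\<^bsub>?FC\<^esub> \<psi>' (sr d))" using FC Kd a p(2,3)[OF ob(1)] Ko ob by simp
    have "vcomp U ?P M \<star> d = cmpt T C \<I> (?N \<star> d)"
      using vcomp_mp[OF M P d] commutant_algebra_mp[OF S F(3) Md] Ml[OF d] by simp
    also have "\<dots> = ?E \<star> (\<psi> (tg d) \<bullet>\<^bsub>?FC\<^esub> ((K \<star> d) \<bullet>\<^bsub>?FC\<^esub> \<psi>' (sr d)))"
      unfolding N(3)[OF d, symmetric] by (rule evp[symmetric]) (rule gok_mp[OF N(1) d])
    also have "\<dots> = (?E \<star> \<psi> (tg d)) \<bullet>\<^bsub>C\<^esub> ((?E \<star> (K \<star> d)) \<bullet>\<^bsub>C\<^esub> (?E \<star> \<psi>' (sr d)))"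
      using Kpsi Kd a b p(2,3)[OF ob(1)] p(2,3)[OF ob(2)] Ko ob by (simp add: gmp_cmp[OF ev])
    also have "\<dots> = cmpt T C \<I> (\<psi> (tg d)) \<bullet>\<^bsub>C\<^esub> ((?B \<star> d) \<bullet>\<^bsub>C\<^esub> cmpt T C \<I> (\<psi>' (sr d)))"
      using Kc[OF s(8) d] a b Kd by (simp add: evp BL)
    finally have e: "vcomp U ?P M \<star> d = \<dots>" .
    note x = ginvD[OF gi[OF ob(1)]] and y = ginvD[OF gi[OF ob(2)]] and Bd = gok_mp[OF algebrasD(1)[OF F(4)] d]
    have "(vcomp U ?P M \<star> d) \<bullet>\<^bsub>C\<^esub> cmpt T C \<I> (\<psi> (sr d)) = cmpt T C \<I> (\<psi> (tg d)) \<bullet>\<^bsub>C\<^esub> ((?B \<star> d) \<bullet>\<^bsub>C\<^esub> (cmpt T C \<I> (\<psi>' (sr d)) \<bullet>\<^bsub>C\<^esub> cmpt T C \<I> (\<psi> (sr d))))"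
      unfolding e using s(3) x(1-6) y(1-6) Bd p(2,3)[OF ob(1)] p(2,3)[OF ob(2)] Bo ob a(3-6) b(3-6)
      by (simp add: gcmp_assoc)
    also have "\<dots> = cmpt T C \<I> (\<psi> (tg d)) \<bullet>\<^bsub>C\<^esub> (?B \<star> d)"
      unfolding x(7) using s(3) Bd p(2)[OF ob(1)] Bo ob by simp
    finally show "(FOb ?B (tg d), FOb (vcomp U ?P M) (tg d), ({}, f (tg d))) \<bullet>\<^bsub>C\<^esub> (?B \<star> d)
      = (vcomp U ?P M \<star> d) \<bullet>\<^bsub>C\<^esub> (FOb ?B (sr d), FOb (vcomp U ?P M) (sr d), ({}, f (sr d)))"
      unfolding fe[OF ob(1)] fe[OF ob(2)] by simp
  qed
  have AI: "FOb ?A \<I> \<in> VOb C" using F(5)[OF s(8) s(8)] F(6)[OF s(8)] by (simp add: AR)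
  \<comment> \<open>At \<open>\<I>\<close> the universal arrows of \<open>U\<close> and of the
    commutant are both identities, so the comparison isomorphism there is an identity too.\<close>
  have fI: "f \<I> = VId C (FOb ?A \<I>)"
  proof -
    have cI: "?c \<I> = ?A" by (rule alg_cot_I[OF S F(3)])
    have u1: "(?A, ?A, alg_counit T C \<I> ?A \<triangleright> un) = gid ?FC ?A"
      using arg_cong[OF commutant_kp_un[OF S F(3)], of "lft T C ?A"] cI by (simp add: lft_gid) (simp add: lft_def kp_def cI)
    have "\<psi> \<I> = gid ?FC ?A \<bullet>\<^bsub>?FC\<^esub> \<psi> \<I>" using FC ginvD(1)[OF p(1)[OF s(8)]] p(3)[OF s(8)] cI by simp
    also have "\<dots> = (?R \<I>, ?A, ?\<beta> \<I> \<triangleright> un)" using pq[OF s(8), of un] u1 cI by simp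
    also have "\<dots> = K \<star> kp (kap U) \<I> un" using Kkp(1)[OF s(8), of un] by simp
    also have "\<dots> = gid ?FC ?A" unfolding kp_un[OF s(1) s'(2)] using gmp_id[OF K, of \<I>] Ko[OF s(8)] s(8) s' by (simp add: AR)
    finally have "\<psi> \<I> = gid ?FC ?A" .
    then have "cmpt T C \<I> (\<psi> \<I>) = gid C (FOb ?A \<I>)" using cmpt_id(2)[OF s(5) F(3), of \<I>] s(6,8) by (simp add: Alg_def)
    then show ?thesis unfolding f_def using AI s(3) by (simp add: gid_def app_def un_def)
  qed
  have "algebra_morphism J C (FOb ?A \<I>) U ?B ?W ?P M f"
    unfolding algebra_morphism_def
    using F(4) commutant_algebra_algebra[OF S F(3)] tm fn fI Po[OF s(8)] Bo[OF s(8)] alg_cot_I[OF S F(3)] by (simp add: AR)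
  then show ?thesis unfolding commutes_with_def by blast
qed

section \<open>Transformations of bifold algebras\<close>

lemma kappa_gmp:
  assumes "vfunctor W C F" "kappas J W \<kappa>" "\<I> \<in> J" "u \<in> J" "okel q" "ty q = u"
  shows "(FOb F u, FOb F \<I>, (FHom F u \<I> \<cdot> \<kappa> u) \<triangleright> q) = F \<star> kp \<kappa> u q" "gok C (F \<star> kp \<kappa> u q)"
  using assms cotD[OF kappasD(3)[OF assms(2,4)]] vfun_typ(2-4)[OF assms(1), of u \<I>] kappasD(2)[OF assms(2)]
    gok_mp[OF assms(1) gok_kp[OF assms(2,5,6,4)]]
  by (simp_all add: gmp_kp)

text \<open>Naturality at \<open>u\<close> is forced by naturality at \<open>\<I>\<close>: composing
  with the universal arrow at a fresh \<open>q\<close> moves both sides from \<open>u\<close> to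
  \<open>\<I>\<close> through the two interchange laws, and the cotensor property cancels that
  arrow. The partial functors are abstracted to \<open>R\<close> and \<open>L\<close> so that the
  two theories can be exchanged.\<close>

lemma half_natural:
  fixes T U :: "('o, 'm) jtheory" and C :: "('c, 'o, 'm) cvcat"
  assumes C: "vcategory C" and kU: "kappas J U \<kappa>" and I: "\<I> \<in> J" and T: "VOb T = J"
    and R: "\<And>u. u \<in> J \<Longrightarrow> vfunctor T C (R u)" "\<And>u. u \<in> J \<Longrightarrow> vfunctor T C (R' u)"
    and L: "\<And>t. t \<in> J \<Longrightarrow> vfunctor U C (L t)" "\<And>t. t \<in> J \<Longrightarrow> vfunctor U C (L' t)"
    and ob: "\<And>t u. \<lbrakk>t \<in> J; u \<in> J\<rbrakk> \<Longrightarrow> FOb (R u) t = FOb (L t) u" "\<And>t u. \<lbrakk>t \<in> J; u \<in> J\<rbrakk> \<Longrightarrow> FOb (R' u) t = FOb (L' t) u"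
    and e: "gok T e" "gc e \<inter> Q = {}" and u: "u \<in> J"
    and int: "\<And>d. \<lbrakk>gok U d; gc e \<inter> gc d = {}\<rbrakk> \<Longrightarrow> (R (tg d) \<star> e) \<bullet>\<^bsub>C\<^esub> (L (sr e) \<star> d) = (L (tg e) \<star> d) \<bullet>\<^bsub>C\<^esub> (R (sr d) \<star> e)"
    and int': "\<And>d. \<lbrakk>gok U d; gc e \<inter> gc d = {}\<rbrakk> \<Longrightarrow> (R' (tg d) \<star> e) \<bullet>\<^bsub>C\<^esub> (L' (sr e) \<star> d) = (L' (tg e) \<star> d) \<bullet>\<^bsub>C\<^esub> (R' (sr d) \<star> e)"
    and cot: "is_cotensor C u (FOb (L' (tg e)) \<I>) (FOb (L' (tg e)) u) (FHom (L' (tg e)) u \<I> \<cdot> \<kappa> u)"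
    and a: "\<And>t. t \<in> J \<Longrightarrow> gok C (a t) \<and> sr (a t) = FOb (L t) \<I> \<and> tg (a t) = FOb (L' t) \<I> \<and> gc (a t) = Q"
    and an: "(R' \<I> \<star> e) \<bullet>\<^bsub>C\<^esub> a (sr e) = a (tg e) \<bullet>\<^bsub>C\<^esub> (R \<I> \<star> e)"
    and p: "\<And>t. t \<in> J \<Longrightarrow> gok C (p t) \<and> sr (p t) = FOb (L t) u \<and> tg (p t) = FOb (L' t) u \<and> gc (p t) = Q"
    and pa: "\<And>t q. \<lbrakk>t \<in> J; okel q; ty q = u; Q \<inter> ct q = {}\<rbrakk> \<Longrightarrow> (L' t \<star> kp \<kappa> u q) \<bullet>\<^bsub>C\<^esub> p t = a t \<bullet>\<^bsub>C\<^esub> (L t \<star> kp \<kappa> u q)"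
    and Q: "okctx Q"
  shows "(R' u \<star> e) \<bullet>\<^bsub>C\<^esub> p (sr e) = p (tg e) \<bullet>\<^bsub>C\<^esub> (R u \<star> e)"
proof -
  have ts: "sr e \<in> J" "tg e \<in> J" using gok_D(1,2)[OF e(1)] T by simp_all
  have "okctx (Q \<union> gc e)" "u \<in> Ob V" using Q gok_D(5)[OF e(1)] cotD[OF cot] by simp_all
  then obtain q where q: "isoel q" "ty q = u" "ct q \<inter> (Q \<union> gc e) = {}" using fresh_gen by metis
  then have d: "ct q \<inter> Q = {}" "Q \<inter> ct q = {}" "ct q \<inter> gc e = {}" "gc e \<inter> ct q = {}" "Q \<inter> gc e = {}" "gc e \<inter> Q = {}" using e(2) by auto
  let ?k = "kp \<kappa> u q" and ?s = "sr e" and ?t = "tg e"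
  have oq: "okel q" using q by simp
  have k: "gok U ?k" by (rule gok_kp[OF kU oq q(2) u])
  note Lk = kappa_gmp(2)[OF L(1)[OF ts(1)] kU I u oq q(2)] kappa_gmp(2)[OF L(1)[OF ts(2)] kU I u oq q(2)]
    kappa_gmp(2)[OF L(2)[OF ts(1)] kU I u oq q(2)] kappa_gmp(2)[OF L(2)[OF ts(2)] kU I u oq q(2)]
  note Re = gok_mp[OF R(1)[OF u] e(1)] gok_mp[OF R(1)[OF I] e(1)] gok_mp[OF R(2)[OF u] e(1)] gok_mp[OF R(2)[OF I] e(1)]
  note pp = p[OF ts(1)] p[OF ts(2)] and aa = a[OF ts(1)] a[OF ts(2)]
  note o = ob(1)[OF ts(1) u] ob(1)[OF ts(2) u] ob(1)[OF ts(1) I] ob(1)[OF ts(2) I] ob(2)[OF ts(1) u] ob(2)[OF ts(2) u] ob(2)[OF ts(1) I] ob(2)[OF ts(2) I]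
  note i = int[OF k, simplified, OF d(4)] and i' = int'[OF k, simplified, OF d(4)]
  have "(L' ?t \<star> ?k) \<bullet>\<^bsub>C\<^esub> ((R' u \<star> e) \<bullet>\<^bsub>C\<^esub> p ?s) = ((R' \<I> \<star> e) \<bullet>\<^bsub>C\<^esub> (L' ?s \<star> ?k)) \<bullet>\<^bsub>C\<^esub> p ?s"
    unfolding i' by (rule gcmp_assoc[symmetric]) (use C Lk Re pp o d in simp_all)
  also have "\<dots> = (R' \<I> \<star> e) \<bullet>\<^bsub>C\<^esub> (a ?s \<bullet>\<^bsub>C\<^esub> (L ?s \<star> ?k))"
    unfolding pa[OF ts(1) oq q(2) d(2), symmetric] by (rule gcmp_assoc) (use C Lk Re pp o d in simp_all)
  also have "\<dots> = (a ?t \<bullet>\<^bsub>C\<^esub> (R \<I> \<star> e)) \<bullet>\<^bsub>C\<^esub> (L ?s \<star> ?k)"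
    unfolding an[symmetric] by (rule gcmp_assoc[symmetric]) (use C Lk Re aa o d in simp_all)
  also have "\<dots> = a ?t \<bullet>\<^bsub>C\<^esub> ((L ?t \<star> ?k) \<bullet>\<^bsub>C\<^esub> (R u \<star> e))"
    unfolding i[symmetric] by (rule gcmp_assoc) (use C Lk Re aa o d in simp_all)
  also have "\<dots> = ((L' ?t \<star> ?k) \<bullet>\<^bsub>C\<^esub> p ?t) \<bullet>\<^bsub>C\<^esub> (R u \<star> e)"
    unfolding pa[OF ts(2) oq q(2) d(2)] by (rule gcmp_assoc[symmetric]) (use C Lk Re aa o d in simp_all)
  also have "\<dots> = (L' ?t \<star> ?k) \<bullet>\<^bsub>C\<^esub> (p ?t \<bullet>\<^bsub>C\<^esub> (R u \<star> e))"
    by (rule gcmp_assoc) (use C Lk Re pp o d in simp_all)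
  finally show ?thesis unfolding kappa_gmp(1)[OF L(2)[OF ts(2)] kU I u oq q(2), symmetric]
    by (rule cotensor_ext'[OF _ C cot q(1,2)]) (use C Re pp o d in \<open>simp_all add: disj Un_commute\<close>)
qed

text \<open>A transformation depending on the context \<open>Q\<close>, with naturality split into
  the two variables. It is formulated without an end, so that it can serve to construct one.\<close>

definition natfam :: "'o set \<Rightarrow> ('o, 'm) jtheory \<Rightarrow> ('o, 'm) jtheory \<Rightarrow> ('c, 'o, 'm) cvcat \<Rightarrow> ('o \<times> 'o, 'c, 'm) vfun \<Rightarrow> ('o \<times> 'o, 'c, 'm) vfun
   \<Rightarrow> 'o ctx \<Rightarrow> ('o \<Rightarrow> 'o \<Rightarrow> ('c, 'o, 'm) gr) \<Rightarrow> bool" where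
  "natfam J T U C D D' Q p \<longleftrightarrow>
    (\<forall>t\<in>J. \<forall>u\<in>J. gok C (p t u) \<and> sr (p t u) = FOb D (t, u) \<and> tg (p t u) = FOb D' (t, u) \<and> gc (p t u) = Q) \<and>
    (\<forall>e u. gok T e \<and> u \<in> J \<and> gc e \<inter> Q = {} \<longrightarrow> (fix_right T U D' u \<star> e) \<bullet>\<^bsub>C\<^esub> p (sr e) u = p (tg e) u \<bullet>\<^bsub>C\<^esub> (fix_right T U D u \<star> e)) \<and>
    (\<forall>d t. gok U d \<and> t \<in> J \<and> gc d \<inter> Q = {} \<longrightarrow> (fix_left T U D' t \<star> d) \<bullet>\<^bsub>C\<^esub> p t (sr d) = p t (tg d) \<bullet>\<^bsub>C\<^esub> (fix_left T U D t \<star> d))"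

lemma natfamD:
  assumes "natfam J T U C D D' Q p"
  shows "\<lbrakk>t \<in> J; u \<in> J\<rbrakk> \<Longrightarrow> gok C (p t u) \<and> sr (p t u) = FOb D (t, u) \<and> tg (p t u) = FOb D' (t, u) \<and> gc (p t u) = Q"
    "\<lbrakk>gok T e; u \<in> J; gc e \<inter> Q = {}\<rbrakk> \<Longrightarrow> (fix_right T U D' u \<star> e) \<bullet>\<^bsub>C\<^esub> p (sr e) u = p (tg e) u \<bullet>\<^bsub>C\<^esub> (fix_right T U D u \<star> e)"
    "\<lbrakk>gok U d; t \<in> J; gc d \<inter> Q = {}\<rbrakk> \<Longrightarrow> (fix_left T U D' t \<star> d) \<bullet>\<^bsub>C\<^esub> p t (sr d) = p t (tg d) \<bullet>\<^bsub>C\<^esub> (fix_left T U D t \<star> d)"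
  using assms unfolding natfam_def by blast+

text \<open>Naturality along the universal arrow at \<open>u\<close> expresses \<open>p t u\<close>
  through \<open>p t \<I>\<close>, because \<open>D'\<close> at \<open>(t, u)\<close> is a cotensor
  by \<open>u\<close> of its value at \<open>(t, \<I>)\<close>.\<close>

lemma natfam_unique:
  assumes S: "setting J T C" and S': "setting J U C" and D: "D \<in> bifold_algebras J T U C" "D' \<in> bifold_algebras J T U C"
    and Q: "okctx Q" and p: "natfam J T U C D D' Q p" "natfam J T U C D D' Q p'" and eq: "\<And>t. t \<in> J \<Longrightarrow> p t \<I> = p' t \<I>"
    and t: "t \<in> J" and u: "u \<in> J"
  shows "p t u = p' t u"
proof -
  note s = settingD[OF S] and s' = settingD[OF S'] and F = bifold_faces[OF S S' D(1)] and F' = bifold_faces[OF S S' D(2)]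
  note kU = theory_kappas[OF s(1) s'(2)] and L' = algebrasD(1)[OF F'(2)[OF t]]
  obtain q where q: "isoel q" "ty q = u" "ct q \<inter> Q = {}" using fresh_gen[OF Q arities_Ob[OF s(1) u]] by blast
  have oq: "okel q" using q by simp
  have k: "gok U (kp (kap U) u q)" by (rule gok_kp[OF kU oq q(2) u])
  note n = natfamD(3)[OF p(1) k t, simplified, OF q(3)] and n' = natfamD(3)[OF p(2) k t, simplified, OF q(3)]
  have "(fix_left T U D' t \<star> kp (kap U) u q) \<bullet>\<^bsub>C\<^esub> p t u = (fix_left T U D' t \<star> kp (kap U) u q) \<bullet>\<^bsub>C\<^esub> p' t u"
    unfolding n n' eq[OF t] ..
  then show ?thesis unfolding kappa_gmp(1)[OF L' kU s(8) u oq q(2), symmetric]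
    by (rule cotensor_ext'[OF _ s(3) alg_kappa_cotensor[OF S' F'(2)[OF t] u] q(1,2)])
      (use natfamD(1)[OF p(1) t u] natfamD(1)[OF p(2) t u] F'(7) u q in \<open>simp_all add: disj\<close>)
qed

text \<open>The family \<open>p\<close> is obtained by lifting \<open>\<alpha>\<close> along the
  second variable, and then \<open>half_natural\<close> makes it natural in the first. For the
  second variable one must know that \<open>p\<close> is also the lift of \<open>\<beta>\<close>
  along the first (\<open>claim\<close>), and there the agreement at \<open>\<I>\<close> is
  used.\<close>

lemma natfam_ex:
  assumes S: "setting J T C" and S': "setting J U C" and D: "D \<in> bifold_algebras J T U C" "D' \<in> bifold_algebras J T U C"
    and a: "gok (Alg J T C) \<alpha>" "sr \<alpha> = left_face T U D" "tg \<alpha> = left_face T U D'"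
    and b: "gok (Alg J U C) \<beta>" "sr \<beta> = right_face T U D" "tg \<beta> = right_face T U D'" "gc \<beta> = gc \<alpha>"
    and ab: "cmpt T C \<I> \<alpha> = cmpt U C \<I> \<beta>"
  obtains p where "natfam J T U C D D' (gc \<alpha>) p" "\<And>t. t \<in> J \<Longrightarrow> p t \<I> = cmpt T C t \<alpha>" "\<And>u. u \<in> J \<Longrightarrow> p \<I> u = cmpt U C u \<beta>"
proof -
  note s = settingD[OF S] and s' = settingD[OF S'] and F = bifold_faces[OF S S' D(1)] and F' = bifold_faces[OF S S' D(2)]
  note kU = theory_kappas[OF s(1) s'(2)] and kT = theory_kappas[OF s(1) s(2)]
  let ?Q = "gc \<alpha>" let ?R = "fix_right T U D" and ?L = "fix_left T U D" and ?R' = "fix_right T U D'" and ?L' = "fix_left T U D'"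
  have Q: "okctx ?Q" using gok_D(5)[OF a(1)] .
  note a1 = a(1)[unfolded Alg_def] and b1 = b(1)[unfolded Alg_def]
  note R = algebrasD(1)[OF F(1)] and R' = algebrasD(1)[OF F'(1)] and L = algebrasD(1)[OF F(2)] and L' = algebrasD(1)[OF F'(2)]
  have ac: "gok C (cmpt T C t \<alpha>) \<and> sr (cmpt T C t \<alpha>) = FOb (?L t) \<I> \<and> tg (cmpt T C t \<alpha>) = FOb (?L' t) \<I> \<and> gc (cmpt T C t \<alpha>) = ?Q" if t: "t \<in> J" for t
    using gok_cmpt[OF s(5) a1, of t] t s a F(6,7) F'(6,7) by (simp add: left_face_def)
  have bc: "gok C (cmpt U C u \<beta>) \<and> sr (cmpt U C u \<beta>) = FOb (?R u) \<I> \<and> tg (cmpt U C u \<beta>) = FOb (?R' u) \<I> \<and> gc (cmpt U C u \<beta>) = ?Q" if u: "u \<in> J" for u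
    using gok_cmpt[OF s'(5) b1, of u] u s s' b F(6,7) F'(6,7) by (simp add: right_face_def)
  have ob: "FOb (?R u) t = FOb (?L t) u" "FOb (?R' u) t = FOb (?L' t) u" if "t \<in> J" "u \<in> J" for t u
    using F(6,7) F'(6,7) that by simp_all
  have "\<exists>h. gok C h \<and> sr h = FOb (?L t) u \<and> tg h = FOb (?L' t) u \<and> gc h = ?Q \<and>
     (\<forall>q. okel q \<longrightarrow> ty q = u \<longrightarrow> ?Q \<inter> ct q = {} \<longrightarrow> (?L' t \<star> kp (kap U) u q) \<bullet>\<^bsub>C\<^esub> h = cmpt T C t \<alpha> \<bullet>\<^bsub>C\<^esub> (?L t \<star> kp (kap U) u q))"
    if t: "t \<in> J" and u: "u \<in> J" for t u
  proof -
    note c' = alg_kappa_cotensor[OF S' F'(2)[OF t] u] and c = cotD[OF alg_kappa_cotensor[OF S' F(2)[OF t] u]]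
    have x: "gok C (cmpt T C t \<alpha>)" "tg (cmpt T C t \<alpha>) = FOb (?L' t) \<I>" "sr (cmpt T C t \<alpha>) = FOb (?L t) \<I>" "gc (cmpt T C t \<alpha>) = ?Q" using ac[OF t] by simp_all
    obtain h where h: "gok C h" "sr h = FOb (?L t) u" "tg h = FOb (?L' t) u" "gc h = ?Q"
      "\<And>q. \<lbrakk>okel q; ty q = u; ?Q \<inter> ct q = {}\<rbrakk> \<Longrightarrow> (FOb (?L' t) u, FOb (?L' t) \<I>, (FHom (?L' t) u \<I> \<cdot> kap U u) \<triangleright> q) \<bullet>\<^bsub>C\<^esub> h
         = cmpt T C t \<alpha> \<bullet>\<^bsub>C\<^esub> (FOb (?L t) u, FOb (?L t) \<I>, (FHom (?L t) u \<I> \<cdot> kap U u) \<triangleright> q)"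
      using cotensor_lift_all[OF s(3) c' x(1,2) c(3,4) _ c(2)] c(5) unfolding x(3,4) by blast
    have "(?L' t \<star> kp (kap U) u q) \<bullet>\<^bsub>C\<^esub> h = cmpt T C t \<alpha> \<bullet>\<^bsub>C\<^esub> (?L t \<star> kp (kap U) u q)" if q: "okel q" "ty q = u" "?Q \<inter> ct q = {}" for q
      using h(5)[OF q] unfolding kappa_gmp(1)[OF L'[OF t] kU s(8) u q(1,2)] kappa_gmp(1)[OF L[OF t] kU s(8) u q(1,2)] .
    then show ?thesis using h(1-4) by blast
  qed
  then have "\<exists>p. \<forall>t\<in>J. \<forall>u\<in>J. gok C (p t u) \<and> sr (p t u) = FOb (?L t) u \<and> tg (p t u) = FOb (?L' t) u \<and> gc (p t u) = ?Q \<and>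
     (\<forall>q. okel q \<longrightarrow> ty q = u \<longrightarrow> ?Q \<inter> ct q = {} \<longrightarrow> (?L' t \<star> kp (kap U) u q) \<bullet>\<^bsub>C\<^esub> p t u = cmpt T C t \<alpha> \<bullet>\<^bsub>C\<^esub> (?L t \<star> kp (kap U) u q))"
    by (intro bchoice ballI) blast
  then obtain p where p: "\<And>t u. \<lbrakk>t \<in> J; u \<in> J\<rbrakk> \<Longrightarrow> gok C (p t u) \<and> sr (p t u) = FOb (?L t) u \<and> tg (p t u) = FOb (?L' t) u \<and> gc (p t u) = ?Q"
    and pa: "\<And>t u q. \<lbrakk>t \<in> J; u \<in> J; okel q; ty q = u; ?Q \<inter> ct q = {}\<rbrakk> \<Longrightarrow>
      (?L' t \<star> kp (kap U) u q) \<bullet>\<^bsub>C\<^esub> p t u = cmpt T C t \<alpha> \<bullet>\<^bsub>C\<^esub> (?L t \<star> kp (kap U) u q)"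
    by blast
  have an: "(?R' \<I> \<star> e) \<bullet>\<^bsub>C\<^esub> cmpt T C (sr e) \<alpha> = cmpt T C (tg e) \<alpha> \<bullet>\<^bsub>C\<^esub> (?R \<I> \<star> e)" if "gok T e" "gc e \<inter> ?Q = {}" for e
    using cmpt_nat[OF s(5) a1 that] a by (simp add: left_face_def)
  have bn: "(?L' \<I> \<star> d) \<bullet>\<^bsub>C\<^esub> cmpt U C (sr d) \<beta> = cmpt U C (tg d) \<beta> \<bullet>\<^bsub>C\<^esub> (?L \<I> \<star> d)" if "gok U d" "gc d \<inter> ?Q = {}" for d
    using cmpt_nat[OF s'(5) b1 that(1)] that b by (simp add: right_face_def)
  note int = faces_interchange[OF S S' D(1)] and int' = faces_interchange[OF S S' D(2)]
  \<comment> \<open>Both sides end in \<open>D'\<close> at \<open>(\<I>, u)\<close>, a cotensor of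
    its value at \<open>(\<I>, \<I>)\<close>. They are compared after the universal arrow at a
    second fresh variable \<open>q\<close>, which reduces everything to the common component of
    \<open>\<alpha>\<close> and \<open>\<beta>\<close>.\<close>
  have claim: "(?R' u \<star> kp (kap T) t r) \<bullet>\<^bsub>C\<^esub> p t u = cmpt U C u \<beta> \<bullet>\<^bsub>C\<^esub> (?R u \<star> kp (kap T) t r)"
    if t: "t \<in> J" and u: "u \<in> J" and r: "okel r" "ty r = t" "?Q \<inter> ct r = {}" for t u r
  proof -
    have "okctx (?Q \<union> ct r)" using Q r by simp
    then obtain q where q: "isoel q" "ty q = u" "ct q \<inter> (?Q \<union> ct r) = {}" using fresh_gen arities_Ob[OF s(1) u] by metis
    then have d: "ct q \<inter> ?Q = {}" "?Q \<inter> ct q = {}" "ct q \<inter> ct r = {}" "ct r \<inter> ct q = {}" "ct r \<inter> ?Q = {}" "?Q \<inter> ct r = {}" using r(3) by auto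
    have oq: "okel q" using q by simp
    let ?k = "kp (kap U) u q" and ?l = "kp (kap T) t r"
    have k: "gok U ?k" by (rule gok_kp[OF kU oq q(2) u])
    have l: "gok T ?l" by (rule gok_kp[OF kT r(1,2) t])
    note Lk = gok_mp[OF L[OF t] k] gok_mp[OF L'[OF t] k] gok_mp[OF L[OF s(8)] k] gok_mp[OF L'[OF s(8)] k]
    note Rl = gok_mp[OF R[OF u] l] gok_mp[OF R'[OF u] l] gok_mp[OF R[OF s(8)] l] gok_mp[OF R'[OF s(8)] l]
    note o = ob[OF t u] ob[OF t s(8)] ob[OF s(8) u] ob[OF s(8) s(8)]
    note i = int[OF l k, simplified, OF d(4)] and i' = int'[OF l k, simplified, OF d(4)]
    note A = ac[OF t] ac[OF s(8)] bc[OF u] bc[OF s(8)] p[OF t u]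
    have "(?L' \<I> \<star> ?k) \<bullet>\<^bsub>C\<^esub> ((?R' u \<star> ?l) \<bullet>\<^bsub>C\<^esub> p t u) = ((?R' \<I> \<star> ?l) \<bullet>\<^bsub>C\<^esub> (?L' t \<star> ?k)) \<bullet>\<^bsub>C\<^esub> p t u"
      unfolding i' by (rule gcmp_assoc[symmetric]) (use s(3) Lk Rl A o d in simp_all)
    also have "\<dots> = (?R' \<I> \<star> ?l) \<bullet>\<^bsub>C\<^esub> (cmpt T C t \<alpha> \<bullet>\<^bsub>C\<^esub> (?L t \<star> ?k))"
      unfolding pa[OF t u oq q(2) d(2), symmetric] by (rule gcmp_assoc) (use s(3) Lk Rl A o d in simp_all)
    also have "\<dots> = ((?R' \<I> \<star> ?l) \<bullet>\<^bsub>C\<^esub> cmpt T C t \<alpha>) \<bullet>\<^bsub>C\<^esub> (?L t \<star> ?k)"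
      by (rule gcmp_assoc[symmetric]) (use s(3) Lk Rl A o d in simp_all)
    also have "(?R' \<I> \<star> ?l) \<bullet>\<^bsub>C\<^esub> cmpt T C t \<alpha> = cmpt U C \<I> \<beta> \<bullet>\<^bsub>C\<^esub> (?R \<I> \<star> ?l)"
      using an[OF l] d ab by simp
    also have "(cmpt U C \<I> \<beta> \<bullet>\<^bsub>C\<^esub> (?R \<I> \<star> ?l)) \<bullet>\<^bsub>C\<^esub> (?L t \<star> ?k) = cmpt U C \<I> \<beta> \<bullet>\<^bsub>C\<^esub> ((?L \<I> \<star> ?k) \<bullet>\<^bsub>C\<^esub> (?R u \<star> ?l))"
      unfolding i[symmetric] by (rule gcmp_assoc) (use s(3) Lk Rl A o d in simp_all)
    also have "\<dots> = (cmpt U C \<I> \<beta> \<bullet>\<^bsub>C\<^esub> (?L \<I> \<star> ?k)) \<bullet>\<^bsub>C\<^esub> (?R u \<star> ?l)"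
      by (rule gcmp_assoc[symmetric]) (use s(3) Lk Rl A o d in simp_all)
    also have "cmpt U C \<I> \<beta> \<bullet>\<^bsub>C\<^esub> (?L \<I> \<star> ?k) = (?L' \<I> \<star> ?k) \<bullet>\<^bsub>C\<^esub> cmpt U C u \<beta>"
      using bn[OF k] d by simp
    also have "((?L' \<I> \<star> ?k) \<bullet>\<^bsub>C\<^esub> cmpt U C u \<beta>) \<bullet>\<^bsub>C\<^esub> (?R u \<star> ?l) = (?L' \<I> \<star> ?k) \<bullet>\<^bsub>C\<^esub> (cmpt U C u \<beta> \<bullet>\<^bsub>C\<^esub> (?R u \<star> ?l))"
      by (rule gcmp_assoc) (use s(3) Lk Rl A o d in simp_all)
    finally show ?thesis unfolding kappa_gmp(1)[OF L'[OF s(8)] kU s(8) u oq q(2), symmetric]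
      by (rule cotensor_ext'[OF _ s(3) alg_kappa_cotensor[OF S' F'(2)[OF s(8)] u] q(1,2)])
        (use s(3) Rl A o d r(3) in \<open>simp_all add: disj Un_commute\<close>)
  qed
  have "natfam J T U C D D' ?Q p"
    unfolding natfam_def
  proof (intro conjI ballI allI impI)
    fix t u assume "t \<in> J" "u \<in> J"
    then show "gok C (p t u)" "sr (p t u) = FOb D (t, u)" "tg (p t u) = FOb D' (t, u)" "gc (p t u) = ?Q"
      using p F(7) F'(7) by simp_all
  next
    fix e u assume *: "gok T e \<and> u \<in> J \<and> gc e \<inter> ?Q = {}"
    then have e: "gok T e" "gc e \<inter> ?Q = {}" and u: "u \<in> J" by simp_all
    have "tg e \<in> J" using gok_D(2)[OF e(1)] s by simp
    then show "(?R' u \<star> e) \<bullet>\<^bsub>C\<^esub> p (sr e) u = p (tg e) u \<bullet>\<^bsub>C\<^esub> (?R u \<star> e)"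
      using alg_kappa_cotensor[OF S' F'(2) u]
      by (intro half_natural[where p = "\<lambda>t. p t u" and a = "\<lambda>t. cmpt T C t \<alpha>", OF s(3) kU s(8,6) R R' L L' ob e u int[OF e(1)] int'[OF e(1)] _ ac an[OF e] _ _ Q])
        (use p pa u in simp_all)
  next
    fix d t assume *: "gok U d \<and> t \<in> J \<and> gc d \<inter> ?Q = {}"
    then have d: "gok U d" "gc d \<inter> ?Q = {}" and t: "t \<in> J" by simp_all
    have J: "tg d \<in> J" using gok_D(2)[OF d(1)] s' by simp
    show "(?L' t \<star> d) \<bullet>\<^bsub>C\<^esub> p t (sr d) = p t (tg d) \<bullet>\<^bsub>C\<^esub> (?L t \<star> d)"
    \<comment> \<open>The two theories change places here: \<open>\<beta>\<close> is the family at
      \<open>\<I>\<close>, and \<open>claim\<close> is the lifting property with respect to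
      it.\<close>
    proof (rule half_natural[where p = "\<lambda>u. p t u" and a = "\<lambda>u. cmpt U C u \<beta>" and R = ?L and R' = ?L' and L = ?R and L' = ?R',
        OF s(3) kT s(8) s'(6) L L' R R' _ _ d t _ _ alg_kappa_cotensor[OF S F'(1)[OF J] t] bc bn[OF d] _ _ Q])
      show "(?L (tg e) \<star> d) \<bullet>\<^bsub>C\<^esub> (?R (sr d) \<star> e) = (?R (tg d) \<star> e) \<bullet>\<^bsub>C\<^esub> (?L (sr e) \<star> d)"
        "(?L' (tg e) \<star> d) \<bullet>\<^bsub>C\<^esub> (?R' (sr d) \<star> e) = (?R' (tg d) \<star> e) \<bullet>\<^bsub>C\<^esub> (?L' (sr e) \<star> d)"
        if "gok T e" "gc d \<inter> gc e = {}" for e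
        using int[OF that(1) d(1)] int'[OF that(1) d(1)] that(2) by (simp_all add: Int_commute)
      show "(?R' u \<star> kp (kap T) t q) \<bullet>\<^bsub>C\<^esub> p t u = cmpt U C u \<beta> \<bullet>\<^bsub>C\<^esub> (?R u \<star> kp (kap T) t q)"
        if "u \<in> J" "okel q" "ty q = t" "?Q \<inter> ct q = {}" for u q using claim[OF t that] .
    qed (use p[OF t] ob t in simp_all)
  qed
  \<comment> \<open>The universal arrow at the unit element is an identity, so the lifting equation
    at \<open>un\<close> reads off the component.\<close>
  moreover have "p t \<I> = cmpt T C t \<alpha>" if t: "t \<in> J" for t
    using pa[OF t s(8), of un] p[OF t s(8)] ac[OF t] gmp_id[OF L[OF t], of \<I>] gmp_id[OF L'[OF t], of \<I>] s(3,8) s'(6)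
    by (simp add: kp_un[OF s(1) s'(2)])
  moreover have "p \<I> u = cmpt U C u \<beta>" if u: "u \<in> J" for u
    using claim[OF s(8) u, of un] p[OF s(8) u] bc[OF u] gmp_id[OF R[OF u], of \<I>] gmp_id[OF R'[OF u], of \<I>] s(3,6,8) ob[OF s(8) u]
    by (simp add: kp_un[OF s(1) s(2)])
  ultimately show thesis using that by blast
qed

text \<open>A graded arrow of one factor paired with an identity of the other is a graded arrow of
  the tensor product, so naturality of the wedge specialises to each variable.\<close>

lemma wedge_natfam:
  assumes S: "setting J T C" and S': "setting J U C" and D: "D \<in> bifold_algebras J T U C" "D' \<in> bifold_algebras J T U C"
    and w: "wedge (vtensor T U) C D D' X \<mu>" and x: "okel x" "ty x = X"
  shows "natfam J T U C D D' (ct x) (\<lambda>t u. (FOb D (t, u), FOb D' (t, u), \<mu> (t, u) \<triangleright> x))"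
proof -
  note s = settingD[OF S] and s' = settingD[OF S'] and d = bifoldD(1)[OF D(1)] bifoldD(1)[OF D(2)]
  note F = bifold_faces[OF S S' D(1)] and F' = bifold_faces[OF S S' D(2)]
  note wt = wedge_typ[OF w] and g = wedge_gr[OF d w _ x]
  show ?thesis unfolding natfam_def
  proof (intro conjI ballI allI impI)
    fix t u assume tu: "t \<in> J" "u \<in> J"
    show "gok C (FOb D (t, u), FOb D' (t, u), \<mu> (t, u) \<triangleright> x)"
      using wt(2-4)[of "(t, u)"] tu s s' x F(5) F'(5) by simp
  next
    fix e u assume *: "gok T e \<and> u \<in> J \<and> gc e \<inter> ct x = {}"
    then show "(fix_right T U D' u \<star> e) \<bullet>\<^bsub>C\<^esub> (FOb D (sr e, u), FOb D' (sr e, u), \<mu> (sr e, u) \<triangleright> x) =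
        (FOb D (tg e, u), FOb D' (tg e, u), \<mu> (tg e, u) \<triangleright> x) \<bullet>\<^bsub>C\<^esub> (fix_right T U D u \<star> e)"
      using g[of "gt e (gid U u)"] fix_right_mp[OF s(7) s'(7) d(1), of u e] fix_right_mp[OF s(7) s'(7) d(2), of u e] s' s by simp
  next
    fix e t assume *: "gok U e \<and> t \<in> J \<and> gc e \<inter> ct x = {}"
    then show "(fix_left T U D' t \<star> e) \<bullet>\<^bsub>C\<^esub> (FOb D (t, sr e), FOb D' (t, sr e), \<mu> (t, sr e) \<triangleright> x) =
        (FOb D (t, tg e), FOb D' (t, tg e), \<mu> (t, tg e) \<triangleright> x) \<bullet>\<^bsub>C\<^esub> (fix_left T U D t \<star> e)"
      using g[of "gt (gid T t) e"] fix_left_mp[OF s(7) s'(7) d(1), of t e] fix_left_mp[OF s(7) s'(7) d(2), of t e] s' s by simp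
  qed simp_all
qed

text \<open>On a decomposable arrow both functors factor by \<open>partial_interchange\<close> into
  one step in each variable, and naturality is applied once to each step. Decomposable test arrows
  are enough by \<open>wedgeI_gen\<close>.\<close>

lemma natfam_wedge:
  assumes S: "setting J T C" and S': "setting J U C" and D: "D \<in> bifold_algebras J T U C" "D' \<in> bifold_algebras J T U C"
    and x: "isoel x" "ty x = X" and p: "natfam J T U C D D' (ct x) p"
    and m: "\<And>t u. \<lbrakk>t \<in> J; u \<in> J\<rbrakk> \<Longrightarrow> \<mu> (t, u) \<in> Ar V \<and> Dom V (\<mu> (t, u)) = X \<and> Cod V (\<mu> (t, u)) = VHom C (FOb D (t, u)) (FOb D' (t, u)) \<and>
      \<mu> (t, u) \<triangleright> x = ge (p t u)"
  shows "wedge (vtensor T U) C D D' X \<mu>"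
proof (rule wedgeI_gen[OF bifoldD(1)[OF D(1)] bifoldD(1)[OF D(2)] x])
  note s = settingD[OF S] and s' = settingD[OF S'] and d = bifoldD(1)[OF D(1)] bifoldD(1)[OF D(2)]
  note F = bifold_faces[OF S S' D(1)] and F' = bifold_faces[OF S S' D(2)]
  show "\<mu> a \<in> Ar V \<and> Dom V (\<mu> a) = X \<and> Cod V (\<mu> a) = VHom C (FOb D a) (FOb D' a)" if "a \<in> VOb (vtensor T U)" for a
    using that m s s' by auto
  have e: "(FOb D (t, u), FOb D' (t, u), \<mu> (t, u) \<triangleright> x) = p t u" if "t \<in> J" "u \<in> J" for t u
    using m[OF that] natfamD(1)[OF p that] by (intro gr_eqI) simp_all
  fix a b assume "a \<in> VOb (vtensor T U)" "b \<in> VOb (vtensor T U)"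
  then obtain t u t' u' where ab: "a = (t, u)" "b = (t', u')" "t \<in> J" "u \<in> J" "t' \<in> J" "u' \<in> J" using s s' by auto
  have H: "VHom T t t' \<in> Ob V" "VHom U u u' \<in> Ob V" using ab s s' by simp_all
  \<comment> \<open>Variables for the two tensor factors of the hom-object, fresh for
    \<open>x\<close> and for each other.\<close>
  obtain y where y: "isoel y" "ty y = VHom T t t'" "ct y \<inter> ct x = {}" using fresh_gen[OF okel_ct[OF isoel_okel[OF x(1)]] H(1)] by blast
  have "okctx (ct x \<union> ct y)" using x y by simp
  then obtain z where z: "isoel z" "ty z = VHom U u u'" "ct z \<inter> (ct x \<union> ct y) = {}" using fresh_gen H(2) by metis
  then have z2: "ct z \<inter> ct x = {}" "ct z \<inter> ct y = {}" by auto
  let ?e = "(t, t', y)" and ?d = "(u, u', z)"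
  have g: "gok T ?e" "gok U ?d" using ab y z s s' by simp_all
  have dd: "gc ?e \<inter> gc ?d = {}" "gc ?e \<inter> ct x = {}" "gc ?d \<inter> ct x = {}" using y z2 by (simp_all add: Int_commute)
  note P = partial_interchange[OF s(7) s'(7) d(1) g dd(1)] and P' = partial_interchange[OF s(7) s'(7) d(2) g dd(1)]
  let ?R = "fix_right T U D" and ?L = "fix_left T U D" and ?R' = "fix_right T U D'" and ?L' = "fix_left T U D'"
  note k = gok_mp[OF algebrasD(1)[OF F(1)[OF ab(6)]] g(1)] gok_mp[OF algebrasD(1)[OF F'(1)[OF ab(6)]] g(1)]
    gok_mp[OF algebrasD(1)[OF F(2)[OF ab(3)]] g(2)] gok_mp[OF algebrasD(1)[OF F'(2)[OF ab(3)]] g(2)]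
  note pp = natfamD(1)[OF p ab(3,4)] natfamD(1)[OF p ab(3,6)] natfamD(1)[OF p ab(5,6)]
  have dx: "ct y \<inter> ct z = {}" "ct y \<inter> ct x = {}" "ct z \<inter> ct x = {}" "ct z \<inter> ct y = {}" "ct x \<inter> ct y = {}" "ct x \<inter> ct z = {}"
    using y z2 by (auto simp: Int_commute)
  note o = F(6,7) F'(6,7)
  have "(D' \<star> gt ?e ?d) \<bullet>\<^bsub>C\<^esub> p t u = ((?R' u' \<star> ?e) \<bullet>\<^bsub>C\<^esub> (?L' t \<star> ?d)) \<bullet>\<^bsub>C\<^esub> p t u" using P'(1) by simp
  also have "\<dots> = (?R' u' \<star> ?e) \<bullet>\<^bsub>C\<^esub> ((?L' t \<star> ?d) \<bullet>\<^bsub>C\<^esub> p t u)"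
    by (rule gcmp_assoc) (use s(3) k pp dx o ab in \<open>simp_all del: gok_tuple\<close>)
  also have "(?L' t \<star> ?d) \<bullet>\<^bsub>C\<^esub> p t u = p t u' \<bullet>\<^bsub>C\<^esub> (?L t \<star> ?d)" using natfamD(3)[OF p g(2) ab(3) dd(3)] by simp
  also have "(?R' u' \<star> ?e) \<bullet>\<^bsub>C\<^esub> (p t u' \<bullet>\<^bsub>C\<^esub> (?L t \<star> ?d)) = ((?R' u' \<star> ?e) \<bullet>\<^bsub>C\<^esub> p t u') \<bullet>\<^bsub>C\<^esub> (?L t \<star> ?d)"
    by (rule gcmp_assoc[symmetric]) (use s(3) k pp dx o ab in \<open>simp_all del: gok_tuple\<close>)
  also have "(?R' u' \<star> ?e) \<bullet>\<^bsub>C\<^esub> p t u' = p t' u' \<bullet>\<^bsub>C\<^esub> (?R u' \<star> ?e)" using natfamD(2)[OF p g(1) ab(6) dd(2)] by simp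
  also have "(p t' u' \<bullet>\<^bsub>C\<^esub> (?R u' \<star> ?e)) \<bullet>\<^bsub>C\<^esub> (?L t \<star> ?d) = p t' u' \<bullet>\<^bsub>C\<^esub> ((?R u' \<star> ?e) \<bullet>\<^bsub>C\<^esub> (?L t \<star> ?d))"
    by (rule gcmp_assoc) (use s(3) k pp dx o ab in \<open>simp_all del: gok_tuple\<close>)
  also have "\<dots> = p t' u' \<bullet>\<^bsub>C\<^esub> (D \<star> gt ?e ?d)" using P(1) by simp
  finally have "(D' \<star> gt ?e ?d) \<bullet>\<^bsub>C\<^esub> p t u = p t' u' \<bullet>\<^bsub>C\<^esub> (D \<star> gt ?e ?d)" .
  then show "\<exists>q. isoel q \<and> ty q = VHom (vtensor T U) a b \<and> ct q \<inter> ct x = {} \<and>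
      (D' \<star> (a, b, q)) \<bullet>\<^bsub>C\<^esub> (FOb D a, FOb D' a, \<mu> a \<triangleright> x) = (FOb D b, FOb D' b, \<mu> b \<triangleright> x) \<bullet>\<^bsub>C\<^esub> (D \<star> (a, b, q))"
    unfolding ab e[OF ab(3,4)] e[OF ab(5,6)]
    by (intro exI[of _ "y \<bowtie> z"]) (use y z(1,2) dx in \<open>simp add: gt_def disj\<close>)
qed

section \<open>Pullbacks of enriched categories\<close>

lemma pb:
  assumes "has_pullbacks V" "f \<in> Ar V" "g \<in> Ar V" "Cod V f = Cod V g"
  shows "is_pullback V f g (pb_ob V f g) (pb_fst V f g) (pb_snd V f g)"
proof -
  obtain P p q where "is_pullback V f g P p q" using assms unfolding has_pullbacks_def by blast
  then have "case (P, p, q) of (P, p, q) \<Rightarrow> is_pullback V f g P p q" by simp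
  then have "\<exists>x. case x of (P, p, q) \<Rightarrow> is_pullback V f g P p q" by (rule exI)
  from someI_ex[OF this] show ?thesis by (simp add: pb_def pb_ob_def pb_fst_def pb_snd_def case_prod_unfold)
qed

lemma pb_typ:
  assumes "has_pullbacks V" "f \<in> Ar V" "g \<in> Ar V" "Cod V f = Cod V g"
  shows "pb_ob V f g \<in> Ob V" "pb_fst V f g \<in> Ar V" "Dom V (pb_fst V f g) = pb_ob V f g" "Cod V (pb_fst V f g) = Dom V f"
    "pb_snd V f g \<in> Ar V" "Dom V (pb_snd V f g) = pb_ob V f g" "Cod V (pb_snd V f g) = Dom V g"
    "f \<cdot> pb_fst V f g = g \<cdot> pb_snd V f g"
proof -
  note p = pb[OF assms, unfolded is_pullback_def in_hom_def]
  show 1: "pb_fst V f g \<in> Ar V" "Dom V (pb_fst V f g) = pb_ob V f g" "Cod V (pb_fst V f g) = Dom V f"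
    "pb_snd V f g \<in> Ar V" "Dom V (pb_snd V f g) = pb_ob V f g" "Cod V (pb_snd V f g) = Dom V g"
    "f \<cdot> pb_fst V f g = g \<cdot> pb_snd V f g" using p by blast+
  show "pb_ob V f g \<in> Ob V" using Dom_Ob[OF 1(1)] 1(2) by simp
qed

lemma pb_pair:
  assumes "has_pullbacks V" "f \<in> Ar V" "g \<in> Ar V" "Cod V f = Cod V g"
    and "r \<in> Ar V" "s \<in> Ar V" "Dom V r = X" "Dom V s = X" "Cod V r = Dom V f" "Cod V s = Dom V g" "f \<cdot> r = g \<cdot> s"
  shows "pb_pair V f g X r s \<in> Ar V" "Dom V (pb_pair V f g X r s) = X" "Cod V (pb_pair V f g X r s) = pb_ob V f g"
    "pb_fst V f g \<cdot> pb_pair V f g X r s = r" "pb_snd V f g \<cdot> pb_pair V f g X r s = s"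
proof -
  have "\<guillemotleft>r : X \<rightarrow> Dom V f\<guillemotright> \<and> \<guillemotleft>s : X \<rightarrow> Dom V g\<guillemotright> \<and> f \<cdot> r = g \<cdot> s" using assms by (simp add: in_hom_def)
  then have "\<exists>!h. \<guillemotleft>h : X \<rightarrow> pb_ob V f g\<guillemotright> \<and> pb_fst V f g \<cdot> h = r \<and> pb_snd V f g \<cdot> h = s"
    using pb[OF assms(1-4)] unfolding is_pullback_def by blast
  from theI'[OF this] show "pb_pair V f g X r s \<in> Ar V" "Dom V (pb_pair V f g X r s) = X" "Cod V (pb_pair V f g X r s) = pb_ob V f g"
    "pb_fst V f g \<cdot> pb_pair V f g X r s = r" "pb_snd V f g \<cdot> pb_pair V f g X r s = s"
    unfolding pb_pair_def in_hom_def by auto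
qed

lemma pb_ext:
  assumes "has_pullbacks V" "f \<in> Ar V" "g \<in> Ar V" "Cod V f = Cod V g"
    and h: "h \<in> Ar V" "h' \<in> Ar V" "Dom V h = Dom V h'" "Cod V h = pb_ob V f g" "Cod V h' = pb_ob V f g"
    "pb_fst V f g \<cdot> h = pb_fst V f g \<cdot> h'" "pb_snd V f g \<cdot> h = pb_snd V f g \<cdot> h'"
  shows "h = h'"
proof -
  note t = pb_typ[OF assms(1-4)]
  have "f \<cdot> (pb_fst V f g \<cdot> h) = g \<cdot> (pb_snd V f g \<cdot> h)"
    using h t assms(2,3) t(8) by (simp flip: Cmp_assoc)
  then have "\<guillemotleft>pb_fst V f g \<cdot> h : Dom V h \<rightarrow> Dom V f\<guillemotright> \<and> \<guillemotleft>pb_snd V f g \<cdot> h : Dom V h \<rightarrow> Dom V g\<guillemotright> \<and>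
      f \<cdot> (pb_fst V f g \<cdot> h) = g \<cdot> (pb_snd V f g \<cdot> h)" using h t by (simp add: in_hom_def)
  then have "\<exists>!k. \<guillemotleft>k : Dom V h \<rightarrow> pb_ob V f g\<guillemotright> \<and> pb_fst V f g \<cdot> k = pb_fst V f g \<cdot> h \<and> pb_snd V f g \<cdot> k = pb_snd V f g \<cdot> h"
    using pb[OF assms(1-4)] unfolding is_pullback_def by blast
  then show ?thesis by (rule ex1_eqD) (use h in \<open>simp_all add: in_hom_def\<close>)
qed

definition pfst :: "('a, 'c, 'm) vfun \<Rightarrow> ('b, 'c, 'm) vfun \<Rightarrow> ('a \<times> 'b) \<times> ('a \<times> 'b) \<times> ('o, 'm) el \<Rightarrow> ('a, 'o, 'm) gr" where
  "pfst F G p = (fst (sr p), fst (tg p),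
     pb_fst V (FHom F (fst (sr p)) (fst (tg p))) (FHom G (snd (sr p)) (snd (tg p))) \<triangleright> ge p)"

definition psnd :: "('a, 'c, 'm) vfun \<Rightarrow> ('b, 'c, 'm) vfun \<Rightarrow> ('a \<times> 'b) \<times> ('a \<times> 'b) \<times> ('o, 'm) el \<Rightarrow> ('b, 'o, 'm) gr" where
  "psnd F G p = (snd (sr p), snd (tg p),
     pb_snd V (FHom F (fst (sr p)) (fst (tg p))) (FHom G (snd (sr p)) (snd (tg p))) \<triangleright> ge p)"

context
  fixes A :: "('a, 'o, 'm) vcat" and B :: "('b, 'o, 'm) vcat" and C :: "('c, 'o, 'm, 'z) vcat_scheme"
    and F :: "('a, 'c, 'm) vfun" and G :: "('b, 'c, 'm) vfun"
  assumes pbs: "has_pullbacks V" and F: "vfunctor A C F" and G: "vfunctor B C G"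
begin

abbreviation (input) "pbl x y \<equiv> FHom F (fst x) (fst y)"
abbreviation (input) "pbr x y \<equiv> FHom G (snd x) (snd y)"
abbreviation (input) "PB \<equiv> vpullback A B F G"

abbreviation (input) "pf \<equiv> pfst F G"
abbreviation (input) "ps \<equiv> psnd F G"

lemma pfs_simps: "sr (pf p) = fst (sr p)" "tg (pf p) = fst (tg p)" "gc (pf p) = gc p"
  "sr (ps p) = snd (sr p)" "tg (ps p) = snd (tg p)" "gc (ps p) = gc p"
  by (simp_all add: pfst_def psnd_def)

lemma PB_VOb: "x \<in> VOb PB \<longleftrightarrow> fst x \<in> VOb A \<and> snd x \<in> VOb B \<and> FOb F (fst x) = FOb G (snd x)"
  by (auto simp: vpullback_def Let_def mem_Times_iff)

lemma PB_VHom: "VHom PB x y = pb_ob V (pbl x y) (pbr x y)"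
  by (simp add: vpullback_def Let_def)

lemma PB_arr:
  assumes "x \<in> VOb PB" "y \<in> VOb PB"
  shows "pbl x y \<in> Ar V" "pbr x y \<in> Ar V" "Dom V (pbl x y) = VHom A (fst x) (fst y)" "Dom V (pbr x y) = VHom B (snd x) (snd y)"
    "Cod V (pbl x y) = Cod V (pbr x y)" "Cod V (pbl x y) = VHom C (FOb F (fst x)) (FOb F (fst y))"
  using assms vfun_typ(2-4)[OF F, of "fst x" "fst y"] vfun_typ(2-4)[OF G, of "snd x" "snd y"] by (simp_all add: PB_VOb)

lemma PB_typ: assumes "x \<in> VOb PB" "y \<in> VOb PB"
  shows "pb_ob V (pbl x y) (pbr x y) \<in> Ob V"
    "pb_fst V (pbl x y) (pbr x y) \<in> Ar V" "Dom V (pb_fst V (pbl x y) (pbr x y)) = pb_ob V (pbl x y) (pbr x y)"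
    "Cod V (pb_fst V (pbl x y) (pbr x y)) = VHom A (fst x) (fst y)"
    "pb_snd V (pbl x y) (pbr x y) \<in> Ar V" "Dom V (pb_snd V (pbl x y) (pbr x y)) = pb_ob V (pbl x y) (pbr x y)"
    "Cod V (pb_snd V (pbl x y) (pbr x y)) = VHom B (snd x) (snd y)"
    "pbl x y \<cdot> pb_fst V (pbl x y) (pbr x y) = pbr x y \<cdot> pb_snd V (pbl x y) (pbr x y)"
  using pb_typ[OF pbs PB_arr(1,2,5)[OF assms]] PB_arr(3,4)[OF assms] by simp_all

lemma gok_pfs: assumes p: "gok PB p"
  shows "gok A (pf p)" "gok B (ps p)" "F \<star> pf p = G \<star> ps p"
proof -
  note d = gok_D[OF p] and t = PB_typ[OF gok_D(1,2)[OF p]] and a = PB_arr[OF gok_D(1,2)[OF p]]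
  note o = d(1)[unfolded PB_VOb] d(2)[unfolded PB_VOb]
  have ty: "ty (ge p) = pb_ob V (pbl (sr p) (tg p)) (pbr (sr p) (tg p))" using d(4) by (simp add: PB_VHom)
  show "gok A (pf p)" "gok B (ps p)" using o t d(3) ty by (simp_all add: pfst_def psnd_def)
  have "pbl (sr p) (tg p) \<triangleright> pb_fst V (pbl (sr p) (tg p)) (pbr (sr p) (tg p)) \<triangleright> ge p
    = (pbr (sr p) (tg p) \<cdot> pb_snd V (pbl (sr p) (tg p)) (pbr (sr p) (tg p))) \<triangleright> ge p"
    by (rule app_collapse[OF t(8)]) (use t a d(3) ty in simp_all)
  then show "F \<star> pf p = G \<star> ps p" using o t a d(3) ty by (simp add: pfst_def psnd_def gmp_tuple)
qed

lemma pfs_ext: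
  assumes p: "gok PB p" "gok PB p'" and e: "sr p = sr p'" "tg p = tg p'" "gc p = gc p'" "pf p = pf p'" "ps p = ps p'"
  shows "p = p'"
proof -
  note d = gok_D[OF p(1)] and d' = gok_D[OF p(2)] and a = PB_arr[OF gok_D(1,2)[OF p(1)]]
  have "snd (ge p) = snd (ge p')"
    by (rule pb_ext[OF pbs a(1,2,5)]) (use d d' e in \<open>simp_all add: PB_VHom pfst_def psnd_def app_def\<close>)
  then show ?thesis using e by (intro gr_eqI el_eqI) simp_all
qed

text \<open>With \<open>pfs_ext\<close>, graded arrows of the pullback are pairs of graded arrows
  with the same context and the same image, so category laws can be verified on the two
  projections.\<close>

lemma pfs_ex:
  assumes a: "gok A a" and b: "gok B b" and ab: "gc a = gc b" "F \<star> a = G \<star> b"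
  obtains p where "gok PB p" "sr p = (sr a, sr b)" "tg p = (tg a, tg b)" "gc p = gc a" "pf p = a" "ps p = b"
proof -
  note da = gok_D[OF a] and db = gok_D[OF b]
  let ?x = "(sr a, sr b)" and ?y = "(tg a, tg b)"
  have o: "?x \<in> VOb PB" "?y \<in> VOb PB" using da db arg_cong[OF ab(2), of sr] arg_cong[OF ab(2), of tg] by (simp_all add: PB_VOb)
  note r = PB_arr[OF o] and t = PB_typ[OF o]
  have "FHom F (sr a) (tg a) \<triangleright> ge a = FHom G (sr b) (tg b) \<triangleright> ge b" using ab(2) by (simp add: gmp_def)
  then have e: "pbl ?x ?y \<cdot> snd (ge a) = pbr ?x ?y \<cdot> snd (ge b)" by (simp add: app_def)
  have h: "snd (ge a) \<in> Ar V" "snd (ge b) \<in> Ar V" "Dom V (snd (ge a)) = den (gc a)" "Dom V (snd (ge b)) = den (gc a)"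
    "Cod V (snd (ge a)) = Dom V (pbl ?x ?y)" "Cod V (snd (ge b)) = Dom V (pbr ?x ?y)" using da db ab(1) r by simp_all
  note k = pb_pair[OF pbs r(1,2,5) h e]
  let ?h = "pb_pair V (pbl ?x ?y) (pbr ?x ?y) (den (gc a)) (snd (ge a)) (snd (ge b))"
  let ?p = "(?x, ?y, ?h \<triangleright> idc (gc a))"
  have c: "pb_fst V (pbl ?x ?y) (pbr ?x ?y) \<triangleright> ?h \<triangleright> idc (gc a) = snd (ge a) \<triangleright> idc (gc a)"
    "pb_snd V (pbl ?x ?y) (pbr ?x ?y) \<triangleright> ?h \<triangleright> idc (gc a) = snd (ge b) \<triangleright> idc (gc a)"
    by (rule app_collapse[OF k(4)], (use k t da in simp_all)[5], rule app_collapse[OF k(5)], (use k t da in simp_all)[5])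
  show thesis
  proof (rule that[of ?p])
    show "gok PB ?p" using o k(1-3) da by (simp add: PB_VHom)
    show "pf ?p = a" using c(1) el_idc[OF da(3)] gr_eta[of a] by (simp add: pfst_def)
    show "ps ?p = b" using c(2) el_idc[OF db(3)] gr_eta[of b] ab(1) by (simp add: psnd_def)
  qed (use da in simp_all)
qed

lemma PB_VComp:
  assumes o: "x \<in> VOb PB" "y \<in> VOb PB" "z \<in> VOb PB"
  shows "VComp PB x y z \<in> Ar V" "Dom V (VComp PB x y z) = VHom PB y z \<otimes> VHom PB x y" "Cod V (VComp PB x y z) = VHom PB x z"
    "pb_fst V (pbl x z) (pbr x z) \<cdot> VComp PB x y z = VComp A (fst x) (fst y) (fst z) \<cdot> (pb_fst V (pbl y z) (pbr y z) \<odot> pb_fst V (pbl x y) (pbr x y))"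
    "pb_snd V (pbl x z) (pbr x z) \<cdot> VComp PB x y z = VComp B (snd x) (snd y) (snd z) \<cdot> (pb_snd V (pbl y z) (pbr y z) \<odot> pb_snd V (pbl x y) (pbr x y))"
proof -
  note A = vfun_cat(1)[OF F] and B = vfun_cat(1)[OF G] and C = vfun_cat(2)[OF F]
  note t = PB_typ[OF o(1,2)] PB_typ[OF o(2,3)] PB_typ[OF o(1,3)] and r = PB_arr[OF o(1,3)]
  note ob = o[unfolded PB_VOb]
  let ?Y = "VHom PB y z" and ?X = "VHom PB x y"
  let ?r = "VComp A (fst x) (fst y) (fst z) \<cdot> (pb_fst V (pbl y z) (pbr y z) \<odot> pb_fst V (pbl x y) (pbr x y))"
  let ?s = "VComp B (snd x) (snd y) (snd z) \<cdot> (pb_snd V (pbl y z) (pbr y z) \<odot> pb_snd V (pbl x y) (pbr x y))"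
  have XY: "?X \<in> Ob V" "?Y \<in> Ob V" using t by (simp_all add: PB_VHom)
  let ?q = "(y, z, gen 0 ?Y)" and ?p = "(x, y, gen 1 ?X)"
  have g: "gok PB ?q" "gok PB ?p" using o XY by simp_all
  note gp = gok_pfs[OF g(2)] and gq = gok_pfs[OF g(1)]
  \<comment> \<open>The arrows defining composition are a compatible pair because \<open>F\<close>
    and \<open>G\<close> preserve composition; generic arrows are enough to see it.\<close>
  have "F \<star> (pf ?q \<bullet>\<^bsub>A\<^esub> pf ?p) = G \<star> (ps ?q \<bullet>\<^bsub>B\<^esub> ps ?p)"
    using gmp_cmp[OF F gq(1) gp(1)] gmp_cmp[OF G gq(2) gp(2)] gp(3) gq(3) by (simp add: pfs_simps)
  then have e: "pbl x z \<cdot> ?r = pbr x z \<cdot> ?s"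
    by (intro arr_ext[of _ "gen 0 ?Y \<bowtie> gen 1 ?X"])
      (use A B t r ob XY in \<open>simp_all add: pfst_def psnd_def gmp_def gcmp_def PB_VHom\<close>)
  have h: "?r \<in> Ar V" "?s \<in> Ar V" "Dom V ?r = ?Y \<otimes> ?X" "Dom V ?s = ?Y \<otimes> ?X" "Cod V ?r = Dom V (pbl x z)" "Cod V ?s = Dom V (pbr x z)"
    using A B t r ob by (simp_all add: PB_VHom)
  have c: "VComp PB x y z = pb_pair V (pbl x z) (pbr x z) (?Y \<otimes> ?X) ?r ?s" by (simp add: vpullback_def Let_def)
  note k = pb_pair[OF pbs r(1,2,5) h e]
  show "VComp PB x y z \<in> Ar V" "Dom V (VComp PB x y z) = VHom PB y z \<otimes> VHom PB x y" "Cod V (VComp PB x y z) = VHom PB x z"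
    "pb_fst V (pbl x z) (pbr x z) \<cdot> VComp PB x y z = ?r" "pb_snd V (pbl x z) (pbr x z) \<cdot> VComp PB x y z = ?s"
    using k unfolding c by (simp_all add: PB_VHom)
qed

lemma PB_VId:
  assumes o: "x \<in> VOb PB"
  shows "VId PB x \<in> Ar V" "Dom V (VId PB x) = \<I>" "Cod V (VId PB x) = VHom PB x x"
    "pb_fst V (pbl x x) (pbr x x) \<cdot> VId PB x = VId A (fst x)" "pb_snd V (pbl x x) (pbr x x) \<cdot> VId PB x = VId B (snd x)"
proof -
  note A = vfun_cat(1)[OF F] and B = vfun_cat(1)[OF G] and r = PB_arr[OF o o] and ob = o[unfolded PB_VOb]
  have "F \<star> gid A (fst x) = G \<star> gid B (snd x)" using gmp_id[OF F, of "fst x"] gmp_id[OF G, of "snd x"] ob by simp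
  then have e: "pbl x x \<cdot> VId A (fst x) = pbr x x \<cdot> VId B (snd x)"
    by (intro arr_ext[of _ un]) (use A B r ob in \<open>simp_all add: gid_def gmp_def\<close>)
  have h: "VId A (fst x) \<in> Ar V" "VId B (snd x) \<in> Ar V" "Dom V (VId A (fst x)) = \<I>" "Dom V (VId B (snd x)) = \<I>"
    "Cod V (VId A (fst x)) = Dom V (pbl x x)" "Cod V (VId B (snd x)) = Dom V (pbr x x)" using A B r ob by simp_all
  have c: "VId PB x = pb_pair V (pbl x x) (pbr x x) \<I> (VId A (fst x)) (VId B (snd x))" by (simp add: vpullback_def Let_def)
  note k = pb_pair[OF pbs r(1,2,5) h e]
  show "VId PB x \<in> Ar V" "Dom V (VId PB x) = \<I>" "Cod V (VId PB x) = VHom PB x x"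
    "pb_fst V (pbl x x) (pbr x x) \<cdot> VId PB x = VId A (fst x)" "pb_snd V (pbl x x) (pbr x x) \<cdot> VId PB x = VId B (snd x)"
    using k unfolding c by (simp_all add: PB_VHom)
qed

lemma pfs_cmp:
  assumes g: "gok PB q" "gok PB p" "sr q = tg p" "gc q \<inter> gc p = {}"
  shows "gok PB (q \<bullet>\<^bsub>PB\<^esub> p)" "pf (q \<bullet>\<^bsub>PB\<^esub> p) = pf q \<bullet>\<^bsub>A\<^esub> pf p" "ps (q \<bullet>\<^bsub>PB\<^esub> p) = ps q \<bullet>\<^bsub>B\<^esub> ps p"
proof -
  note dq = gok_D[OF g(1)] and dp = gok_D[OF g(2)]
  note A = vfun_cat(1)[OF F] and B = vfun_cat(1)[OF G]
  note k = PB_VComp[OF dp(1) dp(2) dq(2)] and t = PB_typ[OF dp(1) dp(2)] PB_typ[OF dp(2) dq(2)] PB_typ[OF dp(1) dq(2)]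
  note ob = dp(1)[unfolded PB_VOb] dp(2)[unfolded PB_VOb] dq(2)[unfolded PB_VOb]
  have ty: "okel (ge q \<bowtie> ge p)" "ty (ge q \<bowtie> ge p) = VHom PB (tg p) (tg q) \<otimes> VHom PB (sr p) (tg p)" using dq dp g(3,4) by simp_all
  show "gok PB (q \<bullet>\<^bsub>PB\<^esub> p)" using dq dp k ty g by (simp add: gcmp_def)
  have c: "pb_fst V (pbl (sr p) (tg q)) (pbr (sr p) (tg q)) \<triangleright> VComp PB (sr p) (tg p) (tg q) \<triangleright> (ge q \<bowtie> ge p)
    = (VComp A (fst (sr p)) (fst (tg p)) (fst (tg q)) \<cdot> (pb_fst V (pbl (tg p) (tg q)) (pbr (tg p) (tg q)) \<odot> pb_fst V (pbl (sr p) (tg p)) (pbr (sr p) (tg p)))) \<triangleright> (ge q \<bowtie> ge p)"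
    "pb_snd V (pbl (sr p) (tg q)) (pbr (sr p) (tg q)) \<triangleright> VComp PB (sr p) (tg p) (tg q) \<triangleright> (ge q \<bowtie> ge p)
    = (VComp B (snd (sr p)) (snd (tg p)) (snd (tg q)) \<cdot> (pb_snd V (pbl (tg p) (tg q)) (pbr (tg p) (tg q)) \<odot> pb_snd V (pbl (sr p) (tg p)) (pbr (sr p) (tg p)))) \<triangleright> (ge q \<bowtie> ge p)"
    by (rule app_collapse[OF k(4)], (use k t ty in \<open>simp_all add: PB_VHom\<close>)[5], rule app_collapse[OF k(5)], (use k t ty in \<open>simp_all add: PB_VHom\<close>)[5])
  show "pf (q \<bullet>\<^bsub>PB\<^esub> p) = pf q \<bullet>\<^bsub>A\<^esub> pf p"
    using c(1) A t dq dp ob g(3,4) by (simp add: pfst_def gcmp_def PB_VHom)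
  show "ps (q \<bullet>\<^bsub>PB\<^esub> p) = ps q \<bullet>\<^bsub>B\<^esub> ps p"
    using c(2) B t dq dp ob g(3,4) by (simp add: psnd_def gcmp_def PB_VHom)
qed

lemma pfs_id:
  assumes o: "x \<in> VOb PB"
  shows "gok PB (gid PB x)" "pf (gid PB x) = gid A (fst x)" "ps (gid PB x) = gid B (snd x)"
proof -
  note k = PB_VId[OF o] and t = PB_typ[OF o o]
  show "gok PB (gid PB x)" using k o by (simp add: gid_def)
  have c: "pb_fst V (pbl x x) (pbr x x) \<triangleright> VId PB x \<triangleright> un = VId A (fst x) \<triangleright> un"
    "pb_snd V (pbl x x) (pbr x x) \<triangleright> VId PB x \<triangleright> un = VId B (snd x) \<triangleright> un"
    by (rule app_collapse[OF k(4)], (use k t in \<open>simp_all add: PB_VHom\<close>)[5], rule app_collapse[OF k(5)], (use k t in \<open>simp_all add: PB_VHom\<close>)[5])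
  show "pf (gid PB x) = gid A (fst x)" "ps (gid PB x) = gid B (snd x)" using c by (simp_all add: pfst_def psnd_def gid_def)
qed

lemma PB_vcategory: "vcategory PB"
proof (rule vcategoryI)
  note A = vfun_cat(1)[OF F] and B = vfun_cat(1)[OF G]
  fix f g h
  assume *: "gok PB h" "gok PB g" "gok PB f" "sr h = tg g" "sr g = tg f" "gc h \<inter> gc g = {}" "gc h \<inter> gc f = {}" "gc g \<inter> gc f = {}"
  then have d: "gc (h \<bullet>\<^bsub>PB\<^esub> g) \<inter> gc f = {}" "gc h \<inter> gc (g \<bullet>\<^bsub>PB\<^esub> f) = {}" by (simp_all add: disj)
  note hg = pfs_cmp[OF *(1,2,4,6)] and gf = pfs_cmp[OF *(2,3,5,8)]
  have s: "sr (h \<bullet>\<^bsub>PB\<^esub> g) = tg f" "sr h = tg (g \<bullet>\<^bsub>PB\<^esub> f)" using * by simp_all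
  note l = pfs_cmp[OF hg(1) *(3) s(1) d(1)] and r = pfs_cmp[OF *(1) gf(1) s(2) d(2)]
  show "(h \<bullet>\<^bsub>PB\<^esub> g) \<bullet>\<^bsub>PB\<^esub> f = h \<bullet>\<^bsub>PB\<^esub> (g \<bullet>\<^bsub>PB\<^esub> f)"
    by (rule pfs_ext[OF l(1) r(1)])
      (use l r hg gf * A B gok_pfs(1,2)[OF *(1)] gok_pfs(1,2)[OF *(2)] gok_pfs(1,2)[OF *(3)] in \<open>simp_all add: gcmp_assoc pfs_simps Un_assoc\<close>)
next
  note A = vfun_cat(1)[OF F] and B = vfun_cat(1)[OF G]
  fix f assume f: "gok PB f"
  note i = pfs_id[OF gok_D(1)[OF f]] and j = pfs_id[OF gok_D(2)[OF f]]
  note l = pfs_cmp[OF j(1) f, simplified] and r = pfs_cmp[OF f i(1), simplified]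
  show "gid PB (tg f) \<bullet>\<^bsub>PB\<^esub> f = f"
    by (rule pfs_ext[OF l(1) f]) (use l j A B gok_pfs(1,2)[OF f] in \<open>simp_all add: pfs_simps\<close>)
  show "f \<bullet>\<^bsub>PB\<^esub> gid PB (sr f) = f"
    by (rule pfs_ext[OF r(1) f]) (use r i A B gok_pfs(1,2)[OF f] in \<open>simp_all add: pfs_simps\<close>)
qed (use PB_typ(1) PB_VId(1-3) PB_VComp(1-3) in \<open>simp_all add: in_hom_def PB_VHom\<close>)

end

lemma vfull_simps [simp]: "VOb (vfull C S) = VOb C \<inter> S" "VHom (vfull C S) = VHom C" "VComp (vfull C S) = VComp C" "VId (vfull C S) = VId C"
  by (simp_all add: vfull_def)

lemma vfull_gr: "gid (vfull C S) = gid C" "gcmp (vfull C S) = gcmp C" "gok (vfull C S) e \<longleftrightarrow> gok C e \<and> sr e \<in> S \<and> tg e \<in> S"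
proof -
  show "gid (vfull C S) = gid C" by (rule ext) (simp add: gid_def)
  show "gcmp (vfull C S) = gcmp C" by (intro ext) (simp add: gcmp_def)
  show "gok (vfull C S) e \<longleftrightarrow> gok C e \<and> sr e \<in> S \<and> tg e \<in> S" unfolding gok_def vfull_simps by blast
qed

lemma vfull_vcategory: "vcategory C \<Longrightarrow> vcategory (vfull C S)"
  unfolding vcategory_def by simp

lemma vfull_ginv: "ginv (vfull C S) f g \<longleftrightarrow> ginv C f g \<and> sr f \<in> S \<and> tg f \<in> S"
  unfolding ginv_def vfull_gr by metis

section \<open>Fully faithful and essentially surjective functors\<close>

lemma vid_vfunctor: assumes A: "vcategory A" shows "vfunctor A A (vid A)" "gok A e \<Longrightarrow> vid A \<star> e = e"
proof -
  show mp: "vid A \<star> e = e" if "gok A e" for e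
    using gok_D[OF that] gr_eta[of e] by (simp add: vid_def gmp_def)
  show "vfunctor A A (vid A)"
  proof (rule vfunctorI[OF A A vid_def])
    show "vid A \<star> gid A a = gid A (FOb (vid A) a)" if "a \<in> VOb A" for a
      using mp[OF gok_id[OF A that]] that by (simp add: vid_def)
    show "vid A \<star> (g \<bullet>\<^bsub>A\<^esub> f) = (vid A \<star> g) \<bullet>\<^bsub>A\<^esub> (vid A \<star> f)" if "gok A g" "gok A f" "sr g = tg f" "gc g \<inter> gc f = {}" for g f
      using mp[OF gok_cmp[OF A that]] mp[OF that(1)] mp[OF that(2)] by simp
  qed (use A in simp_all)
qed

lemma vid_FOb [simp]: "a \<in> VOb A \<Longrightarrow> FOb (vid A) a = a"
  by (simp add: vid_def)

text \<open>Full faithfulness on graded arrows of arbitrary context. The context of the preimage is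
  automatically that of \<open>y\<close>, as \<open>\<star>\<close> preserves contexts.\<close>

definition gff :: "('a, 'o, 'm, 'y) vcat_scheme \<Rightarrow> ('b, 'o, 'm, 'z) vcat_scheme \<Rightarrow> ('a, 'b, 'm) vfun \<Rightarrow> bool" where
  "gff A B F \<longleftrightarrow> (\<forall>a\<in>VOb A. \<forall>a'\<in>VOb A. \<forall>y. gok B y \<and> sr y = FOb F a \<and> tg y = FOb F a' \<longrightarrow>
     (\<exists>x. gok A x \<and> sr x = a \<and> tg x = a' \<and> F \<star> x = y)) \<and>
   (\<forall>x x'. gok A x \<and> gok A x' \<and> sr x = sr x' \<and> tg x = tg x' \<and> F \<star> x = F \<star> x' \<longrightarrow> x = x')"

lemma gffD:
  assumes "gff A B F"
  shows "\<lbrakk>a \<in> VOb A; a' \<in> VOb A; gok B y; sr y = FOb F a; tg y = FOb F a'\<rbrakk> \<Longrightarrow> \<exists>x. gok A x \<and> sr x = a \<and> tg x = a' \<and> F \<star> x = y"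
    "\<lbrakk>gok A x; gok A x'; sr x = sr x'; tg x = tg x'; F \<star> x = F \<star> x'\<rbrakk> \<Longrightarrow> x = x'"
  using assms unfolding gff_def by blast+

text \<open>Yoneda: a preimage of the generic element of the hom-object of \<open>B\<close> is an
  inverse of the action of \<open>F\<close> on that hom.\<close>

lemma gff_iso:
  assumes F: "vfunctor A B F" and ff: "gff A B F" and a: "a \<in> VOb A" "a' \<in> VOb A"
  shows "is_iso V (FHom F a a')"
proof -
  note A = vfun_cat(1)[OF F] and B = vfun_cat(2)[OF F] and t = vfun_typ(2-4)[OF F a] and o = vfun_typ(1)[OF F a(1)] vfun_typ(1)[OF F a(2)]
  let ?Y = "VHom B (FOb F a) (FOb F a')" and ?X = "VHom A a a'"
  have XY: "?Y \<in> Ob V" "?X \<in> Ob V" using A B a o by simp_all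
  have "gok B (FOb F a, FOb F a', gen 0 ?Y)" using o XY by simp
  then obtain x where x: "gok A x" "sr x = a" "tg x = a'" "F \<star> x = (FOb F a, FOb F a', gen 0 ?Y)"
    using gffD(1)[OF ff a] by (metis gr_simps(1,2))
  note d = gok_D[OF x(1)]
  have gx: "ct (ge x) = ct (gen 0 ?Y)" using arg_cong[OF x(4), of gc] by simp
  obtain h where h: "h \<in> Ar V" "Dom V h = ty (gen 0 ?Y)" "Cod V h = ty (ge x)" "h \<triangleright> gen 0 ?Y = ge x"
    by (rule el_arr[of "gen 0 ?Y" "ge x"]) (use XY d gx in simp_all)
  have h2: "Dom V h = ?Y" "Cod V h = ?X" using h XY d x by simp_all
  have 1: "FHom F a a' \<cdot> h = Idn V ?Y"
    by (rule arr_ext[of _ "gen 0 ?Y"]) (use h h2 x XY t in \<open>simp_all add: gmp_def\<close>)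
  have 2: "h \<cdot> FHom F a a' = Idn V ?X"
  proof (rule arr_ext[of _ "gen 0 ?X"])
    have "(a, a', h \<triangleright> FHom F a a' \<triangleright> gen 0 ?X) = (a, a', gen 0 ?X)"
    proof (rule gffD(2)[OF ff])
      have "FHom F a a' \<triangleright> h \<triangleright> FHom F a a' \<triangleright> gen 0 ?X = Idn V ?Y \<triangleright> FHom F a a' \<triangleright> gen 0 ?X"
        by (rule app_collapse[OF 1]) (use h(1) h2 t XY in simp_all)
      then show "F \<star> (a, a', h \<triangleright> FHom F a a' \<triangleright> gen 0 ?X) = F \<star> (a, a', gen 0 ?X)" using t XY by (simp add: gmp_tuple)
    qed (use a h(1) h2 t XY in simp_all)
    then show "(h \<cdot> FHom F a a') \<triangleright> gen 0 ?X = Idn V ?X \<triangleright> gen 0 ?X" using h(1) h2 t XY by simp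
  qed (use h(1) h2 t XY in simp_all)
  show ?thesis by (rule is_isoI[of _ h]) (use 1 2 h(1) h2 t in simp_all)
qed

lemma vnatural_isoI:
  assumes H: "vfunctor A B H" and K: "vfunctor A B K"
    and p: "\<And>a. a \<in> VOb A \<Longrightarrow> ginv B (\<alpha> a) (\<alpha>' a)" "\<And>a. a \<in> VOb A \<Longrightarrow> sr (\<alpha> a) = FOb H a" "\<And>a. a \<in> VOb A \<Longrightarrow> tg (\<alpha> a) = FOb K a"
    and n: "\<And>e. gok A e \<Longrightarrow> \<alpha> (tg e) \<bullet>\<^bsub>B\<^esub> (H \<star> e) = (K \<star> e) \<bullet>\<^bsub>B\<^esub> \<alpha> (sr e)"
  shows "vnatural_iso A B H K (\<lambda>a. snd (ge (\<alpha> a)))"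
proof -
  note B = vfun_cat(2)[OF H]
  have e: "(FOb H a, FOb K a, ({}, snd (ge (\<alpha> a)))) = \<alpha> a" if "a \<in> VOb A" for a
    using gr_empty_eta[OF ginvD(3)[OF p(1)[OF that]]] p(2,3)[OF that] by simp
  show ?thesis unfolding vnatural_iso_def vnatural_gr[OF H K]
  proof (intro conjI ballI allI impI)
    fix a assume a: "a \<in> VOb A"
    have "gok B (FOb H a, FOb K a, ({}, snd (ge (\<alpha> a))))" unfolding e[OF a] by (rule ginvD(1)[OF p(1)[OF a]])
    then show "\<guillemotleft>snd (ge (\<alpha> a)) : \<I> \<rightarrow> VHom B (FOb H a) (FOb K a)\<guillemotright>"
      unfolding gok_empty by simp
    show "uiso B (FOb H a) (FOb K a) (snd (ge (\<alpha> a)))" using ginv_uiso[OF B p(1)[OF a]] p(2,3)[OF a] by simp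
  next
    fix d assume d: "gok A d"
    show "(FOb H (tg d), FOb K (tg d), ({}, snd (ge (\<alpha> (tg d))))) \<bullet>\<^bsub>B\<^esub> (H \<star> d)
        = (K \<star> d) \<bullet>\<^bsub>B\<^esub> (FOb H (sr d), FOb K (sr d), ({}, snd (ge (\<alpha> (sr d)))))"
      unfolding e[OF gok_D(1)[OF d]] e[OF gok_D(2)[OF d]] using n[OF d] .
  qed
qed

text \<open>The standard inverse of a fully faithful and essentially surjective functor. The objects
  \<open>g\<close> and isomorphisms \<open>\<phi>\<close> are supplied by the caller, who needs to
  know later that the isomorphisms lie over identities.\<close>

lemma gff_eso_inverse:
  assumes F: "vfunctor A B F" and ff: "gff A B F"
    and g: "\<And>b. b \<in> VOb B \<Longrightarrow> g b \<in> VOb A" and p: "\<And>b. b \<in> VOb B \<Longrightarrow> ginv B (\<phi> b) (\<phi>' b)"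
      "\<And>b. b \<in> VOb B \<Longrightarrow> sr (\<phi> b) = FOb F (g b)" "\<And>b. b \<in> VOb B \<Longrightarrow> tg (\<phi> b) = b"
  obtains G \<eta> \<eta>' where "vfunctor B A G" "\<And>b. b \<in> VOb B \<Longrightarrow> FOb G b = g b"
    "\<And>y. gok B y \<Longrightarrow> F \<star> (G \<star> y) = \<phi>' (tg y) \<bullet>\<^bsub>B\<^esub> (y \<bullet>\<^bsub>B\<^esub> \<phi> (sr y))"
    "\<And>y. gok B y \<Longrightarrow> \<phi> (tg y) \<bullet>\<^bsub>B\<^esub> (F \<star> (G \<star> y)) = y \<bullet>\<^bsub>B\<^esub> \<phi> (sr y)"
    "\<And>a. a \<in> VOb A \<Longrightarrow> ginv A (\<eta> a) (\<eta>' a)" "\<And>a. a \<in> VOb A \<Longrightarrow> sr (\<eta> a) = a" "\<And>a. a \<in> VOb A \<Longrightarrow> tg (\<eta> a) = g (FOb F a)"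
    "\<And>a. a \<in> VOb A \<Longrightarrow> F \<star> \<eta> a = \<phi>' (FOb F a)" "\<And>a. a \<in> VOb A \<Longrightarrow> F \<star> \<eta>' a = \<phi> (FOb F a)"
    "\<And>x. gok A x \<Longrightarrow> \<eta> (tg x) \<bullet>\<^bsub>A\<^esub> x = (G \<star> (F \<star> x)) \<bullet>\<^bsub>A\<^esub> \<eta> (sr x)"
proof -
  note A = vfun_cat(1)[OF F] and B = vfun_cat(2)[OF F] and Fo = vfun_typ(1)[OF F]
  note vb = vid_vfunctor[OF B]
  \<comment> \<open>Conjugation by \<open>\<phi>\<close> moves the identity functor of
    \<open>B\<close> to objects in the image of \<open>F\<close>; inverting the action of
    \<open>F\<close> on homs then gives \<open>G\<close>.\<close>
  let ?R = "transport B B (vid B) \<phi>' \<phi>"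
  have pi: "\<And>b. b \<in> VOb B \<Longrightarrow> ginv B (\<phi>' b) (\<phi> b)" "\<And>b. b \<in> VOb B \<Longrightarrow> sr (\<phi>' b) = b" "\<And>b. b \<in> VOb B \<Longrightarrow> tg (\<phi>' b) = FOb F (g b)"
    using ginv_sym[OF p(1)] ginvD(5,6)[OF p(1)] p(2,3) by simp_all
  have pv: "\<And>b. b \<in> VOb B \<Longrightarrow> sr (\<phi>' b) = FOb (vid B) b" using pi(2) by simp
  have R: "vfunctor B B ?R" "\<And>b. b \<in> VOb B \<Longrightarrow> FOb ?R b = FOb F (g b)"
    "\<And>y. gok B y \<Longrightarrow> ?R \<star> y = \<phi>' (tg y) \<bullet>\<^bsub>B\<^esub> (y \<bullet>\<^bsub>B\<^esub> \<phi> (sr y))"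
  proof -
    show "vfunctor B B ?R" by (rule transport(1)[OF vb(1)]) (use pi(1) pv in simp_all)
    show "FOb ?R b = FOb F (g b)" if "b \<in> VOb B" for b
      using transport(2)[OF vb(1), of \<phi>' \<phi> b] pi pv that by simp
    show "?R \<star> y = \<phi>' (tg y) \<bullet>\<^bsub>B\<^esub> (y \<bullet>\<^bsub>B\<^esub> \<phi> (sr y))" if "gok B y" for y
      using transport(3)[OF vb(1), of \<phi>' \<phi> y] pi pv that vb(2)[OF that] by simp
  qed
  define G where "G = mk_vfun (VOb B) g (\<lambda>b b'. inv_arr V (FHom F (g b) (g b')) \<cdot> FHom ?R b b')"
  have Go: "FOb G b = g b" if "b \<in> VOb B" for b using that by (simp add: G_def)
  have Gok: "gok A (G \<star> y)" and FG: "F \<star> (G \<star> y) = ?R \<star> y" if y: "gok B y" for y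
  proof -
    note d = gok_D[OF y] and i = gff_iso[OF F ff g[OF gok_D(1)[OF y]] g[OF gok_D(2)[OF y]]]
    note t = vfun_typ(2-4)[OF F g[OF d(1)] g[OF d(2)]] vfun_typ(2-4)[OF R(1) d(1,2)]
    show "gok A (G \<star> y)" "F \<star> (G \<star> y) = ?R \<star> y"
      using d i t g R(2) by (simp_all add: G_def gmp_def)
  qed
  have ginj: "x = x'" if "gok A x" "gok A x'" "sr x = sr x'" "tg x = tg x'" "F \<star> x = F \<star> x'" for x x'
    using gffD(2)[OF ff that] .
  have G: "vfunctor B A G"
  proof (rule vfunctorI[OF B A G_def])
    fix b assume b: "b \<in> VOb B"
    show "g b \<in> VOb A" using g[OF b] .
    note i = gok_id[OF B b]
    show "G \<star> gid B b = gid A (FOb G b)"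
      by (rule ginj[OF Gok[OF i]]) (use FG[OF i] gmp_id[OF R(1) b] gmp_id[OF F g[OF b]] Go[OF b] R(2)[OF b] A g[OF b] in simp_all)
    fix b' assume b': "b' \<in> VOb B"
    show "inv_arr V (FHom F (g b) (g b')) \<cdot> FHom ?R b b' \<in> Ar V \<and> Dom V (inv_arr V (FHom F (g b) (g b')) \<cdot> FHom ?R b b') = VHom B b b' \<and>
      Cod V (inv_arr V (FHom F (g b) (g b')) \<cdot> FHom ?R b b') = VHom A (g b) (g b')"
      using gff_iso[OF F ff g[OF b] g[OF b']] vfun_typ(2-4)[OF F g[OF b] g[OF b']] vfun_typ(2-4)[OF R(1) b b'] R(2) b b' by simp
  next
    fix h f assume *: "gok B h" "gok B f" "sr h = tg f" "gc h \<inter> gc f = {}"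
    note hf = gok_cmp[OF B *] and k = Gok[OF *(1)] Gok[OF *(2)]
    have s: "sr (G \<star> h) = tg (G \<star> f)" "gc (G \<star> h) \<inter> gc (G \<star> f) = {}" using * by simp_all
    show "G \<star> (h \<bullet>\<^bsub>B\<^esub> f) = (G \<star> h) \<bullet>\<^bsub>A\<^esub> (G \<star> f)"
      by (rule ginj[OF Gok[OF hf] gok_cmp[OF A k s]])
        (use FG[OF hf] FG[OF *(1)] FG[OF *(2)] gmp_cmp[OF R(1) *] gmp_cmp[OF F k s] in simp_all)
  qed
  have nat: "\<phi> (tg y) \<bullet>\<^bsub>B\<^esub> (F \<star> (G \<star> y)) = y \<bullet>\<^bsub>B\<^esub> \<phi> (sr y)" if y: "gok B y" for y
    unfolding FG[OF y] R(3)[OF y]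
    by (rule ginv_cancel'[OF B p(1)[OF gok_D(2)[OF y]]]) (use B y ginvD[OF p(1)[OF gok_D(1)[OF y]]] p(3) in simp_all)
  \<comment> \<open>The unit is the preimage of \<open>\<phi>'\<close>, so its invertibility and
    naturality can be tested after applying \<open>F\<close>.\<close>
  have "\<exists>x. gok A x \<and> sr x = a \<and> tg x = g (FOb F a) \<and> F \<star> x = \<phi>' (FOb F a)" if a: "a \<in> VOb A" for a
    by (rule gffD(1)[OF ff a g[OF Fo[OF a]]]) (use ginvD[OF p(1)[OF Fo[OF a]]] pi(2,3)[OF Fo[OF a]] in simp_all)
  then have "\<exists>\<eta>. \<forall>a\<in>VOb A. gok A (\<eta> a) \<and> sr (\<eta> a) = a \<and> tg (\<eta> a) = g (FOb F a) \<and> F \<star> \<eta> a = \<phi>' (FOb F a)"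
    by (intro bchoice ballI) blast
  then obtain \<eta> where \<eta>: "\<And>a. a \<in> VOb A \<Longrightarrow> gok A (\<eta> a)" "\<And>a. a \<in> VOb A \<Longrightarrow> sr (\<eta> a) = a" "\<And>a. a \<in> VOb A \<Longrightarrow> tg (\<eta> a) = g (FOb F a)"
    "\<And>a. a \<in> VOb A \<Longrightarrow> F \<star> \<eta> a = \<phi>' (FOb F a)" by blast
  have "\<exists>x. gok A x \<and> sr x = g (FOb F a) \<and> tg x = a \<and> F \<star> x = \<phi> (FOb F a)" if a: "a \<in> VOb A" for a
    by (rule gffD(1)[OF ff g[OF Fo[OF a]] a]) (use ginvD[OF p(1)[OF Fo[OF a]]] p(2,3)[OF Fo[OF a]] in simp_all)
  then have "\<exists>\<eta>. \<forall>a\<in>VOb A. gok A (\<eta> a) \<and> sr (\<eta> a) = g (FOb F a) \<and> tg (\<eta> a) = a \<and> F \<star> \<eta> a = \<phi> (FOb F a)"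
    by (intro bchoice ballI) blast
  then obtain \<eta>' where \<eta>': "\<And>a. a \<in> VOb A \<Longrightarrow> gok A (\<eta>' a)" "\<And>a. a \<in> VOb A \<Longrightarrow> sr (\<eta>' a) = g (FOb F a)" "\<And>a. a \<in> VOb A \<Longrightarrow> tg (\<eta>' a) = a"
    "\<And>a. a \<in> VOb A \<Longrightarrow> F \<star> \<eta>' a = \<phi> (FOb F a)" by blast
  have gc0: "gc (\<eta> a) = {}" "gc (\<eta>' a) = {}" if a: "a \<in> VOb A" for a
    using arg_cong[OF \<eta>(4)[OF a], of gc] arg_cong[OF \<eta>'(4)[OF a], of gc] ginvD(3,4)[OF p(1)[OF Fo[OF a]]] by simp_all
  have inv: "ginv A (\<eta> a) (\<eta>' a)" if a: "a \<in> VOb A" for a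
  proof -
    note e = \<eta>[OF a] and e' = \<eta>'[OF a] and z = gc0[OF a] and q = ginvD[OF p(1)[OF Fo[OF a]]] and ga = g[OF Fo[OF a]]
    have s: "sr (\<eta>' a) = tg (\<eta> a)" "sr (\<eta> a) = tg (\<eta>' a)" "gc (\<eta>' a) \<inter> gc (\<eta> a) = {}" "gc (\<eta> a) \<inter> gc (\<eta>' a) = {}" using e e' z by simp_all
    have 1: "\<eta>' a \<bullet>\<^bsub>A\<^esub> \<eta> a = gid A a"
      by (rule ginj[OF gok_cmp[OF A e'(1) e(1) s(1,3)] gok_id[OF A a]])
        (use e e' gmp_cmp[OF F e'(1) e(1) s(1,3)] gmp_id[OF F a] q p(3)[OF Fo[OF a]] in simp_all)
    have 2: "\<eta> a \<bullet>\<^bsub>A\<^esub> \<eta>' a = gid A (g (FOb F a))"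
      by (rule ginj[OF gok_cmp[OF A e(1) e'(1) s(2,4)] gok_id[OF A ga]])
        (use e e' gmp_cmp[OF F e(1) e'(1) s(2,4)] gmp_id[OF F ga] q p(2)[OF Fo[OF a]] in simp_all)
    show ?thesis using e e' z 1 2 by (simp add: ginv_def)
  qed
  have enat: "\<eta> (tg x) \<bullet>\<^bsub>A\<^esub> x = (G \<star> (F \<star> x)) \<bullet>\<^bsub>A\<^esub> \<eta> (sr x)" if x: "gok A x" for x
  proof -
    have o: "sr x \<in> VOb A" "tg x \<in> VOb A" using x by simp_all
    note Fx = gok_mp[OF F x] note GF = Gok[OF Fx] note e = \<eta>[OF o(1)] and e2 = \<eta>[OF o(2)] and z = gc0[OF o(1)] gc0[OF o(2)]
    note q = ginvD[OF p(1)[OF Fo[OF o(1)]]] and q2 = ginvD[OF p(1)[OF Fo[OF o(2)]]]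
    have s: "sr (\<eta> (tg x)) = tg x" "gc (\<eta> (tg x)) \<inter> gc x = {}" "sr (G \<star> (F \<star> x)) = tg (\<eta> (sr x))" "gc (G \<star> (F \<star> x)) \<inter> gc (\<eta> (sr x)) = {}"
      using e e2 z Go Fo o by simp_all
    have "F \<star> ((G \<star> (F \<star> x)) \<bullet>\<^bsub>A\<^esub> \<eta> (sr x)) = (\<phi>' (FOb F (tg x)) \<bullet>\<^bsub>B\<^esub> ((F \<star> x) \<bullet>\<^bsub>B\<^esub> \<phi> (FOb F (sr x)))) \<bullet>\<^bsub>B\<^esub> \<phi>' (FOb F (sr x))"
      using gmp_cmp[OF F GF e(1) s(3,4)] FG[OF Fx] R(3)[OF Fx] e(4) by simp
    also have "\<dots> = \<phi>' (FOb F (tg x)) \<bullet>\<^bsub>B\<^esub> ((F \<star> x) \<bullet>\<^bsub>B\<^esub> (\<phi> (FOb F (sr x)) \<bullet>\<^bsub>B\<^esub> \<phi>' (FOb F (sr x))))"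
      using B Fx q(1-6) q2(1-6) p(2,3)[OF Fo[OF o(1)]] p(2,3)[OF Fo[OF o(2)]] by (simp add: gcmp_assoc)
    also have "\<dots> = \<phi>' (FOb F (tg x)) \<bullet>\<^bsub>B\<^esub> (F \<star> x)"
      unfolding q(8) using B Fx p(3)[OF Fo[OF o(1)]] by simp
    also have "\<dots> = F \<star> (\<eta> (tg x) \<bullet>\<^bsub>A\<^esub> x)" using gmp_cmp[OF F e2(1) x s(1,2)] e2(4) by simp
    finally show ?thesis
      by (intro ginj[OF gok_cmp[OF A e2(1) x s(1,2)] gok_cmp[OF A GF e(1) s(3,4)]]) (use e e2 Go Fo o in simp_all)
  qed
  show thesis
    by (rule that[of G \<eta> \<eta>']) (use G Go FG R(3) nat inv \<eta>(2-4) \<eta>'(4) enat in simp_all)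
qed

section \<open>Fibres of functors to the base category\<close>

text \<open>Arrows of a fibre are triples. This map and \<open>ue\<close> translate between them and
  graded arrows of empty context, where the calculus is available.\<close>

definition fe :: "'a \<times> 'a \<times> 'm \<Rightarrow> ('a, 'o, 'm) gr" where
  "fe X = (fst X, fst (snd X), ({}, snd (snd X)))"

definition ue :: "('a, 'o, 'm) gr \<Rightarrow> 'a \<times> 'a \<times> 'm" where
  "ue e = (sr e, tg e, snd (ge e))"

lemma ue_fe [simp]: "ue (fe X) = X"
  by (simp add: ue_def fe_def)

lemma fe_ue [simp]: "gc e = {} \<Longrightarrow> fe (ue e) = e"
  using gr_empty_eta[of e] by (simp add: ue_def fe_def)

lemma fe_simps [simp]: "sr (fe X) = fst X" "tg (fe X) = fst (snd X)" "gc (fe X) = {}"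
  by (simp_all add: fe_def ct_def)

lemma ue_simps [simp]: "fst (ue e) = sr e" "fst (snd (ue e)) = tg e"
  by (simp_all add: ue_def)

lemma fibre_simps [simp]: "Ob (fibre A C P c) = {a \<in> VOb A. FOb P a = c}"
  "Dom (fibre A C P c) X = fst X" "Cod (fibre A C P c) X = fst (snd X)"
  "Cmp (fibre A C P c) Y X = ue (fe Y \<bullet>\<^bsub>A\<^esub> fe X)"
  by (simp_all add: fibre_def case_prod_unfold ue_def fe_def gcmp_def ucomp_def app_def ten_def mrg_empty)

lemma fibre_Idn [simp]: "\<lbrakk>vcategory A; a \<in> VOb A\<rbrakk> \<Longrightarrow> Idn (fibre A C P c) a = ue (gid A a)"
  by (simp add: fibre_def ue_def gid_VId)

lemma fibre_Ar:
  assumes P: "vfunctor A C P"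
  shows "X \<in> Ar (fibre A C P c) \<longleftrightarrow> FOb P (fst X) = c \<and> FOb P (fst (snd X)) = c \<and> gok A (fe X) \<and> P \<star> fe X = gid C c"
proof -
  have "P \<star> fe X = gid C c \<longleftrightarrow> FHom P (fst X) (fst (snd X)) \<cdot> snd (snd X) = VId C c"
    if "fst X \<in> VOb A" "FOb P (fst X) = c" "FOb P (fst (snd X)) = c"
  proof -
    have c: "c \<in> VOb C" using vfun_typ(1)[OF P that(1)] that(2) by simp
    show ?thesis using that vfun_cat(2)[OF P] c by (simp add: fe_def gmp_tuple gid_VId app_def)
  qed
  then show ?thesis by (auto simp: fibre_def fe_def gok_empty case_prod_unfold simp del: gok_tuple)
qed

lemma fibre_category:
  assumes P: "vfunctor A C P"
  shows "category (fibre A C P c)"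
proof -
  note A = vfun_cat(1)[OF P] and C = vfun_cat(2)[OF P] and ar = fibre_Ar[OF P]
  have cmp: "gok A (fe Y \<bullet>\<^bsub>A\<^esub> fe X)" if "gok A (fe X)" "gok A (fe Y)" "fst Y = fst (snd X)" for X Y
    using that A by simp
  show ?thesis
  proof
    fix X assume X: "X \<in> Ar (fibre A C P c)"
    have o: "fst X \<in> VOb A" "fst (snd X) \<in> VOb A" using X gok_D(1,2)[of A "fe X"] unfolding ar by simp_all
    show "Dom (fibre A C P c) X \<in> Ob (fibre A C P c)" "Cod (fibre A C P c) X \<in> Ob (fibre A C P c)" using X o unfolding ar by simp_all
    show "Cmp (fibre A C P c) (Idn (fibre A C P c) (Cod (fibre A C P c) X)) X = X" "Cmp (fibre A C P c) X (Idn (fibre A C P c) (Dom (fibre A C P c) X)) = X"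
      using X o A unfolding ar by simp_all
  next
    fix a assume a: "a \<in> Ob (fibre A C P c)"
    show "Idn (fibre A C P c) a \<in> Ar (fibre A C P c)" "Dom (fibre A C P c) (Idn (fibre A C P c) a) = a" "Cod (fibre A C P c) (Idn (fibre A C P c) a) = a"
      using a A gmp_id[OF P, of a] by (simp_all add: ar)
  next
    fix X Y assume XY: "X \<in> Ar (fibre A C P c)" "Y \<in> Ar (fibre A C P c)" "Dom (fibre A C P c) Y = Cod (fibre A C P c) X"
    have c: "c \<in> VOb C" using XY(1) vfun_typ(1)[OF P, of "fst X"] gok_D(1)[of A "fe X"] unfolding ar by auto
    show "Cmp (fibre A C P c) Y X \<in> Ar (fibre A C P c)"
      using XY cmp[of X Y] gmp_cmp[OF P, of "fe Y" "fe X"] C c unfolding ar by simp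
    show "Dom (fibre A C P c) (Cmp (fibre A C P c) Y X) = Dom (fibre A C P c) X" "Cod (fibre A C P c) (Cmp (fibre A C P c) Y X) = Cod (fibre A C P c) Y"
      by simp_all
  next
    fix X Y Z assume XY: "X \<in> Ar (fibre A C P c)" "Y \<in> Ar (fibre A C P c)" "Z \<in> Ar (fibre A C P c)"
      "Dom (fibre A C P c) Y = Cod (fibre A C P c) X" "Dom (fibre A C P c) Z = Cod (fibre A C P c) Y"
    then show "Cmp (fibre A C P c) (Cmp (fibre A C P c) Z Y) X = Cmp (fibre A C P c) Z (Cmp (fibre A C P c) Y X)"
      using A gcmp_assoc[of A "fe Z" "fe Y" "fe X"] unfolding ar by simp
  qed
qed

lemma underlying_simps [simp]: "OOb (underlying_functor F) = FOb F" "OAr (underlying_functor F) X = ue (F \<star> fe X)"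
  by (simp_all add: underlying_functor_def case_prod_unfold ue_def gmp_def fe_def app_def)

lemma fibre_functor:
  assumes F: "vfunctor A B F" and P: "vfunctor A C P" and Q: "vfunctor B C Q"
    and o: "\<And>a. a \<in> VOb A \<Longrightarrow> FOb Q (FOb F a) = FOb P a" and h: "\<And>x. gok A x \<Longrightarrow> Q \<star> (F \<star> x) = P \<star> x"
  shows "is_functor (fibre A C P c) (fibre B C Q c) (underlying_functor F)"
proof -
  note arA = fibre_Ar[OF P] and arB = fibre_Ar[OF Q] and A = vfun_cat(1)[OF F] and B = vfun_cat(2)[OF F]
  have ob: "fst X \<in> VOb A" "fst (snd X) \<in> VOb A" if "gok A (fe X)" for X using gok_D(1,2)[OF that] by simp_all
  show ?thesis unfolding is_functor_def in_hom_def
  proof (intro conjI ballI impI)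
    show "category (fibre A C P c)" "category (fibre B C Q c)" by (rule fibre_category[OF P], rule fibre_category[OF Q])
    show "OOb (underlying_functor F) a \<in> Ob (fibre B C Q c)" if "a \<in> Ob (fibre A C P c)" for a
      using that o vfun_typ(1)[OF F] by simp
    show "OAr (underlying_functor F) (Idn (fibre A C P c) a) = Idn (fibre B C Q c) (OOb (underlying_functor F) a)" if "a \<in> Ob (fibre A C P c)" for a
      using that A B gmp_id[OF F, of a] vfun_typ(1)[OF F, of a] by simp
    fix X assume X: "X \<in> Ar (fibre A C P c)"
    then show "OAr (underlying_functor F) X \<in> Ar (fibre B C Q c)"
      using gok_mp[OF F, of "fe X"] h[of "fe X"] ob[of X] o[of "fst X"] o[of "fst (snd X)"] unfolding arA by (simp add: arB)
    show "Dom (fibre B C Q c) (OAr (underlying_functor F) X) = OOb (underlying_functor F) (Dom (fibre A C P c) X)"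
      "Cod (fibre B C Q c) (OAr (underlying_functor F) X) = OOb (underlying_functor F) (Cod (fibre A C P c) X)" by simp_all
    fix Y assume "Y \<in> Ar (fibre A C P c)" "Dom (fibre A C P c) Y = Cod (fibre A C P c) X"
    with X show "OAr (underlying_functor F) (Cmp (fibre A C P c) Y X) = Cmp (fibre B C Q c) (OAr (underlying_functor F) Y) (OAr (underlying_functor F) X)"
      using gmp_cmp[OF F, of "fe Y" "fe X"] unfolding arA by simp
  qed
qed

lemma fibre_iso:
  assumes P: "vfunctor A C P" and i: "ginv A e e'" and c: "FOb P (sr e) = c" "FOb P (tg e) = c" and id: "P \<star> e = gid C c" "P \<star> e' = gid C c"
  shows "ue e \<in> Ar (fibre A C P c)" "is_iso (fibre A C P c) (ue e)"
proof -
  note g = ginvD[OF i] and ar = fibre_Ar[OF P] and A = vfun_cat(1)[OF P]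
  have m: "ue e \<in> Ar (fibre A C P c)" "ue e' \<in> Ar (fibre A C P c)" using g c id by (simp_all add: ar)
  show "ue e \<in> Ar (fibre A C P c)" by (fact m(1))
  have "sr e \<in> VOb A" "tg e \<in> VOb A" using g(1) by simp_all
  then have "inverse_arrows (fibre A C P c) (ue e) (ue e')"
    unfolding inverse_arrows_def in_hom_def using m g A by simp
  then show "is_iso (fibre A C P c) (ue e)" unfolding is_iso_def by blast
qed

text \<open>Because the isomorphisms \<open>\<phi>\<close> lie over identities, the inverse
  \<open>G\<close> commutes strictly with the functors to \<open>C\<close>, and the unit lies over
  identities as well. The enriched equivalence and those of the fibres therefore come from the same
  data.\<close>

lemma equivalence_over:
  assumes F: "vfunctor A B F" and ff: "gff A B F" and P: "vfunctor A C P" and Q: "vfunctor B C Q"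
    and o: "\<And>a. a \<in> VOb A \<Longrightarrow> FOb Q (FOb F a) = FOb P a" and h: "\<And>x. gok A x \<Longrightarrow> Q \<star> (F \<star> x) = P \<star> x"
    and eso: "\<And>b. b \<in> VOb B \<Longrightarrow> \<exists>a \<phi> \<phi>'. a \<in> VOb A \<and> ginv B \<phi> \<phi>' \<and> sr \<phi> = FOb F a \<and> tg \<phi> = b \<and> Q \<star> \<phi> = gid C (FOb Q b)"
  shows "vequivalence A B F" "is_equivalence (fibre A C P c) (fibre B C Q c) (underlying_functor F)"
proof -
  note A = vfun_cat(1)[OF F] and B = vfun_cat(2)[OF F] and C = vfun_cat(2)[OF P]
  have "\<exists>t. fst t \<in> VOb A \<and> ginv B (fst (snd t)) (snd (snd t)) \<and> sr (fst (snd t)) = FOb F (fst t) \<and> tg (fst (snd t)) = b \<and> Q \<star> fst (snd t) = gid C (FOb Q b)"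
    if b: "b \<in> VOb B" for b
  proof -
    obtain a \<phi> \<phi>' where "a \<in> VOb A" "ginv B \<phi> \<phi>'" "sr \<phi> = FOb F a" "tg \<phi> = b" "Q \<star> \<phi> = gid C (FOb Q b)" using eso[OF b] by blast
    then show ?thesis by (intro exI[of _ "(a, \<phi>, \<phi>')"]) simp
  qed
  then have "\<exists>t. \<forall>b\<in>VOb B. fst (t b) \<in> VOb A \<and> ginv B (fst (snd (t b))) (snd (snd (t b))) \<and> sr (fst (snd (t b))) = FOb F (fst (t b)) \<and> tg (fst (snd (t b))) = b \<and> Q \<star> fst (snd (t b)) = gid C (FOb Q b)"
    by (intro bchoice ballI)
  then obtain t where t: "\<forall>b\<in>VOb B. fst (t b) \<in> VOb A \<and> ginv B (fst (snd (t b))) (snd (snd (t b))) \<and> sr (fst (snd (t b))) = FOb F (fst (t b)) \<and> tg (fst (snd (t b))) = b \<and> Q \<star> fst (snd (t b)) = gid C (FOb Q b)" ..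
  define g where "g b = fst (t b)" for b
  define \<phi> where "\<phi> b = fst (snd (t b))" for b
  define \<phi>' where "\<phi>' b = snd (snd (t b))" for b
  have g: "\<And>b. b \<in> VOb B \<Longrightarrow> g b \<in> VOb A" and p: "\<And>b. b \<in> VOb B \<Longrightarrow> ginv B (\<phi> b) (\<phi>' b)"
      "\<And>b. b \<in> VOb B \<Longrightarrow> sr (\<phi> b) = FOb F (g b)" "\<And>b. b \<in> VOb B \<Longrightarrow> tg (\<phi> b) = b" and Qp: "\<And>b. b \<in> VOb B \<Longrightarrow> Q \<star> \<phi> b = gid C (FOb Q b)"
    using t unfolding g_def \<phi>_def \<phi>'_def by blast+
  have Qo: "FOb Q (FOb F (g b)) = FOb Q b" if "b \<in> VOb B" for b
    using arg_cong[OF Qp[OF that], of sr] p(2)[OF that] by simp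
  have Qp': "Q \<star> \<phi>' b = gid C (FOb Q b)" if b: "b \<in> VOb B" for b
  proof -
    note i = ginvD[OF ginv_mp[OF Q p(1)[OF b]]]
    have "gid C (FOb Q b) \<bullet>\<^bsub>C\<^esub> (Q \<star> \<phi>' b) = gid C (FOb Q b)" using i(8) Qp[OF b] p(3)[OF b] by simp
    then show ?thesis using gid_left[OF C i(2), of "FOb Q b"] i(6) p(2)[OF b] Qo[OF b] by simp
  qed
  obtain G \<eta> \<eta>' where G: "vfunctor B A G" "\<And>b. b \<in> VOb B \<Longrightarrow> FOb G b = g b"
    and FG: "\<And>y. gok B y \<Longrightarrow> F \<star> (G \<star> y) = \<phi>' (tg y) \<bullet>\<^bsub>B\<^esub> (y \<bullet>\<^bsub>B\<^esub> \<phi> (sr y))"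
    and nat: "\<And>y. gok B y \<Longrightarrow> \<phi> (tg y) \<bullet>\<^bsub>B\<^esub> (F \<star> (G \<star> y)) = y \<bullet>\<^bsub>B\<^esub> \<phi> (sr y)"
    and e: "\<And>a. a \<in> VOb A \<Longrightarrow> ginv A (\<eta> a) (\<eta>' a)" "\<And>a. a \<in> VOb A \<Longrightarrow> sr (\<eta> a) = a" "\<And>a. a \<in> VOb A \<Longrightarrow> tg (\<eta> a) = g (FOb F a)"
    and Fe: "\<And>a. a \<in> VOb A \<Longrightarrow> F \<star> \<eta> a = \<phi>' (FOb F a)" "\<And>a. a \<in> VOb A \<Longrightarrow> F \<star> \<eta>' a = \<phi> (FOb F a)"
    and enat: "\<And>x. gok A x \<Longrightarrow> \<eta> (tg x) \<bullet>\<^bsub>A\<^esub> x = (G \<star> (F \<star> x)) \<bullet>\<^bsub>A\<^esub> \<eta> (sr x)"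
    using gff_eso_inverse[OF F ff g p] by blast
  note Fo = vfun_typ(1)[OF F] and Go = vfun_typ(1)[OF G(1)]
  have GF: "vfunctor A A (vcomp A G F)" and FG': "vfunctor B B (vcomp B F G)"
    by (rule vcomp_functor[OF F G(1)], rule vcomp_functor[OF G(1) F])
  have 1: "vnatural_iso A A (vid A) (vcomp A G F) (\<lambda>a. snd (ge (\<eta> a)))"
    by (rule vnatural_isoI[OF vid_vfunctor(1)[OF A] GF e(1)])
      (use e(2,3) G(2) Fo enat vid_vfunctor(2)[OF A] vcomp_mp[OF F G(1)] in simp_all)
  have 2: "vnatural_iso B B (vcomp B F G) (vid B) (\<lambda>b. snd (ge (\<phi> b)))"
    by (rule vnatural_isoI[OF FG' vid_vfunctor(1)[OF B] p(1)])
      (use p(2,3) G(2) nat vid_vfunctor(2)[OF B] vcomp_mp[OF G(1) F] in simp_all)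
  show "vequivalence A B F" unfolding vequivalence_def using F G(1) 1 2 by blast
  have Po: "FOb P (FOb G b) = FOb Q b" if "b \<in> VOb B" for b using o[OF g[OF that]] Qo[OF that] G(2)[OF that] by simp
  \<comment> \<open>\<open>Q\<close> turns both isomorphisms of the conjugation describing
    \<open>F \<star> (G \<star> y)\<close> into identities.\<close>
  have PG: "P \<star> (G \<star> y) = Q \<star> y" if y: "gok B y" for y
  proof -
    have ob: "sr y \<in> VOb B" "tg y \<in> VOb B" using y by simp_all
    note a = ginvD[OF p(1)[OF ob(1)]] and b = ginvD[OF p(1)[OF ob(2)]] and Qy = gok_mp[OF Q y]
    have yp: "gok B (y \<bullet>\<^bsub>B\<^esub> \<phi> (sr y))" using B y a p(3)[OF ob(1)] by simp
    have "P \<star> (G \<star> y) = Q \<star> (F \<star> (G \<star> y))" using h[OF gok_mp[OF G(1) y]] by simp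
    also have "\<dots> = (Q \<star> \<phi>' (tg y)) \<bullet>\<^bsub>C\<^esub> ((Q \<star> y) \<bullet>\<^bsub>C\<^esub> (Q \<star> \<phi> (sr y)))"
      unfolding FG[OF y] using yp y a b p(3) ob by (simp add: gmp_cmp[OF Q])
    also have "\<dots> = Q \<star> y" using Qp[OF ob(1)] Qp'[OF ob(2)] Qy C by simp
    finally show ?thesis .
  qed
  have UF: "is_functor (fibre A C P c) (fibre B C Q c) (underlying_functor F)" by (rule fibre_functor[OF F P Q o h])
  have UG: "is_functor (fibre B C Q c) (fibre A C P c) (underlying_functor G)" by (rule fibre_functor[OF G(1) Q P Po PG])
  note arA = fibre_Ar[OF P] and arB = fibre_Ar[OF Q]
  have 3: "natural_iso (fibre A C P c) (fibre A C P c) functor_id (functor_comp (underlying_functor G) (underlying_functor F)) (\<lambda>a. ue (\<eta> a))"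
    unfolding natural_iso_def in_hom_def
  proof (intro conjI ballI)
    fix a assume "a \<in> Ob (fibre A C P c)"
    then have a: "a \<in> VOb A" "FOb P a = c" by simp_all
    have id: "P \<star> \<eta> a = gid C c" "P \<star> \<eta>' a = gid C c"
      using h[OF ginvD(1)[OF e(1)[OF a(1)]]] h[OF ginvD(2)[OF e(1)[OF a(1)]]] Fe[OF a(1)] Qp[OF Fo[OF a(1)]] Qp'[OF Fo[OF a(1)]] o[OF a(1)] a(2) by simp_all
    have c: "FOb P (sr (\<eta> a)) = c" "FOb P (tg (\<eta> a)) = c"
      using e(2,3)[OF a(1)] a Po[OF Fo[OF a(1)]] G(2)[OF Fo[OF a(1)]] o[OF a(1)] by simp_all
    note i = fibre_iso[OF P e(1)[OF a(1)] c id]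
    show "ue (\<eta> a) \<in> Ar (fibre A C P c)" "is_iso (fibre A C P c) (ue (\<eta> a))" by (fact i)+
    show "Dom (fibre A C P c) (ue (\<eta> a)) = OOb functor_id a" using e(2)[OF a(1)] by (simp add: functor_id_def)
    show "Cod (fibre A C P c) (ue (\<eta> a)) = OOb (functor_comp (underlying_functor G) (underlying_functor F)) a"
      using e(3)[OF a(1)] G(2)[OF Fo[OF a(1)]] by (simp add: functor_comp_def)
  next
    fix X assume "X \<in> Ar (fibre A C P c)"
    then have x: "gok A (fe X)" unfolding arA by simp
    have ob: "fst X \<in> VOb A" "fst (snd X) \<in> VOb A" using gok_D(1,2)[OF x] by simp_all
    show "Cmp (fibre A C P c) (ue (\<eta> (Cod (fibre A C P c) X))) (OAr functor_id X)
      = Cmp (fibre A C P c) (OAr (functor_comp (underlying_functor G) (underlying_functor F)) X) (ue (\<eta> (Dom (fibre A C P c) X)))"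
      using enat[OF x] ginvD(3)[OF e(1)[OF ob(1)]] ginvD(3)[OF e(1)[OF ob(2)]] by (simp add: functor_id_def functor_comp_def)
  qed
  have 4: "natural_iso (fibre B C Q c) (fibre B C Q c) (functor_comp (underlying_functor F) (underlying_functor G)) functor_id (\<lambda>b. ue (\<phi> b))"
    unfolding natural_iso_def in_hom_def
  proof (intro conjI ballI)
    fix b assume "b \<in> Ob (fibre B C Q c)"
    then have b: "b \<in> VOb B" "FOb Q b = c" by simp_all
    have c: "FOb Q (sr (\<phi> b)) = c" "FOb Q (tg (\<phi> b)) = c" "Q \<star> \<phi> b = gid C c" "Q \<star> \<phi>' b = gid C c"
      using p(2,3)[OF b(1)] b Qo[OF b(1)] Qp[OF b(1)] Qp'[OF b(1)] by simp_all
    note i = fibre_iso[OF Q p(1)[OF b(1)] c]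
    show "ue (\<phi> b) \<in> Ar (fibre B C Q c)" "is_iso (fibre B C Q c) (ue (\<phi> b))" by (fact i)+
    show "Dom (fibre B C Q c) (ue (\<phi> b)) = OOb (functor_comp (underlying_functor F) (underlying_functor G)) b"
      "Cod (fibre B C Q c) (ue (\<phi> b)) = OOb functor_id b"
      using p(2,3)[OF b(1)] G(2)[OF b(1)] by (simp_all add: functor_id_def functor_comp_def)
  next
    fix X assume "X \<in> Ar (fibre B C Q c)"
    then have x: "gok B (fe X)" unfolding arB by simp
    have ob: "fst X \<in> VOb B" "fst (snd X) \<in> VOb B" using gok_D(1,2)[OF x] by simp_all
    show "Cmp (fibre B C Q c) (ue (\<phi> (Cod (fibre B C Q c) X))) (OAr (functor_comp (underlying_functor F) (underlying_functor G)) X)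
      = Cmp (fibre B C Q c) (OAr functor_id X) (ue (\<phi> (Dom (fibre B C Q c) X)))"
      using nat[OF x] ginvD(3)[OF p(1)[OF ob(1)]] ginvD(3)[OF p(1)[OF ob(2)]] by (simp add: functor_id_def functor_comp_def)
  qed
  show "is_equivalence (fibre A C P c) (fibre B C Q c) (underlying_functor F)"
    unfolding is_equivalence_def using UF UG 3 4 by blast
qed

section \<open>The comparison of bifold algebras with commuting pairs\<close>

context
  fixes J :: "'o set" and T U :: "('o, 'm) jtheory" and C :: "('c, 'o, 'm) cvcat"
  assumes S: "setting J T C" and S': "setting J U C" and pbs: "has_pullbacks V"
begin

abbreviation (input) "bifs \<equiv> bifold_algebras J T U C"
abbreviation (input) "faces D \<equiv> (left_face T U D, right_face T U D)"
abbreviation (input) "ppf \<equiv> pfst (alg_carrier J T C) (alg_carrier J U C)"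
abbreviation (input) "pps \<equiv> psnd (alg_carrier J T C) (alg_carrier J U C)"

lemma alg_carrier_vfunctor: "vfunctor (Alg J T C) C (alg_carrier J T C)" "vfunctor (Alg J U C) C (alg_carrier J U C)"
  using evaluation_vfunctor[OF settingD(5)[OF S], of \<I>] evaluation_vfunctor[OF settingD(5)[OF S'], of \<I>] settingD(6,8)[OF S] settingD(6)[OF S']
  by (simp_all add: Alg_def alg_carrier_def)

lemma alg_carrier_mp: "gok (Alg J T C) a \<Longrightarrow> alg_carrier J T C \<star> a = cmpt T C \<I> a"
  "gok (Alg J U C) b \<Longrightarrow> alg_carrier J U C \<star> b = cmpt U C \<I> b"
  by (simp_all add: Alg_def alg_carrier_def evaluation_mp)

lemma alg_carrier_FOb: "A \<in> algebras J T C \<Longrightarrow> FOb (alg_carrier J T C) A = FOb A \<I>"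
  "B \<in> algebras J U C \<Longrightarrow> FOb (alg_carrier J U C) B = FOb B \<I>"
  by (simp_all add: alg_carrier_def evaluation_def)

lemmas Pair_pfs = gok_pfs[OF pbs alg_carrier_vfunctor, folded Pair_def]
lemmas Pair_pfs_ext = pfs_ext[OF pbs alg_carrier_vfunctor, folded Pair_def]
lemmas Pair_pfs_ex = pfs_ex[OF pbs alg_carrier_vfunctor, folded Pair_def]
lemmas Pair_pfs_cmp = pfs_cmp[OF pbs alg_carrier_vfunctor, folded Pair_def]
lemmas Pair_pfs_id = pfs_id[OF pbs alg_carrier_vfunctor, folded Pair_def]
lemmas Pair_vcategory = PB_vcategory[OF pbs alg_carrier_vfunctor, folded Pair_def]
lemmas Pair_VOb = PB_VOb[OF pbs alg_carrier_vfunctor, folded Pair_def]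

lemma Pair_simps: "sr (ppf y) = fst (sr y)" "tg (ppf y) = fst (tg y)" "gc (ppf y) = gc y"
  "sr (pps y) = snd (sr y)" "tg (pps y) = snd (tg y)" "gc (pps y) = gc y"
  by (simp_all add: pfs_simps[OF pbs alg_carrier_vfunctor])

lemma faces_Pair: assumes D: "D \<in> bifs" shows "faces D \<in> VOb (Pair J T U C)" "faces D \<in> VOb (CPair J T U C)"
proof -
  note F = bifold_faces[OF S S' D]
  have 1: "FOb (left_face T U D) \<I> = FOb (right_face T U D) \<I>"
    using F(6,7) settingD(8)[OF S] by (simp add: left_face_def right_face_def)
  show "faces D \<in> VOb (Pair J T U C)" using F(3,4) 1 by (simp add: Pair_VOb alg_carrier_FOb)
  then show "faces D \<in> VOb (CPair J T U C)" using bifold_commutes[OF S S' D] by (simp add: CPair_def)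
qed

text \<open>Projections of pullbacks and of ends are jointly monic, so a graded arrow of pairs is
  determined by its components on the two faces.\<close>

lemma Pair_eqI:
  assumes y: "gok (Pair J T U C) y" "gok (Pair J T U C) y'" and e: "sr y = sr y'" "tg y = tg y'" "gc y = gc y'"
    and t: "\<And>t. t \<in> J \<Longrightarrow> cmpt T C t (ppf y) = cmpt T C t (ppf y')" and u: "\<And>u. u \<in> J \<Longrightarrow> cmpt U C u (pps y) = cmpt U C u (pps y')"
  shows "y = y'"
proof (rule Pair_pfs_ext[OF y e])
  note s = settingD[OF S] and s' = settingD[OF S']
  show "ppf y = ppf y'"
    by (rule cmpt_ext[OF s(5) Pair_pfs(1)[OF y(1), unfolded Alg_def] Pair_pfs(1)[OF y(2), unfolded Alg_def]])
      (use e t s in \<open>simp_all add: Pair_simps\<close>)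
  show "pps y = pps y'"
    by (rule cmpt_ext[OF s'(5) Pair_pfs(2)[OF y(1), unfolded Alg_def] Pair_pfs(2)[OF y(2), unfolded Alg_def]])
      (use e u s' in \<open>simp_all add: Pair_simps\<close>)
qed

text \<open>The agreement at \<open>\<I>\<close> that \<open>natfam_ex\<close> asks for is the
  condition of lying in the pullback over carriers.\<close>

lemma pair_natfam:
  assumes D: "D \<in> bifs" "D' \<in> bifs" and y: "gok (Pair J T U C) y" "sr y = faces D" "tg y = faces D'"
  obtains p where "natfam J T U C D D' (gc y) p" "\<And>t. t \<in> J \<Longrightarrow> p t \<I> = cmpt T C t (ppf y)" "\<And>u. u \<in> J \<Longrightarrow> p \<I> u = cmpt U C u (pps y)"
proof -
  note g = Pair_pfs[OF y(1)]
  have "cmpt T C \<I> (ppf y) = cmpt U C \<I> (pps y)" using g alg_carrier_mp by simp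
  from natfam_ex[OF S S' D g(1) _ _ g(2) _ _ _ this] y that show thesis by (simp add: Pair_simps) blast
qed

text \<open>Setting either argument to \<open>\<I>\<close> gives transformations of the faces; over
  the carrier both have the component \<open>p \<I> \<I>\<close>, so they form an arrow of the
  pullback.\<close>

lemma natfam_pair:
  assumes D: "D \<in> bifs" "D' \<in> bifs" and Q: "okctx Q" and p: "natfam J T U C D D' Q p"
  obtains y where "gok (Pair J T U C) y" "sr y = faces D" "tg y = faces D'" "gc y = Q"
    "\<And>t. t \<in> J \<Longrightarrow> cmpt T C t (ppf y) = p t \<I>" "\<And>u. u \<in> J \<Longrightarrow> cmpt U C u (pps y) = p \<I> u"
proof -
  note s = settingD[OF S] and s' = settingD[OF S'] and F = bifold_faces[OF S S' D(1)] and F' = bifold_faces[OF S S' D(2)]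
  have mT: "gok C (p t \<I>) \<and> sr (p t \<I>) = FOb (left_face T U D) t \<and> tg (p t \<I>) = FOb (left_face T U D') t \<and> gc (p t \<I>) = Q" if "t \<in> VOb T" for t
    using natfamD(1)[OF p, of t \<I>] that s F(6) F'(6) by (simp add: left_face_def)
  have nT: "(left_face T U D' \<star> e) \<bullet>\<^bsub>C\<^esub> p (sr e) \<I> = p (tg e) \<I> \<bullet>\<^bsub>C\<^esub> (left_face T U D \<star> e)" if "gok T e" "gc e \<inter> Q = {}" for e
    using natfamD(2)[OF p, of e \<I>] that s by (simp add: left_face_def)
  obtain a where a: "gok (fun_cat T C (algebras J T C)) a" "sr a = left_face T U D" "tg a = left_face T U D'" "gc a = Q"
    "\<And>t. t \<in> VOb T \<Longrightarrow> cmpt T C t a = p t \<I>"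
    by (rule cmpt_ex[OF s(5) F(3) F'(3) Q Q, where m = "\<lambda>t. p t \<I>"], rule mT, assumption, rule nT, assumption, assumption, rule that, simp_all)
  have mU: "gok C (p \<I> u) \<and> sr (p \<I> u) = FOb (right_face T U D) u \<and> tg (p \<I> u) = FOb (right_face T U D') u \<and> gc (p \<I> u) = Q" if "u \<in> VOb U" for u
    using natfamD(1)[OF p, of \<I> u] that s s' F(7) F'(7) by (simp add: right_face_def)
  have nU: "(right_face T U D' \<star> e) \<bullet>\<^bsub>C\<^esub> p \<I> (sr e) = p \<I> (tg e) \<bullet>\<^bsub>C\<^esub> (right_face T U D \<star> e)" if "gok U e" "gc e \<inter> Q = {}" for e
    using natfamD(3)[OF p, of e \<I>] that s by (simp add: right_face_def)
  obtain b where b: "gok (fun_cat U C (algebras J U C)) b" "sr b = right_face T U D" "tg b = right_face T U D'" "gc b = Q"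
    "\<And>u. u \<in> VOb U \<Longrightarrow> cmpt U C u b = p \<I> u"
    by (rule cmpt_ex[OF s'(5) F(4) F'(4) Q Q, where m = "p \<I>"], rule mU, assumption, rule nU, assumption, assumption, rule that, simp_all)
  have ga: "gok (Alg J T C) a" and gb: "gok (Alg J U C) b" using a(1) b(1) by (simp_all add: Alg_def)
  have ab: "gc a = gc b" using a(4) b(4) by simp
  have e: "alg_carrier J T C \<star> a = alg_carrier J U C \<star> b"
    using alg_carrier_mp(1)[OF ga] alg_carrier_mp(2)[OF gb] a(5)[of \<I>] b(5)[of \<I>] s s' by simp
  obtain y where "gok (Pair J T U C) y" "sr y = (sr a, sr b)" "tg y = (tg a, tg b)" "gc y = gc a" "ppf y = a" "pps y = b"
    by (rule Pair_pfs_ex[OF ga gb ab e])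
  then show thesis using that[of y] a b s s' by simp
qed

text \<open>A generic element of the hom-object \<open>E\<close> of pairs is a universal pair of
  transformations between faces. Its extension by \<open>pair_natfam\<close> is then a universal
  family, and this is the end.\<close>

lemma bifold_end:
  assumes D: "D \<in> bifs" "D' \<in> bifs"
  shows "has_end (vtensor T U) C D D'"
proof -
  note s = settingD[OF S] and s' = settingD[OF S'] and F = bifold_faces[OF S S' D(1)] and F' = bifold_faces[OF S S' D(2)]
  let ?P = "Pair J T U C"
  define E where "E = VHom ?P (faces D) (faces D')"
  note o = faces_Pair(1)[OF D(1)] faces_Pair(1)[OF D(2)]
  have E: "E \<in> Ob V" unfolding E_def using Pair_vcategory o by simp
  have g0: "gok ?P (faces D, faces D', gen 0 E)" using o E by (simp add: E_def)
  obtain p where p: "natfam J T U C D D' {(0, E)} p" "\<And>t. t \<in> J \<Longrightarrow> p t \<I> = cmpt T C t (ppf (faces D, faces D', gen 0 E))"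
    "\<And>u. u \<in> J \<Longrightarrow> p \<I> u = cmpt U C u (pps (faces D, faces D', gen 0 E))"
    by (rule pair_natfam[OF D g0]) simp_all
  \<comment> \<open>The family lives over the one-name context of the generic element, so each
    member comes from an arrow out of \<open>E\<close>.\<close>
  have "\<exists>m. m \<in> Ar V \<and> Dom V m = E \<and> Cod V m = VHom C (FOb D (t, u)) (FOb D' (t, u)) \<and> m \<triangleright> gen 0 E = ge (p t u)"
    if tu: "t \<in> J" "u \<in> J" for t u
  proof -
    note q = natfamD(1)[OF p(1) tu]
    obtain m where "m \<in> Ar V" "Dom V m = ty (gen 0 E)" "Cod V m = ty (ge (p t u))" "m \<triangleright> gen 0 E = ge (p t u)"
      by (rule el_arr[of "gen 0 E" "ge (p t u)"]) (use q E gok_D(3)[of C "p t u"] in simp_all)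
    then show ?thesis using q gok_D(4)[of C "p t u"] E by (intro exI[of _ m]) simp
  qed
  then obtain m where m: "\<And>t u. \<lbrakk>t \<in> J; u \<in> J\<rbrakk> \<Longrightarrow> m t u \<in> Ar V \<and> Dom V (m t u) = E \<and> Cod V (m t u) = VHom C (FOb D (t, u)) (FOb D' (t, u)) \<and>
      m t u \<triangleright> gen 0 E = ge (p t u)"
    by metis
  define \<mu> where "\<mu> x = m (fst x) (snd x)" for x
  have w: "wedge (vtensor T U) C D D' E \<mu>"
    by (rule natfam_wedge[OF S S' D, of "gen 0 E" _ p]) (use E p(1) m in \<open>simp_all add: \<mu>_def\<close>)
  note cT = nat_pr_typ[OF s(5) F(3) F'(3), unfolded s(6)] and cU = nat_pr_typ[OF s'(5) F(4) F'(4), unfolded s'(6)]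
  note pt = PB_typ[OF pbs alg_carrier_vfunctor, folded Pair_def, OF o, simplified]
  have Ee: "E = pb_ob V (FHom (alg_carrier J T C) (left_face T U D) (left_face T U D')) (FHom (alg_carrier J U C) (right_face T U D) (right_face T U D'))"
    unfolding E_def Pair_def by (simp add: PB_VHom[OF pbs alg_carrier_vfunctor])
  \<comment> \<open>On the faces the end projections are composites of a pullback projection and an
    end projection. Thus \<open>yT\<close> and \<open>yU\<close> describe every graded arrow of
    pairs and not only the generic one.\<close>
  have mT: "\<mu> (t, \<I>) = nat_pr T C (left_face T U D) (left_face T U D') t \<cdot>
      pb_fst V (FHom (alg_carrier J T C) (left_face T U D) (left_face T U D')) (FHom (alg_carrier J U C) (right_face T U D) (right_face T U D'))" if t: "t \<in> J" for t
    by (rule arr_ext[of _ "gen 0 E"])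
      (use m[OF t s(8)] p(2)[OF t] E t cT pt Ee in \<open>simp_all add: \<mu>_def cmpt_def pfst_def\<close>)
  have mU: "\<mu> (\<I>, u) = nat_pr U C (right_face T U D) (right_face T U D') u \<cdot>
      pb_snd V (FHom (alg_carrier J T C) (left_face T U D) (left_face T U D')) (FHom (alg_carrier J U C) (right_face T U D) (right_face T U D'))" if u: "u \<in> J" for u
    by (rule arr_ext[of _ "gen 0 E"])
      (use m[OF s(8) u] p(3)[OF u] E u cU pt Ee in \<open>simp_all add: \<mu>_def cmpt_def psnd_def\<close>)
  have yT: "cmpt T C t (ppf y) = (FOb D (t, \<I>), FOb D' (t, \<I>), \<mu> (t, \<I>) \<triangleright> ge y)"
    if "gok ?P y" "sr y = faces D" "tg y = faces D'" "t \<in> J" for t y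
    using that cT pt Ee gok_D(3,4)[of ?P y] F(6) F'(6) by (simp add: mT cmpt_def pfst_def E_def[symmetric]) (simp add: left_face_def)
  have yU: "cmpt U C u (pps y) = (FOb D (\<I>, u), FOb D' (\<I>, u), \<mu> (\<I>, u) \<triangleright> ge y)"
    if "gok ?P y" "sr y = faces D" "tg y = faces D'" "u \<in> J" for u y
    using that cU pt Ee gok_D(3,4)[of ?P y] F(7) F'(7) by (simp add: mU cmpt_def psnd_def E_def[symmetric]) (simp add: right_face_def)
  have "\<exists>!h. \<guillemotleft>h : X \<rightarrow> E\<guillemotright> \<and> (\<forall>a\<in>VOb (vtensor T U). \<mu> a \<cdot> h = \<nu> a)" if nu: "wedge (vtensor T U) C D D' X \<nu>" for X \<nu>
  proof -
    note wt = wedge_typ[OF nu]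
    let ?x = "gen 0 X"
    have X: "X \<in> Ob V" using wt(1) .
    have x: "okel ?x" "ty ?x = X" "isoel ?x" using X by simp_all
    note n = wedge_natfam[OF S S' D nu x(1,2)]
    obtain y where y: "gok ?P y" "sr y = faces D" "tg y = faces D'" "gc y = ct ?x"
      and yt: "\<And>t. t \<in> J \<Longrightarrow> cmpt T C t (ppf y) = (FOb D (t, \<I>), FOb D' (t, \<I>), \<nu> (t, \<I>) \<triangleright> ?x)"
      and yu: "\<And>u. u \<in> J \<Longrightarrow> cmpt U C u (pps y) = (FOb D (\<I>, u), FOb D' (\<I>, u), \<nu> (\<I>, u) \<triangleright> ?x)"
      by (rule natfam_pair[OF D okel_ct[OF x(1)] n]; rule that; simp)
    obtain h where h: "h \<in> Ar V" "Dom V h = ty ?x" "Cod V h = ty (ge y)" "h \<triangleright> ?x = ge y"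
      by (rule el_arr[OF x(3), of "ge y"]) (use y gok_D(3)[OF y(1)] in simp_all)
    have h2: "Dom V h = X" "Cod V h = E" using h x gok_D(4)[OF y(1)] y by (simp_all add: E_def)
    have hx: "okel (h \<triangleright> ?x)" "ty (h \<triangleright> ?x) = E" using h(1) h2 x by simp_all
    note n' = wedge_natfam[OF S S' D w hx]
    \<comment> \<open>Both sides belong to natural families, so by \<open>natfam_unique\<close> it
      suffices that they agree on the left face.\<close>
    have eq: "\<mu> (t, u) \<cdot> h = \<nu> (t, u)" if tu: "t \<in> J" "u \<in> J" for t u
    proof -
      have "(FOb D (t, u), FOb D' (t, u), \<mu> (t, u) \<triangleright> h \<triangleright> ?x) = (FOb D (t, u), FOb D' (t, u), \<nu> (t, u) \<triangleright> ?x)"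
        by (rule natfam_unique[OF S S' D okel_ct[OF x(1)] _ n _ tu]) (use n' yT[OF y(1-3)] yt y(4) h(4) in simp_all)
      then show ?thesis
        by (intro arr_ext[OF _ x(3)]) (use wt(2-4)[of "(t, u)"] m[OF tu] h h2 X s s' tu in \<open>simp_all add: \<mu>_def\<close>)
    qed
    show ?thesis
    proof (rule ex1I[of _ h])
      show "\<guillemotleft>h : X \<rightarrow> E\<guillemotright> \<and> (\<forall>a\<in>VOb (vtensor T U). \<mu> a \<cdot> h = \<nu> a)" using eq h(1) h2 s s' by (auto simp: in_hom_def)
      fix k assume k: "\<guillemotleft>k : X \<rightarrow> E\<guillemotright> \<and> (\<forall>a\<in>VOb (vtensor T U). \<mu> a \<cdot> k = \<nu> a)"
      then have kt: "k \<in> Ar V" "Dom V k = X" "Cod V k = E" and ke: "\<And>t u. \<lbrakk>t \<in> J; u \<in> J\<rbrakk> \<Longrightarrow> \<mu> (t, u) \<cdot> k = \<nu> (t, u)"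
        using s s' by (auto simp: in_hom_def)
      let ?z = "(faces D, faces D', k \<triangleright> ?x)"
      have z: "gok ?P ?z" using o kt x by (simp add: E_def)
      have kk: "\<mu> (t, u) \<triangleright> k \<triangleright> ?x = \<mu> (t, u) \<triangleright> ge y" if tu: "t \<in> J" "u \<in> J" for t u
      proof -
        have "\<mu> (t, u) \<triangleright> k \<triangleright> ?x = \<nu> (t, u) \<triangleright> ?x" by (rule app_collapse[OF ke[OF tu]]) (use kt x m[OF tu] in \<open>simp_all add: \<mu>_def\<close>)
        also have "\<dots> = \<mu> (t, u) \<triangleright> h \<triangleright> ?x" by (rule app_collapse[OF eq[OF tu], symmetric]) (use h(1) h2 x m[OF tu] in \<open>simp_all add: \<mu>_def\<close>)
        finally show ?thesis unfolding h(4) .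
      qed
      have "?z = y"
      proof (rule Pair_eqI[OF z y(1)])
        show "cmpt T C t (ppf ?z) = cmpt T C t (ppf y)" if "t \<in> J" for t
          using yT[OF z _ _ that] yT[OF y(1-3) that] kk[OF that s(8)] by simp
        show "cmpt U C u (pps ?z) = cmpt U C u (pps y)" if "u \<in> J" for u
          using yU[OF z _ _ that] yU[OF y(1-3) that] kk[OF s(8) that] by simp
      qed (use y in simp_all)
      then have "k \<triangleright> ?x = ge y" by (metis gr_simps(3))
      then show "k = h" by (intro arr_ext[OF _ x(3)]) (use kt h h2 x in simp_all)
    qed
  qed
  then show ?thesis using w unfolding has_end_def is_end_def by blast
qed

text \<open>From here on bifold algebras form an enriched category, and the tools for functor
  categories apply to them.\<close>

lemma bifold_fcat: "fcat (vtensor T U) C bifs"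
  using bifold_end vtensor_vcategory[OF settingD(7)[OF S] settingD(7)[OF S']] settingD(3)[OF S] bifoldD(1)
  unfolding fcat_def fun_cat_exists_def by blast

section \<open>The comparison functor\<close>

text \<open>The end chosen for \<open>D\<close> and \<open>D'\<close> need not be the pullback used
  for pairs. The action on homs is therefore selected by its effect on components at both faces, for
  all graded arrows at once.\<close>

definition biface :: "('o \<times> 'o, 'c, 'm) vfun \<Rightarrow> ('o \<times> 'o, 'c, 'm) vfun \<Rightarrow> 'm" where
  "biface D D' = (SOME h. h \<in> Ar V \<and> Dom V h = nat_ob (vtensor T U) C D D' \<and> Cod V h = VHom (Pair J T U C) (faces D) (faces D') \<and>
     (\<forall>z. gok (BiAlg J T U C) z \<and> sr z = D \<and> tg z = D' \<longrightarrow>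
       (\<forall>t\<in>J. cmpt T C t (ppf (faces D, faces D', h \<triangleright> ge z)) = cmpt (vtensor T U) C (t, \<I>) z) \<and>
       (\<forall>u\<in>J. cmpt U C u (pps (faces D, faces D', h \<triangleright> ge z)) = cmpt (vtensor T U) C (\<I>, u) z)))"

definition bifold_pair :: "(('o \<times> 'o, 'c, 'm) vfun, ('o, 'c, 'm) vfun \<times> ('o, 'c, 'm) vfun, 'm) vfun" where
  "bifold_pair = mk_vfun bifs (\<lambda>D. faces D) biface"

lemma BiAlg_natfam:
  assumes z: "gok (BiAlg J T U C) z"
  shows "natfam J T U C (sr z) (tg z) (gc z) (\<lambda>t u. cmpt (vtensor T U) C (t, u) z)"
proof -
  have d: "sr z \<in> bifs" "tg z \<in> bifs" "okel (ge z)" "ty (ge z) = nat_ob (vtensor T U) C (sr z) (tg z)"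
    using gok_D[OF z] by (simp_all add: BiAlg_def)
  have "wedge (vtensor T U) C (sr z) (tg z) (nat_ob (vtensor T U) C (sr z) (tg z)) (nat_pr (vtensor T U) C (sr z) (tg z))"
    using fcatD(4)[OF bifold_fcat d(1,2)] by (simp add: is_end_def)
  from wedge_natfam[OF S S' d(1,2) this d(3,4)] show ?thesis by (simp add: cmpt_def)
qed

text \<open>Together with \<open>BiAlg_natfam\<close> this identifies graded arrows of bifold
  algebras with natural families.\<close>

lemma natfam_BiAlg:
  assumes D: "D \<in> bifs" "D' \<in> bifs" and Q: "okctx Q" and p: "natfam J T U C D D' Q p"
  obtains z where "gok (BiAlg J T U C) z" "sr z = D" "tg z = D'" "gc z = Q" "\<And>t u. \<lbrakk>t \<in> J; u \<in> J\<rbrakk> \<Longrightarrow> cmpt (vtensor T U) C (t, u) z = p t u"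
proof -
  note s = settingD[OF S] and s' = settingD[OF S']
  define \<mu> where "\<mu> x = snd (ge (p (fst x) (snd x)))" for x
  note q = natfamD(1)[OF p]
  have id: "\<mu> (t, u) \<triangleright> idc Q = ge (p t u)" if "t \<in> J" "u \<in> J" for t u
    using q[OF that] gok_D(3)[of C "p t u"] el_idc[of "ge (p t u)"] by (simp add: \<mu>_def)
  have m: "\<mu> (t, u) \<in> Ar V \<and> Dom V (\<mu> (t, u)) = den Q \<and> Cod V (\<mu> (t, u)) = VHom C (FOb D (t, u)) (FOb D' (t, u)) \<and>
      \<mu> (t, u) \<triangleright> idc Q = ge (p t u)" if "t \<in> J" "u \<in> J" for t u
    using q[OF that] gok_D(3,4)[of C "p t u"] id[OF that] by (simp add: \<mu>_def)
  have w: "wedge (vtensor T U) C D D' (den Q) \<mu>"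
    by (rule natfam_wedge[OF S S' D, of "idc Q" _ p]) (use Q p m in simp_all)
  note l = nat_lift[OF bifold_fcat D w] and t = nat_pr_typ[OF bifold_fcat D]
  let ?h = "nat_lift (vtensor T U) C D D' (den Q) \<mu>"
  let ?z = "(D, D', ?h \<triangleright> idc Q)"
  have "cmpt (vtensor T U) C (t, u) ?z = p t u" if tu: "t \<in> J" "u \<in> J" for t u
  proof -
    have "nat_pr (vtensor T U) C D D' (t, u) \<triangleright> ?h \<triangleright> idc Q = \<mu> (t, u) \<triangleright> idc Q"
      by (rule app_collapse[OF l(4)]) (use l(1-3) t Q tu s s' in simp_all)
    then show ?thesis using id[OF tu] q[OF tu] by (intro gr_eqI) (simp_all add: cmpt_def)
  qed
  then show thesis by (intro that[of ?z]) (use l Q D in \<open>simp_all add: BiAlg_def\<close>)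
qed

lemma biface:
  assumes D: "D \<in> bifs" "D' \<in> bifs"
  shows "biface D D' \<in> Ar V" "Dom V (biface D D') = nat_ob (vtensor T U) C D D'" "Cod V (biface D D') = VHom (Pair J T U C) (faces D) (faces D')"
    "\<lbrakk>gok (BiAlg J T U C) z; sr z = D; tg z = D'; t \<in> J\<rbrakk> \<Longrightarrow> cmpt T C t (ppf (faces D, faces D', biface D D' \<triangleright> ge z)) = cmpt (vtensor T U) C (t, \<I>) z"
    "\<lbrakk>gok (BiAlg J T U C) z; sr z = D; tg z = D'; u \<in> J\<rbrakk> \<Longrightarrow> cmpt U C u (pps (faces D, faces D', biface D D' \<triangleright> ge z)) = cmpt (vtensor T U) C (\<I>, u) z"
proof -
  note s = settingD[OF S] and s' = settingD[OF S'] and F = bifold_faces[OF S S' D(1)] and F' = bifold_faces[OF S S' D(2)]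
  let ?P = "Pair J T U C" and ?E = "nat_ob (vtensor T U) C D D'"
  note o = faces_Pair(1)[OF D(1)] faces_Pair(1)[OF D(2)]
  note tp = nat_pr_typ[OF bifold_fcat D]
  let ?x = "gen 0 ?E"
  have x: "isoel ?x" "okel ?x" "ty ?x = ?E" using tp(1) by simp_all
  have g0: "gok (BiAlg J T U C) (D, D', ?x)" using D x by (simp add: BiAlg_def)
  note n = BiAlg_natfam[OF g0, simplified]
  obtain y where y: "gok ?P y" "sr y = faces D" "tg y = faces D'" "gc y = {(0, ?E)}"
    and yt: "\<And>t. t \<in> J \<Longrightarrow> cmpt T C t (ppf y) = cmpt (vtensor T U) C (t, \<I>) (D, D', ?x)"
    and yu: "\<And>u. u \<in> J \<Longrightarrow> cmpt U C u (pps y) = cmpt (vtensor T U) C (\<I>, u) (D, D', ?x)"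
    by (rule natfam_pair[OF D _ n]) (use okel_ct[OF x(2)] in simp, rule that, assumption+)
  \<comment> \<open>Applied to the generic element, restriction to the faces yields an arrow of
    \<open>V\<close>; \<open>mT\<close> and \<open>mU\<close> then extend its description from that
    element to every \<open>z\<close>.\<close>
  obtain h where h: "h \<in> Ar V" "Dom V h = ?E" "Cod V h = ty (ge y)" "h \<triangleright> ?x = ge y"
    by (rule el_arr[OF x(1), of "ge y"]) (use y gok_D(3)[OF y(1)] x in simp_all)
  have hc: "Cod V h = VHom ?P (faces D) (faces D')" using h(3) gok_D(4)[OF y(1)] y by simp
  have ye: "y = (faces D, faces D', h \<triangleright> ?x)" using y h(4) by (intro gr_eqI) simp_all
  note cT = nat_pr_typ[OF s(5) F(3) F'(3), unfolded s(6)] and cU = nat_pr_typ[OF s'(5) F(4) F'(4), unfolded s'(6)]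
  note pt = PB_typ[OF pbs alg_carrier_vfunctor, folded Pair_def, OF o, simplified]
  let ?f = "FHom (alg_carrier J T C) (left_face T U D) (left_face T U D')" and ?g = "FHom (alg_carrier J U C) (right_face T U D) (right_face T U D')"
  have Ee: "VHom ?P (faces D) (faces D') = pb_ob V ?f ?g" unfolding Pair_def by (simp add: PB_VHom[OF pbs alg_carrier_vfunctor])
  have mT: "nat_pr T C (left_face T U D) (left_face T U D') t \<cdot> pb_fst V ?f ?g \<cdot> h = nat_pr (vtensor T U) C D D' (t, \<I>)" if t: "t \<in> J" for t
    by (rule arr_ext[OF _ x(1)]) (use yt[OF t] h(1,2) hc x t cT pt Ee tp s s' in \<open>simp_all add: ye cmpt_def pfst_def\<close>)
  have mU: "nat_pr U C (right_face T U D) (right_face T U D') u \<cdot> pb_snd V ?f ?g \<cdot> h = nat_pr (vtensor T U) C D D' (\<I>, u)" if u: "u \<in> J" for u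
    by (rule arr_ext[OF _ x(1)]) (use yu[OF u] h(1,2) hc x u cU pt Ee tp s s' in \<open>simp_all add: ye cmpt_def psnd_def\<close>)
  have "h \<in> Ar V \<and> Dom V h = ?E \<and> Cod V h = VHom ?P (faces D) (faces D') \<and>
     (\<forall>z. gok (BiAlg J T U C) z \<and> sr z = D \<and> tg z = D' \<longrightarrow>
       (\<forall>t\<in>J. cmpt T C t (ppf (faces D, faces D', h \<triangleright> ge z)) = cmpt (vtensor T U) C (t, \<I>) z) \<and>
       (\<forall>u\<in>J. cmpt U C u (pps (faces D, faces D', h \<triangleright> ge z)) = cmpt (vtensor T U) C (\<I>, u) z))"
  proof (intro conjI allI impI ballI)
    fix z assume *: "gok (BiAlg J T U C) z \<and> sr z = D \<and> tg z = D'"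
    then have d: "okel (ge z)" "ty (ge z) = ?E" "sr z = D" "tg z = D'" using gok_D(3,4)[of "BiAlg J T U C" z] by (simp_all add: BiAlg_def)
    fix t assume t: "t \<in> J"
    have "nat_pr T C (left_face T U D) (left_face T U D') t \<triangleright> pb_fst V ?f ?g \<triangleright> h \<triangleright> ge z = nat_pr (vtensor T U) C D D' (t, \<I>) \<triangleright> ge z"
      unfolding mT[OF t, symmetric] using d h(1,2) hc cT t pt Ee by simp
    then show "cmpt T C t (ppf (faces D, faces D', h \<triangleright> ge z)) = cmpt (vtensor T U) C (t, \<I>) z"
      using d F(6) F'(6) t by (simp add: cmpt_def pfst_def) (simp add: left_face_def)
  next
    fix z assume *: "gok (BiAlg J T U C) z \<and> sr z = D \<and> tg z = D'"
    then have d: "okel (ge z)" "ty (ge z) = ?E" "sr z = D" "tg z = D'" using gok_D(3,4)[of "BiAlg J T U C" z] by (simp_all add: BiAlg_def)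
    fix u assume u: "u \<in> J"
    have "nat_pr U C (right_face T U D) (right_face T U D') u \<triangleright> pb_snd V ?f ?g \<triangleright> h \<triangleright> ge z = nat_pr (vtensor T U) C D D' (\<I>, u) \<triangleright> ge z"
      unfolding mU[OF u, symmetric] using d h(1,2) hc cU u pt Ee by simp
    then show "cmpt U C u (pps (faces D, faces D', h \<triangleright> ge z)) = cmpt (vtensor T U) C (\<I>, u) z"
      using d F(7) F'(7) u by (simp add: cmpt_def psnd_def) (simp add: right_face_def)
  qed (use h(1,2) hc in simp_all)
  from someI[of "\<lambda>h. h \<in> Ar V \<and> Dom V h = ?E \<and> Cod V h = VHom ?P (faces D) (faces D') \<and>
     (\<forall>z. gok (BiAlg J T U C) z \<and> sr z = D \<and> tg z = D' \<longrightarrow>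
       (\<forall>t\<in>J. cmpt T C t (ppf (faces D, faces D', h \<triangleright> ge z)) = cmpt (vtensor T U) C (t, \<I>) z) \<and>
       (\<forall>u\<in>J. cmpt U C u (pps (faces D, faces D', h \<triangleright> ge z)) = cmpt (vtensor T U) C (\<I>, u) z))", OF this, folded biface_def]
  show "biface D D' \<in> Ar V" "Dom V (biface D D') = nat_ob (vtensor T U) C D D'" "Cod V (biface D D') = VHom (Pair J T U C) (faces D) (faces D')"
    "\<lbrakk>gok (BiAlg J T U C) z; sr z = D; tg z = D'; t \<in> J\<rbrakk> \<Longrightarrow> cmpt T C t (ppf (faces D, faces D', biface D D' \<triangleright> ge z)) = cmpt (vtensor T U) C (t, \<I>) z"
    "\<lbrakk>gok (BiAlg J T U C) z; sr z = D; tg z = D'; u \<in> J\<rbrakk> \<Longrightarrow> cmpt U C u (pps (faces D, faces D', biface D D' \<triangleright> ge z)) = cmpt (vtensor T U) C (\<I>, u) z"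
    by blast+
qed

lemma bifold_pair_mp:
  assumes z: "gok (BiAlg J T U C) z"
  shows "gok (CPair J T U C) (bifold_pair \<star> z)" "gok (Pair J T U C) (bifold_pair \<star> z)"
    "sr (bifold_pair \<star> z) = faces (sr z)" "tg (bifold_pair \<star> z) = faces (tg z)" "gc (bifold_pair \<star> z) = gc z"
    "t \<in> J \<Longrightarrow> cmpt T C t (ppf (bifold_pair \<star> z)) = cmpt (vtensor T U) C (t, \<I>) z"
    "u \<in> J \<Longrightarrow> cmpt U C u (pps (bifold_pair \<star> z)) = cmpt (vtensor T U) C (\<I>, u) z"
proof -
  have d: "sr z \<in> bifs" "tg z \<in> bifs" "okel (ge z)" "ty (ge z) = nat_ob (vtensor T U) C (sr z) (tg z)"
    using gok_D[OF z] by (simp_all add: BiAlg_def)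
  note b = biface[OF d(1,2)]
  have e: "bifold_pair \<star> z = (faces (sr z), faces (tg z), biface (sr z) (tg z) \<triangleright> ge z)"
    using d by (simp add: bifold_pair_def gmp_def)
  show p: "gok (Pair J T U C) (bifold_pair \<star> z)" using b(1-3) d faces_Pair(1)[OF d(1)] faces_Pair(1)[OF d(2)] by (simp add: e)
  show "gok (CPair J T U C) (bifold_pair \<star> z)"
    using p faces_Pair(2)[OF d(1)] faces_Pair(2)[OF d(2)] by (simp add: CPair_def vfull_gr e del: gok_tuple)
  show "sr (bifold_pair \<star> z) = faces (sr z)" "tg (bifold_pair \<star> z) = faces (tg z)" "gc (bifold_pair \<star> z) = gc z"
    using e d by simp_all
  show "t \<in> J \<Longrightarrow> cmpt T C t (ppf (bifold_pair \<star> z)) = cmpt (vtensor T U) C (t, \<I>) z"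
    "u \<in> J \<Longrightarrow> cmpt U C u (pps (bifold_pair \<star> z)) = cmpt (vtensor T U) C (\<I>, u) z"
    using b(4,5)[OF z] unfolding e by simp_all
qed

lemma BiAlg_vcategory: "vcategory (BiAlg J T U C)" "vcategory (CPair J T U C)"
  using fun_cat_vcategory[OF bifold_fcat] vfull_vcategory[OF Pair_vcategory] by (simp_all add: BiAlg_def CPair_def)

lemma bifold_pair_vfunctor: "vfunctor (BiAlg J T U C) (CPair J T U C) bifold_pair"
proof (rule vfunctorI[OF BiAlg_vcategory])
  note s = settingD[OF S] and s' = settingD[OF S'] and I = settingD(8)[OF S]
  note mp = bifold_pair_mp
  have K: "gid (CPair J T U C) = gid (Pair J T U C)" "gcmp (CPair J T U C) = gcmp (Pair J T U C)" by (simp_all add: CPair_def vfull_gr)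
  have BO: "VOb (BiAlg J T U C) = bifs" by (simp add: BiAlg_def)
  show "bifold_pair = mk_vfun (VOb (BiAlg J T U C)) (\<lambda>D. faces D) biface" unfolding BO bifold_pair_def ..
  fix D assume "D \<in> VOb (BiAlg J T U C)"
  then have D: "D \<in> bifs" unfolding BO .
  note F = bifold_faces[OF S S' D]
  show "faces D \<in> VOb (CPair J T U C)" using faces_Pair(2)[OF D] .
  have g: "gok (BiAlg J T U C) (gid (BiAlg J T U C) D)" using cmpt_id(1)[OF bifold_fcat D] by (simp add: BiAlg_def)
  note i = Pair_pfs_id[OF faces_Pair(1)[OF D], simplified]
  note ci = cmpt_id(2)[OF bifold_fcat D, folded BiAlg_def]
  have bo: "FOb bifold_pair D = faces D" using D by (simp add: bifold_pair_def)
  show "bifold_pair \<star> gid (BiAlg J T U C) D = gid (CPair J T U C) (FOb bifold_pair D)" unfolding K bo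
  proof (rule Pair_eqI[OF mp(2)[OF g] i(1)])
    show "cmpt T C t (ppf (bifold_pair \<star> gid (BiAlg J T U C) D)) = cmpt T C t (ppf (gid (Pair J T U C) (faces D)))" if t: "t \<in> J" for t
      using mp(6)[OF g t] ci[of "(t, \<I>)"] cmpt_id(2)[OF s(5) F(3), of t] t s s' F(6) i(2) by (simp add: Alg_def) (simp add: left_face_def)
    show "cmpt U C t (pps (bifold_pair \<star> gid (BiAlg J T U C) D)) = cmpt U C t (pps (gid (Pair J T U C) (faces D)))" if t: "t \<in> J" for t
      using mp(7)[OF g t] ci[of "(\<I>, t)"] cmpt_id(2)[OF s'(5) F(4), of t] t s s' F(7) i(3) by (simp add: Alg_def) (simp add: right_face_def)
  qed (use mp(3-5)[OF g] in simp_all)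
next
  note K = BiAlg_def CPair_def
  fix D D' assume "D \<in> VOb (BiAlg J T U C)" "D' \<in> VOb (BiAlg J T U C)"
  then show "biface D D' \<in> Ar V \<and> Dom V (biface D D') = VHom (BiAlg J T U C) D D' \<and> Cod V (biface D D') = VHom (CPair J T U C) (faces D) (faces D')"
    using biface(1-3)[of D D'] by (simp add: K)
next
  note s = settingD[OF S] and s' = settingD[OF S']
  note mp = bifold_pair_mp
  have K: "gcmp (CPair J T U C) = gcmp (Pair J T U C)" by (simp_all add: CPair_def vfull_gr)
  fix g f assume *: "gok (BiAlg J T U C) g" "gok (BiAlg J T U C) f" "sr g = tg f" "gc g \<inter> gc f = {}"
  note c = cmpt_cmp[OF bifold_fcat, folded BiAlg_def, OF *]
  have t: "sr (bifold_pair \<star> g) = tg (bifold_pair \<star> f)" "gc (bifold_pair \<star> g) \<inter> gc (bifold_pair \<star> f) = {}"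
    using mp(3,5)[OF *(1)] mp(4,5)[OF *(2)] *(3,4) by simp_all
  note pc = Pair_pfs_cmp[OF mp(2)[OF *(1)] mp(2)[OF *(2)] t]
  have tp: "sr (ppf (bifold_pair \<star> g)) = tg (ppf (bifold_pair \<star> f))" "gc (ppf (bifold_pair \<star> g)) \<inter> gc (ppf (bifold_pair \<star> f)) = {}"
    "sr (pps (bifold_pair \<star> g)) = tg (pps (bifold_pair \<star> f))" "gc (pps (bifold_pair \<star> g)) \<inter> gc (pps (bifold_pair \<star> f)) = {}"
    using t by (simp_all add: Pair_simps)
  note gp = Pair_pfs[OF mp(2)[OF *(1)], unfolded Alg_def] Pair_pfs[OF mp(2)[OF *(2)], unfolded Alg_def]
  note cT = cmpt_cmp(2)[OF s(5) gp(1,4) tp(1,2), folded Alg_def] and cU = cmpt_cmp(2)[OF s'(5) gp(2,5) tp(3,4), folded Alg_def]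
  show "bifold_pair \<star> (g \<bullet>\<^bsub>BiAlg J T U C\<^esub> f) = (bifold_pair \<star> g) \<bullet>\<^bsub>CPair J T U C\<^esub> (bifold_pair \<star> f)" unfolding K
  proof (rule Pair_eqI[OF mp(2)[OF c(1)] pc(1)])
    show "cmpt T C t (ppf (bifold_pair \<star> (g \<bullet>\<^bsub>BiAlg J T U C\<^esub> f))) = cmpt T C t (ppf ((bifold_pair \<star> g) \<bullet>\<^bsub>Pair J T U C\<^esub> (bifold_pair \<star> f)))" if t: "t \<in> J" for t
      using mp(6)[OF c(1) t] mp(6)[OF *(1) t] mp(6)[OF *(2) t] c(2)[of "(t, \<I>)"] cT[of t] t s s' unfolding pc(2) by simp
    show "cmpt U C t (pps (bifold_pair \<star> (g \<bullet>\<^bsub>BiAlg J T U C\<^esub> f))) = cmpt U C t (pps ((bifold_pair \<star> g) \<bullet>\<^bsub>Pair J T U C\<^esub> (bifold_pair \<star> f)))" if t: "t \<in> J" for t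
      using mp(7)[OF c(1) t] mp(7)[OF *(1) t] mp(7)[OF *(2) t] c(2)[of "(\<I>, t)"] cU[of t] t s s' unfolding pc(3) by simp
  qed (use mp(3-5)[OF c(1)] mp(3-5)[OF *(1)] mp(3-5)[OF *(2)] in simp_all)
qed

text \<open>Fullness is the extension of a pair of face transformations to a natural family.
  Faithfulness is \<open>natfam_unique\<close>, applied to the components on the left face.\<close>

lemma bifold_pair_gff: "gff (BiAlg J T U C) (CPair J T U C) bifold_pair"
  unfolding gff_def
proof (intro conjI ballI allI impI)
  note mp = bifold_pair_mp
  note K = vfull_gr(3)[of "Pair J T U C", folded CPair_def]
  fix D D' y assume "D \<in> VOb (BiAlg J T U C)" "D' \<in> VOb (BiAlg J T U C)"
  then have D: "D \<in> bifs" "D' \<in> bifs" by (simp_all add: BiAlg_def)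
  assume *: "gok (CPair J T U C) y \<and> sr y = FOb bifold_pair D \<and> tg y = FOb bifold_pair D'"
  have y: "gok (Pair J T U C) y" "sr y = faces D" "tg y = faces D'" using * D by (simp_all add: CPair_def vfull_gr bifold_pair_def)
  obtain p where p: "natfam J T U C D D' (gc y) p" "\<And>t. t \<in> J \<Longrightarrow> p t \<I> = cmpt T C t (ppf y)" "\<And>u. u \<in> J \<Longrightarrow> p \<I> u = cmpt U C u (pps y)"
    by (rule pair_natfam[OF D y], rule that, assumption, simp_all)
  obtain z where z: "gok (BiAlg J T U C) z" "sr z = D" "tg z = D'" "gc z = gc y" "\<And>t u. \<lbrakk>t \<in> J; u \<in> J\<rbrakk> \<Longrightarrow> cmpt (vtensor T U) C (t, u) z = p t u"
    by (rule natfam_BiAlg[OF D gok_D(5)[OF y(1)] p(1)], rule that, simp_all)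
  have "bifold_pair \<star> z = y"
    by (rule Pair_eqI[OF mp(2)[OF z(1)] y(1)]) (use mp(3-7)[OF z(1)] z y p settingD(8)[OF S] in simp_all)
  then show "\<exists>x. gok (BiAlg J T U C) x \<and> sr x = D \<and> tg x = D' \<and> bifold_pair \<star> x = y" using z(1-3) by blast
next
  note mp = bifold_pair_mp and s = settingD[OF S] and s' = settingD[OF S']
  fix x x' assume *: "gok (BiAlg J T U C) x \<and> gok (BiAlg J T U C) x' \<and> sr x = sr x' \<and> tg x = tg x' \<and> bifold_pair \<star> x = bifold_pair \<star> x'"
  then have x: "gok (BiAlg J T U C) x" "gok (BiAlg J T U C) x'" and e: "sr x = sr x'" "tg x = tg x'" "bifold_pair \<star> x = bifold_pair \<star> x'" by blast+
  have g: "gc x = gc x'" using mp(5)[OF x(1)] mp(5)[OF x(2)] e(3) by simp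
  have D: "sr x \<in> bifs" "tg x \<in> bifs" using gok_D(1,2)[OF x(1)] by (simp_all add: BiAlg_def)
  show "x = x'"
  proof (rule cmpt_ext[OF bifold_fcat x[unfolded BiAlg_def] e(1,2) g])
    fix a assume "a \<in> VOb (vtensor T U)"
    then obtain t u where a: "a = (t, u)" "t \<in> J" "u \<in> J" using s s' by auto
    show "cmpt (vtensor T U) C a x = cmpt (vtensor T U) C a x'" unfolding a(1)
    proof (rule natfam_unique[OF S S' D gok_D(5)[OF x(1)] BiAlg_natfam[OF x(1)] _ _ a(2,3)])
      show "natfam J T U C (sr x) (tg x) (gc x) (\<lambda>t u. cmpt (vtensor T U) C (t, u) x')" using BiAlg_natfam[OF x(2)] e g by simp
      show "cmpt (vtensor T U) C (t, \<I>) x = cmpt (vtensor T U) C (t, \<I>) x'" if "t \<in> J" for t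
        using mp(6)[OF x(1) that] mp(6)[OF x(2) that] e(3) by simp
    qed
  qed
qed

text \<open>The carrier is read off from the first member of the pair; over the pullback the second
  member has the same image in \<open>C\<close>.\<close>

lemma cpair_carrier:
  "vfunctor (CPair J T U C) C (cpair_carrier J T U C)"
  "gok (CPair J T U C) y \<Longrightarrow> cpair_carrier J T U C \<star> y = cmpt T C \<I> (ppf y)"
proof -
  note s = settingD[OF S] and s' = settingD[OF S']
  let ?P = "Pair J T U C" and ?K = "CPair J T U C"
  let ?H = "\<lambda>x x'. FHom (alg_carrier J T C) (fst x) (fst x') \<cdot> pb_fst V (FHom (alg_carrier J T C) (fst x) (fst x')) (FHom (alg_carrier J U C) (snd x) (snd x'))"
  have c: "cpair_carrier J T U C = mk_vfun (VOb ?K) (\<lambda>x. FOb (fst x) \<I>) ?H"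
    by (simp add: cpair_carrier_def mk_vfun_def case_prod_unfold)
  have KP: "x \<in> VOb ?P" if "x \<in> VOb ?K" for x using that by (simp add: CPair_def)
  have K: "gid ?K = gid ?P" "gcmp ?K = gcmp ?P" "\<And>e. gok ?K e \<Longrightarrow> gok ?P e" by (simp_all add: CPair_def vfull_gr)
  have o: "fst x \<in> algebras J T C" if "x \<in> VOb ?K" for x using KP[OF that] by (simp add: Pair_VOb)
  have xc: "FOb A \<I> \<in> VOb C" if "A \<in> algebras J T C" for A using vfun_typ(1)[OF algebrasD(1)[OF that]] s by simp
  have H: "?H x x' \<in> Ar V \<and> Dom V (?H x x') = VHom ?K x x' \<and> Cod V (?H x x') = VHom C (FOb (fst x) \<I>) (FOb (fst x') \<I>)"
    if x: "x \<in> VOb ?K" "x' \<in> VOb ?K" for x x'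
    using PB_typ(1-4)[OF pbs alg_carrier_vfunctor, folded Pair_def, OF KP[OF x(1)] KP[OF x(2)]]
      vfun_typ(2-4)[OF alg_carrier_vfunctor(1), of "fst x" "fst x'"] o[OF x(1)] o[OF x(2)]
    by (simp add: CPair_def Pair_def PB_VHom[OF pbs alg_carrier_vfunctor] alg_carrier_FOb)
  show mp: "cpair_carrier J T U C \<star> y = cmpt T C \<I> (ppf y)" if y: "gok ?K y" for y
  proof -
    note d = gok_D[OF y] and g = Pair_pfs(1)[OF K(3)[OF y]]
    note p = PB_typ(1-4)[OF pbs alg_carrier_vfunctor, folded Pair_def, OF KP[OF d(1)] KP[OF d(2)]]
    have ty: "ty (ge y) = pb_ob V (FHom (alg_carrier J T C) (fst (sr y)) (fst (tg y))) (FHom (alg_carrier J U C) (snd (sr y)) (snd (tg y)))"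
      using d(4) by (simp add: CPair_def Pair_def PB_VHom[OF pbs alg_carrier_vfunctor])
    have "cpair_carrier J T U C \<star> y = alg_carrier J T C \<star> ppf y"
      using d(1-3) ty o[OF d(1)] o[OF d(2)] p vfun_typ(2-4)[OF alg_carrier_vfunctor(1), of "fst (sr y)" "fst (tg y)"]
      by (simp add: c gmp_def pfst_def alg_carrier_FOb)
    then show ?thesis using alg_carrier_mp(1)[OF g] by simp
  qed
  show "vfunctor ?K C (cpair_carrier J T U C)"
  proof (rule vfunctorI[OF BiAlg_vcategory(2) s(3) c])
    fix x assume x: "x \<in> VOb ?K"
    show "FOb (fst x) \<I> \<in> VOb C" using xc[OF o[OF x]] .
    have g: "gok ?K (gid ?K x)" using x BiAlg_vcategory(2) by simp
    show "cpair_carrier J T U C \<star> gid ?K x = gid C (FOb (cpair_carrier J T U C) x)"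
      unfolding mp[OF g] unfolding K using Pair_pfs_id(2)[OF KP[OF x]] cmpt_id(2)[OF s(5) o[OF x], of \<I>] x s by (simp add: c Alg_def)
    show "?H x x' \<in> Ar V \<and> Dom V (?H x x') = VHom ?K x x' \<and> Cod V (?H x x') = VHom C (FOb (fst x) \<I>) (FOb (fst x') \<I>)"
      if "x' \<in> VOb ?K" for x' using H[OF x that] .
  next
    fix g f assume *: "gok ?K g" "gok ?K f" "sr g = tg f" "gc g \<inter> gc f = {}"
    have gf: "gok ?K (g \<bullet>\<^bsub>?K\<^esub> f)" using * BiAlg_vcategory(2) by simp
    note k = K(3)[OF *(1)] K(3)[OF *(2)]
    have "cmpt T C \<I> (ppf g \<bullet>\<^bsub>Alg J T C\<^esub> ppf f) = cmpt T C \<I> (ppf g) \<bullet>\<^bsub>C\<^esub> cmpt T C \<I> (ppf f)"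
      unfolding Alg_def by (rule cmpt_cmp(2)[OF s(5) Pair_pfs(1)[OF k(1), unfolded Alg_def] Pair_pfs(1)[OF k(2), unfolded Alg_def]])
        (use * s in \<open>simp_all add: Pair_simps\<close>)
    then show "cpair_carrier J T U C \<star> (g \<bullet>\<^bsub>?K\<^esub> f) = (cpair_carrier J T U C \<star> g) \<bullet>\<^bsub>C\<^esub> (cpair_carrier J T U C \<star> f)"
      using mp[OF gf] mp[OF *(1)] mp[OF *(2)] Pair_pfs_cmp(2)[OF k *(3,4)] by (simp add: K)
  qed
qed

text \<open>\<open>vnatural_iso\<close> provides inverses object by object. Their naturality
  (\<open>n'\<close>) has to be derived before they can be assembled into an arrow of
  algebras.\<close>

lemma algebra_iso_components:
  assumes A: "A \<in> algebras J U C" "B \<in> algebras J U C" and f: "vnatural_iso U C A B f"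
  obtains b b' where "gok (Alg J U C) b" "sr b = A" "tg b = B" "gc b = {}" "gok (Alg J U C) b'" "sr b' = B" "tg b' = A" "gc b' = {}"
    "\<forall>u\<in>J. ginv C (cmpt U C u b) (cmpt U C u b')" "\<forall>u\<in>J. cmpt U C u b = (FOb A u, FOb B u, ({}, f u))"
proof -
  note s' = settingD[OF S'] and a = algebrasD(1)[OF A(1)] and b = algebrasD(1)[OF A(2)]
  have C: "vcategory C" using s' by simp
  let ?m = "\<lambda>u. (FOb A u, FOb B u, ({} :: 'o ctx, f u))"
  have ob: "FOb A u \<in> VOb C" "FOb B u \<in> VOb C" if "u \<in> J" for u using vfun_typ(1)[OF a] vfun_typ(1)[OF b] that s' by simp_all
  have "\<forall>u\<in>J. \<exists>g. ginv C (?m u) (FOb B u, FOb A u, ({}, g))"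
    using f uiso_ginv[OF C ob] s' unfolding vnatural_iso_def by blast
  from bchoice[OF this] obtain g where g0: "\<forall>u\<in>J. ginv C (?m u) (FOb B u, FOb A u, ({}, g u))" ..
  let ?m' = "\<lambda>u. (FOb B u, FOb A u, ({} :: 'o ctx, g u))"
  have g: "ginv C (?m u) (?m' u)" if "u \<in> J" for u using g0 that by blast
  have n: "?m (tg e) \<bullet>\<^bsub>C\<^esub> (A \<star> e) = (B \<star> e) \<bullet>\<^bsub>C\<^esub> ?m (sr e)" if "gok U e" for e
    using f that unfolding vnatural_iso_def vnatural_gr[OF a b] by blast
  have n': "(A \<star> e) \<bullet>\<^bsub>C\<^esub> ?m' (sr e) = ?m' (tg e) \<bullet>\<^bsub>C\<^esub> (B \<star> e)" if e: "gok U e" for e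
  proof -
    have J: "sr e \<in> J" "tg e \<in> J" using gok_D(1,2)[OF e] s' by simp_all
    note k = gok_mp[OF a e] gok_mp[OF b e] and i = ginvD[OF g[OF J(1)]] and j = ginvD[OF g[OF J(2)]]
    have "(A \<star> e) \<bullet>\<^bsub>C\<^esub> ?m' (sr e) = ((?m' (tg e) \<bullet>\<^bsub>C\<^esub> ?m (tg e)) \<bullet>\<^bsub>C\<^esub> (A \<star> e)) \<bullet>\<^bsub>C\<^esub> ?m' (sr e)"
      unfolding j(7) using k C by (simp del: gok_tuple)
    also have "(?m' (tg e) \<bullet>\<^bsub>C\<^esub> ?m (tg e)) \<bullet>\<^bsub>C\<^esub> (A \<star> e) = ?m' (tg e) \<bullet>\<^bsub>C\<^esub> ((B \<star> e) \<bullet>\<^bsub>C\<^esub> ?m (sr e))"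
      unfolding n[OF e, symmetric] by (rule gcmp_assoc) (use k i j C in \<open>simp_all del: gok_tuple\<close>)
    also have "\<dots> = (?m' (tg e) \<bullet>\<^bsub>C\<^esub> (B \<star> e)) \<bullet>\<^bsub>C\<^esub> ?m (sr e)"
      by (rule gcmp_assoc[symmetric]) (use k i j C in \<open>simp_all del: gok_tuple\<close>)
    also have "((?m' (tg e) \<bullet>\<^bsub>C\<^esub> (B \<star> e)) \<bullet>\<^bsub>C\<^esub> ?m (sr e)) \<bullet>\<^bsub>C\<^esub> ?m' (sr e) = (?m' (tg e) \<bullet>\<^bsub>C\<^esub> (B \<star> e)) \<bullet>\<^bsub>C\<^esub> (?m (sr e) \<bullet>\<^bsub>C\<^esub> ?m' (sr e))"
      by (rule gcmp_assoc) (use k i j C in \<open>simp_all del: gok_tuple\<close>)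
    also have "\<dots> = ?m' (tg e) \<bullet>\<^bsub>C\<^esub> (B \<star> e)"
      unfolding i(8) using k i j C gcmp_assoc[OF C] by (simp del: gok_tuple)
    finally show ?thesis .
  qed
  have m: "gok C (?m u) \<and> sr (?m u) = FOb A u \<and> tg (?m u) = FOb B u \<and> gc (?m u) = {}"
    "gok C (?m' u) \<and> sr (?m' u) = FOb B u \<and> tg (?m' u) = FOb A u \<and> gc (?m' u) = {}" if "u \<in> VOb U" for u
    using ginvD(1,2)[OF g[of u]] that s' by (simp_all add: ct_def del: gok_tuple)
  obtain b where b: "gok (fun_cat U C (algebras J U C)) b" "sr b = A" "tg b = B" "gc b = {}" "\<And>u. u \<in> VOb U \<Longrightarrow> cmpt U C u b = ?m u"
    by (rule cmpt_ex[OF s'(5) A, where Q = "{}" and K = "{}" and m = ?m], simp, simp, rule m(1), assumption, rule n[symmetric], assumption, rule that, assumption, simp_all del: gok_tuple)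
  obtain b' where b': "gok (fun_cat U C (algebras J U C)) b'" "sr b' = B" "tg b' = A" "gc b' = {}" "\<And>u. u \<in> VOb U \<Longrightarrow> cmpt U C u b' = ?m' u"
    by (rule cmpt_ex[OF s'(5) A(2,1), where Q = "{}" and K = "{}" and m = ?m'], simp, simp, rule m(2), assumption, rule n', assumption, rule that, assumption, simp_all del: gok_tuple)
  show thesis by (rule that[of b b']) (use b b' g s' in \<open>simp_all add: Alg_def\<close>)
qed

text \<open>The isomorphism is the identity on the left face and comes from
  \<open>commuting_bifold\<close> on the right. The latter is an identity at \<open>\<I>\<close>, so
  the two match over the carrier, and the pair lies over the identity of the carrier.\<close>

lemma bifold_pair_eso:
  assumes b: "b \<in> VOb (CPair J T U C)"
  shows "\<exists>a \<phi> \<phi>'. a \<in> VOb (BiAlg J T U C) \<and> ginv (CPair J T U C) \<phi> \<phi>' \<and> sr \<phi> = FOb bifold_pair a \<and> tg \<phi> = b \<and>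
    cpair_carrier J T U C \<star> \<phi> = gid C (FOb (cpair_carrier J T U C) b)"
proof -
  note s = settingD[OF S] and s' = settingD[OF S']
  let ?P = "Pair J T U C" and ?K = "CPair J T U C"
  obtain A B where ab: "b = (A, B)" by (cases b)
  have A: "A \<in> algebras J T C" "FOb A \<I> = FOb B \<I>" and bP: "(A, B) \<in> VOb ?P"
    and cw: "commutes_with J C (FOb A \<I>) T A U B"
    using b by (auto simp: CPair_def ab Pair_VOb alg_carrier_FOb)
  obtain D f where D: "D \<in> bifs" "left_face T U D = A" "vnatural_iso U C B (right_face T U D) f" "f \<I> = VId C (FOb A \<I>)" "B \<in> algebras J U C"
    by (rule commuting_bifold[OF S S' A(1) cw])
  note F = bifold_faces[OF S S' D(1)]
  let ?R = "right_face T U D" let ?x = "FOb A \<I>"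
  have x: "?x \<in> VOb C" using vfun_typ(1)[OF algebrasD(1)[OF A(1)]] s by simp
  have RI: "FOb ?R \<I> = ?x" using F(6,7) s(8) unfolding D(2)[symmetric] by (simp add: left_face_def right_face_def)
  obtain \<beta> \<beta>' where be: "gok (Alg J U C) \<beta>" "sr \<beta> = B" "tg \<beta> = ?R" "gc \<beta> = {}" "gok (Alg J U C) \<beta>'" "sr \<beta>' = ?R" "tg \<beta>' = B" "gc \<beta>' = {}"
    and inv0: "\<forall>u\<in>J. ginv C (cmpt U C u \<beta>) (cmpt U C u \<beta>')" and fu: "\<forall>u\<in>J. cmpt U C u \<beta> = (FOb B u, FOb ?R u, ({}, f u))"
    by (rule algebra_iso_components[OF D(5) F(4) D(3)])
  note inv = bspec[OF inv0]
  have bI: "cmpt U C \<I> \<beta> = gid C ?x" using bspec[OF fu s(8)] D(4) A(2) RI gid_VId[OF s(3) x] by simp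
  have bI': "cmpt U C \<I> \<beta>' = gid C ?x"
    using ginvD[OF inv[OF s(8)]] s(3) be(6,7) RI A(2) x gcmp_assoc[OF s(3)] unfolding bI by simp
  let ?i = "gid (Alg J T C) A"
  have i: "gok (Alg J T C) ?i" "\<And>t. t \<in> J \<Longrightarrow> cmpt T C t ?i = gid C (FOb A t)"
    using cmpt_id[OF s(5) A(1)] s by (simp_all add: Alg_def)
  have c: "alg_carrier J T C \<star> ?i = alg_carrier J U C \<star> \<beta>'" "alg_carrier J T C \<star> ?i = alg_carrier J U C \<star> \<beta>"
    using alg_carrier_mp(1)[OF i(1)] alg_carrier_mp(2)[OF be(1)] alg_carrier_mp(2)[OF be(5)] bI bI' i(2)[OF s(8)] by simp_all
  have q: "gc ?i = gc \<beta>'" "gc ?i = gc \<beta>" using be by simp_all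
  \<comment> \<open>Since \<open>f\<close> goes from \<open>B\<close> to the right face, the arrow
    ending in \<open>b\<close> is formed with the inverse \<open>\<beta>'\<close>.\<close>
  obtain \<phi> where p: "gok ?P \<phi>" "sr \<phi> = (sr ?i, sr \<beta>')" "tg \<phi> = (tg ?i, tg \<beta>')" "gc \<phi> = gc ?i" "ppf \<phi> = ?i" "pps \<phi> = \<beta>'"
    by (rule Pair_pfs_ex[OF i(1) be(5) q(1) c(1)])
  obtain \<phi>' where p': "gok ?P \<phi>'" "sr \<phi>' = (sr ?i, sr \<beta>)" "tg \<phi>' = (tg ?i, tg \<beta>)" "gc \<phi>' = gc ?i" "ppf \<phi>' = ?i" "pps \<phi>' = \<beta>"
    by (rule Pair_pfs_ex[OF i(1) be(1) q(2) c(2)])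
  have st: "sr \<phi> = (A, ?R)" "tg \<phi> = (A, B)" "gc \<phi> = {}" "sr \<phi>' = (A, B)" "tg \<phi>' = (A, ?R)" "gc \<phi>' = {}"
    using p(2-4) p'(2-4) be by simp_all
  have o: "(A, ?R) \<in> VOb ?P" "(A, ?R) \<in> VOb ?K" using faces_Pair[OF D(1)] unfolding D(2) .
  have FC: "vcategory (Alg J T C)" using Alg_vcategory[OF S] .
  have ii: "?i \<bullet>\<^bsub>Alg J T C\<^esub> ?i = ?i" using FC i(1) by simp
  have comp: "cmpt U C u (\<beta> \<bullet>\<^bsub>Alg J U C\<^esub> \<beta>') = cmpt U C u \<beta> \<bullet>\<^bsub>C\<^esub> cmpt U C u \<beta>'"
    "cmpt U C u (\<beta>' \<bullet>\<^bsub>Alg J U C\<^esub> \<beta>) = cmpt U C u \<beta>' \<bullet>\<^bsub>C\<^esub> cmpt U C u \<beta>" if "u \<in> J" for u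
    using cmpt_cmp(2)[OF s'(5) be(1)[unfolded Alg_def] be(5)[unfolded Alg_def], of u]
      cmpt_cmp(2)[OF s'(5) be(5)[unfolded Alg_def] be(1)[unfolded Alg_def], of u] be that s' by (simp_all add: Alg_def)
  have t1: "sr \<phi>' = tg \<phi>" "gc \<phi>' \<inter> gc \<phi> = {}" and t2: "sr \<phi> = tg \<phi>'" "gc \<phi> \<inter> gc \<phi>' = {}" using st by simp_all
  note c1 = Pair_pfs_cmp[OF p'(1) p(1) t1] and c2 = Pair_pfs_cmp[OF p(1) p'(1) t2]
  note i1 = Pair_pfs_id[OF o(1), simplified] and i2 = Pair_pfs_id[OF bP, simplified]
  have gU: "cmpt U C u (gid (Alg J U C) ?R) = gid C (FOb ?R u)" "cmpt U C u (gid (Alg J U C) B) = gid C (FOb B u)" if "u \<in> J" for u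
    using cmpt_id(2)[OF s'(5) F(4), of u] cmpt_id(2)[OF s'(5) D(5), of u] that s' by (simp_all add: Alg_def)
  have e1: "\<phi>' \<bullet>\<^bsub>?P\<^esub> \<phi> = gid ?P (sr \<phi>)" unfolding st(1)
    by (rule Pair_eqI[OF c1(1) i1(1)])
      (use st c1(2,3) p(5,6) p'(5,6) ii i1(2,3) comp gU ginvD(8)[OF inv] be in simp_all)
  have e2: "\<phi> \<bullet>\<^bsub>?P\<^esub> \<phi>' = gid ?P (tg \<phi>)" unfolding st(2)
    by (rule Pair_eqI[OF c2(1) i2(1)])
      (use st c2(2,3) p(5,6) p'(5,6) ii i2(2,3) comp gU ginvD(7)[OF inv] be in simp_all)
  have K: "gid ?K = gid ?P" "gcmp ?K = gcmp ?P" by (simp_all add: CPair_def vfull_gr)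
  have "ginv ?P \<phi> \<phi>'" unfolding ginv_def using p(1) p'(1) st e1 e2 by simp
  then have g: "ginv ?K \<phi> \<phi>'" using o(2) b unfolding CPair_def vfull_ginv st by (simp add: ab)
  have "cpair_carrier J T U C \<star> \<phi> = gid C ?x" using cpair_carrier(2)[OF ginvD(1)[OF g]] p(5) i(2)[OF s(8)] by simp
  moreover have "FOb (cpair_carrier J T U C) b = ?x" using b by (simp add: cpair_carrier_def ab)
  moreover have "D \<in> VOb (BiAlg J T U C)" using D(1) by (simp add: BiAlg_def)
  moreover have "sr \<phi> = FOb bifold_pair D" using D(1,2) st(1) by (simp add: bifold_pair_def)
  moreover have "tg \<phi> = b" using st(2) ab by simp
  ultimately show ?thesis using g by metis
qed

text \<open>The comparison commutes strictly with the carrier functors, because the carrier of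
  \<open>D\<close> is that of its left face; so \<open>equivalence_over\<close> yields both
  claims.\<close>

lemma bifold_pair_equivalence:
  "vequivalence (BiAlg J T U C) (CPair J T U C) bifold_pair"
  "is_equivalence (fibre (BiAlg J T U C) C (bialg_carrier J T U C) c) (fibre (CPair J T U C) C (cpair_carrier J T U C) c) (underlying_functor bifold_pair)"
proof -
  note I = settingD(8)[OF S] and s = settingD[OF S] and s' = settingD[OF S']
  have P: "vfunctor (BiAlg J T U C) C (bialg_carrier J T U C)"
    using evaluation_vfunctor[OF bifold_fcat, of "(\<I>, \<I>)"] I s s' by (simp add: BiAlg_def bialg_carrier_def)
  have o: "FOb (cpair_carrier J T U C) (FOb bifold_pair D) = FOb (bialg_carrier J T U C) D" if "D \<in> VOb (BiAlg J T U C)" for D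
  proof -
    have D: "D \<in> bifs" using that by (simp add: BiAlg_def)
    show ?thesis using faces_Pair(2)[OF D] D bifold_faces(6)[OF S S' D I]
      by (simp add: bifold_pair_def cpair_carrier_def bialg_carrier_def evaluation_def left_face_def)
  qed
  have h: "cpair_carrier J T U C \<star> (bifold_pair \<star> z) = bialg_carrier J T U C \<star> z" if "gok (BiAlg J T U C) z" for z
    using cpair_carrier(2)[OF bifold_pair_mp(1)[OF that]] bifold_pair_mp(6)[OF that I]
      evaluation_mp[of "vtensor T U" C bifs z "(\<I>, \<I>)"] that by (simp add: BiAlg_def bialg_carrier_def)
  show "vequivalence (BiAlg J T U C) (CPair J T U C) bifold_pair"
    by (rule equivalence_over(1)[OF bifold_pair_vfunctor bifold_pair_gff P cpair_carrier(1)]; fact o h bifold_pair_eso)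
  show "is_equivalence (fibre (BiAlg J T U C) C (bialg_carrier J T U C) c) (fibre (CPair J T U C) C (cpair_carrier J T U C) c) (underlying_functor bifold_pair)"
    by (rule equivalence_over(2)[OF bifold_pair_vfunctor bifold_pair_gff P cpair_carrier(1)]; fact o h bifold_pair_eso)
qed

end
end

theorem theorem11p11:
  fixes V :: "('o, 'm) smc" and J :: "'o set" and C :: "('c, 'o, 'm) cvcat"
    and T U :: "('o, 'm) jtheory"
  assumes "smcc V"
    and "has_pullbacks V"
    and "smcc.system_of_arities V J"
    and "smcc.admissible V J C"
    and "smcc.is_theory V J T"
    and "smcc.is_theory V J U"
  shows "smcc.fun_cat_exists V (smcc.vtensor V T U) C (smcc.bifold_algebras V J T U C) \<and>
    (\<exists>\<Phi>. smcc.vequivalence V (smcc.BiAlg V J T U C) (smcc.CPair V J T U C) \<Phi> \<and>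
      (\<forall>D \<in> smcc.bifold_algebras V J T U C.
         FOb \<Phi> D = (smcc.left_face V T U D, smcc.right_face V T U D)) \<and>
      (\<forall>c \<in> VOb C. is_equivalence
         (smcc.fibre V (smcc.BiAlg V J T U C) C (smcc.bialg_carrier V J T U C) c)
         (smcc.fibre V (smcc.CPair V J T U C) C (smcc.cpair_carrier V J T U C) c)
         (smcc.underlying_functor V \<Phi>)))"
proof -
  interpret smcc V by fact
  have S: "setting J T C" and S': "setting J U C" using settingI[OF assms(3) _ assms(4)] assms(5,6) by blast+
  show ?thesis
  proof (intro conjI exI[of _ "bifold_pair J T U C"] ballI)
    show "fun_cat_exists (vtensor T U) C (bifold_algebras J T U C)"
      using bifold_fcat[OF S S' assms(2)] by (simp add: fcat_def)
    show "FOb (bifold_pair J T U C) D = (left_face T U D, right_face T U D)" if "D \<in> bifold_algebras J T U C" for D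
      using that by (simp add: bifold_pair_def[OF S S' assms(2)])
  qed (rule bifold_pair_equivalence[OF S S' assms(2)])+
qed

end
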